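(* There is a (randomized) parallel algorithm that, given a weighted directed graph $G=(V,E,w)$ with $n$ vertices, $m$ edges and real edge weights $w$, containing no negative cycles, and a designated source vertex $s$, computes the shortest paths from $s$ to all other vertices spending $O(mn\log n + n^3 h^{-3}\log^4 n)$ work with $O(h+\log n)$ depth, for any $1\le h\le n$. The algorithm is correct with high probability, and all its comparisons are performed between quantities each of which is a sum of edge weights.
   Context: Parallel algorithms are measured by work (total number of operations performed by all processors) and depth (number of parallel steps until the last processor finishes). "With high probability" means with probability at least $1-1/n^{c}$ for a constant $c\ge 1$ that can be chosen arbitrarily large. *)

theory Defs
  imports
    "HOL-Probability.Probability"
    "HOL-Library.Poly_Mapping"
    "Graph_Theory.Graph_Theory"
begin

section \<open>Parallel random access machine\<close>

text \<open>
  The library has no parallel machine model. The one below is the synchronous randomized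
  CRCW PRAM in its work-time presentation: a program is a sequence of parallel steps, in
  each of which processors \<open>0, \<dots>, k - 1\<close> perform one guarded instruction in lockstep. All
  reads of a step precede all its writes. Every arithmetic operation, memory access,
  random draw and comparison counts as one operation; work is the number of operations
  summed over all processors, depth is the number of operations that are performed one
  after the other.

  Shared memory consists of named arrays of two sorts, for machine words and for weights.
  Word arithmetic is modulo a word bound \<open>B\<close>, and weights can only be copied, added,
  subtracted and compared.
\<close>

datatype wop = Add | Sub | Mul | Div | Less

datatype wexp =
    Const nat
  | Pid
  | Load nat wexp
  | Op wop wexp wexp

datatype rexp =
    RZero
  | RLoad nat wexp
  | RAdd rexp rexp
  | RSub rexp rexp

text \<open>
  \<open>Store a x e\<close> and \<open>RStore a x e\<close> write the value of \<open>e\<close> to cell \<open>x\<close> of array \<open>a\<close>;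
  \<open>Compare a x e f\<close> writes 1 or 0 there, according to whether \<open>e \<le> f\<close>. \<open>Draw a e\<close>
  writes an integer drawn uniformly below the value of \<open>e\<close>, independently for each
  processor, to the processor's own cell of array \<open>a\<close>.
\<close>

datatype instr =
    Store nat wexp wexp
  | RStore nat wexp rexp
  | Compare nat wexp rexp rexp
  | Draw nat wexp

text \<open>
  \<open>Par k g i\<close> is a parallel step of \<open>k\<close> processors, where those with guard \<open>g\<close> zero skip
  the instruction \<open>i\<close>. \<open>While b g p\<close> repeats \<open>p\<close> as long as \<open>g\<close> is nonzero, but at most as
  many times as the value of \<open>b\<close> on entry, hence every run terminates. There is no
  unbounded loop, which only makes the existence of a program a stronger claim.
  Control expressions are evaluated with \<open>Pid\<close> = 0.
\<close>

datatype prog =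
    Skip
  | Par wexp wexp instr
  | Seq prog prog
  | Cond wexp prog prog
  | While wexp wexp prog

text \<open>
  A weight cell holds a formal integer combination of arcs, i.e. it records how its
  content was computed from the input weights. A program has access only to the real
  number that this combination denotes, and only by means of \<open>Compare\<close>.
\<close>

type_synonym form = "nat \<Rightarrow>\<^sub>0 int"

definition form_val :: "(nat \<Rightarrow> real) \<Rightarrow> form \<Rightarrow> real" where
  "form_val w f = (\<Sum>e\<in>Poly_Mapping.keys f. of_int (Poly_Mapping.lookup f e) * w e)"

record state =
  wmem :: "nat \<Rightarrow> nat \<Rightarrow> nat"
  rmem :: "nat \<Rightarrow> nat \<Rightarrow> form"
  work :: nat
  depth :: nat
  compared :: "form set"  \<comment> \<open>all operands of the weight comparisons performed so far\<close>

definition charge :: "nat \<Rightarrow> nat \<Rightarrow> state \<Rightarrow> state" where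
  "charge a d \<sigma> = \<sigma>\<lparr>work := work \<sigma> + a, depth := depth \<sigma> + d\<rparr>"

primrec wcost :: "wexp \<Rightarrow> nat" where
  "wcost (Const c) = 1"
| "wcost Pid = 1"
| "wcost (Load a e) = wcost e + 1"
| "wcost (Op f e e') = wcost e + wcost e' + 1"

primrec rcost :: "rexp \<Rightarrow> nat" where
  "rcost RZero = 1"
| "rcost (RLoad a e) = wcost e + 1"
| "rcost (RAdd r r') = rcost r + rcost r' + 1"
| "rcost (RSub r r') = rcost r + rcost r' + 1"

primrec icost :: "instr \<Rightarrow> nat" where
  "icost (Store a x e) = wcost x + wcost e + 1"
| "icost (RStore a x r) = wcost x + rcost r + 1"
| "icost (Compare a x r r') = wcost x + rcost r + rcost r' + 2"
| "icost (Draw a e) = wcost e + 2"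

primrec wop_val :: "wop \<Rightarrow> nat \<Rightarrow> nat \<Rightarrow> nat" where
  "wop_val Add a b = a + b"
| "wop_val Sub a b = a - b"
| "wop_val Mul a b = a * b"
| "wop_val Div a b = a div b"
| "wop_val Less a b = (if a < b then 1 else 0)"

text \<open>Expressions are evaluated for a word bound \<open>B\<close>, a memory state and a processor \<open>i\<close>.\<close>

primrec wval :: "nat \<Rightarrow> state \<Rightarrow> nat \<Rightarrow> wexp \<Rightarrow> nat" where
  "wval B \<sigma> i (Const c) = c mod B"
| "wval B \<sigma> i Pid = i"
| "wval B \<sigma> i (Load a e) = wmem \<sigma> a (wval B \<sigma> i e)"
| "wval B \<sigma> i (Op f e e') = wop_val f (wval B \<sigma> i e) (wval B \<sigma> i e') mod B"

primrec rval :: "nat \<Rightarrow> state \<Rightarrow> nat \<Rightarrow> rexp \<Rightarrow> form" where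
  "rval B \<sigma> i RZero = 0"
| "rval B \<sigma> i (RLoad a e) = rmem \<sigma> a (wval B \<sigma> i e)"
| "rval B \<sigma> i (RAdd r r') = rval B \<sigma> i r + rval B \<sigma> i r'"
| "rval B \<sigma> i (RSub r r') = rval B \<sigma> i r - rval B \<sigma> i r'"

text \<open>
  Concurrent writes follow the ARBITRARY rule: one of the processors writing to a cell
  succeeds, and programs have to work no matter which one. The resolution is given by a
  function of the state before the step, the address and the set of competing processors.
\<close>

type_synonym resolution = "state \<Rightarrow> nat \<Rightarrow> nat set \<Rightarrow> nat"

definition is_resolution :: "resolution \<Rightarrow> bool" where
  "is_resolution res \<longleftrightarrow> (\<forall>\<sigma> x C. finite C \<and> C \<noteq> {} \<longrightarrow> res \<sigma> x C \<in> C)"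

definition cwrite ::
  "(nat \<Rightarrow> nat set \<Rightarrow> nat) \<Rightarrow> nat set \<Rightarrow> (nat \<Rightarrow> nat) \<Rightarrow> (nat \<Rightarrow> 'v) \<Rightarrow> (nat \<Rightarrow> 'v) \<Rightarrow> nat \<Rightarrow> 'v" where
  "cwrite sel A addr val mem x =
     (let C = {i \<in> A. addr i = x} in if C = {} then mem x else val (sel x C))"

text \<open>The instruction is performed by the set \<open>A\<close> of active processors.\<close>

fun step :: "resolution \<Rightarrow> (nat \<Rightarrow> real) \<Rightarrow> nat \<Rightarrow> nat set \<Rightarrow> instr \<Rightarrow> state \<Rightarrow> state pmf" where
  "step res w B A (Store a x e) \<sigma> = return_pmf
     (\<sigma>\<lparr>wmem := (wmem \<sigma>)(a := cwrite (res \<sigma>) A (\<lambda>i. wval B \<sigma> i x) (\<lambda>i. wval B \<sigma> i e) (wmem \<sigma> a))\<rparr>)"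
| "step res w B A (RStore a x r) \<sigma> = return_pmf
     (\<sigma>\<lparr>rmem := (rmem \<sigma>)(a := cwrite (res \<sigma>) A (\<lambda>i. wval B \<sigma> i x) (\<lambda>i. rval B \<sigma> i r) (rmem \<sigma> a))\<rparr>)"
| "step res w B A (Compare a x r r') \<sigma> = return_pmf
     (\<sigma>\<lparr>wmem := (wmem \<sigma>)(a := cwrite (res \<sigma>) A (\<lambda>i. wval B \<sigma> i x)
          (\<lambda>i. if form_val w (rval B \<sigma> i r) \<le> form_val w (rval B \<sigma> i r') then 1 else 0)
          (wmem \<sigma> a)),
        compared := compared \<sigma> \<union> (\<Union>i\<in>A. {rval B \<sigma> i r, rval B \<sigma> i r'})\<rparr>)"
| "step res w B A (Draw a e) \<sigma> = map_pmf
     (\<lambda>\<rho>. \<sigma>\<lparr>wmem := (wmem \<sigma>)(a := (\<lambda>x. if x \<in> A then \<rho> x else wmem \<sigma> a x))\<rparr>)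
     (Pi_pmf A 0 (\<lambda>i. pmf_of_set {..< max 1 (wval B \<sigma> i e)}))"

text \<open>At most \<open>k\<close> iterations of \<open>f\<close> while \<open>g\<close> holds, where each test costs \<open>t\<close>.\<close>

primrec iterate ::
  "nat \<Rightarrow> (state \<Rightarrow> bool) \<Rightarrow> (state \<Rightarrow> state pmf) \<Rightarrow> nat \<Rightarrow> state \<Rightarrow> state pmf" where
  "iterate t g f 0 \<sigma> = return_pmf \<sigma>"
| "iterate t g f (Suc k) \<sigma> =
     (let \<sigma>' = charge t t \<sigma>
      in if g \<sigma> then bind_pmf (f \<sigma>') (iterate t g f k) else return_pmf \<sigma>')"

primrec exec :: "resolution \<Rightarrow> (nat \<Rightarrow> real) \<Rightarrow> nat \<Rightarrow> prog \<Rightarrow> state \<Rightarrow> state pmf" where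
  "exec res w B Skip \<sigma> = return_pmf \<sigma>"
| "exec res w B (Par k g ins) \<sigma> =
     (let K = wval B \<sigma> 0 k; t = wcost g + icost ins
      in map_pmf (charge (wcost k + 1 + K * t) (wcost k + 1 + t))
           (step res w B {i. i < K \<and> wval B \<sigma> i g \<noteq> 0} ins \<sigma>))"
| "exec res w B (Seq p q) \<sigma> = bind_pmf (exec res w B p \<sigma>) (exec res w B q)"
| "exec res w B (Cond e p q) \<sigma> =
     (let \<sigma>' = charge (wcost e + 1) (wcost e + 1) \<sigma>
      in if wval B \<sigma> 0 e \<noteq> 0 then exec res w B p \<sigma>' else exec res w B q \<sigma>')"
| "exec res w B (While b g p) \<sigma> =
     iterate (wcost g + 2) (\<lambda>\<tau>. wval B \<tau> 0 g \<noteq> 0) (exec res w B p) (wval B \<sigma> 0 b)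
       (charge (wcost b + 1) (wcost b + 1) \<sigma>)"

section \<open>Single-source shortest paths on the machine\<close>

text \<open>
  The vertices are \<open>0, \<dots>, n - 1\<close> and the arcs \<open>0, \<dots>, m - 1\<close>, in no particular order.
  Self-loops are allowed. The library's cycles are non-empty and include self-loops.
\<close>

definition sssp_instance ::
  "nat \<Rightarrow> nat \<Rightarrow> (nat, nat) pre_digraph \<Rightarrow> (nat \<Rightarrow> real) \<Rightarrow> nat \<Rightarrow> bool" where
  "sssp_instance n m G w s \<longleftrightarrow>
     fin_digraph G \<and> nomulti_digraph G \<and> verts G = {..<n} \<and> arcs G = {..<m} \<and> s \<in> verts G \<and>
     \<not> (\<exists>p. pre_digraph.cycle G p \<and> wf_digraph.awalk_cost w p < 0)"

text \<open>
  Word array 0 holds the parameters, word arrays 1 and 2 the tails and heads of the arcs,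
  and weight array 0 their weights. All other cells are zero.
\<close>

definition initial :: "nat \<Rightarrow> nat \<Rightarrow> (nat, nat) pre_digraph \<Rightarrow> nat \<Rightarrow> nat \<Rightarrow> state" where
  "initial n m G s h =
     \<lparr>wmem = (\<lambda>a x.
        if a = 0 \<and> x < 4 then [n, m, s, h] ! x
        else if a = 1 \<and> x < m then tail G x
        else if a = 2 \<and> x < m then head G x
        else 0),
      rmem = (\<lambda>a x. if a = 0 \<and> x < m then Poly_Mapping.single x 1 else 0),
      work = 0, depth = 0, compared = {}\<rparr>"

text \<open>
  \<open>pred_walk G P s v p\<close>: \<open>p\<close> is the walk from \<open>s\<close> to \<open>v\<close> found by following the
  predecessor arcs \<open>P\<close> backwards from \<open>v\<close> until \<open>s\<close> is reached.
\<close>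

inductive pred_walk ::
  "(nat, nat) pre_digraph \<Rightarrow> (nat \<Rightarrow> nat) \<Rightarrow> nat \<Rightarrow> nat \<Rightarrow> nat list \<Rightarrow> bool"
  for G P s where
  "pred_walk G P s s []"
| "\<lbrakk>v \<noteq> s; P v \<in> arcs G; head G (P v) = v; pred_walk G P s (tail G (P v)) p\<rbrakk>
    \<Longrightarrow> pred_walk G P s v (p @ [P v])"

text \<open>
  Output: word array 3 says which vertices are reachable from \<open>s\<close> (nonzero entry); for
  these, weight array 1 holds the distance and word array 4 the predecessor arc in a tree
  of shortest paths.
\<close>

definition solves_sssp ::
  "(nat, nat) pre_digraph \<Rightarrow> (nat \<Rightarrow> real) \<Rightarrow> nat \<Rightarrow> state \<Rightarrow> bool" where
  "solves_sssp G w s \<sigma> \<longleftrightarrow>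
     (\<forall>v\<in>verts G.
        (wmem \<sigma> 3 v \<noteq> 0 \<longleftrightarrow> s \<rightarrow>\<^sup>*\<^bsub>G\<^esub> v) \<and>
        (s \<rightarrow>\<^sup>*\<^bsub>G\<^esub> v \<longrightarrow>
           ereal (form_val w (rmem \<sigma> 1 v)) = wf_digraph.\<mu> G w s v \<and>
           (\<exists>p. pred_walk G (wmem \<sigma> 4) s v p \<and> pre_digraph.apath G s p v \<and>
                ereal (wf_digraph.awalk_cost w p) = wf_digraph.\<mu> G w s v)))"

text \<open>The sums of edge weights, as formal expressions. The empty sum is included, being
  the length of the trivial path.\<close>

definition arc_sums :: "(nat, nat) pre_digraph \<Rightarrow> form set" where
  "arc_sums G = {\<Sum>e\<in>#M. Poly_Mapping.single e 1 | M. set_mset M \<subseteq> arcs G}"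

end

theory Submission
  imports Defs
begin

text \<open>
  Put \<open>b = max h (log n)\<close> and sample about \<open>(n / b) log n\<close> vertices, with repetitions, the source
  being the first of them. With high probability every segment of \<open>b\<close> vertices on a fixed shortest
  path contains a sample. First, \<open>O(b)\<close> rounds of Bellman-Ford from all samples in parallel find the shortest
  paths with at most \<open>b\<close> arcs. Then \<open>O(log n)\<close> rounds of min-plus squaring on the samples find the
  distances from the source to the samples, and \<open>O(b)\<close> further Bellman-Ford rounds reach all other
  vertices, which are at most \<open>b\<close> arcs behind a sample. Lengths are compared together with the number
  of arcs, lexicographically, so that shortest walks are simple and the tight arcs form a tree.

  Minima have to be found in constant depth and linear work. A randomized minimum of \<open>d\<close>
  candidates does this with constant success probability: a random sample of about \<open>sqrt d\<close> candidates is reduced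
  to its minimum by comparing all pairs; the few candidates that beat it are thrown into a small
  table, which is again reduced by comparing all pairs. Constant success probability per round suffices: a path of \<open>l\<close> arcs
  needs only \<open>O(l + log n)\<close> rounds, and in min-plus squaring the expected number of surplus links of
  a path decreases geometrically.
\<close>

section \<open>Reasoning about the machine\<close>

text \<open>The analysis separates what is certain from what is likely. Whatever the draws and the
  write conflicts do, a cell in use holds the length and hop count of an actual walk and changes
  only to a lexicographically smaller label. So a failed minimum delays progress but spoils nothing,
  and a label that is optimal stays optimal. Probability enters only through the number of rounds
  until a fixed shortest path is covered. Repeating every minimum until it is reliable would cost
  another logarithm in depth; instead the failures are amortized along the path. The work bound
  comes from \<open>N = O((n / b) log n)\<close>: squaring has \<open>N ^ 3\<close> candidates in
  each of \<open>O(log n)\<close> rounds, which is where the fourth power of the logarithm arises,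
  and Bellman-Ford has \<open>N * m\<close> candidates in \<open>O(b)\<close> rounds, where
  \<open>b\<close> cancels. Taking \<open>b\<close> at least \<open>log n\<close> makes the additive
  logarithm in the number of rounds disappear in \<open>O(b)\<close>. A minimum needs its candidates
  numbered within their target. The arcs come in no particular order, so the arcs into each vertex
  have to be numbered without sorting.\<close>

type_synonym wmemory = "nat \<Rightarrow> nat \<Rightarrow> nat"
type_synonym rmemory = "nat \<Rightarrow> nat \<Rightarrow> form"

text \<open>Values of expressions depend on the two memories alone. Evaluating them without the cost
  counters and \<open>compared\<close> lets assertions be predicates on memories.\<close>

primrec wv :: "nat \<Rightarrow> wmemory \<Rightarrow> nat \<Rightarrow> wexp \<Rightarrow> nat" where
  "wv B W i (Const c) = c mod B"
| "wv B W i Pid = i"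
| "wv B W i (Load a e) = W a (wv B W i e)"
| "wv B W i (Op f e e') = wop_val f (wv B W i e) (wv B W i e') mod B"

primrec rv :: "nat \<Rightarrow> wmemory \<Rightarrow> rmemory \<Rightarrow> nat \<Rightarrow> rexp \<Rightarrow> form" where
  "rv B W R i RZero = 0"
| "rv B W R i (RLoad a e) = R a (wv B W i e)"
| "rv B W R i (RAdd r r') = rv B W R i r + rv B W R i r'"
| "rv B W R i (RSub r r') = rv B W R i r - rv B W R i r'"

lemma wval_eq: "wval B \<sigma> i e = wv B (wmem \<sigma>) i e"
  by (induction e) auto

lemma rval_eq: "rval B \<sigma> i e = rv B (wmem \<sigma>) (rmem \<sigma>) i e"
  by (induction e) (auto simp: wval_eq)

lemma charge_mem [simp]: "wmem (charge a d \<sigma>) = wmem \<sigma>" "rmem (charge a d \<sigma>) = rmem \<sigma>"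
  "compared (charge a d \<sigma>) = compared \<sigma>" "work (charge a d \<sigma>) = work \<sigma> + a"
  "depth (charge a d \<sigma>) = depth \<sigma> + d"
  by (auto simp: charge_def)

primrec instrs :: "prog \<Rightarrow> instr set" where
  "instrs Skip = {}"
| "instrs (Par k g i) = {i}"
| "instrs (Seq p q) = instrs p \<union> instrs q"
| "instrs (Cond e p q) = instrs p \<union> instrs q"
| "instrs (While b g p) = instrs p"

text \<open>Induction principle for reflexive and transitive relations between the states before and
  after a run. The frame rules and the invariant on compared quantities are instances.\<close>

lemma exec_rel:
  assumes refl: "\<And>\<sigma>. P \<sigma> \<sigma>" and trans: "\<And>\<sigma> \<tau> \<upsilon>. P \<sigma> \<tau> \<Longrightarrow> P \<tau> \<upsilon> \<Longrightarrow> P \<sigma> \<upsilon>"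
    and charge: "\<And>a d \<sigma>. P \<sigma> (charge a d \<sigma>)"
    and step: "\<And>ins A \<sigma> \<tau>. ins \<in> instrs p \<Longrightarrow> \<tau> \<in> set_pmf (step res w B A ins \<sigma>) \<Longrightarrow> P \<sigma> \<tau>"
    and "\<tau> \<in> set_pmf (exec res w B p \<sigma>)"
  shows "P \<sigma> \<tau>"
  using step assms(5)
proof (induction p arbitrary: \<sigma> \<tau>)
  case Skip
  then show ?case using refl by simp
next
  case (Par k g i)
  then obtain \<upsilon> a d where "\<upsilon> \<in> set_pmf (step res w B {j. j < wval B \<sigma> 0 k \<and> wval B \<sigma> j g \<noteq> 0} i \<sigma>)" "\<tau> = charge a d \<upsilon>"
    by (auto simp: Let_def)
  then show ?case using Par.prems(1)[of i] charge trans by fastforce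
next
  case (Seq p q)
  from Seq.prems(2) obtain \<upsilon> where u: "\<upsilon> \<in> set_pmf (exec res w B p \<sigma>)" "\<tau> \<in> set_pmf (exec res w B q \<upsilon>)"
    by auto
  show ?case
    by (rule trans[OF Seq.IH(1)[OF _ u(1)] Seq.IH(2)[OF _ u(2)]]) (use Seq.prems(1) in auto)
next
  case (Cond e p q)
  let ?s = "charge (wcost e + 1) (wcost e + 1) \<sigma>"
  have "P ?s \<tau>"
    using Cond.prems(2) Cond.IH(1)[of \<tau> ?s] Cond.IH(2)[of \<tau> ?s] Cond.prems(1)
    by (auto simp: Let_def split: if_splits)
  then show ?case using trans charge by blast
next
  case (While b g p)
  have it: "P \<sigma> \<tau>" if "\<tau> \<in> set_pmf (iterate t h (exec res w B p) k \<sigma>)" for t h k \<sigma> \<tau>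
    using that
  proof (induction k arbitrary: \<sigma>)
    case 0
    then show ?case using refl by simp
  next
    case (Suc k)
    show ?case
    proof (cases "h \<sigma>")
      case True
      then obtain \<upsilon> where u: "\<upsilon> \<in> set_pmf (exec res w B p (charge t t \<sigma>))"
        "\<tau> \<in> set_pmf (iterate t h (exec res w B p) k \<upsilon>)"
        using Suc.prems by (auto simp: Let_def)
      have "P (charge t t \<sigma>) \<upsilon>"
        by (rule While.IH[OF _ u(1)]) (use While.prems(1) in auto)
      then show ?thesis using trans charge Suc.IH[OF u(2)] by blast
    next
      case False
      then show ?thesis using Suc.prems charge by (simp add: Let_def)
    qed
  qed
  from While.prems(2) it charge trans show ?case by (auto simp: Let_def) blast
qed

primrec ww :: "instr \<Rightarrow> nat set" where
  "ww (Store a x e) = {a}" | "ww (RStore a x e) = {}" | "ww (Compare a x e f) = {a}" | "ww (Draw a e) = {a}"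

primrec rw :: "instr \<Rightarrow> nat set" where
  "rw (Store a x e) = {}" | "rw (RStore a x e) = {a}" | "rw (Compare a x e f) = {}" | "rw (Draw a e) = {}"

lemma exec_wframe:
  assumes "\<tau> \<in> set_pmf (exec res w B p \<sigma>)" "\<forall>i\<in>instrs p. a \<notin> ww i"
  shows "wmem \<tau> a = wmem \<sigma> a"
proof -
  have st: "wmem \<upsilon>' a = wmem \<upsilon> a" if "ins \<in> instrs p" "\<upsilon>' \<in> set_pmf (step res w B A ins \<upsilon>)" for ins A \<upsilon> \<upsilon>'
    using assms(2)[rule_format, OF that(1)] that(2) by (cases ins) (auto split: if_splits)
  show ?thesis
    by (rule exec_rel[where P="\<lambda>\<sigma> \<tau>. wmem \<tau> a = wmem \<sigma> a" and p=p and res=res and w=w and B=B])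
       (use assms(1) st in auto)
qed

lemma exec_rframe:
  assumes "\<tau> \<in> set_pmf (exec res w B p \<sigma>)" "\<forall>i\<in>instrs p. a \<notin> rw i"
  shows "rmem \<tau> a = rmem \<sigma> a"
proof -
  have st: "rmem \<upsilon>' a = rmem \<upsilon> a" if "ins \<in> instrs p" "\<upsilon>' \<in> set_pmf (step res w B A ins \<upsilon>)" for ins A \<upsilon> \<upsilon>'
    using assms(2)[rule_format, OF that(1)] that(2) by (cases ins) (auto split: if_splits)
  show ?thesis
    by (rule exec_rel[where P="\<lambda>\<sigma> \<tau>. rmem \<tau> a = rmem \<sigma> a" and p=p and res=res and w=w and B=B])
       (use assms(1) st in auto)
qed

subsection \<open>Sums of edge weights\<close>

lemma arc_sums_zero: "0 \<in> arc_sums G"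
  unfolding arc_sums_def by (rule CollectI, rule exI[of _ "{#}"]) auto

lemma arc_sums_add: "f \<in> arc_sums G \<Longrightarrow> g \<in> arc_sums G \<Longrightarrow> f + g \<in> arc_sums G"
  unfolding arc_sums_def
  apply clarify
  subgoal for M N by (rule exI[of _ "M + N"]) auto
  done

lemma arc_sums_single: "e \<in> arcs G \<Longrightarrow> Poly_Mapping.single e 1 \<in> arc_sums G"
  unfolding arc_sums_def by (rule CollectI, rule exI[of _ "{#e#}"]) auto

text \<open>Subtraction is the only weight operation that leads out of \<open>arc_sums G\<close>,
  and its absence can be read off the program text.\<close>

primrec nosub :: "rexp \<Rightarrow> bool" where
  "nosub RZero = True" | "nosub (RLoad a e) = True"
| "nosub (RAdd r r') = (nosub r \<and> nosub r')" | "nosub (RSub r r') = False"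

primrec nosubi :: "instr \<Rightarrow> bool" where
  "nosubi (Store a x e) = True" | "nosubi (RStore a x e) = nosub e"
| "nosubi (Compare a x e f) = (nosub e \<and> nosub f)" | "nosubi (Draw a e) = True"

text \<open>The rules for stores below expose only this about the resolution: a cell gets the value
  of some competing processor, or keeps its own if there is none.\<close>

lemma cwrite_cases:
  assumes "is_resolution res" "finite A"
  obtains i where "i \<in> A" "addr i = x" "cwrite (res \<sigma>) A addr val mem x = val i"
  | "\<And>i. i \<in> A \<Longrightarrow> addr i \<noteq> x" "cwrite (res \<sigma>) A addr val mem x = mem x"
proof (cases "{i \<in> A. addr i = x} = {}")
  case True
  then have "cwrite (res \<sigma>) A addr val mem x = mem x"
    unfolding cwrite_def by (simp add: Let_def)
  then show ?thesis using that(2) True by blast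
next
  case False
  then have "res \<sigma> x {i \<in> A. addr i = x} \<in> {i \<in> A. addr i = x}"
    using assms(1)[unfolded is_resolution_def, rule_format, of "{i \<in> A. addr i = x}" \<sigma> x] assms(2) by simp
  moreover have "cwrite (res \<sigma>) A addr val mem x = val (res \<sigma> x {i \<in> A. addr i = x})"
    unfolding cwrite_def using False by (simp only: Let_def if_False)
  ultimately show ?thesis using that(1) by auto
qed

lemma cwrite_in: "cwrite sel A addr val mem x \<in> insert (mem x) (range val)"
  unfolding cwrite_def by (auto simp: Let_def)

lemma exec_arc_sums:
  assumes "\<tau> \<in> set_pmf (exec res w B p \<sigma>)" "\<forall>i\<in>instrs p. nosubi i"
    "\<And>a x. rmem \<sigma> a x \<in> arc_sums G" "compared \<sigma> \<subseteq> arc_sums G"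
  shows "compared \<tau> \<subseteq> arc_sums G"
proof -
  define I where "I \<sigma> \<longleftrightarrow> (\<forall>a x. rmem \<sigma> a x \<in> arc_sums G) \<and> compared \<sigma> \<subseteq> arc_sums G" for \<sigma> :: state
  have rv: "rval B \<upsilon> i r \<in> arc_sums G" if "I \<upsilon>" "nosub r" for \<upsilon> i r
    using that(2) by (induction r) (use that(1) in \<open>auto simp: I_def arc_sums_zero arc_sums_add\<close>)
  have st: "I \<upsilon>'" if "ins \<in> instrs p" "\<upsilon>' \<in> set_pmf (step res w B A ins \<upsilon>)" "I \<upsilon>" for ins A \<upsilon> \<upsilon>'
  proof (cases ins)
    case (RStore a x r)
    then have "nosub r" using assms(2) that(1) by auto
    then have *: "range (\<lambda>i. rval B \<upsilon> i r) \<subseteq> arc_sums G" using rv[OF that(3)] by auto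
    have "cwrite (res \<upsilon>) A (\<lambda>i. wval B \<upsilon> i x) (\<lambda>i. rval B \<upsilon> i r) (rmem \<upsilon> a) y \<in> arc_sums G" for y
      using cwrite_in[of "res \<upsilon>" A "\<lambda>i. wval B \<upsilon> i x" "\<lambda>i. rval B \<upsilon> i r" "rmem \<upsilon> a" y] * that(3)
      unfolding I_def by auto
    then show ?thesis using that(2,3) RStore unfolding I_def by simp
  next
    case (Compare a x r r')
    then have "nosub r" "nosub r'" using assms(2) that(1) by auto
    then show ?thesis using rv[OF that(3)] that(2,3) Compare unfolding I_def by auto
  qed (use that(2,3) in \<open>auto simp: I_def\<close>)
  have "I \<sigma> \<longrightarrow> I \<tau>"
    by (rule exec_rel[where P="\<lambda>\<sigma> \<tau>. I \<sigma> \<longrightarrow> I \<tau>" and p=p and res=res and w=w and B=B])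
       (use assms(1) st in \<open>auto simp: I_def\<close>)
  then show ?thesis using assms(3,4) by (auto simp: I_def)
qed

subsection \<open>Static cost bounds\<close>

text \<open>The cost of a program whose processor counts and iteration bounds are parameters, i.e. cells of word
  array 0, which it does not change itself (\<open>okp\<close>) is bounded by evaluating it on the parameters alone.\<close>

definition kv :: "(nat \<Rightarrow> nat) \<Rightarrow> wexp \<Rightarrow> nat" where
  "kv par e = (case e of Const c \<Rightarrow> c | Load a x \<Rightarrow> (case x of Const i \<Rightarrow> par i | _ \<Rightarrow> 0) | _ \<Rightarrow> 0)"

lemma kv_simps [simp]: "kv par (Const c) = c" "kv par (Load a (Const i)) = par i"
  by (auto simp: kv_def)

text \<open>Constants are reduced modulo \<open>B\<close>. With \<open>16 \<le> B\<close> as the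
  only bound on \<open>B\<close>, those below 16 are sure to keep their value, also as addresses of
  parameters.\<close>

primrec okk :: "wexp \<Rightarrow> bool" where
  "okk (Const c) = (c < 16)" | "okk Pid = False"
| "okk (Load a e) = (a = 0 \<and> (\<exists>i<16. e = Const i))" | "okk (Op f e e') = False"

primrec okp :: "prog \<Rightarrow> bool" where
  "okp Skip = True"
| "okp (Par k g i) = (okk k \<and> 0 \<notin> ww i)"
| "okp (Seq p q) = (okp p \<and> okp q)"
| "okp (Cond e p q) = False"
| "okp (While b g p) = (okk b \<and> okp p)"

primrec wbound :: "(nat \<Rightarrow> nat) \<Rightarrow> prog \<Rightarrow> nat" where
  "wbound par Skip = 0"
| "wbound par (Par k g i) = wcost k + 1 + kv par k * (wcost g + icost i)"
| "wbound par (Seq p q) = wbound par p + wbound par q"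
| "wbound par (Cond e p q) = 0"
| "wbound par (While b g p) = wcost b + 1 + kv par b * (wcost g + 2 + wbound par p)"

primrec dbound :: "(nat \<Rightarrow> nat) \<Rightarrow> prog \<Rightarrow> nat" where
  "dbound par Skip = 0"
| "dbound par (Par k g i) = wcost k + 1 + (wcost g + icost i)"
| "dbound par (Seq p q) = dbound par p + dbound par q"
| "dbound par (Cond e p q) = 0"
| "dbound par (While b g p) = wcost b + 1 + kv par b * (wcost g + 2 + dbound par p)"

lemma okp_frame: "okp p \<Longrightarrow> \<forall>i\<in>instrs p. 0 \<notin> ww i"
  by (induction p) auto

lemma okk_kv: "okk k \<Longrightarrow> 16 \<le> B \<Longrightarrow> wval B \<sigma> i k = kv (wmem \<sigma> 0) k"
  by (cases k) auto

lemma step_cost: "\<tau> \<in> set_pmf (step res w B A ins \<sigma>) \<Longrightarrow> work \<tau> = work \<sigma> \<and> depth \<tau> = depth \<sigma>"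
  by (cases ins) auto

text \<open>Since \<open>okp\<close> programs never touch the parameters, every iteration of a loop
  meets the same processor counts. The bound therefore holds on every run, not only in
  expectation.\<close>

lemma exec_cost:
  assumes "16 \<le> B" "\<tau> \<in> set_pmf (exec res w B p \<sigma>)" "okp p"
  shows "work \<tau> \<le> work \<sigma> + wbound (wmem \<sigma> 0) p \<and> depth \<tau> \<le> depth \<sigma> + dbound (wmem \<sigma> 0) p"
  using assms(2,3)
proof (induction p arbitrary: \<sigma> \<tau>)
  case (Par k g i)
  then show ?case
    using okk_kv[of k B \<sigma> 0] assms(1) step_cost by (fastforce simp: Let_def)
next
  case (Seq p q)
  from Seq.prems(1) obtain \<upsilon> where u: "\<upsilon> \<in> set_pmf (exec res w B p \<sigma>)" "\<tau> \<in> set_pmf (exec res w B q \<upsilon>)"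
    by auto
  have "wmem \<upsilon> 0 = wmem \<sigma> 0" using exec_wframe[OF u(1)] okp_frame Seq.prems(2) by auto
  then show ?case using Seq.IH(1)[OF u(1)] Seq.IH(2)[OF u(2)] Seq.prems(2) by auto
next
  case (While b g p)
  have it: "work \<tau> \<le> work \<sigma> + k * (t + wbound (wmem \<sigma> 0) p) \<and> depth \<tau> \<le> depth \<sigma> + k * (t + dbound (wmem \<sigma> 0) p)"
    if "\<tau> \<in> set_pmf (iterate t h (exec res w B p) k \<sigma>)" for t h k \<sigma> \<tau>
    using that
  proof (induction k arbitrary: \<sigma>)
    case (Suc k)
    show ?case
    proof (cases "h \<sigma>")
      case True
      then obtain \<upsilon> where u: "\<upsilon> \<in> set_pmf (exec res w B p (charge t t \<sigma>))"
        "\<tau> \<in> set_pmf (iterate t h (exec res w B p) k \<upsilon>)"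
        using Suc.prems by (auto simp: Let_def)
      have "wmem \<upsilon> 0 = wmem \<sigma> 0" using exec_wframe[OF u(1)] okp_frame While.prems(2) by auto
      then show ?thesis using Suc.IH[OF u(2)] While.IH[OF u(1)] While.prems(2) by (auto simp: algebra_simps)
    next
      case False
      then show ?thesis using Suc.prems by (simp add: Let_def)
    qed
  qed auto
  have "\<tau> \<in> set_pmf (iterate (wcost g + 2) (\<lambda>\<tau>. wval B \<tau> 0 g \<noteq> 0) (exec res w B p) (wval B \<sigma> 0 b)
       (charge (wcost b + 1) (wcost b + 1) \<sigma>))" using While.prems(1) by simp
  from it[OF this] show ?case
    using okk_kv[of b B \<sigma> 0] assms(1) While.prems(2) by (auto simp: algebra_simps)
qed auto

subsection \<open>Failure probabilities\<close>

lemma prob_bind_pmf: "measure_pmf.prob (bind_pmf M f) A = (\<integral>x. measure_pmf.prob (f x) A \<partial>measure_pmf M)"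
proof -
  have "emeasure (measure_pmf (bind_pmf M f)) A = (\<integral>\<^sup>+x. emeasure (measure_pmf (f x)) A \<partial>measure_pmf M)"
    by simp
  also have "\<dots> = (\<integral>\<^sup>+x. ennreal (measure_pmf.prob (f x) A) \<partial>measure_pmf M)"
    by (simp add: measure_pmf.emeasure_eq_measure)
  also have "\<dots> = ennreal (\<integral>x. measure_pmf.prob (f x) A \<partial>measure_pmf M)"
    by (intro nn_integral_eq_integral measure_pmf.integrable_const_bound[where B=1]) auto
  finally show ?thesis
    by (simp add: measure_pmf.emeasure_eq_measure)
qed

text \<open>Total probability with failure bound \<open>a\<close> on the good event and the weaker
  bound \<open>b\<close> off it. Keeping the difference \<open>b - a\<close>, rather than weakening
  the result to \<open>a + \<epsilon>\<close>, is what gives a geometric decrease in loops.\<close>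

lemma prob_bind_le:
  assumes "\<And>x. x \<in> set_pmf M \<Longrightarrow> x \<in> G \<Longrightarrow> measure_pmf.prob (f x) A \<le> a"
    "\<And>x. x \<in> set_pmf M \<Longrightarrow> measure_pmf.prob (f x) A \<le> b" "a \<le> b"
    "measure_pmf.prob M (- G) \<le> \<epsilon>"
  shows "measure_pmf.prob (bind_pmf M f) A \<le> a + \<epsilon> * (b - a)"
proof -
  have "measure_pmf.prob (bind_pmf M f) A \<le> (\<integral>x. a + (b - a) * indicator (- G) x \<partial>measure_pmf M)"
    unfolding prob_bind_pmf
  proof (intro integral_mono_AE)
    show "integrable (measure_pmf M) (\<lambda>x. measure_pmf.prob (f x) A)"
      by (intro measure_pmf.integrable_const_bound[where B=1]) auto
    show "integrable (measure_pmf M) (\<lambda>x. a + (b - a) * indicator (- G) x :: real)"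
      by (intro Bochner_Integration.integrable_add integrable_mult_right) (auto intro: measure_pmf.integrable_const_bound[where B=1])
    show "AE x in measure_pmf M. measure_pmf.prob (f x) A \<le> a + (b - a) * indicator (- G) x"
      using assms by (auto simp: AE_measure_pmf_iff split: split_indicator)
  qed
  also have "\<dots> = a + (b - a) * measure_pmf.prob M (- G)"
    by (subst Bochner_Integration.integral_add) (auto intro: measure_pmf.integrable_const_bound[where B=1])
  also have "\<dots> \<le> a + (b - a) * \<epsilon>" using assms(3,4) by (intro add_left_mono mult_left_mono) auto
  finally show ?thesis by (simp add: mult.commute)
qed

section \<open>A program logic for failure probabilities\<close>

locale machine =
  fixes res :: resolution and w :: "nat \<Rightarrow> real" and B :: nat
  assumes res: "is_resolution res" and B16: "16 \<le> B"
begin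

text \<open>The bound is required for all states with these memories, hence for any counters and any
  history of comparisons. For \<open>\<epsilon> = 0\<close> it says that \<open>Q\<close> holds
  after every possible outcome. As a predicate on memories it can itself be used as a
  postcondition.\<close>

definition hp :: "real \<Rightarrow> prog \<Rightarrow> (wmemory \<Rightarrow> rmemory \<Rightarrow> bool) \<Rightarrow> wmemory \<Rightarrow> rmemory \<Rightarrow> bool" where
  "hp \<epsilon> p Q W R \<longleftrightarrow> (\<forall>\<sigma>. wmem \<sigma> = W \<longrightarrow> rmem \<sigma> = R \<longrightarrow>
     measure_pmf.prob (exec res w B p \<sigma>) {\<tau>. \<not> Q (wmem \<tau>) (rmem \<tau>)} \<le> \<epsilon>)"

lemma hp0_iff: "hp 0 p Q W R \<longleftrightarrow> (\<forall>\<sigma>. wmem \<sigma> = W \<longrightarrow> rmem \<sigma> = R \<longrightarrow>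
     (\<forall>\<tau>\<in>set_pmf (exec res w B p \<sigma>). Q (wmem \<tau>) (rmem \<tau>)))"
proof -
  have "measure_pmf.prob M {\<tau>. \<not> P \<tau>} \<le> 0 \<longleftrightarrow> (\<forall>\<tau>\<in>set_pmf M. P \<tau>)" for M :: "state pmf" and P
    unfolding measure_le_0_iff measure_pmf_zero_iff by blast
  then show ?thesis unfolding hp_def by auto
qed

lemma hp_mono: "hp \<epsilon> p Q W R \<Longrightarrow> \<epsilon> \<le> \<epsilon>' \<Longrightarrow> (\<And>W R. Q W R \<Longrightarrow> Q' W R) \<Longrightarrow> hp \<epsilon>' p Q' W R"
  unfolding hp_def
  apply (intro allI impI)
  subgoal for \<sigma>
    by (rule order_trans[of _ "measure_pmf.prob (exec res w B p \<sigma>) {\<tau>. \<not> Q (wmem \<tau>) (rmem \<tau>)}"])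
       (auto intro!: measure_pmf.finite_measure_mono elim!: allE[of _ \<sigma>])
  done

lemma hp_one: "1 \<le> \<epsilon> \<Longrightarrow> hp \<epsilon> p Q W R"
  unfolding hp_def by (auto intro: order_trans[OF measure_pmf.prob_le_1])

lemma hp_conj:
  assumes "hp a p P W R" "hp b p Q W R"
  shows "hp (a + b) p (\<lambda>W R. P W R \<and> Q W R) W R"
  unfolding hp_def
proof (intro allI impI)
  fix \<sigma> :: state assume s: "wmem \<sigma> = W" "rmem \<sigma> = R"
  let ?P = "{\<tau>. \<not> P (wmem \<tau>) (rmem \<tau>)}" and ?Q = "{\<tau>. \<not> Q (wmem \<tau>) (rmem \<tau>)}"
  have e: "{\<tau>. \<not> (P (wmem \<tau>) (rmem \<tau>) \<and> Q (wmem \<tau>) (rmem \<tau>))} = ?P \<union> ?Q" by auto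
  have "measure_pmf.prob (exec res w B p \<sigma>) (?P \<union> ?Q)
      \<le> measure_pmf.prob (exec res w B p \<sigma>) ?P + measure_pmf.prob (exec res w B p \<sigma>) ?Q"
    by (rule measure_Un_le) auto
  then show "measure_pmf.prob (exec res w B p \<sigma>) {\<tau>. \<not> (P (wmem \<tau>) (rmem \<tau>) \<and> Q (wmem \<tau>) (rmem \<tau>))} \<le> a + b"
    unfolding e using assms(1)[unfolded hp_def, rule_format, OF s] assms(2)[unfolded hp_def, rule_format, OF s] by linarith
qed

lemma hp_conj0: "hp 0 p P W R \<Longrightarrow> hp b p Q W R \<Longrightarrow> hp b p (\<lambda>W R. P W R \<and> Q W R) W R"
  using hp_conj[of 0 p P W R b Q] by simp

lemma hp_ball:
  assumes "finite I" "\<And>i. i \<in> I \<Longrightarrow> hp a p (Q i) W R"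
  shows "hp (real (card I) * a) p (\<lambda>W R. \<forall>i\<in>I. Q i W R) W R"
  using assms
proof (induction I)
  case empty
  then show ?case by (simp add: hp0_iff)
next
  case (insert x I)
  then have "hp (a + real (card I) * a) p (\<lambda>W R. Q x W R \<and> (\<forall>i\<in>I. Q i W R)) W R"
    by (intro hp_conj) auto
  then show ?case using insert by (simp add: algebra_simps)
qed

lemma hp_seq:
  assumes p: "hp a p M W R" and q: "\<And>W R. M W R \<Longrightarrow> hp b q Q W R" and "b \<le> 1"
  shows "hp (a + (1 - a) * b) (Seq p q) Q W R"
  unfolding hp_def
proof (intro allI impI)
  fix \<sigma> :: state assume s: "wmem \<sigma> = W" "rmem \<sigma> = R"
  have c: "- {\<tau>. M (wmem \<tau>) (rmem \<tau>)} = {\<tau>. \<not> M (wmem \<tau>) (rmem \<tau>)}" by auto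
  have "measure_pmf.prob (bind_pmf (exec res w B p \<sigma>) (exec res w B q)) {\<tau>. \<not> Q (wmem \<tau>) (rmem \<tau>)} \<le> b + a * (1 - b)"
  proof (rule prob_bind_le[where G="{\<tau>. M (wmem \<tau>) (rmem \<tau>)}"])
    show "measure_pmf.prob (exec res w B p \<sigma>) (- {\<tau>. M (wmem \<tau>) (rmem \<tau>)}) \<le> a"
      unfolding c using p s unfolding hp_def by auto
  qed (use q \<open>b \<le> 1\<close> in \<open>auto simp: hp_def\<close>)
  then show "measure_pmf.prob (exec res w B (Seq p q) \<sigma>) {\<tau>. \<not> Q (wmem \<tau>) (rmem \<tau>)} \<le> a + (1 - a) * b"
    by (simp add: algebra_simps)
qed

text \<open>The intermediate assertion is the judgement about the rest of the program, so sequences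
  of deterministic steps are verified by symbolic execution without writing any assertion in
  between.\<close>

lemma hp_seq0: "hp 0 p (hp b q Q) W R \<Longrightarrow> b \<le> 1 \<Longrightarrow> hp b (Seq p q) Q W R"
  using hp_seq[of 0 p "hp b q Q" W R b q Q] by simp

lemma hp_seq_add: "hp a p M W R \<Longrightarrow> (\<And>W R. M W R \<Longrightarrow> hp b q Q W R) \<Longrightarrow> 0 \<le> a \<Longrightarrow> 0 \<le> b \<Longrightarrow> hp (a + b) (Seq p q) Q W R"
  apply (cases "b \<le> 1")
  apply (rule hp_mono[OF hp_seq[of a p M W R b q Q]])
  apply (auto simp: algebra_simps intro: hp_one)
  done

lemma hp_frame: "hp 0 p (\<lambda>W' R'. \<forall>a. (\<forall>i\<in>instrs p. a \<notin> ww i) \<longrightarrow> W' a = W a) W R"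
  unfolding hp0_iff using exec_wframe by blast

lemma hp_rframe: "hp 0 p (\<lambda>W' R'. \<forall>a. (\<forall>i\<in>instrs p. a \<notin> rw i) \<longrightarrow> R' a = R a) W R"
  unfolding hp0_iff using exec_rframe by blast

text \<open>The postcondition has to hold for every content \<open>f\<close> that some choice of
  winners can produce. This keeps the resolution function out of all later proofs.\<close>

lemma hp_store:
  assumes "\<And>f. (\<And>x. (\<exists>i<wv B W 0 k. wv B W i g \<noteq> 0 \<and> wv B W i x' = x \<and> f x = wv B W i e) \<or>
      ((\<forall>i<wv B W 0 k. wv B W i g \<noteq> 0 \<longrightarrow> wv B W i x' \<noteq> x) \<and> f x = W a x)) \<Longrightarrow> Q (W(a := f)) R"
  shows "hp 0 (Par k g (Store a x' e)) Q W R"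
  unfolding hp0_iff
proof (intro allI impI ballI)
  fix \<sigma> \<tau> assume s: "wmem \<sigma> = W" "rmem \<sigma> = R" and t: "\<tau> \<in> set_pmf (exec res w B (Par k g (Store a x' e)) \<sigma>)"
  let ?A = "{i. i < wv B W 0 k \<and> wv B W i g \<noteq> 0}"
  let ?f = "cwrite (res \<sigma>) ?A (\<lambda>i. wv B W i x') (\<lambda>i. wv B W i e) (W a)"
  have "wmem \<tau> = W(a := ?f)" "rmem \<tau> = R"
    using t s by (auto simp: Let_def wval_eq)
  moreover have "Q (W(a := ?f)) R"
  proof (rule assms)
    fix x
    show "(\<exists>i<wv B W 0 k. wv B W i g \<noteq> 0 \<and> wv B W i x' = x \<and> ?f x = wv B W i e) \<or>
      ((\<forall>i<wv B W 0 k. wv B W i g \<noteq> 0 \<longrightarrow> wv B W i x' \<noteq> x) \<and> ?f x = W a x)"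
      by (rule cwrite_cases[OF res, of ?A "\<lambda>i. wv B W i x'" x \<sigma> "\<lambda>i. wv B W i e" "W a"]) auto
  qed
  ultimately show "Q (wmem \<tau>) (rmem \<tau>)" by simp
qed

lemma hp_rstore:
  assumes "\<And>f. (\<And>x. (\<exists>i<wv B W 0 k. wv B W i g \<noteq> 0 \<and> wv B W i x' = x \<and> f x = rv B W R i e) \<or>
      ((\<forall>i<wv B W 0 k. wv B W i g \<noteq> 0 \<longrightarrow> wv B W i x' \<noteq> x) \<and> f x = R a x)) \<Longrightarrow> Q W (R(a := f))"
  shows "hp 0 (Par k g (RStore a x' e)) Q W R"
  unfolding hp0_iff
proof (intro allI impI ballI)
  fix \<sigma> \<tau> assume s: "wmem \<sigma> = W" "rmem \<sigma> = R" and t: "\<tau> \<in> set_pmf (exec res w B (Par k g (RStore a x' e)) \<sigma>)"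
  let ?A = "{i. i < wv B W 0 k \<and> wv B W i g \<noteq> 0}"
  let ?f = "cwrite (res \<sigma>) ?A (\<lambda>i. wv B W i x') (\<lambda>i. rv B W R i e) (R a)"
  have "rmem \<tau> = R(a := ?f)" "wmem \<tau> = W"
    using t s by (auto simp: Let_def wval_eq rval_eq)
  moreover have "Q W (R(a := ?f))"
  proof (rule assms)
    fix x
    show "(\<exists>i<wv B W 0 k. wv B W i g \<noteq> 0 \<and> wv B W i x' = x \<and> ?f x = rv B W R i e) \<or>
      ((\<forall>i<wv B W 0 k. wv B W i g \<noteq> 0 \<longrightarrow> wv B W i x' \<noteq> x) \<and> ?f x = R a x)"
      by (rule cwrite_cases[OF res, of ?A "\<lambda>i. wv B W i x'" x \<sigma> "\<lambda>i. rv B W R i e" "R a"]) auto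
  qed
  ultimately show "Q (wmem \<tau>) (rmem \<tau>)" by simp
qed

lemma hp_own:
  assumes "Q (W(a := \<lambda>x. if x < wv B W 0 k \<and> wv B W x g \<noteq> 0 then wv B W x e else W a x)) R"
  shows "hp 0 (Par k g (Store a Pid e)) Q W R"
proof (rule hp_store)
  fix f
  assume f: "(\<exists>i<wv B W 0 k. wv B W i g \<noteq> 0 \<and> wv B W i Pid = x \<and> f x = wv B W i e) \<or>
      ((\<forall>i<wv B W 0 k. wv B W i g \<noteq> 0 \<longrightarrow> wv B W i Pid \<noteq> x) \<and> f x = W a x)" for x
  have "f x = (if x < wv B W 0 k \<and> wv B W x g \<noteq> 0 then wv B W x e else W a x)" for x
    using f[of x] by auto
  then have "f = (\<lambda>x. if x < wv B W 0 k \<and> wv B W x g \<noteq> 0 then wv B W x e else W a x)"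
    by (rule ext)
  then show "Q (W(a := f)) R" using assms by simp
qed

lemma hp_compare:
  assumes "Q (W(a := \<lambda>x. if x < wv B W 0 k \<and> wv B W x g \<noteq> 0
     then (if form_val w (rv B W R x r) \<le> form_val w (rv B W R x r') then 1 else 0) else W a x)) R"
  shows "hp 0 (Par k g (Compare a Pid r r')) Q W R"
  unfolding hp0_iff
proof (intro allI impI ballI)
  fix \<sigma> \<tau> assume s: "wmem \<sigma> = W" "rmem \<sigma> = R" and t: "\<tau> \<in> set_pmf (exec res w B (Par k g (Compare a Pid r r')) \<sigma>)"
  let ?A = "{i. i < wv B W 0 k \<and> wv B W i g \<noteq> 0}"
  let ?v = "\<lambda>x. if form_val w (rv B W R x r) \<le> form_val w (rv B W R x r') then 1 else (0::nat)"
  let ?f = "cwrite (res \<sigma>) ?A (\<lambda>i. i) ?v (W a)"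
  have 1: "wmem \<tau> = W(a := ?f)" "rmem \<tau> = R"
    using t s by (auto simp: Let_def wval_eq rval_eq)
  have "?f x = (if x \<in> ?A then ?v x else W a x)" for x
    by (rule cwrite_cases[OF res, of ?A "\<lambda>i. i" x \<sigma> ?v "W a"]) auto
  then have "?f = (\<lambda>x. if x < wv B W 0 k \<and> wv B W x g \<noteq> 0 then ?v x else W a x)" by auto
  then show "Q (wmem \<tau>) (rmem \<tau>)" using assms by (simp only: 1)
qed

lemma hp_draw:
  assumes "measure_pmf.prob (Pi_pmf {i. i < wv B W 0 k \<and> wv B W i g \<noteq> 0} 0 (\<lambda>i. pmf_of_set {..< max 1 (wv B W i e)}))
     {\<rho>. \<not> Q (W(a := \<lambda>x. if x < wv B W 0 k \<and> wv B W x g \<noteq> 0 then \<rho> x else W a x)) R} \<le> \<epsilon>"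
  shows "hp \<epsilon> (Par k g (Draw a e)) Q W R"
  unfolding hp_def
proof (intro allI impI)
  fix \<sigma> :: state assume s: "wmem \<sigma> = W" "rmem \<sigma> = R"
  show "measure_pmf.prob (exec res w B (Par k g (Draw a e)) \<sigma>) {\<tau>. \<not> Q (wmem \<tau>) (rmem \<tau>)} \<le> \<epsilon>"
    using assms unfolding s[symmetric] by (simp add: Let_def wval_eq vimage_def pmf.map_comp o_def)
qed

lemma draw_range:
  assumes "\<rho> \<in> set_pmf (Pi_pmf A 0 (\<lambda>i. pmf_of_set {..< max 1 (e i :: nat)}))" "finite A" "i \<in> A" "0 < e i"
  shows "\<rho> i < e i"
proof -
  have "\<rho> \<in> PiE_dflt A 0 (\<lambda>i. set_pmf (pmf_of_set {..< max 1 (e i)}))"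
    using assms(1,2) by (simp add: set_Pi_pmf o_def)
  then have "\<rho> i \<in> set_pmf (pmf_of_set {..< max 1 (e i)})" using assms(3) by (auto simp: PiE_dflt_def)
  also have "\<dots> = {..< max 1 (e i)}" by (rule set_pmf_of_set) (auto simp: lessThan_empty_iff max_def split: if_splits)
  finally show ?thesis using assms(4) by auto
qed

definition rep :: "nat \<Rightarrow> prog \<Rightarrow> nat \<Rightarrow> state \<Rightarrow> state pmf" where
  "rep t p k = iterate t (\<lambda>_. True) (exec res w B p) k"

text \<open>The guard \<open>Const 1\<close> never fails, so the loop runs exactly as often as its
  bound says; each test of this guard costs 3, the argument of \<open>rep\<close>.\<close>

lemma hp_for:
  assumes "\<And>\<sigma>. wmem \<sigma> = W \<Longrightarrow> rmem \<sigma> = R \<Longrightarrow>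
     measure_pmf.prob (rep 3 p (wv B W 0 k) \<sigma>) {\<tau>. \<not> Q (wmem \<tau>) (rmem \<tau>)} \<le> \<epsilon>"
  shows "hp \<epsilon> (While k (Const 1) p) Q W R"
proof -
  have "wv B W' 0 (Const 1) \<noteq> 0" for W' using B16 by simp
  then show ?thesis
    unfolding hp_def using assms by (auto simp: rep_def wval_eq numeral_3_eq_3)
qed

lemma rep_Suc: "rep t p (Suc k) \<sigma> = bind_pmf (exec res w B p (charge t t \<sigma>)) (rep t p k)"
  by (simp add: rep_def Let_def)

lemma hp_for_inv:
  assumes "I 0 W R" "\<And>j W R. I j W R \<Longrightarrow> hp 0 p (I (Suc j)) W R"
  shows "hp 0 (While k (Const 1) p) (I (wv B W 0 k)) W R"
proof (rule hp_for)
  have *: "\<forall>\<tau>\<in>set_pmf (rep 3 p K \<sigma>). I (j + K) (wmem \<tau>) (rmem \<tau>)" if "I j (wmem \<sigma>) (rmem \<sigma>)" for j K \<sigma>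
    using that
  proof (induction K arbitrary: j \<sigma>)
    case 0
    then show ?case by (simp add: rep_def)
  next
    case (Suc K)
    have "I (Suc j) (wmem \<upsilon>) (rmem \<upsilon>)" if "\<upsilon> \<in> set_pmf (exec res w B p (charge 3 3 \<sigma>))" for \<upsilon>
      using assms(2)[OF Suc.prems, unfolded hp0_iff, rule_format, of "charge 3 3 \<sigma>"] that by auto
    then show ?case using Suc.IH[of "Suc j"] by (auto simp: rep_Suc)
  qed
  fix \<sigma> :: state assume "wmem \<sigma> = W" "rmem \<sigma> = R"
  then have "measure_pmf.prob (rep 3 p (wv B W 0 k) \<sigma>) {\<tau>. \<not> I (wv B W 0 k) (wmem \<tau>) (rmem \<tau>)} = 0"
    using *[of 0 \<sigma> "wv B W 0 k"] assms(1) by (subst measure_pmf_zero_iff) auto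
  then show "measure_pmf.prob (rep 3 p (wv B W 0 k) \<sigma>) {\<tau>. \<not> I (wv B W 0 k) (wmem \<tau>) (rmem \<tau>)} \<le> 0" by simp
qed

text \<open>Exponential moment argument: at level \<open>i\<close> with \<open>K\<close> rounds
  left, the failure probability is at most \<open>2 ^ (l - i) * (1 - p / 2) ^ K\<close>. A round
  raises the level with probability at least \<open>p\<close>, which halves the first factor, so on
  average this factor shrinks by \<open>p / 2 + (1 - p) = 1 - p / 2\<close>. The case
  \<open>l = 0\<close> is kept apart because then failure is impossible, even if the loop runs zero
  times.\<close>

lemma hp_for_levels:
  assumes p: "0 < p" "p \<le> 1"
    and pres: "\<And>i W R. I W R \<Longrightarrow> E i W R \<Longrightarrow> hp 0 b (\<lambda>W R. I W R \<and> E i W R) W R"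
    and prog: "\<And>i W R. i < l \<Longrightarrow> I W R \<Longrightarrow> E i W R \<Longrightarrow> hp (1 - p) b (E (Suc i)) W R"
    and init: "I W R" "E 0 W R"
  shows "hp (if l = 0 then 0 else 2 ^ l * (1 - p / 2) ^ wv B W 0 k) (While k (Const 1) b) (E l) W R"
proof (rule hp_for)
  have *: "measure_pmf.prob (rep 3 b K \<sigma>) {\<tau>. \<not> E l (wmem \<tau>) (rmem \<tau>)}
     \<le> (if i = l then 0 else 2 ^ (l - i) * (1 - p / 2) ^ K)"
    if "I (wmem \<sigma>) (rmem \<sigma>)" "E i (wmem \<sigma>) (rmem \<sigma>)" "i \<le> l" for i K \<sigma>
    using that
  proof (induction K arbitrary: i \<sigma>)
    case 0
    have "(1::real) \<le> 2 ^ (l - i)" by simp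
    then show ?case using 0 by (auto simp: rep_def measure_return_pmf indicator_def)
  next
    case (Suc K)
    let ?M = "exec res w B b (charge 3 3 \<sigma>)"
    have I: "I (wmem \<upsilon>) (rmem \<upsilon>)" "E i (wmem \<upsilon>) (rmem \<upsilon>)" if "\<upsilon> \<in> set_pmf ?M" for \<upsilon>
      using pres[OF Suc.prems(1,2), unfolded hp0_iff, rule_format, of "charge 3 3 \<sigma>"] that by auto
    show ?case
    proof (cases "i = l")
      case True
      then have "measure_pmf.prob (rep 3 b (Suc K) \<sigma>) {\<tau>. \<not> E l (wmem \<tau>) (rmem \<tau>)} \<le> 0 + 0 * (0 - 0)"
        unfolding rep_Suc by (intro prob_bind_le[where G=UNIV]) (use Suc.IH[of _ i] I in \<open>auto\<close>)
      then show ?thesis using True by simp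
    next
      case False
      then have il: "i < l" using Suc.prems(3) by simp
      let ?r = "(1 - p / 2) ^ K"
      have r: "0 \<le> ?r" using p by (intro zero_le_power) auto
      have r2: "2 ^ (l - i) = 2 * (2 :: real) ^ (l - Suc i)" using il
        by (metis Suc_diff_Suc power_Suc)
      have le: "(if Suc i = l then 0 else 2 ^ (l - Suc i) * ?r) \<le> 2 ^ (l - Suc i) * ?r"
        using r by simp
      have "measure_pmf.prob (rep 3 b (Suc K) \<sigma>) {\<tau>. \<not> E l (wmem \<tau>) (rmem \<tau>)}
        \<le> 2 ^ (l - Suc i) * ?r + (1 - p) * (2 ^ (l - i) * ?r - 2 ^ (l - Suc i) * ?r)"
        unfolding rep_Suc
      proof (rule prob_bind_le[where G="{\<upsilon>. E (Suc i) (wmem \<upsilon>) (rmem \<upsilon>)}"])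
        fix \<upsilon> assume u: "\<upsilon> \<in> set_pmf ?M" "\<upsilon> \<in> {\<upsilon>. E (Suc i) (wmem \<upsilon>) (rmem \<upsilon>)}"
        show "measure_pmf.prob (rep 3 b K \<upsilon>) {\<tau>. \<not> E l (wmem \<tau>) (rmem \<tau>)} \<le> 2 ^ (l - Suc i) * ?r"
          using Suc.IH[OF I(1)[OF u(1)], of "Suc i"] u(2) il le by (auto split: if_splits)
      next
        fix \<upsilon> assume u: "\<upsilon> \<in> set_pmf ?M"
        show "measure_pmf.prob (rep 3 b K \<upsilon>) {\<tau>. \<not> E l (wmem \<tau>) (rmem \<tau>)} \<le> 2 ^ (l - i) * ?r"
          using Suc.IH[OF I[OF u]] il by auto
      next
        show "2 ^ (l - Suc i) * ?r \<le> 2 ^ (l - i) * ?r" using r by (simp add: r2)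
        have c: "- {\<upsilon>. E (Suc i) (wmem \<upsilon>) (rmem \<upsilon>)} = {\<upsilon>. \<not> E (Suc i) (wmem \<upsilon>) (rmem \<upsilon>)}" by auto
        show "measure_pmf.prob ?M (- {\<upsilon>. E (Suc i) (wmem \<upsilon>) (rmem \<upsilon>)}) \<le> 1 - p"
          unfolding c using prog[OF il Suc.prems(1,2), unfolded hp_def, rule_format, of "charge 3 3 \<sigma>"] by simp
      qed
      also have "\<dots> = 2 ^ (l - i) * (1 - p / 2) ^ Suc K" by (simp add: r2 algebra_simps)
      finally show ?thesis using False by simp
    qed
  qed
  fix \<sigma> :: state assume "wmem \<sigma> = W" "rmem \<sigma> = R"
  then show "measure_pmf.prob (rep 3 b (wv B W 0 k) \<sigma>) {\<tau>. \<not> E l (wmem \<tau>) (rmem \<tau>)}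
     \<le> (if l = 0 then 0 else 2 ^ l * (1 - p / 2) ^ wv B W 0 k)"
    using *[of \<sigma> 0 "wv B W 0 k"] init by auto
qed

end

section \<open>Minima in constant depth\<close>

definition wnot :: "wexp \<Rightarrow> wexp" where "wnot e = Op Less e (Const 1)"
definition wand :: "wexp \<Rightarrow> wexp \<Rightarrow> wexp" where
  "wand e f = Op Mul (Op Less (Const 0) e) (Op Less (Const 0) f)"
definition wor :: "wexp \<Rightarrow> wexp \<Rightarrow> wexp" where "wor e f = wnot (wand (wnot e) (wnot f))"
definition weq :: "wexp \<Rightarrow> wexp \<Rightarrow> wexp" where "weq e f = wand (wnot (Op Less e f)) (wnot (Op Less f e))"
definition wmd :: "wexp \<Rightarrow> wexp \<Rightarrow> wexp" where "wmd e f = Op Sub e (Op Mul (Op Div e f) f)"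
definition prm :: "nat \<Rightarrow> wexp" where "prm i = Load 0 (Const i)"

fun seqs :: "prog list \<Rightarrow> prog" where
  "seqs [] = Skip"
| "seqs [p] = p"
| "seqs (p # q # ps) = Seq p (seqs (q # ps))"

primrec rds :: "wexp \<Rightarrow> nat set" where
  "rds (Const c) = {}" | "rds Pid = {}" | "rds (Load a e) = insert a (rds e)" | "rds (Op f e e') = rds e \<union> rds e'"

lemma wv_cong: "(\<And>a. a \<in> rds e \<Longrightarrow> W' a = W a) \<Longrightarrow> wv B W' i e = wv B W i e"
  by (induction e) auto

lemma rds_simps [simp]: "rds (wnot e) = rds e" "rds (wand e f) = rds e \<union> rds f"
  "rds (wor e f) = rds e \<union> rds f" "rds (weq e f) = rds e \<union> rds f" "rds (wmd e f) = rds e \<union> rds f"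
  "rds (prm i) = {0}"
  by (auto simp: wnot_def wand_def wor_def weq_def wmd_def prm_def)

definition lexlt :: "real \<times> nat \<Rightarrow> real \<times> nat \<Rightarrow> bool" where
  "lexlt a b \<longleftrightarrow> fst a < fst b \<or> fst a = fst b \<and> snd a < snd b"

lemma lexlt_irrefl [simp]: "\<not> lexlt a a" by (simp add: lexlt_def)
lemma lexlt_trans: "lexlt a b \<Longrightarrow> lexlt b c \<Longrightarrow> lexlt a c" by (auto simp: lexlt_def)
lemma not_lexlt_trans: "\<not> lexlt a b \<Longrightarrow> \<not> lexlt b c \<Longrightarrow> \<not> lexlt a c" by (auto simp: lexlt_def)
lemma lexlt_linear: "\<not> lexlt a b \<Longrightarrow> \<not> lexlt b a \<Longrightarrow> a = b" by (cases a; cases b) (auto simp: lexlt_def)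

lemma mult_add_unique:
  fixes a b Z :: nat
  assumes "a * Z + b = a' * Z + b'" "b < Z" "b' < Z"
  shows "a = a'" "b = b'"
proof -
  have "(a * Z + b) div Z = (a' * Z + b') div Z" "(a * Z + b) mod Z = (a' * Z + b') mod Z"
    using assms(1) by simp_all
  then show "a = a'" "b = b'" using assms(2,3) by simp_all
qed

lemma of_bool_pos [simp]: "(0 < (if P then 1 else (0::nat))) = P" "(0 < (if P then Suc 0 else (0::nat))) = P"
  "((if P then 1 else (0::nat)) = 0) = (\<not> P)" "((if P then Suc 0 else (0::nat)) = 0) = (\<not> P)"
  by auto

text \<open>Comparing in both directions decides strict order and equality of two lengths without
  subtracting them; hop counts break ties. A cell not in use beats nothing and is beaten by every
  cell in use.\<close>

definition cmp2 :: "wexp \<Rightarrow> wexp \<Rightarrow> wexp \<Rightarrow> prog" where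
  "cmp2 k ex ey = seqs
    [Par k (Const 1) (Compare 24 Pid (RLoad 1 ex) (RLoad 1 ey)),
     Par k (Const 1) (Compare 25 Pid (RLoad 1 ey) (RLoad 1 ex)),
     Par k (Const 1) (Store 26 Pid (wand (Load 3 ex) (wor (wnot (Load 3 ey))
       (wand (Load 24 Pid) (wor (wnot (Load 25 Pid)) (Op Less (Load 5 ex) (Load 5 ey)))))))]"

text \<open>
  Memory layout. The cells are indexed jointly in word array 3 (nonzero if the cell is in use), weight array 1
  (length) and word array 5 (number of arcs). Candidate \<open>p\<close> is described by the entries at \<open>p\<close> of the
  word arrays 12 (nonzero if active), 13 (target cell), 14 (rank among the candidates for this target), 15 (their
  number \<open>d\<close>), 16 (a power of two \<open>t\<close> with \<open>t\<^sup>2 \<le> d < 4 t\<^sup>2\<close>, the size of a sample), 17 and 18 (the cells whose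
  sum it is). Arrays 29 and 31 to 35 hold slot addresses and activity flags derived from these, array 19
  the candidates by target and rank, arrays 20 to 22 random draws, slots and defeated slots, array 23 the
  winner for each target.

  Word array 0 holds the parameters: 0 to 3 are \<open>n\<close>, \<open>m\<close>, \<open>s\<close>, \<open>h\<close>; 4 is the number \<open>L\<close> of binary digits of \<open>n\<close>,
  5 is \<open>b = max h L\<close>, 6 is the number \<open>N\<close> of samples, 7 and 8 are the numbers of rounds of the two kinds,
  9 and 10 their numbers of candidates, 11 a cell that is never in use, 12 the first cell for candidates, 13
  is \<open>N + n\<close> and 14 is \<open>m n\<close>.
\<close>

definition cand :: wexp where "cand = Op Add (prm 12) Pid"

text \<open>Sums with \<open>n\<close> or more arcs are discarded. Nothing is lost, since
  lexicographically shortest walks are simple, and hop counts stay small enough that adding two of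
  them does not overflow.\<close>

definition mkcand :: "wexp \<Rightarrow> prog" where
  "mkcand k = seqs
    [Par k (Const 1) (RStore 1 cand (RAdd (RLoad 1 (Load 17 Pid)) (RLoad 1 (Load 18 Pid)))),
     Par k (Const 1) (Store 5 cand (Op Add (Load 5 (Load 17 Pid)) (Load 5 (Load 18 Pid)))),
     Par k (Const 1) (Store 3 cand (wand (Load 12 Pid) (wand (Load 3 (Load 17 Pid)) (wand (Load 3 (Load 18 Pid))
       (Op Less (Op Add (Load 5 (Load 17 Pid)) (Load 5 (Load 18 Pid))) (prm 0))))))]"

text \<open>All pairs of the \<open>t\<close> slots of a target are compared at once: the processor
  of rank \<open>a * t + b\<close> lets slot \<open>b\<close> attack slot \<open>a\<close>, and
  \<open>t * t \<le> d\<close> guarantees that it exists. The undefeated slots in use have equal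
  labels, so it does not matter which of them the concurrent write selects.\<close>

definition duel :: "wexp \<Rightarrow> prog" where
  "duel k = seqs
    [Par k (Load 34 Pid) (Store 22 (Load 31 Pid) (Const 0)),
     cmp2 k (Load 21 (Load 33 Pid)) (Load 21 (Load 32 Pid)),
     Par k (wand (Load 35 Pid) (Load 26 Pid)) (Store 22 (Load 32 Pid) (Const 1)),
     Par k (wand (Load 34 Pid) (wand (wnot (Load 22 (Load 31 Pid))) (Load 3 (Load 21 (Load 31 Pid)))))
       (Store 23 (Load 13 Pid) (Load 21 (Load 31 Pid)))]"

text \<open>The cell of parameter 11 is never in use and thus loses against every candidate in use;
  it stands for the absence of a winner.\<close>

definition reset_win :: "wexp \<Rightarrow> prog" where
  "reset_win k = Par k (Load 12 Pid) (Store 23 (Load 13 Pid) (prm 11))"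

text \<open>Every active processor draws, but only the draws of those with rank below
  \<open>t\<close> are read: they own the \<open>t\<close> slots.\<close>

definition draw_sample :: "wexp \<Rightarrow> prog" where
  "draw_sample k = Par k (Load 12 Pid) (Draw 20 (Load 15 Pid))"

definition survivors :: "wexp \<Rightarrow> prog" where
  "survivors k = seqs
    [Par k (Load 34 Pid) (Store 21 (Load 31 Pid) (Load 19 (Op Add (Load 29 Pid) (Load 20 Pid)))),
     duel k,
     cmp2 k cand (Load 23 (Load 13 Pid)),
     Par k (Load 34 Pid) (Store 21 (Load 31 Pid) (prm 11))]"

text \<open>Slots are drawn from a range of \<open>8 t\<close> although the table has only
  \<open>t\<close> of them, as more could not be compared pairwise by \<open>d\<close> processors.
  Up to \<open>4 t\<close> survivors then leave a given slot to its owner with probability at least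
  1/2, and the slot exists with probability 1/8.\<close>

definition draw_slot :: "wexp \<Rightarrow> prog" where
  "draw_slot k = Par k (Load 12 Pid) (Draw 20 (Op Mul (Const 8) (Load 16 Pid)))"

definition throw :: "wexp \<Rightarrow> prog" where
  "throw k = seqs
    [Par k (wand (Load 26 Pid) (Op Less (Load 20 Pid) (Load 16 Pid)))
       (Store 21 (Op Add (Load 29 Pid) (Load 20 Pid)) cand),
     duel k]"

text \<open>Only the candidate recorded as winner of its target may write, so at most one processor
  writes to each cell, and only if it improves the cell.\<close>

definition update :: "wexp \<Rightarrow> prog" where
  "update k = seqs
    [cmp2 k cand (Load 13 Pid),
     Par k (Const 1) (Store 28 Pid (wand (wand (Load 12 Pid) (Load 26 Pid)) (weq (Load 23 (Load 13 Pid)) cand))),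
     Par k (Load 28 Pid) (RStore 1 (Load 13 Pid) (RLoad 1 cand)),
     Par k (Load 28 Pid) (Store 5 (Load 13 Pid) (Load 5 cand)),
     Par k (Load 28 Pid) (Store 3 (Load 13 Pid) (Const 1))]"

definition pick :: "wexp \<Rightarrow> prog" where
  "pick k = seqs [reset_win k, draw_sample k, survivors k, draw_slot k, throw k]"

definition round :: "wexp \<Rightarrow> prog" where
  "round k = seqs [mkcand k, pick k, update k]"

section \<open>Evaluation of words, writes without conflict, and lexicographic comparison\<close>

context machine
begin

lemma small_mod [simp]: "c < 16 \<Longrightarrow> c mod B = c"
  using B16 by simp

lemma B_gt [simp]: "0 < B" "Suc 0 < B" "B \<noteq> Suc 0" "B \<noteq> 0"
  using B16 by simp_all

lemma wv_bool [simp]: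
  "wv B W i (wnot e) = (if wv B W i e = 0 then 1 else 0)"
  "wv B W i (wand e f) = (if wv B W i e \<noteq> 0 \<and> wv B W i f \<noteq> 0 then 1 else 0)"
  "wv B W i (wor e f) = (if wv B W i e \<noteq> 0 \<or> wv B W i f \<noteq> 0 then 1 else 0)"
  "wv B W i (weq e f) = (if wv B W i e = wv B W i f then 1 else 0)"
proof -
  show n: "wv B W i (wnot e) = (if wv B W i e = 0 then 1 else 0)" for e
    by (auto simp: wnot_def)
  show a: "wv B W i (wand e f) = (if wv B W i e \<noteq> 0 \<and> wv B W i f \<noteq> 0 then 1 else 0)" for e f
    by (auto simp: wand_def)
  show "wv B W i (wor e f) = (if wv B W i e \<noteq> 0 \<or> wv B W i f \<noteq> 0 then 1 else 0)"
    by (auto simp: wor_def n a)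
  show "wv B W i (weq e f) = (if wv B W i e = wv B W i f then 1 else 0)"
    by (auto simp: weq_def n a)
qed

lemma wv_prm [simp]: "j < 16 \<Longrightarrow> wv B W i (prm j) = W 0 j"
  by (simp add: prm_def)

lemma wv_wmd: "wv B W i e < B \<Longrightarrow> wv B W i (wmd e f) = wv B W i e mod wv B W i f"
proof -
  assume l: "wv B W i e < B"
  let ?a = "wv B W i e" and ?b = "wv B W i f"
  have "?a div ?b < B" using l div_le_dividend[of ?a ?b] by linarith
  moreover have "?a div ?b * ?b < B" using l div_times_less_eq_dividend[of ?a ?b] by linarith
  moreover have "?a - ?a div ?b * ?b < B" using l by linarith
  ultimately show ?thesis by (simp add: wmd_def minus_div_mult_eq_mod)
qed

lemma hp_store':
  assumes "\<And>W'. (\<And>b. b \<noteq> a \<Longrightarrow> W' b = W b) \<Longrightarrow>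
    (\<And>x. (\<exists>i<wv B W 0 k. wv B W i g \<noteq> 0 \<and> wv B W i x' = x \<and> W' a x = wv B W i e) \<or>
      ((\<forall>i<wv B W 0 k. wv B W i g \<noteq> 0 \<longrightarrow> wv B W i x' \<noteq> x) \<and> W' a x = W a x)) \<Longrightarrow> Q W' R"
  shows "hp 0 (Par k g (Store a x' e)) Q W R"
  by (rule hp_store, rule assms) auto

text \<open>If all processors competing for a cell write the same value, the resolution has no
  influence and the result is determined.\<close>

lemma hp_store_inj:
  assumes inj: "\<And>i j. i < wv B W 0 k \<Longrightarrow> j < wv B W 0 k \<Longrightarrow> wv B W i g \<noteq> 0 \<Longrightarrow> wv B W j g \<noteq> 0 \<Longrightarrow>
      wv B W i x' = wv B W j x' \<Longrightarrow> wv B W i e = wv B W j e"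
    and Q: "\<And>W'. (\<And>b. b \<noteq> a \<Longrightarrow> W' b = W b) \<Longrightarrow>
      (\<And>i. i < wv B W 0 k \<Longrightarrow> wv B W i g \<noteq> 0 \<Longrightarrow> W' a (wv B W i x') = wv B W i e) \<Longrightarrow>
      (\<And>x. (\<And>i. i < wv B W 0 k \<Longrightarrow> wv B W i g \<noteq> 0 \<Longrightarrow> wv B W i x' \<noteq> x) \<Longrightarrow> W' a x = W a x) \<Longrightarrow> Q W' R"
  shows "hp 0 (Par k g (Store a x' e)) Q W R"
proof (rule hp_store')
  fix W'
  assume f: "\<And>b. b \<noteq> a \<Longrightarrow> W' b = W b"
    and c: "\<And>x. (\<exists>i<wv B W 0 k. wv B W i g \<noteq> 0 \<and> wv B W i x' = x \<and> W' a x = wv B W i e) \<or>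
      ((\<forall>i<wv B W 0 k. wv B W i g \<noteq> 0 \<longrightarrow> wv B W i x' \<noteq> x) \<and> W' a x = W a x)"
  show "Q W' R"
  proof (rule Q[OF f])
    fix i assume i: "i < wv B W 0 k" "wv B W i g \<noteq> 0"
    from c[of "wv B W i x'"] i inj[OF _ i(1) _ i(2)] show "W' a (wv B W i x') = wv B W i e" by metis
  next
    fix x assume "\<And>i. i < wv B W 0 k \<Longrightarrow> wv B W i g \<noteq> 0 \<Longrightarrow> wv B W i x' \<noteq> x"
    then show "W' a x = W a x" using c[of x] by blast
  qed auto
qed

lemma hp_rstore_inj:
  assumes inj: "\<And>i j. i < wv B W 0 k \<Longrightarrow> j < wv B W 0 k \<Longrightarrow> wv B W i g \<noteq> 0 \<Longrightarrow> wv B W j g \<noteq> 0 \<Longrightarrow>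
      wv B W i x' = wv B W j x' \<Longrightarrow> rv B W R i e = rv B W R j e"
    and Q: "\<And>R'. (\<And>b. b \<noteq> a \<Longrightarrow> R' b = R b) \<Longrightarrow>
      (\<And>i. i < wv B W 0 k \<Longrightarrow> wv B W i g \<noteq> 0 \<Longrightarrow> R' a (wv B W i x') = rv B W R i e) \<Longrightarrow>
      (\<And>x. (\<And>i. i < wv B W 0 k \<Longrightarrow> wv B W i g \<noteq> 0 \<Longrightarrow> wv B W i x' \<noteq> x) \<Longrightarrow> R' a x = R a x) \<Longrightarrow> Q W R'"
  shows "hp 0 (Par k g (RStore a x' e)) Q W R"
proof (rule hp_rstore)
  fix f
  assume c: "\<And>x. (\<exists>i<wv B W 0 k. wv B W i g \<noteq> 0 \<and> wv B W i x' = x \<and> f x = rv B W R i e) \<or>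
      ((\<forall>i<wv B W 0 k. wv B W i g \<noteq> 0 \<longrightarrow> wv B W i x' \<noteq> x) \<and> f x = R a x)"
  show "Q W (R(a := f))"
  proof (rule Q)
    fix i assume i: "i < wv B W 0 k" "wv B W i g \<noteq> 0"
    from c[of "wv B W i x'"] i inj[OF _ i(1) _ i(2)] show "(R(a := f)) a (wv B W i x') = rv B W R i e"
      by (metis fun_upd_same)
  next
    fix x assume "\<And>i. i < wv B W 0 k \<Longrightarrow> wv B W i g \<noteq> 0 \<Longrightarrow> wv B W i x' \<noteq> x"
    then show "(R(a := f)) a x = R a x" using c[of x] by auto
  qed auto
qed

definition lab :: "wmemory \<Rightarrow> rmemory \<Rightarrow> nat \<Rightarrow> real \<times> nat" where
  "lab W R c = (form_val w (R 1 c), W 5 c)"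

definition beats :: "wmemory \<Rightarrow> rmemory \<Rightarrow> nat \<Rightarrow> nat \<Rightarrow> bool" where
  "beats W R x y \<longleftrightarrow> W 3 x \<noteq> 0 \<and> (W 3 y = 0 \<or> lexlt (lab W R x) (lab W R y))"

lemma hp_cmp2:
  assumes d: "{24, 25, 26} \<inter> (rds k \<union> rds ex \<union> rds ey) = {}"
    and Q: "\<And>W'. (\<And>a. a \<noteq> 24 \<Longrightarrow> a \<noteq> 25 \<Longrightarrow> a \<noteq> 26 \<Longrightarrow> W' a = W a) \<Longrightarrow>
      (\<And>i. i < wv B W 0 k \<Longrightarrow> W' 26 i = (if beats W R (wv B W i ex) (wv B W i ey) then 1 else 0)) \<Longrightarrow> Q W' R"
  shows "hp 0 (cmp2 k ex ey) Q W R"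
proof -
  have dd: "{24, 25, 26} \<inter> rds k = {}" "{24, 25, 26} \<inter> rds ex = {}" "{24, 25, 26} \<inter> rds ey = {}"
    using d by blast+
  have c: "wv B (W(24 := f)) i e = wv B W i e" "wv B (W(24 := f, 25 := g)) i e = wv B W i e"
    if "{24, 25, 26} \<inter> rds e = {}" for e i f g
    using that by (auto intro!: wv_cong)
  define X Y K where "X = (\<lambda>i. wv B W i ex)" and "Y = (\<lambda>i. wv B W i ey)" and "K = wv B W 0 k"
  have X: "wv B W i ex = X i" "wv B (W(24 := f)) i ex = X i" "wv B (W(24 := f, 25 := g)) i ex = X i"
    and Y: "wv B W i ey = Y i" "wv B (W(24 := f)) i ey = Y i" "wv B (W(24 := f, 25 := g)) i ey = Y i"
    and K: "wv B W 0 k = K" "wv B (W(24 := f)) 0 k = K" "wv B (W(24 := f, 25 := g)) 0 k = K" for i f g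
    by (simp_all only: c[OF dd(1)] c[OF dd(2)] c[OF dd(3)] X_def Y_def K_def)
  show ?thesis
    unfolding cmp2_def seqs.simps
    apply (rule hp_seq0, rule hp_compare, rule hp_seq0, rule hp_compare, rule hp_own, rule Q)
    subgoal by simp
    subgoal for i
      unfolding K X Y
      apply (simp only: wv_bool wv.simps rv.simps X Y fun_upd_same fun_upd_other if_True small_mod simp_thms)
      apply (cases "W 3 (X i) = 0"; cases "W 3 (Y i) = 0"; cases "form_val w (R 1 (X i)) \<le> form_val w (R 1 (Y i))";
          cases "form_val w (R 1 (Y i)) \<le> form_val w (R 1 (X i))"; cases "W 5 (X i) < W 5 (Y i)")
      apply (simp_all add: beats_def lab_def lexlt_def K X Y)
      done
    by simp_all
qed

end

text \<open>By \<open>same\<close> and \<open>onto\<close>, the ranks of the active candidates of a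
  target number them from 0 to \<open>d - 1\<close> without gaps. A processor can therefore be
  addressed by its rank, and ranks can encode slots as well as pairs of slots. A target owns the
  \<open>Z\<close> addresses from \<open>tgt p * Z\<close> on; since ranks are below
  \<open>d \<le> Z\<close>, different targets never share a slot.\<close>

locale desc = machine +
  fixes j :: nat and W0 :: wmemory and R0 :: rmemory
  assumes j16: "j < 16"
    and O1: "W0 0 12 = W0 0 11 + 1"
    and bounds: "W0 0 11 + 1 + W0 0 j < B" "W0 0 11 * W0 0 13 + W0 0 13 < B" "8 * W0 0 13 < B" "2 * W0 0 0 < B"
    and adr: "\<And>p. p < W0 0 j \<Longrightarrow> W0 12 p \<noteq> 0 \<Longrightarrow> W0 13 p < W0 0 11 \<and> W0 17 p < W0 0 11 \<and> W0 18 p < W0 0 11"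
    and rk: "\<And>p. p < W0 0 j \<Longrightarrow> W0 12 p \<noteq> 0 \<Longrightarrow> W0 14 p < W0 15 p \<and> W0 15 p \<le> W0 0 13"
    and tt: "\<And>p. p < W0 0 j \<Longrightarrow> W0 12 p \<noteq> 0 \<Longrightarrow>
       0 < W0 16 p \<and> W0 16 p * W0 16 p \<le> W0 15 p \<and> W0 15 p < 4 * (W0 16 p * W0 16 p)"
    and slot_adr: "\<And>p. p < W0 0 j \<Longrightarrow> W0 12 p \<noteq> 0 \<Longrightarrow>
       W0 29 p = W0 13 p * W0 0 13 \<and> W0 31 p = W0 13 p * W0 0 13 + W0 14 p \<and>
       W0 32 p = W0 13 p * W0 0 13 + W0 14 p div W0 16 p \<and>
       W0 33 p = W0 13 p * W0 0 13 + W0 14 p mod W0 16 p"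
    and table: "\<And>p. p < W0 0 j \<Longrightarrow> W0 12 p \<noteq> 0 \<Longrightarrow> W0 19 (W0 31 p) = W0 0 11 + 1 + p"
    and small: "\<And>p. p < W0 0 j \<Longrightarrow> W0 34 p \<noteq> 0 \<longleftrightarrow> W0 12 p \<noteq> 0 \<and> W0 14 p < W0 16 p"
    and pairs: "\<And>p. p < W0 0 j \<Longrightarrow> W0 35 p \<noteq> 0 \<longleftrightarrow> W0 12 p \<noteq> 0 \<and> W0 14 p < W0 16 p * W0 16 p"
    and same: "\<And>p q. p < W0 0 j \<Longrightarrow> q < W0 0 j \<Longrightarrow> W0 12 p \<noteq> 0 \<Longrightarrow> W0 12 q \<noteq> 0 \<Longrightarrow> W0 13 p = W0 13 q \<Longrightarrow>
       W0 15 p = W0 15 q \<and> W0 16 p = W0 16 q \<and> (W0 14 p = W0 14 q \<longrightarrow> p = q)"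
    and onto: "\<And>p r. p < W0 0 j \<Longrightarrow> W0 12 p \<noteq> 0 \<Longrightarrow> r < W0 15 p \<Longrightarrow>
       \<exists>q<W0 0 j. W0 12 q \<noteq> 0 \<and> W0 13 q = W0 13 p \<and> W0 14 q = r"
begin

abbreviation "M \<equiv> W0 0 j"
abbreviation "Nul \<equiv> W0 0 11"
abbreviation "Z \<equiv> W0 0 13"
abbreviation "tgt p \<equiv> W0 13 p"
abbreviation "rnk p \<equiv> W0 14 p"
abbreviation "dg p \<equiv> W0 15 p"
abbreviation "t p \<equiv> W0 16 p"
abbreviation "cnd p \<equiv> W0 0 11 + 1 + p"

definition grp :: "nat \<Rightarrow> nat set" where "grp g = {p. p < M \<and> W0 12 p \<noteq> 0 \<and> tgt p = g}"

lemma grpD: assumes "p \<in> grp g" shows "p < M" "W0 12 p \<noteq> 0" "tgt p = g" using assms by (auto simp: grp_def)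

lemma finite_grp [simp]: "finite (grp g)" by (simp add: grp_def)

lemma grp_same: "p \<in> grp g \<Longrightarrow> q \<in> grp g \<Longrightarrow> dg p = dg q \<and> t p = t q"
  using same[of p q] by (auto simp: grp_def)

lemma t_le: "p \<in> grp g \<Longrightarrow> t p \<le> dg p" "p \<in> grp g \<Longrightarrow> dg p \<le> Z" "p \<in> grp g \<Longrightarrow> rnk p < dg p" "p \<in> grp g \<Longrightarrow> 0 < t p"
  using tt[of p] rk[of p] grpD[of p g] by (auto intro: le_trans[OF le_square])

lemma grp_onto: "p \<in> grp g \<Longrightarrow> r < dg p \<Longrightarrow> \<exists>q\<in>grp g. rnk q = r"
  using onto[of p r] by (auto simp: grp_def)

lemma rnk_bij: "p \<in> grp g \<Longrightarrow> bij_betw rnk (grp g) {..<dg p}"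
  unfolding bij_betw_def
proof
  assume p: "p \<in> grp g"
  show "inj_on rnk (grp g)" by (rule inj_onI) (use same in \<open>auto simp: grp_def\<close>)
  have "rnk q < dg p" if "q \<in> grp g" for q using t_le(3)[OF that] grp_same[OF p that] by simp
  then show "rnk ` grp g = {..<dg p}"
  proof (intro equalityI subsetI)
    fix r assume "r \<in> {..<dg p}"
    then obtain q where "q \<in> grp g" "rnk q = r" using grp_onto[OF p] by auto
    then show "r \<in> rnk ` grp g" by blast
  qed auto
qed

lemma act_grp: "p < M \<Longrightarrow> W0 12 p \<noteq> 0 \<Longrightarrow> p \<in> grp (tgt p)"
  by (simp add: grp_def)

lemma small_grp: "p < M \<Longrightarrow> W0 34 p \<noteq> 0 \<longleftrightarrow> p \<in> grp (tgt p) \<and> rnk p < t p"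
  using small by (auto simp: grp_def)

lemma slot_grp: "p \<in> grp g \<Longrightarrow> W0 29 p = g * Z" "p \<in> grp g \<Longrightarrow> W0 31 p = g * Z + rnk p"
  "p \<in> grp g \<Longrightarrow> W0 32 p = g * Z + rnk p div t p" "p \<in> grp g \<Longrightarrow> W0 33 p = g * Z + rnk p mod t p"
  using slot_adr[of p] by (auto simp: grp_def)

lemma own_slot_inj:
  assumes "p \<in> grp g" "q \<in> grp g'" "W0 31 p = W0 31 q" shows "p = q"
proof -
  have "g * Z + rnk p = g' * Z + rnk q" using assms by (simp add: slot_grp)
  moreover have "rnk p < Z" "rnk q < Z" using t_le(2,3)[OF assms(1)] t_le(2,3)[OF assms(2)] by linarith+
  ultimately have "g = g'" "rnk p = rnk q" using mult_add_unique[of g Z "rnk p" g' "rnk q"] by auto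
  then show ?thesis using assms(1,2) same[of p q] by (auto simp: grp_def)
qed

text \<open>Selecting the winners touches scratch arrays only. Labels and candidates are not among
  them, so \<open>beats\<close> may be evaluated in the initial memory throughout.\<close>

definition agr :: "wmemory \<Rightarrow> bool" where
  "agr W \<longleftrightarrow> (\<forall>a. a \<notin> {20, 21, 22, 23, 24, 25, 26, 28} \<longrightarrow> W a = W0 a)"

lemma agr_eqs:
  assumes "agr W"
  shows "W 0 = W0 0" "W 3 = W0 3" "W 5 = W0 5" "W 12 = W0 12" "W 13 = W0 13" "W 14 = W0 14" "W 15 = W0 15"
    "W 16 = W0 16" "W 17 = W0 17" "W 18 = W0 18" "W 19 = W0 19" "W 29 = W0 29" "W 31 = W0 31" "W 32 = W0 32"
    "W 33 = W0 33" "W 34 = W0 34" "W 35 = W0 35"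
  using assms by (simp_all add: agr_def)

lemma agr_upd: "agr W \<Longrightarrow> (\<And>b. b \<noteq> a \<Longrightarrow> W' b = W b) \<Longrightarrow> a \<in> {20, 21, 22, 23, 24, 25, 26, 28} \<Longrightarrow> agr W'"
  unfolding agr_def by metis

lemma beats_agr: "agr W \<Longrightarrow> beats W R = beats W0 R"
  by (auto simp: beats_def lab_def fun_eq_iff agr_eqs)

lemma cand_val: "agr W \<Longrightarrow> p < M \<Longrightarrow> wv B W p cand = cnd p"
  using O1 bounds by (simp add: cand_def agr_eqs)

lemma hp_reset:
  assumes a: "agr W" and Q: "\<And>W'. agr W' \<Longrightarrow> (\<And>p. p < M \<Longrightarrow> W0 12 p \<noteq> 0 \<Longrightarrow> W' 23 (tgt p) = Nul) \<Longrightarrow> Q W' R0"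
  shows "hp 0 (reset_win (prm j)) Q W R0"
  unfolding reset_win_def
proof (rule hp_store_inj)
  fix W' assume W': "\<And>b. b \<noteq> 23 \<Longrightarrow> W' b = W b"
    "\<And>i. i < wv B W 0 (prm j) \<Longrightarrow> wv B W i (Load 12 Pid) \<noteq> 0 \<Longrightarrow> W' 23 (wv B W i (Load 13 Pid)) = wv B W i (prm 11)"
  show "Q W' R0"
  proof (rule Q)
    show "agr W'" using agr_upd[OF a W'(1)] by simp
    show "W' 23 (tgt p) = Nul" if "p < M" "W0 12 p \<noteq> 0" for p
      using W'(2)[of p] that agr_eqs[OF a] j16 by simp
  qed
qed simp

lemma ex_unbeaten:
  assumes "finite S" "\<exists>x\<in>S. W 3 x \<noteq> 0"
  shows "\<exists>x\<in>S. W 3 x \<noteq> 0 \<and> (\<forall>y\<in>S. \<not> beats W R y x)"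
  using assms
proof (induction S)
  case (insert x S)
  show ?case
  proof (cases "\<exists>x\<in>S. W 3 x \<noteq> 0")
    case True
    then obtain z where z: "z \<in> S" "W 3 z \<noteq> 0" "\<forall>y\<in>S. \<not> beats W R y z" using insert by blast
    show ?thesis
    proof (cases "beats W R x z")
      case True
      then have x: "W 3 x \<noteq> 0" "lexlt (lab W R x) (lab W R z)" using z by (auto simp: beats_def)
      have "\<not> beats W R y x" if y: "y \<in> insert x S" for y
      proof
        assume b: "beats W R y x"
        then have l: "W 3 y \<noteq> 0" "lexlt (lab W R y) (lab W R x)" using x(1) by (auto simp: beats_def)
        then have "y \<noteq> x" by auto
        then have "\<not> beats W R y z" using y z(3) by blast
        then show False using l(1) lexlt_trans[OF l(2) x(2)] by (simp add: beats_def)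
      qed
      then show ?thesis using x by blast
    qed (use z in blast)
  next
    case False
    then show ?thesis using insert.prems by (auto simp: beats_def)
  qed
qed auto

text \<open>The case of empty slots matters for the second duel: there it preserves the winner of
  the sample when no candidate beats it.\<close>

lemma hp_duel:
  assumes a: "agr W"
    and Q: "\<And>W'. agr W' \<Longrightarrow> W' 21 = W 21 \<Longrightarrow>
      (\<And>g p S. p \<in> grp g \<Longrightarrow> S = (\<lambda>a. W 21 (g * Z + a)) ` {..<t p} \<Longrightarrow> (\<forall>x\<in>S. W0 3 x = 0) \<Longrightarrow> W' 23 g = W 23 g) \<Longrightarrow>
      (\<And>g p S. p \<in> grp g \<Longrightarrow> S = (\<lambda>a. W 21 (g * Z + a)) ` {..<t p} \<Longrightarrow> (\<exists>x\<in>S. W0 3 x \<noteq> 0) \<Longrightarrow>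
         W' 23 g \<in> S \<and> W0 3 (W' 23 g) \<noteq> 0 \<and> (\<forall>y\<in>S. \<not> beats W0 R0 y (W' 23 g))) \<Longrightarrow> Q W' R0"
  shows "hp 0 (duel (prm j)) Q W R0"
  unfolding duel_def seqs.simps
proof (rule hp_seq0, rule hp_store_inj, simp)
  fix W1 assume W1: "\<And>b. b \<noteq> 22 \<Longrightarrow> W1 b = W b"
    "\<And>i. i < wv B W 0 (prm j) \<Longrightarrow> wv B W i (Load 34 Pid) \<noteq> 0 \<Longrightarrow> W1 22 (wv B W i (Load 31 Pid)) = wv B W i (Const 0)"
  have a1: "agr W1" using agr_upd[OF a W1(1)] by simp
  have l1: "W1 22 (W0 31 p) = 0" if "p < M" "W0 34 p \<noteq> 0" for p
    using W1(2)[of p] that agr_eqs[OF a] j16 by simp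
  show "hp 0 (Seq (cmp2 (prm j) (Load 21 (Load 33 Pid)) (Load 21 (Load 32 Pid)))
     (Seq (Par (prm j) (wand (Load 35 Pid) (Load 26 Pid)) (Store 22 (Load 32 Pid) (Const 1)))
      (Par (prm j) (wand (Load 34 Pid) (wand (wnot (Load 22 (Load 31 Pid))) (Load 3 (Load 21 (Load 31 Pid)))))
       (Store 23 (Load 13 Pid) (Load 21 (Load 31 Pid)))))) Q W1 R0"
  proof (rule hp_seq0, rule hp_cmp2)
    fix W2 assume W2: "\<And>a. a \<noteq> 24 \<Longrightarrow> a \<noteq> 25 \<Longrightarrow> a \<noteq> 26 \<Longrightarrow> W2 a = W1 a"
      "\<And>i. i < wv B W1 0 (prm j) \<Longrightarrow> W2 26 i = (if beats W1 R0 (wv B W1 i (Load 21 (Load 33 Pid)))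
         (wv B W1 i (Load 21 (Load 32 Pid))) then 1 else 0)"
    have a2: "agr W2" using a1 W2(1) unfolding agr_def by auto
    have b2: "W2 26 p \<noteq> 0 \<longleftrightarrow> beats W0 R0 (W 21 (W0 33 p)) (W 21 (W0 32 p))" if "p < M" for p
      using W2(2)[of p] that j16 W1(1)[of 21] by (simp add: agr_eqs[OF a1] beats_agr[OF a1])
    show "hp 0 (Seq (Par (prm j) (wand (Load 35 Pid) (Load 26 Pid)) (Store 22 (Load 32 Pid) (Const 1)))
      (Par (prm j) (wand (Load 34 Pid) (wand (wnot (Load 22 (Load 31 Pid))) (Load 3 (Load 21 (Load 31 Pid)))))
       (Store 23 (Load 13 Pid) (Load 21 (Load 31 Pid))))) Q W2 R0"
    proof (rule hp_seq0, rule hp_store_inj, simp)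
      fix W3 assume W3: "\<And>b. b \<noteq> 22 \<Longrightarrow> W3 b = W2 b"
        "\<And>i. i < wv B W2 0 (prm j) \<Longrightarrow> wv B W2 i (wand (Load 35 Pid) (Load 26 Pid)) \<noteq> 0 \<Longrightarrow>
           W3 22 (wv B W2 i (Load 32 Pid)) = wv B W2 i (Const 1)"
        "\<And>x. (\<And>i. i < wv B W2 0 (prm j) \<Longrightarrow> wv B W2 i (wand (Load 35 Pid) (Load 26 Pid)) \<noteq> 0 \<Longrightarrow>
           wv B W2 i (Load 32 Pid) \<noteq> x) \<Longrightarrow> W3 22 x = W2 22 x"
      have a3: "agr W3" using agr_upd[OF a2 W3(1)] by simp
      have s21: "W3 21 = W 21" using W3(1)[of 21] W2(1)[of 21] W1(1)[of 21] by simp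
      have lose: "W3 22 (W0 31 p) \<noteq> 0 \<longleftrightarrow> (\<exists>b<t p. beats W0 R0 (W 21 (g * Z + b)) (W 21 (g * Z + rnk p)))"
        if p: "p \<in> grp g" "rnk p < t p" for p g
      proof
        assume n: "W3 22 (W0 31 p) \<noteq> 0"
        have "p < M" "W0 34 p \<noteq> 0" using p grpD[OF p(1)] small_grp[of p] by auto
        then have "W2 22 (W0 31 p) = 0" using l1 W2(1)[of 22] by simp
        then have z: "W2 22 (W0 31 p) \<noteq> W3 22 (W0 31 p)" using n by simp
        have "\<exists>i. i < wv B W2 0 (prm j) \<and> wv B W2 i (wand (Load 35 Pid) (Load 26 Pid)) \<noteq> 0 \<and> wv B W2 i (Load 32 Pid) = W0 31 p"
        proof (rule ccontr)
          assume c: "\<not> ?thesis"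
          have "W3 22 (W0 31 p) = W2 22 (W0 31 p)" by (rule W3(3)) (use c in blast)
          then show False using z by simp
        qed
        then obtain i where i: "i < wv B W2 0 (prm j)" "wv B W2 i (wand (Load 35 Pid) (Load 26 Pid)) \<noteq> 0"
          "wv B W2 i (Load 32 Pid) = W0 31 p" by blast
        have i': "i < M" "W0 35 i \<noteq> 0" "W2 26 i \<noteq> 0" "W0 32 i = W0 31 p"
          using i agr_eqs[OF a2] j16
          by (simp_all split: if_split_asm)
        have ai: "W0 12 i \<noteq> 0" "rnk i < t i * t i" using pairs[OF i'(1)] i'(2) by auto
        have ig: "i \<in> grp (tgt i)" using act_grp i'(1) ai by simp
        have "tgt i * Z + rnk i div t i = g * Z + rnk p" using i'(4) slot_grp(3)[OF ig] slot_grp(2)[OF p(1)] by simp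
        moreover have "rnk i div t i < t i" using ai by (simp add: less_mult_imp_div_less)
        moreover have "t i \<le> Z" "rnk p < Z" using t_le(1,2)[OF ig] t_le(2,3)[OF p(1)] by auto
        ultimately have e: "tgt i = g" "rnk i div t i = rnk p" using mult_add_unique[of "tgt i" Z "rnk i div t i" g "rnk p"] by auto
        then have ti: "t i = t p" using grp_same[of i g p] ig p(1) by auto
        have "beats W0 R0 (W 21 (g * Z + rnk i mod t p)) (W 21 (g * Z + rnk p))"
          using b2[OF i'(1)] i'(3) slot_grp(3,4)[OF ig] e ti by simp
        moreover have "rnk i mod t p < t p" using t_le(4)[OF p(1)] by simp
        ultimately show "\<exists>b<t p. beats W0 R0 (W 21 (g * Z + b)) (W 21 (g * Z + rnk p))" by blast
      next
        assume "\<exists>b<t p. beats W0 R0 (W 21 (g * Z + b)) (W 21 (g * Z + rnk p))"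
        then obtain b where b: "b < t p" "beats W0 R0 (W 21 (g * Z + b)) (W 21 (g * Z + rnk p))" by blast
        \<comment> \<open>The processor in charge of the pair of slots \<open>rnk p\<close> and
          \<open>b\<close> has rank \<open>rnk p * t p + b\<close>; this is a valid rank because it
          is below \<open>t p * t p\<close>, which is at most \<open>dg p\<close>.\<close>
        have "rnk p * t p + b < t p * t p"
        proof -
          have "rnk p * t p + b < rnk p * t p + t p" using b by simp
          also have "\<dots> = Suc (rnk p) * t p" by simp
          also have "\<dots> \<le> t p * t p" using p(2) by (intro mult_le_mono) auto
          finally show ?thesis .
        qed
        moreover have "t p * t p \<le> dg p" using tt grpD[OF p(1)] by simp
        ultimately obtain i where i: "i \<in> grp g" "rnk i = rnk p * t p + b"
          using grp_onto[OF p(1), of "rnk p * t p + b"] by auto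
        have ti: "t i = t p" using grp_same[OF i(1) p(1)] by simp
        have d: "rnk i div t i = rnk p" "rnk i mod t i = b" using i(2) b(1) ti by auto
        have iM: "i < M" using grpD[OF i(1)] by simp
        have "W0 35 i \<noteq> 0" using pairs[OF iM] grpD[OF i(1)] i(2) ti \<open>rnk p * t p + b < t p * t p\<close> by simp
        moreover have "W2 26 i \<noteq> 0" using b2[OF iM] slot_grp(3,4)[OF i(1)] d b(2) by simp
        moreover have "W0 32 i = W0 31 p" using slot_grp[OF i(1)] slot_grp[OF p(1)] d by simp
        ultimately show "W3 22 (W0 31 p) \<noteq> 0" using W3(2)[of i] iM agr_eqs[OF a2] j16 by simp
      qed
      show "hp 0 (Par (prm j) (wand (Load 34 Pid) (wand (wnot (Load 22 (Load 31 Pid))) (Load 3 (Load 21 (Load 31 Pid)))))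
       (Store 23 (Load 13 Pid) (Load 21 (Load 31 Pid)))) Q W3 R0"
      proof (rule hp_store')
        fix W4 assume W4: "\<And>b. b \<noteq> 23 \<Longrightarrow> W4 b = W3 b"
          "\<And>x. (\<exists>i<wv B W3 0 (prm j). wv B W3 i (wand (Load 34 Pid) (wand (wnot (Load 22 (Load 31 Pid))) (Load 3 (Load 21 (Load 31 Pid))))) \<noteq> 0 \<and>
              wv B W3 i (Load 13 Pid) = x \<and> W4 23 x = wv B W3 i (Load 21 (Load 31 Pid))) \<or>
            ((\<forall>i<wv B W3 0 (prm j). wv B W3 i (wand (Load 34 Pid) (wand (wnot (Load 22 (Load 31 Pid))) (Load 3 (Load 21 (Load 31 Pid))))) \<noteq> 0 \<longrightarrow>
              wv B W3 i (Load 13 Pid) \<noteq> x) \<and> W4 23 x = W3 23 x)"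
        have a4: "agr W4" using agr_upd[OF a3 W4(1)] by simp
        have s23: "W3 23 = W 23" using W3(1)[of 23] W2(1)[of 23] W1(1)[of 23] by simp
        have w4: "(\<exists>i<M. W0 34 i \<noteq> 0 \<and> W3 22 (W0 31 i) = 0 \<and> W0 3 (W 21 (W0 31 i)) \<noteq> 0 \<and> tgt i = x \<and> W4 23 x = W 21 (W0 31 i)) \<or>
          ((\<forall>i<M. W0 34 i \<noteq> 0 \<and> W3 22 (W0 31 i) = 0 \<and> W0 3 (W 21 (W0 31 i)) \<noteq> 0 \<longrightarrow> tgt i \<noteq> x) \<and> W4 23 x = W 23 x)" for x
          using W4(2)[of x] agr_eqs[OF a3] j16 by (simp add: s21 s23)
        show "Q W4 R0"
        proof (rule Q)
          show "agr W4" by fact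
          show "W4 21 = W 21" using W4(1)[of 21] s21 by simp
        next
          fix g p S assume p: "p \<in> grp g" and S: "S = (\<lambda>a. W 21 (g * Z + a)) ` {..<t p}" and n: "\<forall>x\<in>S. W0 3 x = 0"
          have "W0 3 (W 21 (W0 31 i)) = 0" if i: "i < M" "W0 34 i \<noteq> 0" "tgt i = g" for i
          proof -
            have ig: "i \<in> grp g" "rnk i < t i" using small_grp[OF i(1)] i by auto
            then have "W 21 (W0 31 i) \<in> S" unfolding S slot_grp(2)[OF ig(1)] using grp_same[OF ig(1) p] by auto
            then show ?thesis using n by auto
          qed
          then show "W4 23 g = W 23 g" using w4[of g] by auto
        next
          fix g p S assume p: "p \<in> grp g" and S: "S = (\<lambda>a. W 21 (g * Z + a)) ` {..<t p}" and n: "\<exists>x\<in>S. W0 3 x \<noteq> 0"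
          have "finite S" using S by simp
          from ex_unbeaten[where W=W0 and R=R0, OF this n] obtain x where x: "x \<in> S" "W0 3 x \<noteq> 0" "\<forall>y\<in>S. \<not> beats W0 R0 y x" by blast
          then obtain a where xa: "a < t p" "x = W 21 (g * Z + a)" using S by auto
          then obtain i where i: "i \<in> grp g" "rnk i = a" using grp_onto[OF p, of a] t_le(1)[OF p] by auto
          have iM: "i < M" "tgt i = g" using grpD[OF i(1)] by auto
          have ti: "t i = t p" using grp_same[OF i(1) p] by simp
          have "W3 22 (W0 31 i) = 0" using lose[OF i(1)] i(2) xa ti x(3) S by auto
          moreover have "W0 34 i \<noteq> 0" using small_grp[OF iM(1)] i iM xa ti by simp
          moreover have "W0 3 (W 21 (W0 31 i)) \<noteq> 0" using slot_grp(2)[OF i(1)] i(2) xa x(2) by simp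
          ultimately obtain q where q: "q < M" "W0 34 q \<noteq> 0" "W3 22 (W0 31 q) = 0" "W0 3 (W 21 (W0 31 q)) \<noteq> 0" "tgt q = g"
            "W4 23 g = W 21 (W0 31 q)" using w4[of g] iM by blast
          have qg: "q \<in> grp g" "rnk q < t q" using small_grp[OF q(1)] q by auto
          have tq: "t q = t p" using grp_same[OF qg(1) p] by simp
          have wq: "W4 23 g = W 21 (g * Z + rnk q)" using q(6) slot_grp(2)[OF qg(1)] by simp
          have "\<not> beats W0 R0 y (W4 23 g)" if "y \<in> S" for y
            using lose[OF qg] q(3) that S tq wq by auto
          then show "W4 23 g \<in> S \<and> W0 3 (W4 23 g) \<noteq> 0 \<and> (\<forall>y\<in>S. \<not> beats W0 R0 y (W4 23 g))"
            using wq qg tq S q(4,6) by auto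
        qed
      qed
    qed simp
  qed (use j16 in auto)
qed simp

end

section \<open>Probabilities of a useful sample and of a throw without collision\<close>

lemma prob_uniform_avoid:
  assumes "0 < D" "X \<subseteq> {..<D}"
  shows "measure_pmf.prob (pmf_of_set {..<D}) (- X) = 1 - real (card X) / real D"
proof -
  have ne: "{..<D} \<noteq> {}" using assms(1) by (simp add: lessThan_empty_iff)
  have "{..<D} \<inter> - X = {..<D} - X" by auto
  moreover have "card ({..<D} - X) = D - card X" using assms(2) by (simp add: card_Diff_subset finite_subset[OF assms(2)])
  moreover have "card X \<le> D" using card_mono[OF _ assms(2)] by simp
  ultimately show ?thesis using assms(1) ne by (simp add: measure_pmf_of_set of_nat_diff field_simps)
qed

text \<open>The draws of \<open>Q\<close> are independent and each misses \<open>X\<close> with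
  probability \<open>1 - card X / d\<close>, so all of them miss with probability at most
  \<open>exp (- card X * card Q / d)\<close>, which is at most \<open>1 / e\<close> by the last
  assumption.\<close>

lemma prob_sample_miss:
  assumes "finite A" "Q \<subseteq> A" "\<And>i. i \<in> Q \<Longrightarrow> e i = d" "X \<subseteq> {..<d}" "0 < d" "d \<le> card X * card Q"
  shows "measure_pmf.prob (Pi_pmf A 0 (\<lambda>i. pmf_of_set {..<max 1 (e i :: nat)})) {\<rho>. \<forall>q\<in>Q. \<rho> q \<notin> X} \<le> 1 / 2"
proof -
  let ?k = "real (card X)" and ?t = "card Q"
  have "{\<rho>. \<forall>q\<in>Q. \<rho> q \<notin> X} = Pi A (\<lambda>i. if i \<in> Q then - X else UNIV)"
    using assms(2) by (auto simp: Pi_def)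
  then have "measure_pmf.prob (Pi_pmf A 0 (\<lambda>i. pmf_of_set {..<max 1 (e i)})) {\<rho>. \<forall>q\<in>Q. \<rho> q \<notin> X}
     = (\<Prod>i\<in>A. measure_pmf.prob (pmf_of_set {..<max 1 (e i)}) (if i \<in> Q then - X else UNIV))"
    using measure_Pi_pmf_Pi[OF assms(1)] by simp
  also have "\<dots> = (\<Prod>i\<in>Q. measure_pmf.prob (pmf_of_set {..<max 1 (e i)}) (- X))"
    using assms(1,2) by (intro prod.mono_neutral_cong_right) auto
  also have "\<dots> = (\<Prod>i\<in>Q. 1 - ?k / real d)"
    using assms(3-5) by (intro prod.cong refl) (simp add: max_def prob_uniform_avoid)
  also have "\<dots> = (1 - ?k / real d) ^ ?t" by simp
  also have "\<dots> \<le> exp (- (?k / real d)) ^ ?t"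
  proof (rule power_mono)
    show "1 - ?k / real d \<le> exp (- (?k / real d))" using exp_ge_add_one_self[of "- (?k / real d)"] by simp
    have "card X \<le> d" using card_mono[OF _ assms(4)] by simp
    then show "0 \<le> 1 - ?k / real d" using assms(5) by simp
  qed
  also have "\<dots> = exp (- (?k * real ?t / real d))" by (simp add: exp_of_nat_mult[symmetric])
  also have "\<dots> \<le> exp (- 1)"
  proof -
    have "real d \<le> ?k * real ?t" using assms(6) by (metis of_nat_le_iff of_nat_mult)
    then have "1 \<le> ?k * real ?t / real d" using assms(5) by simp
    then show ?thesis by simp
  qed
  also have "\<dots> \<le> 1 / 2"
  proof -
    have "2 \<le> exp (1::real)" using exp_ge_add_one_self[of 1] by simp
    then show ?thesis by (simp add: exp_minus field_simps)
  qed
  finally show ?thesis .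
qed

text \<open>Sum over the \<open>t\<close> admissible values of \<open>\<rho> z\<close>. Each is
  drawn with probability \<open>1 / (8 t)\<close>, and by Bernoulli's inequality the fewer than
  \<open>4 t\<close> other draws all avoid it with probability at least
  \<open>1 - 4 t / (8 t) = 1 / 2\<close>. In total this is at least 1/16.\<close>

lemma prob_collision:
  assumes "finite A" "S \<subseteq> A" "z \<in> S" "\<And>i. i \<in> S \<Longrightarrow> e i = 8 * t" "card S \<le> 4 * t" "0 < t"
  shows "measure_pmf.prob (Pi_pmf A 0 (\<lambda>i. pmf_of_set {..<max 1 (e i :: nat)}))
     {\<rho>. \<not> (\<rho> z < t \<and> (\<forall>p\<in>S. p \<noteq> z \<longrightarrow> \<rho> p \<noteq> \<rho> z))} \<le> 15 / 16"
proof -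
  let ?M = "Pi_pmf A 0 (\<lambda>i. pmf_of_set {..<max 1 (e i)})"
  let ?D = "8 * real t"
  define F where "F y = Pi A (\<lambda>i. if i = z then {y} else if i \<in> S then - {y} else UNIV)" for y :: nat
  have fS: "finite S" using assms(1,2) finite_subset by auto
  have zA: "z \<in> A" using assms by auto
  have G: "{\<rho>. \<rho> z < t \<and> (\<forall>p\<in>S. p \<noteq> z \<longrightarrow> \<rho> p \<noteq> \<rho> z)} = (\<Union>y<t. F y)"
    using assms(2) zA unfolding F_def Pi_def by (auto split: if_splits)
  have e8: "max 1 (e i) = 8 * t" if "i \<in> S" for i using assms(4)[OF that] assms(6) by auto
  have P: "measure_pmf.prob ?M (F y) \<ge> 1 / (16 * real t)" if y: "y < t" for y
  proof -
    have c: "card {y} = 1" by simp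
    have "measure_pmf.prob ?M (F y) = (\<Prod>i\<in>A. measure_pmf.prob (pmf_of_set {..<max 1 (e i)}) (if i = z then {y} else if i \<in> S then - {y} else UNIV))"
      unfolding F_def by (rule measure_Pi_pmf_Pi[OF assms(1)])
    also have "\<dots> = (\<Prod>i\<in>S. measure_pmf.prob (pmf_of_set {..<max 1 (e i)}) (if i = z then {y} else - {y}))"
      using assms(1,2,3) by (intro prod.mono_neutral_cong_right) auto
    also have "\<dots> = (\<Prod>i\<in>S. if i = z then 1 / ?D else 1 - 1 / ?D)"
    proof (rule prod.cong[OF refl])
      fix i assume i: "i \<in> S"
      have "{..<8 * t} \<inter> {y} = {y}" using y by auto
      moreover have "{..<8 * t} \<noteq> {}" using assms(6) by (simp add: lessThan_empty_iff)
      ultimately have "measure_pmf.prob (pmf_of_set {..<8 * t}) {y} = 1 / ?D" using assms(6)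
        by (simp add: measure_pmf_of_set)
      moreover have "measure_pmf.prob (pmf_of_set {..<8 * t}) (- {y}) = 1 - 1 / ?D"
        using prob_uniform_avoid[of "8 * t" "{y}"] y by simp
      ultimately show "measure_pmf.prob (pmf_of_set {..<max 1 (e i)}) (if i = z then {y} else - {y}) = (if i = z then 1 / ?D else 1 - 1 / ?D)"
        unfolding e8[OF i] by simp
    qed
    also have "\<dots> = (1 / ?D) * (1 - 1 / ?D) ^ (card S - 1)"
      using fS assms(3) by (simp add: prod.remove[of S z])
    also have "\<dots> \<ge> (1 / ?D) * (1 - real (card S - 1) * (1 / ?D))"
    proof (rule mult_left_mono)
      have "1 + real (card S - 1) * (- (1 / ?D)) \<le> (1 + (- (1 / ?D))) ^ (card S - 1)"
        by (rule Bernoulli_inequality) (use assms(6) in \<open>simp add: field_simps\<close>)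
      then show "1 - real (card S - 1) * (1 / ?D) \<le> (1 - 1 / ?D) ^ (card S - 1)" by simp
    qed simp
    moreover have "(1 / ?D) * (1 - real (card S - 1) * (1 / ?D)) \<ge> (1 / ?D) * (1 / 2)"
    proof (rule mult_left_mono)
      have "real (card S - 1) \<le> 4 * real t" using assms(5) by linarith
      then show "1 / 2 \<le> 1 - real (card S - 1) * (1 / ?D)" using assms(6) by (simp add: field_simps)
    qed simp
    ultimately show ?thesis by (simp add: field_simps)
  qed
  have "measure_pmf.prob ?M (\<Union>y<t. F y) = (\<Sum>y<t. measure_pmf.prob ?M (F y))"
  proof (rule measure_pmf.finite_measure_finite_Union)
    show "disjoint_family_on F {..<t}"
    proof (unfold disjoint_family_on_def, intro ballI impI)
      fix x y assume "x \<noteq> (y::nat)"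
      then show "F x \<inter> F y = {}" using zA unfolding F_def Pi_def by fastforce
    qed
  qed auto
  also have "\<dots> \<ge> (\<Sum>y<t. 1 / (16 * real t))" by (intro sum_mono P) auto
  moreover have "(\<Sum>y<t. 1 / (16 * real t)) = 1 / 16" using assms(6) by simp
  ultimately have "measure_pmf.prob ?M {\<rho>. \<rho> z < t \<and> (\<forall>p\<in>S. p \<noteq> z \<longrightarrow> \<rho> p \<noteq> \<rho> z)} \<ge> 1 / 16"
    unfolding G by simp
  moreover have "{\<rho>. \<not> (\<rho> z < t \<and> (\<forall>p\<in>S. p \<noteq> z \<longrightarrow> \<rho> p \<noteq> \<rho> z))} = UNIV - {\<rho>. \<rho> z < t \<and> (\<forall>p\<in>S. p \<noteq> z \<longrightarrow> \<rho> p \<noteq> \<rho> z)}"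
    by auto
  ultimately show ?thesis
    using measure_pmf.prob_compl[of "{\<rho>. \<rho> z < t \<and> (\<forall>p\<in>S. p \<noteq> z \<longrightarrow> \<rho> p \<noteq> \<rho> z)}" ?M] by simp
qed

text \<open>A minimal element of the rest is added \<open>k\<close> times. A threshold on the labels
  would not do, since ties may make it impossible to cut off exactly \<open>k\<close>
  elements.\<close>

lemma ex_lower_set:
  fixes less :: "'a \<Rightarrow> 'a \<Rightarrow> bool"
  assumes "finite S" "k \<le> card S"
    and min: "\<And>T. T \<subseteq> S \<Longrightarrow> T \<noteq> {} \<Longrightarrow> \<exists>x\<in>T. \<forall>y\<in>T. \<not> less y x"
  shows "\<exists>A\<subseteq>S. card A = k \<and> (\<forall>a\<in>A. \<forall>p\<in>S - A. \<not> less p a)"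
  using assms(2)
proof (induction k)
  case 0
  then show ?case by (intro exI[of _ "{}"]) auto
next
  case (Suc k)
  then obtain A where A: "A \<subseteq> S" "card A = k" "\<forall>a\<in>A. \<forall>p\<in>S - A. \<not> less p a" by auto
  have "S - A \<noteq> {}" using A Suc.prems assms(1) by (metis Diff_eq_empty_iff card_mono finite_subset not_less_eq_eq)
  then obtain x where x: "x \<in> S - A" "\<forall>y\<in>S - A. \<not> less y x" using min[of "S - A"] by auto
  have "finite A" using A(1) assms(1) finite_subset by auto
  then show ?case using A x by (intro exI[of _ "insert x A"]) auto
qed

section \<open>One randomized minimum for all targets at once\<close>

locale cands = desc +
  assumes nul: "W0 3 (W0 0 11) = 0"
    and vact: "\<And>p. p < W0 0 j \<Longrightarrow> W0 3 (W0 0 11 + 1 + p) \<noteq> 0 \<Longrightarrow> W0 12 p \<noteq> 0"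
begin

lemma beats_mono: "W0 3 x \<noteq> 0 \<Longrightarrow> \<not> beats W0 R0 y x \<Longrightarrow> beats W0 R0 y z \<Longrightarrow> beats W0 R0 x z"
  by (auto simp: beats_def lexlt_def)

lemma adr_lt: "p \<in> grp g \<Longrightarrow> r \<le> Z \<Longrightarrow> g * Z + r < B"
proof -
  assume p: "p \<in> grp g" "r \<le> Z"
  have "g < Nul" using adr[of p] grpD[OF p(1)] by auto
  then have "Suc g * Z \<le> Nul * Z" by (intro mult_le_mono) auto
  then show ?thesis using bounds(2) p(2) by simp
qed

lemma slot_proc: "p \<in> grp g \<Longrightarrow> a < t p \<Longrightarrow> \<exists>i\<in>grp g. rnk i = a \<and> W0 34 i \<noteq> 0 \<and> W0 31 i = g * Z + a \<and> i < M"
proof -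
  assume p: "p \<in> grp g" "a < t p"
  then obtain i where i: "i \<in> grp g" "rnk i = a" using grp_onto[OF p(1), of a] t_le(1)[OF p(1)] by auto
  have "i < M" "tgt i = g" using grpD[OF i(1)] by auto
  moreover have "t i = t p" using grp_same[OF i(1) p(1)] by simp
  ultimately show ?thesis using i p small_grp[of i] slot_grp(2)[OF i(1)] by auto
qed

text \<open>The last clause is what the probability analysis builds on: no candidate that was drawn
  into the sample beats the interim winner, so a low candidate in the sample leaves few survivors.
  The slots are emptied again in preparation of the throw.\<close>

lemma hp_survivors:
  assumes a: "agr W" and win: "\<And>p. p < M \<Longrightarrow> W0 12 p \<noteq> 0 \<Longrightarrow> W 23 (tgt p) = Nul"
    and dr: "\<And>p. p < M \<Longrightarrow> W0 12 p \<noteq> 0 \<Longrightarrow> W 20 p < dg p"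
    and Q: "\<And>W'. agr W' \<Longrightarrow> (\<And>p. p < M \<Longrightarrow> W' 26 p \<noteq> 0 \<longleftrightarrow> beats W0 R0 (cnd p) (W' 23 (tgt p))) \<Longrightarrow>
      (\<And>g p. p \<in> grp g \<Longrightarrow> W' 23 g = Nul \<or> (\<exists>q\<in>grp g. W' 23 g = cnd q \<and> W0 3 (cnd q) \<noteq> 0)) \<Longrightarrow>
      (\<And>g p a. p \<in> grp g \<Longrightarrow> a < t p \<Longrightarrow> W' 21 (g * Z + a) = Nul) \<Longrightarrow>
      (\<And>g p a. p \<in> grp g \<Longrightarrow> a \<in> grp g \<Longrightarrow> rnk p < t p \<Longrightarrow> rnk a = W 20 p \<Longrightarrow> \<not> beats W0 R0 (cnd a) (W' 23 g)) \<Longrightarrow> Q W' R0"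
  shows "hp 0 (survivors (prm j)) Q W R0"
  unfolding survivors_def seqs.simps
proof (rule hp_seq0, rule hp_store_inj)
  fix i i' assume i: "i < wv B W 0 (prm j)" "wv B W i (Load 34 Pid) \<noteq> 0"
    and i': "i' < wv B W 0 (prm j)" "wv B W i' (Load 34 Pid) \<noteq> 0"
    and e: "wv B W i (Load 31 Pid) = wv B W i' (Load 31 Pid)"
  have "i < M" "i' < M" "W0 34 i \<noteq> 0" "W0 34 i' \<noteq> 0" "W0 31 i = W0 31 i'"
    using i i' e j16 by (simp_all add: agr_eqs[OF a])
  then have "i = i'" using own_slot_inj small_grp by blast
  then show "wv B W i (Load 19 (Op Add (Load 29 Pid) (Load 20 Pid))) = wv B W i' (Load 19 (Op Add (Load 29 Pid) (Load 20 Pid)))" by simp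
next
  fix W1 assume W1: "\<And>b. b \<noteq> 21 \<Longrightarrow> W1 b = W b"
    "\<And>i. i < wv B W 0 (prm j) \<Longrightarrow> wv B W i (Load 34 Pid) \<noteq> 0 \<Longrightarrow>
       W1 21 (wv B W i (Load 31 Pid)) = wv B W i (Load 19 (Op Add (Load 29 Pid) (Load 20 Pid)))"
  have a1: "agr W1" using agr_upd[OF a W1(1)] by simp
  have sl: "\<exists>q\<in>grp g. rnk q = W 20 i \<and> W1 21 (g * Z + rnk i) = cnd q" if i: "i \<in> grp g" "rnk i < t i" for i g
  proof -
    have iM: "i < M" "W0 12 i \<noteq> 0" "tgt i = g" using grpD[OF i(1)] by auto
    have s: "W0 34 i \<noteq> 0" using small_grp[OF iM(1)] i iM by auto
    have d: "W 20 i < dg i" using dr iM by simp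
    obtain q where q: "q \<in> grp g" "rnk q = W 20 i" using grp_onto[OF i(1) d] by blast
    have "g * Z + W 20 i < B" using adr_lt[OF i(1), of "W 20 i"] d t_le(2)[OF i(1)] by simp
    then have "W1 21 (W0 31 i) = W0 19 (g * Z + W 20 i)"
      using W1(2)[of i] iM s j16 slot_grp(1)[OF i(1)] by (simp add: agr_eqs[OF a])
    also have "g * Z + W 20 i = W0 31 q" using slot_grp(2)[OF q(1)] q(2) by simp
    also have "W0 19 (W0 31 q) = cnd q" using table grpD[OF q(1)] by simp
    finally show ?thesis using q slot_grp(2)[OF i(1)] by auto
  qed
  have S: "\<exists>q\<in>grp g. x = cnd q" if "x \<in> (\<lambda>a. W1 21 (g * Z + a)) ` {..<t p}" "p \<in> grp g" for x p g
  proof -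
    from that obtain b where b: "b < t p" "x = W1 21 (g * Z + b)" by auto
    from slot_proc[OF that(2) b(1)] obtain i where i: "i \<in> grp g" "rnk i = b" by blast
    then show ?thesis using sl[OF i(1)] b grp_same[OF i(1) that(2)] by auto
  qed
  show "hp 0 (Seq (duel (prm j)) (Seq (cmp2 (prm j) cand (Load 23 (Load 13 Pid)))
      (Par (prm j) (Load 34 Pid) (Store 21 (Load 31 Pid) (prm 11))))) Q W1 R0"
  proof (rule hp_seq0, rule hp_duel[OF a1])
    fix W2 assume a2: "agr W2" and s2: "W2 21 = W1 21"
      and n2: "\<And>g p S. p \<in> grp g \<Longrightarrow> S = (\<lambda>a. W1 21 (g * Z + a)) ` {..<t p} \<Longrightarrow> \<forall>x\<in>S. W0 3 x = 0 \<Longrightarrow> W2 23 g = W1 23 g"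
      and y2: "\<And>g p S. p \<in> grp g \<Longrightarrow> S = (\<lambda>a. W1 21 (g * Z + a)) ` {..<t p} \<Longrightarrow> \<exists>x\<in>S. W0 3 x \<noteq> 0 \<Longrightarrow>
         W2 23 g \<in> S \<and> W0 3 (W2 23 g) \<noteq> 0 \<and> (\<forall>y\<in>S. \<not> beats W0 R0 y (W2 23 g))"
    have form: "W2 23 g = Nul \<or> (\<exists>q\<in>grp g. W2 23 g = cnd q \<and> W0 3 (cnd q) \<noteq> 0)" if p: "p \<in> grp g" for g p
    proof (cases "\<forall>x\<in>(\<lambda>a. W1 21 (g * Z + a)) ` {..<t p}. W0 3 x = 0")
      case True
      then have "W2 23 g = W1 23 g" using n2[OF p refl] by blast
      also have "\<dots> = Nul" using W1(1)[of 23] win grpD[OF p] by auto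
      finally show ?thesis by simp
    next
      case False
      then have "W2 23 g \<in> (\<lambda>a. W1 21 (g * Z + a)) ` {..<t p}" "W0 3 (W2 23 g) \<noteq> 0" using y2[OF p refl] by blast+
      then show ?thesis using S[OF _ p] by metis
    qed
    have hit: "\<not> beats W0 R0 (cnd b) (W2 23 g)" if p: "p \<in> grp g" "b \<in> grp g" "rnk p < t p" "rnk b = W 20 p" for g p b
    proof -
      from sl[OF p(1,3)] obtain q where q: "q \<in> grp g" "rnk q = W 20 p" "W1 21 (g * Z + rnk p) = cnd q" by blast
      have "q = b" using q p(2,4) same[of q b] by (auto simp: grp_def)
      then have m: "cnd b \<in> (\<lambda>a. W1 21 (g * Z + a)) ` {..<t p}" using q p(3) by force
      show ?thesis
      proof (cases "W0 3 (cnd b) = 0")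
        case False
        then have "\<exists>x\<in>(\<lambda>a. W1 21 (g * Z + a)) ` {..<t p}. W0 3 x \<noteq> 0" using m by blast
        then show ?thesis using y2[OF p(1) refl] m by blast
      qed (simp add: beats_def)
    qed
    show "hp 0 (Seq (cmp2 (prm j) cand (Load 23 (Load 13 Pid))) (Par (prm j) (Load 34 Pid) (Store 21 (Load 31 Pid) (prm 11)))) Q W2 R0"
    proof (rule hp_seq0, rule hp_cmp2)
      fix W3 assume W3: "\<And>a. a \<noteq> 24 \<Longrightarrow> a \<noteq> 25 \<Longrightarrow> a \<noteq> 26 \<Longrightarrow> W3 a = W2 a"
        "\<And>i. i < wv B W2 0 (prm j) \<Longrightarrow> W3 26 i = (if beats W2 R0 (wv B W2 i cand) (wv B W2 i (Load 23 (Load 13 Pid))) then 1 else 0)"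
      have a3: "agr W3" using a2 W3(1) unfolding agr_def by auto
      have b3: "W3 26 p \<noteq> 0 \<longleftrightarrow> beats W0 R0 (cnd p) (W2 23 (tgt p))" if "p < M" for p
        using W3(2)[of p] that j16 by (simp add: agr_eqs[OF a2] beats_agr[OF a2] cand_val[OF a2])
      show "hp 0 (Par (prm j) (Load 34 Pid) (Store 21 (Load 31 Pid) (prm 11))) Q W3 R0"
      proof (rule hp_store_inj)
        fix W4 assume W4: "\<And>b. b \<noteq> 21 \<Longrightarrow> W4 b = W3 b"
          "\<And>i. i < wv B W3 0 (prm j) \<Longrightarrow> wv B W3 i (Load 34 Pid) \<noteq> 0 \<Longrightarrow> W4 21 (wv B W3 i (Load 31 Pid)) = wv B W3 i (prm 11)"
        have e: "W4 23 = W2 23" "W4 26 = W3 26" using W4(1) W3(1) by simp_all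
        show "Q W4 R0"
        proof (rule Q)
          show "agr W4" using agr_upd[OF a3 W4(1)] by simp
          show "W4 26 p \<noteq> 0 \<longleftrightarrow> beats W0 R0 (cnd p) (W4 23 (tgt p))" if "p < M" for p
            using b3[OF that] e by simp
          show "W4 23 g = Nul \<or> (\<exists>q\<in>grp g. W4 23 g = cnd q \<and> W0 3 (cnd q) \<noteq> 0)" if "p \<in> grp g" for g p
            using form[OF that] e by simp
          show "W4 21 (g * Z + b) = Nul" if p: "p \<in> grp g" "b < t p" for g p b
          proof -
            from slot_proc[OF p] obtain i where i: "i < M" "W0 34 i \<noteq> 0" "W0 31 i = g * Z + b" by blast
            then show ?thesis using W4(2)[of i] j16 by (simp add: agr_eqs[OF a3])
          qed
          show "\<not> beats W0 R0 (cnd b) (W4 23 g)" if "p \<in> grp g" "b \<in> grp g" "rnk p < t p" "rnk b = W 20 p" for g p b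
            using hit[OF that] e by simp
        qed
      qed simp
    qed (auto simp: cand_def)
  qed simp
qed simp

text \<open>The deterministic half of the second phase, for one target with minimum
  \<open>z\<close>. Other candidates may have the same label as \<open>z\<close>, so the winner
  \<open>q\<close> is characterized by not being beaten by \<open>z\<close>.\<close>

lemma hp_throw:
  assumes a: "agr W" and sv: "\<And>p. p < M \<Longrightarrow> W 26 p \<noteq> 0 \<longleftrightarrow> beats W0 R0 (cnd p) (W 23 (tgt p))"
    and win: "W 23 g = Nul \<or> (\<exists>q\<in>grp g. W 23 g = cnd q \<and> W0 3 (cnd q) \<noteq> 0)"
    and z: "z \<in> grp g" "W0 3 (cnd z) \<noteq> 0" "\<And>p. p \<in> grp g \<Longrightarrow> \<not> beats W0 R0 (cnd p) (cnd z)"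
    and slots: "\<And>a. a < t z \<Longrightarrow> W 21 (g * Z + a) = Nul"
    and dr: "\<And>p. p < M \<Longrightarrow> W0 12 p \<noteq> 0 \<Longrightarrow> W 20 p < 8 * t p"
    and alone: "beats W0 R0 (cnd z) (W 23 g) \<Longrightarrow> W 20 z < t z \<and> (\<forall>p\<in>grp g. p \<noteq> z \<longrightarrow> beats W0 R0 (cnd p) (W 23 g) \<longrightarrow> W 20 p \<noteq> W 20 z)"
    and Q: "\<And>W' q. agr W' \<Longrightarrow> q \<in> grp g \<Longrightarrow> W' 23 g = cnd q \<Longrightarrow> W0 3 (cnd q) \<noteq> 0 \<Longrightarrow> \<not> beats W0 R0 (cnd z) (cnd q) \<Longrightarrow> Q W' R0"
  shows "hp 0 (throw (prm j)) Q W R0"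
  unfolding throw_def seqs.simps
proof (rule hp_seq0, rule hp_store')
  let ?g = "wand (Load 26 Pid) (Op Less (Load 20 Pid) (Load 16 Pid))" and ?x = "Op Add (Load 29 Pid) (Load 20 Pid)"
  fix W1 assume W1: "\<And>b. b \<noteq> 21 \<Longrightarrow> W1 b = W b"
    "\<And>x. (\<exists>i<wv B W 0 (prm j). wv B W i ?g \<noteq> 0 \<and> wv B W i ?x = x \<and> W1 21 x = wv B W i cand) \<or>
      ((\<forall>i<wv B W 0 (prm j). wv B W i ?g \<noteq> 0 \<longrightarrow> wv B W i ?x \<noteq> x) \<and> W1 21 x = W 21 x)"
  have a1: "agr W1" using agr_upd[OF a W1(1)] by simp
  have sg: "i \<in> grp (tgt i) \<and> W0 29 i + W 20 i < B \<and> W0 29 i = tgt i * Z" if i: "i < M" "W 26 i \<noteq> 0" "W 20 i < t i" for i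
  proof -
    \<comment> \<open>Array 26 was computed for inactive processors as well, but their candidate
      cells are not in use and hence beat nothing.\<close>
    have "W0 12 i \<noteq> 0" using sv[OF i(1)] i(2) vact[OF i(1)] by (auto simp: beats_def)
    then have ig: "i \<in> grp (tgt i)" using act_grp i by simp
    then show ?thesis using adr_lt[OF ig, of "W 20 i"] i(3) t_le(1,2)[OF ig] slot_grp(1)[OF ig] by simp
  qed
  have w1: "(\<exists>i<M. W 26 i \<noteq> 0 \<and> W 20 i < t i \<and> (W0 29 i + W 20 i) mod B = x \<and> W1 21 x = cnd i) \<or>
     ((\<forall>i<M. W 26 i \<noteq> 0 \<and> W 20 i < t i \<longrightarrow> (W0 29 i + W 20 i) mod B \<noteq> x) \<and> W1 21 x = W 21 x)" for x
    using W1(2)[of x] j16 by (auto simp: agr_eqs[OF a] cand_val[OF a])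
  have slot: "W1 21 (g * Z + b) = Nul \<or> (\<exists>i\<in>grp g. W 26 i \<noteq> 0 \<and> W 20 i = b \<and> W1 21 (g * Z + b) = cnd i)" if b: "b < t z" for b
    using w1[of "g * Z + b"]
  proof
    assume "\<exists>i<M. W 26 i \<noteq> 0 \<and> W 20 i < t i \<and> (W0 29 i + W 20 i) mod B = g * Z + b \<and> W1 21 (g * Z + b) = cnd i"
    then obtain i where i: "i < M" "W 26 i \<noteq> 0" "W 20 i < t i" "(W0 29 i + W 20 i) mod B = g * Z + b" "W1 21 (g * Z + b) = cnd i" by blast
    have s: "i \<in> grp (tgt i)" "W0 29 i + W 20 i < B" "W0 29 i = tgt i * Z" using sg[OF i(1-3)] by auto
    then have "tgt i * Z + W 20 i = g * Z + b" using i(4) by simp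
    moreover have "W 20 i < Z" "b < Z" using i(3) b t_le(1,2)[OF s(1)] t_le(1,2)[OF z(1)] by auto
    ultimately have "tgt i = g" "W 20 i = b" using mult_add_unique[of "tgt i" Z "W 20 i" g b] by auto
    then show ?thesis using i s by auto
  next
    assume "(\<forall>i<M. W 26 i \<noteq> 0 \<and> W 20 i < t i \<longrightarrow> (W0 29 i + W 20 i) mod B \<noteq> g * Z + b) \<and> W1 21 (g * Z + b) = W 21 (g * Z + b)"
    then show ?thesis using slots[OF b] by simp
  qed
  show "hp 0 (duel (prm j)) Q W1 R0"
  proof (rule hp_duel[OF a1])
    fix W2 assume a2: "agr W2" and s2: "W2 21 = W1 21"
      and n2: "\<And>g p S. p \<in> grp g \<Longrightarrow> S = (\<lambda>a. W1 21 (g * Z + a)) ` {..<t p} \<Longrightarrow> \<forall>x\<in>S. W0 3 x = 0 \<Longrightarrow> W2 23 g = W1 23 g"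
      and y2: "\<And>g p S. p \<in> grp g \<Longrightarrow> S = (\<lambda>a. W1 21 (g * Z + a)) ` {..<t p} \<Longrightarrow> \<exists>x\<in>S. W0 3 x \<noteq> 0 \<Longrightarrow>
         W2 23 g \<in> S \<and> W0 3 (W2 23 g) \<noteq> 0 \<and> (\<forall>y\<in>S. \<not> beats W0 R0 y (W2 23 g))"
    let ?S = "(\<lambda>a. W1 21 (g * Z + a)) ` {..<t z}"
    show "Q W2 R0"
    proof (cases "beats W0 R0 (cnd z) (W 23 g)")
      \<comment> \<open>The sample already contained a minimum: nobody survived, the slots stay
        empty and the duel keeps the interim winner.\<close>
      case False
      then have f: "W0 3 (W 23 g) \<noteq> 0" using z(2) by (auto simp: beats_def)
      then obtain q where q: "q \<in> grp g" "W 23 g = cnd q" using win nul by auto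
      have w0: "W 26 i = 0" if i: "i \<in> grp g" for i
      proof (rule ccontr)
        assume "W 26 i \<noteq> 0"
        then have "beats W0 R0 (cnd i) (W 23 g)" using sv[OF grpD(1)[OF i]] grpD(3)[OF i] by simp
        then show False using beats_mono[OF z(2) z(3)[OF i]] False by blast
      qed
      have xN: "x = Nul" if "x \<in> ?S" for x
      proof -
        from that obtain b where b: "b < t z" "x = W1 21 (g * Z + b)" by auto
        from slot[OF b(1)] show ?thesis
        proof
          assume "\<exists>i\<in>grp g. W 26 i \<noteq> 0 \<and> W 20 i = b \<and> W1 21 (g * Z + b) = cnd i"
          then obtain i where i: "i \<in> grp g" "W 26 i \<noteq> 0" by blast
          from i(2) w0[OF i(1)] show ?thesis by (rule notE)
        next
          assume "W1 21 (g * Z + b) = Nul"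
          then show ?thesis using b(2) by (rule trans[rotated])
        qed
      qed
      have xZ: "\<forall>x\<in>?S. W0 3 x = 0"
      proof
        fix x assume "x \<in> ?S"
        then have "x = Nul" by (rule xN)
        then show "W0 3 x = 0" using nul by simp
      qed
      have "W2 23 g = W1 23 g" by (rule n2[OF z(1) refl xZ])
      also have "\<dots> = cnd q" using W1(1)[of 23] q by simp
      finally show ?thesis using Q[OF a2 q(1)] f False q(2) by simp
    next
      case True
      from alone[OF this] have z1: "W 20 z < t z"
        "\<And>p. p \<in> grp g \<Longrightarrow> p \<noteq> z \<Longrightarrow> beats W0 R0 (cnd p) (W 23 g) \<Longrightarrow> W 20 p \<noteq> W 20 z"
        by blast+
      have zz: "z < M" "W 26 z \<noteq> 0" using sv[of z] grpD[OF z(1)] True by auto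
      have zmod: "(W0 29 z + W 20 z) mod B = g * Z + W 20 z"
        using sg[OF zz z1(1)] grpD[OF z(1)] by auto
      have nn: "W1 21 (g * Z + W 20 z) \<noteq> Nul"
        using w1[of "g * Z + W 20 z"]
      proof
        assume "\<exists>i<M. W 26 i \<noteq> 0 \<and> W 20 i < t i \<and> (W0 29 i + W 20 i) mod B = g * Z + W 20 z \<and> W1 21 (g * Z + W 20 z) = cnd i"
        then obtain i where "W1 21 (g * Z + W 20 z) = cnd i" by blast
        then show ?thesis by simp
      next
        assume "(\<forall>i<M. W 26 i \<noteq> 0 \<and> W 20 i < t i \<longrightarrow> (W0 29 i + W 20 i) mod B \<noteq> g * Z + W 20 z) \<and> W1 21 (g * Z + W 20 z) = W 21 (g * Z + W 20 z)"
        then show ?thesis using zz z1(1) zmod by blast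
      qed
      then obtain i where i: "i \<in> grp g" "W 26 i \<noteq> 0" "W 20 i = W 20 z" "W1 21 (g * Z + W 20 z) = cnd i"
        using slot[OF z1(1)] by blast
      have "beats W0 R0 (cnd i) (W 23 g)" using sv[of i] i grpD[OF i(1)] by auto
      then have "i = z" using z1(2)[OF i(1)] i(3) by blast
      then have m: "cnd z \<in> ?S" using i(4) z1(1) by force
      then have "\<exists>x\<in>?S. W0 3 x \<noteq> 0" using z(2) by (rule bexI[rotated])
      note y = y2[OF z(1) refl this]
      note yS = y[THEN conjunct1] and y0 = y[THEN conjunct2, THEN conjunct1] and yb = y[THEN conjunct2, THEN conjunct2]
      from yb m have yz: "\<not> beats W0 R0 (cnd z) (W2 23 g)" by (rule bspec)
      from yS obtain b where b: "W2 23 g = W1 21 (g * Z + b)" "b < t z" by (elim imageE) simp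
      have "W1 21 (g * Z + b) \<noteq> Nul"
      proof
        assume "W1 21 (g * Z + b) = Nul"
        then show False using y0 b(1) nul by simp
      qed
      then obtain q where q: "q \<in> grp g" "W1 21 (g * Z + b) = cnd q" using slot[OF b(2)] by blast
      have "W2 23 g = cnd q" using b(1) q(2) by (rule trans)
      from Q[OF a2 q(1) this] y0 yz this show ?thesis by simp
    qed
  qed
qed simp

text \<open>Nothing is assumed about the winner array: whatever it holds, a cell changes only to a
  better candidate of its own group. So this applies also after an unsuccessful selection.\<close>

lemma hp_update:
  assumes a: "agr W"
    and Q: "\<And>W' R'. (\<And>a. a \<notin> {3, 5, 20, 21, 22, 23, 24, 25, 26, 28} \<Longrightarrow> W' a = W0 a) \<Longrightarrow>
      (\<And>c. (\<exists>p\<in>grp c. W 23 c = cnd p \<and> beats W0 R0 (cnd p) c \<and> W' 3 c = 1 \<and> W' 5 c = W0 5 (cnd p) \<and> R' 1 c = R0 1 (cnd p)) \<or>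
        ((\<forall>p\<in>grp c. W 23 c = cnd p \<longrightarrow> \<not> beats W0 R0 (cnd p) c) \<and> W' 3 c = W0 3 c \<and> W' 5 c = W0 5 c \<and> R' 1 c = R0 1 c)) \<Longrightarrow> Q W' R'"
  shows "hp 0 (update (prm j)) Q W R0"
  unfolding update_def seqs.simps
proof (rule hp_seq0, rule hp_cmp2)
  let ?P1 = "Par (prm j) (Const 1) (Store 28 Pid (wand (wand (Load 12 Pid) (Load 26 Pid)) (weq (Load 23 (Load 13 Pid)) cand)))"
  let ?P2 = "Par (prm j) (Load 28 Pid) (RStore 1 (Load 13 Pid) (RLoad 1 cand))"
  let ?P3 = "Par (prm j) (Load 28 Pid) (Store 5 (Load 13 Pid) (Load 5 cand))"
  let ?P4 = "Par (prm j) (Load 28 Pid) (Store 3 (Load 13 Pid) (Const 1))"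
  fix W1 assume W1: "\<And>a. a \<noteq> 24 \<Longrightarrow> a \<noteq> 25 \<Longrightarrow> a \<noteq> 26 \<Longrightarrow> W1 a = W a"
    "\<And>i. i < wv B W 0 (prm j) \<Longrightarrow> W1 26 i = (if beats W R0 (wv B W i cand) (wv B W i (Load 13 Pid)) then 1 else 0)"
  have a1: "agr W1" using a W1(1) unfolding agr_def by auto
  have b1: "W1 26 p = (if beats W0 R0 (cnd p) (tgt p) then 1 else 0)" if "p < M" for p
    using W1(2)[of p] that j16 by (simp add: agr_eqs[OF a] beats_agr[OF a] cand_val[OF a])
  have e23: "W1 23 = W 23" using W1(1)[of 23] by simp
  define U where "U p \<longleftrightarrow> p < M \<and> W0 12 p \<noteq> 0 \<and> beats W0 R0 (cnd p) (tgt p) \<and> W 23 (tgt p) = cnd p" for p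
  have Uinj: "p = q" if "U p" "U q" "tgt p = tgt q" for p q
  proof -
    have "W 23 (tgt p) = cnd p" "W 23 (tgt q) = cnd q" using that(1,2) by (simp_all only: U_def)
    then have "cnd p = cnd q" using that(3) by (simp only:)
    then show ?thesis by simp
  qed
  show "hp 0 (Seq ?P1 (Seq ?P2 (Seq ?P3 ?P4))) Q W1 R0"
  proof (rule hp_seq0, rule hp_store_inj, simp)
    fix W2 assume W2: "\<And>b. b \<noteq> 28 \<Longrightarrow> W2 b = W1 b"
      "\<And>i. i < wv B W1 0 (prm j) \<Longrightarrow> wv B W1 i (Const 1) \<noteq> 0 \<Longrightarrow>
        W2 28 (wv B W1 i Pid) = wv B W1 i (wand (wand (Load 12 Pid) (Load 26 Pid)) (weq (Load 23 (Load 13 Pid)) cand))"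
    have a2: "agr W2" using agr_upd[OF a1 W2(1)] by simp
    have u2: "W2 28 p \<noteq> 0 \<longleftrightarrow> U p" if "p < M" for p
      using W2(2)[of p] that j16 unfolding U_def
      by (simp add: agr_eqs[OF a1] cand_val[OF a1] b1 e23) blast
    have UM: "U p \<Longrightarrow> p < M" for p by (simp add: U_def)
    show "hp 0 (Seq ?P2 (Seq ?P3 ?P4)) Q W2 R0"
    proof (rule hp_seq0, rule hp_rstore_inj)
      fix i i' assume i: "i < wv B W2 0 (prm j)" "i' < wv B W2 0 (prm j)" "wv B W2 i (Load 28 Pid) \<noteq> 0"
        "wv B W2 i' (Load 28 Pid) \<noteq> 0" "wv B W2 i (Load 13 Pid) = wv B W2 i' (Load 13 Pid)"
      then have "i = i'" using Uinj[of i i'] u2[of i] u2[of i'] j16 by (simp add: agr_eqs[OF a2])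
      then show "rv B W2 R0 i (RLoad 1 cand) = rv B W2 R0 i' (RLoad 1 cand)" by simp
    next
      fix R1 assume R1: "\<And>b. b \<noteq> 1 \<Longrightarrow> R1 b = R0 b"
        "\<And>i. i < wv B W2 0 (prm j) \<Longrightarrow> wv B W2 i (Load 28 Pid) \<noteq> 0 \<Longrightarrow> R1 1 (wv B W2 i (Load 13 Pid)) = rv B W2 R0 i (RLoad 1 cand)"
        "\<And>x. (\<And>i. i < wv B W2 0 (prm j) \<Longrightarrow> wv B W2 i (Load 28 Pid) \<noteq> 0 \<Longrightarrow> wv B W2 i (Load 13 Pid) \<noteq> x) \<Longrightarrow> R1 1 x = R0 1 x"
      have r1: "R1 1 (tgt p) = R0 1 (cnd p)" if "U p" for p
        using R1(2)[of p] UM[OF that] u2[OF UM[OF that]] that j16 by (simp add: agr_eqs[OF a2] cand_val[OF a2])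
      have r0: "R1 1 x = R0 1 x" if n: "\<And>p. U p \<Longrightarrow> tgt p \<noteq> x" for x
      proof (rule R1(3))
        fix i assume "i < wv B W2 0 (prm j)" "wv B W2 i (Load 28 Pid) \<noteq> 0"
        then have "U i" using u2[of i] j16 by (simp add: agr_eqs[OF a2])
        then show "wv B W2 i (Load 13 Pid) \<noteq> x" using n[of i] by (simp add: agr_eqs[OF a2])
      qed
      show "hp 0 (Seq ?P3 ?P4) Q W2 R1"
      proof (rule hp_seq0, rule hp_store_inj)
        fix i i' assume i: "i < wv B W2 0 (prm j)" "i' < wv B W2 0 (prm j)" "wv B W2 i (Load 28 Pid) \<noteq> 0"
          "wv B W2 i' (Load 28 Pid) \<noteq> 0" "wv B W2 i (Load 13 Pid) = wv B W2 i' (Load 13 Pid)"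
        then have "i = i'" using Uinj[of i i'] u2[of i] u2[of i'] j16 by (simp add: agr_eqs[OF a2])
        then show "wv B W2 i (Load 5 cand) = wv B W2 i' (Load 5 cand)" by simp
      next
        fix W3 assume W3: "\<And>b. b \<noteq> 5 \<Longrightarrow> W3 b = W2 b"
          "\<And>i. i < wv B W2 0 (prm j) \<Longrightarrow> wv B W2 i (Load 28 Pid) \<noteq> 0 \<Longrightarrow> W3 5 (wv B W2 i (Load 13 Pid)) = wv B W2 i (Load 5 cand)"
          "\<And>x. (\<And>i. i < wv B W2 0 (prm j) \<Longrightarrow> wv B W2 i (Load 28 Pid) \<noteq> 0 \<Longrightarrow> wv B W2 i (Load 13 Pid) \<noteq> x) \<Longrightarrow> W3 5 x = W2 5 x"
        have h1: "W3 5 (tgt p) = W0 5 (cnd p)" if "U p" for p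
          using W3(2)[of p] UM[OF that] u2[OF UM[OF that]] that j16 by (simp add: agr_eqs[OF a2] cand_val[OF a2])
        have h0: "W3 5 x = W0 5 x" if n: "\<And>p. U p \<Longrightarrow> tgt p \<noteq> x" for x
        proof -
          have "W3 5 x = W2 5 x"
          proof (rule W3(3))
            fix i assume "i < wv B W2 0 (prm j)" "wv B W2 i (Load 28 Pid) \<noteq> 0"
            then have "U i" using u2[of i] j16 by (simp add: agr_eqs[OF a2])
            then show "wv B W2 i (Load 13 Pid) \<noteq> x" using n[of i] by (simp add: agr_eqs[OF a2])
          qed
          then show ?thesis by (simp add: agr_eqs[OF a2])
        qed
        have e3: "W3 0 = W0 0" "W3 28 = W2 28" "W3 13 = W0 13" "W3 3 = W0 3"
          using W3(1) by (simp_all add: agr_eqs[OF a2])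
        show "hp 0 ?P4 Q W3 R1"
        proof (rule hp_store_inj)
          fix W4 assume W4: "\<And>b. b \<noteq> 3 \<Longrightarrow> W4 b = W3 b"
            "\<And>i. i < wv B W3 0 (prm j) \<Longrightarrow> wv B W3 i (Load 28 Pid) \<noteq> 0 \<Longrightarrow> W4 3 (wv B W3 i (Load 13 Pid)) = wv B W3 i (Const 1)"
            "\<And>x. (\<And>i. i < wv B W3 0 (prm j) \<Longrightarrow> wv B W3 i (Load 28 Pid) \<noteq> 0 \<Longrightarrow> wv B W3 i (Load 13 Pid) \<noteq> x) \<Longrightarrow> W4 3 x = W3 3 x"
          have f1: "W4 3 (tgt p) = 1" if "U p" for p
            using W4(2)[of p] UM[OF that] u2[OF UM[OF that]] that j16 by (simp add: e3)
          have f0: "W4 3 x = W0 3 x" if n: "\<And>p. U p \<Longrightarrow> tgt p \<noteq> x" for x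
          proof -
            have "W4 3 x = W3 3 x"
            proof (rule W4(3))
              fix i assume "i < wv B W3 0 (prm j)" "wv B W3 i (Load 28 Pid) \<noteq> 0"
              then have "U i" using u2[of i] j16 by (simp add: e3)
              then show "wv B W3 i (Load 13 Pid) \<noteq> x" using n[of i] by (simp add: e3)
            qed
            then show ?thesis by (simp add: e3)
          qed
          have e4: "W4 5 = W3 5" using W4(1)[of 5] by simp
          show "Q W4 R1"
          proof (rule Q)
            fix b :: nat assume b: "b \<notin> {3, 5, 20, 21, 22, 23, 24, 25, 26, 28}"
            then have "W4 b = W2 b" using W4(1)[of b] W3(1)[of b] by simp
            then show "W4 b = W0 b" using a2 b unfolding agr_def by simp
          next
            fix c
            show "(\<exists>p\<in>grp c. W 23 c = cnd p \<and> beats W0 R0 (cnd p) c \<and> W4 3 c = 1 \<and> W4 5 c = W0 5 (cnd p) \<and> R1 1 c = R0 1 (cnd p)) \<or>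
              ((\<forall>p\<in>grp c. W 23 c = cnd p \<longrightarrow> \<not> beats W0 R0 (cnd p) c) \<and> W4 3 c = W0 3 c \<and> W4 5 c = W0 5 c \<and> R1 1 c = R0 1 c)"
            proof (cases "\<exists>p. U p \<and> tgt p = c")
              case True
              then obtain p where p: "U p" "tgt p = c" by blast
              then have "p \<in> grp c" "W 23 c = cnd p" "beats W0 R0 (cnd p) c" by (auto simp: U_def grp_def)
              then show ?thesis using f1[OF p(1)] h1[OF p(1)] r1[OF p(1)] p(2) e4 by auto
            next
              case False
              then have n: "\<And>p. U p \<Longrightarrow> tgt p \<noteq> c" by blast
              have "\<not> beats W0 R0 (cnd p) c" if "p \<in> grp c" "W 23 c = cnd p" for p
                using n[of p] that by (auto simp: U_def grp_def)
              then show ?thesis using f0[OF n] h0[OF n] r0[OF n] e4 by simp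
            qed
          qed
        qed simp
      qed simp
    qed simp
  qed simp
qed (auto simp: cand_def)

end

context machine
begin

lemma hp_seq_last: "hp a p (hp 0 q Q) W R \<Longrightarrow> hp a (Seq p q) Q W R"
  using hp_seq[of a p "hp 0 q Q" W R 0 q Q] by simp

lemma hp_draw_good:
  fixes W k g e
  defines "A \<equiv> {i. i < wv B W 0 k \<and> wv B W i g \<noteq> 0}"
  assumes p: "measure_pmf.prob (Pi_pmf A 0 (\<lambda>i. pmf_of_set {..< max 1 (wv B W i e)})) {\<rho>. \<not> good \<rho>} \<le> \<epsilon>"
    and Q: "\<And>\<rho>. good \<rho> \<Longrightarrow> (\<And>i. i \<in> A \<Longrightarrow> 0 < wv B W i e \<Longrightarrow> \<rho> i < wv B W i e) \<Longrightarrow>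
      Q (W(a := \<lambda>x. if x \<in> A then \<rho> x else W a x)) R"
  shows "hp \<epsilon> (Par k g (Draw a e)) Q W R"
proof (rule hp_draw)
  let ?M = "Pi_pmf A 0 (\<lambda>i. pmf_of_set {..< max 1 (wv B W i e)})"
  have fA: "finite A" by (simp add: A_def)
  have "measure_pmf.prob ?M {\<rho>. \<not> Q (W(a := \<lambda>x. if x \<in> A then \<rho> x else W a x)) R} \<le> measure_pmf.prob ?M {\<rho>. \<not> good \<rho>}"
  proof (rule measure_pmf.finite_measure_mono_AE)
    show "AE \<rho> in measure_pmf ?M. \<rho> \<in> {\<rho>. \<not> Q (W(a := \<lambda>x. if x \<in> A then \<rho> x else W a x)) R} \<longrightarrow> \<rho> \<in> {\<rho>. \<not> good \<rho>}"
      unfolding AE_measure_pmf_iff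
    proof (intro ballI impI)
      fix \<rho> assume r: "\<rho> \<in> set_pmf ?M" and n: "\<rho> \<in> {\<rho>. \<not> Q (W(a := \<lambda>x. if x \<in> A then \<rho> x else W a x)) R}"
      have "\<not> good \<rho>"
      proof
        assume "good \<rho>"
        then have "Q (W(a := \<lambda>x. if x \<in> A then \<rho> x else W a x)) R"
          by (rule Q) (rule draw_range[OF r fA])
        then show False using n by simp
      qed
      then show "\<rho> \<in> {\<rho>. \<not> good \<rho>}" by simp
    qed
  qed auto
  then show "measure_pmf.prob (Pi_pmf {i. i < wv B W 0 k \<and> wv B W i g \<noteq> 0} 0 (\<lambda>i. pmf_of_set {..<max 1 (wv B W i e)}))
     {\<rho>. \<not> Q (W(a := \<lambda>x. if x < wv B W 0 k \<and> wv B W x g \<noteq> 0 then \<rho> x else W a x)) R} \<le> \<epsilon>"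
    using p unfolding A_def by simp
qed

end

context cands
begin

text \<open>The sample is useful with probability at least 1/2, and then the throw isolates the
  minimum with probability at least 1/16; \<open>1/2 + 1/2 * 15/16 = 31/32\<close>. It suffices to
  compare with the true minimum \<open>z\<close> of the group, since \<open>p0\<close> does not beat
  it.\<close>

lemma hp_pick:
  assumes a: "agr W" and p0: "p0 \<in> grp g" "W0 3 (cnd p0) \<noteq> 0"
    and Q: "\<And>W' q. agr W' \<Longrightarrow> q \<in> grp g \<Longrightarrow> W' 23 g = cnd q \<Longrightarrow> W0 3 (cnd q) \<noteq> 0 \<Longrightarrow>
      \<not> beats W0 R0 (cnd p0) (cnd q) \<Longrightarrow> Q W' R0"
  shows "hp (31 / 32) (pick (prm j)) Q W R0"
proof -
  have "\<exists>x\<in>cnd ` grp g. W0 3 x \<noteq> 0 \<and> (\<forall>y\<in>cnd ` grp g. \<not> beats W0 R0 y x)"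
  proof (rule ex_unbeaten)
    show "finite (cnd ` grp g)" by (rule finite_imageI) simp
    show "\<exists>x\<in>cnd ` grp g. W0 3 x \<noteq> 0" using p0 by (intro bexI[of _ "cnd p0"] imageI)
  qed
  then obtain x where x: "x \<in> cnd ` grp g" "W0 3 x \<noteq> 0" "\<forall>y\<in>cnd ` grp g. \<not> beats W0 R0 y x" by (elim bexE conjE) simp
  from x(1) obtain z where zx: "x = cnd z" and z1: "z \<in> grp g" by (elim imageE) simp
  have z2: "W0 3 (cnd z) \<noteq> 0" using x(2) unfolding zx .
  have z3: "\<not> beats W0 R0 (cnd p) (cnd z)" if "p \<in> grp g" for p
    using x(3) imageI[OF that, of cnd] unfolding zx by (rule bspec)
  note z = z1 z2 z3
  \<comment> \<open>The quotient \<open>dg z / t z\<close> rounded up: the least size of a set of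
    low candidates that \<open>t z\<close> draws are expected to hit once. From
    \<open>dg z < 4 * (t z * t z)\<close> it is at most \<open>4 * t z\<close>, the load the throw
    can bear.\<close>
  define k where "k = (dg z - 1) div t z + 1"
  have tz: "0 < t z" "dg z < 4 * (t z * t z)" "0 < dg z" using t_le[OF z(1)] tt[of z] grpD[OF z(1)] by auto
  have kd: "dg z \<le> k * t z"
  proof -
    have "dg z - 1 = (dg z - 1) div t z * t z + (dg z - 1) mod t z" by (rule div_mult_mod_eq[symmetric])
    moreover have "(dg z - 1) mod t z < t z" using tz(1) by simp
    ultimately have "dg z - 1 < (dg z - 1) div t z * t z + t z" by linarith
    then have "dg z \<le> (dg z - 1) div t z * t z + t z" by linarith
    then show ?thesis unfolding k_def add_mult_distrib by simp
  qed
  have k4: "k \<le> 4 * t z"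
  proof -
    have "dg z - 1 < (4 * t z) * t z" using tz(2) by simp
    then have "(dg z - 1) div t z < 4 * t z" by (simp add: less_mult_imp_div_less)
    then show ?thesis unfolding k_def by simp
  qed
  define V where "V = {p \<in> grp g. W0 3 (cnd p) \<noteq> 0}"
  have fV: "finite V" unfolding V_def by simp
  have low: "\<exists>x\<in>T. \<forall>y\<in>T. \<not> beats W0 R0 (cnd y) (cnd x)" if T: "T \<subseteq> V" "T \<noteq> {}" for T
  proof -
    have "\<exists>x\<in>cnd ` T. W0 3 x \<noteq> 0 \<and> (\<forall>y\<in>cnd ` T. \<not> beats W0 R0 y x)"
    proof (rule ex_unbeaten)
      show "finite (cnd ` T)" by (intro finite_imageI finite_subset[OF T(1) fV])
      obtain y where y: "y \<in> T" using T(2) by auto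
      then have "W0 3 (cnd y) \<noteq> 0" using T(1) unfolding V_def by auto
      then show "\<exists>x\<in>cnd ` T. W0 3 x \<noteq> 0" using y by (intro bexI[of _ "cnd y"] imageI)
    qed
    then obtain x where x: "x \<in> cnd ` T" "\<forall>y\<in>cnd ` T. \<not> beats W0 R0 y x" by (elim bexE conjE) (rule that)
    from x(1) obtain v where v: "x = cnd v" "v \<in> T" by (rule imageE)
    have "\<not> beats W0 R0 (cnd y) (cnd v)" if "y \<in> T" for y
      using x(2) imageI[OF that, of cnd] unfolding v(1) by (rule bspec)
    then show ?thesis using v(2) by (intro bexI[of _ v] ballI)
  qed
  obtain A where A: "k \<le> card V \<Longrightarrow> A \<subseteq> V \<and> card A = k \<and> (\<forall>b\<in>A. \<forall>p\<in>V - A. \<not> beats W0 R0 (cnd p) (cnd b))"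
    using ex_lower_set[of V k "\<lambda>p q. beats W0 R0 (cnd p) (cnd q)", OF fV _ low] by metis
  define hit where "hit \<rho> \<longleftrightarrow> card V \<le> k \<or> (\<exists>q\<in>grp g. rnk q < t z \<and> \<rho> q \<in> rnk ` A)" for \<rho> :: "nat \<Rightarrow> nat"
  have hit_cong: "hit f" if "\<And>p. p \<in> grp g \<Longrightarrow> f p = \<rho> p" "hit \<rho>" for f \<rho> :: "nat \<Rightarrow> nat"
    using that(2) unfolding hit_def by (elim disjE bexE) (auto simp: that(1) intro!: bexI)
  have injr: "inj_on rnk (grp g)" using rnk_bij[OF z(1)] by (simp add: bij_betw_def)
  have imr: "rnk ` grp g = {..<dg z}" using rnk_bij[OF z(1)] by (simp add: bij_betw_def)
  have missp: "measure_pmf.prob (Pi_pmf X 0 (\<lambda>i. pmf_of_set {..<max 1 (e i)})) {\<rho>. \<not> hit \<rho>} \<le> 1 / 2"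
    if X: "finite X" "grp g \<subseteq> X" and e: "\<And>i. i \<in> grp g \<Longrightarrow> e i = dg z" for X e
  proof (cases "k \<le> card V")
    case False
    then have "{\<rho>. \<not> hit \<rho>} = {}" by (auto simp: hit_def)
    then show ?thesis by simp
  next
    case True
    define S where "S = {q \<in> grp g. rnk q < t z}"
    have "rnk ` S = {..<t z}"
    proof (intro equalityI subsetI)
      fix r assume "r \<in> {..<t z}"
      then have "r \<in> rnk ` grp g" using imr t_le(1)[OF z(1)] by auto
      then show "r \<in> rnk ` S" using \<open>r \<in> {..<t z}\<close> unfolding S_def by auto
    qed (auto simp: S_def)
    moreover have "inj_on rnk S" by (rule inj_on_subset[OF injr]) (auto simp: S_def)
    ultimately have cS: "card S = t z" using card_image[of rnk S] by simp
    have AV: "A \<subseteq> grp g" using A[OF True] unfolding V_def by auto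
    then have cA: "card (rnk ` A) = k" using card_image[OF inj_on_subset[OF injr AV]] A[OF True] by simp
    have "measure_pmf.prob (Pi_pmf X 0 (\<lambda>i. pmf_of_set {..<max 1 (e i)})) {\<rho>. \<not> hit \<rho>}
      \<le> measure_pmf.prob (Pi_pmf X 0 (\<lambda>i. pmf_of_set {..<max 1 (e i)})) {\<rho>. \<forall>q\<in>S. \<rho> q \<notin> rnk ` A}"
      by (rule measure_pmf.finite_measure_mono) (auto simp: hit_def S_def)
    also have "\<dots> \<le> 1 / 2"
    proof (rule prob_sample_miss[where d="dg z"])
      show "S \<subseteq> X" using X(2) by (auto simp: S_def)
      show "rnk ` A \<subseteq> {..<dg z}" using image_mono[OF AV, of rnk] imr by simp
      show "dg z \<le> card (rnk ` A) * card S" using kd cS cA by simp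
    qed (use X e tz(3) in \<open>auto simp: S_def\<close>)
    finally show ?thesis .
  qed
  have "hp (1/2 + (1 - 1/2) * (15/16)) (Seq (draw_sample (prm j)) (Seq (survivors (prm j)) (Seq (draw_slot (prm j)) (throw (prm j))))) Q W1 R0"
    if a1: "agr W1" and win1: "\<And>p. p < M \<Longrightarrow> W0 12 p \<noteq> 0 \<Longrightarrow> W1 23 (tgt p) = Nul" for W1
  proof (rule hp_seq[where M="\<lambda>W' R'. R' = R0 \<and> agr W' \<and> (\<forall>p. p < M \<longrightarrow> W0 12 p \<noteq> 0 \<longrightarrow> W' 23 (tgt p) = Nul) \<and>
      (\<forall>p. p < M \<longrightarrow> W0 12 p \<noteq> 0 \<longrightarrow> W' 20 p < dg p) \<and> hit (W' 20)"])
    show "hp (1/2) (draw_sample (prm j)) (\<lambda>W' R'. R' = R0 \<and> agr W' \<and> (\<forall>p. p < M \<longrightarrow> W0 12 p \<noteq> 0 \<longrightarrow> W' 23 (tgt p) = Nul) \<and>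
      (\<forall>p. p < M \<longrightarrow> W0 12 p \<noteq> 0 \<longrightarrow> W' 20 p < dg p) \<and> hit (W' 20)) W1 R0"
      unfolding draw_sample_def
    proof (rule hp_draw_good)
      let ?A = "{i. i < wv B W1 0 (prm j) \<and> wv B W1 i (Load 12 Pid) \<noteq> 0}"
      have A': "?A = {i. i < M \<and> W0 12 i \<noteq> 0}" using j16 by (simp add: agr_eqs[OF a1])
      show "measure_pmf.prob (Pi_pmf ?A 0 (\<lambda>i. pmf_of_set {..<max 1 (wv B W1 i (Load 15 Pid))})) {\<rho>. \<not> hit \<rho>} \<le> 1 / 2"
      proof (rule missp)
        show "finite ?A" by simp
        show "grp g \<subseteq> ?A" unfolding A' by (auto simp: grp_def)
        show "wv B W1 i (Load 15 Pid) = dg z" if "i \<in> grp g" for i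
          using grp_same[OF that z(1)] by (simp add: agr_eqs[OF a1])
      qed
      fix \<rho> assume h: "hit \<rho>" and r: "\<And>i. i \<in> ?A \<Longrightarrow> 0 < wv B W1 i (Load 15 Pid) \<Longrightarrow> \<rho> i < wv B W1 i (Load 15 Pid)"
      let ?W = "W1(20 := \<lambda>x. if x \<in> ?A then \<rho> x else W1 20 x)"
      have "agr ?W" by (rule agr_upd[OF a1, of 20]) auto
      moreover have "\<forall>p. p < M \<longrightarrow> W0 12 p \<noteq> 0 \<longrightarrow> ?W 23 (tgt p) = Nul" using win1 by simp
      moreover have "\<forall>p. p < M \<longrightarrow> W0 12 p \<noteq> 0 \<longrightarrow> ?W 20 p < dg p"
      proof (intro allI impI)
        fix p assume p: "p < M" "W0 12 p \<noteq> 0"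
        then have "p \<in> ?A" "0 < dg p" using A' rk[OF p] by auto
        then show "?W 20 p < dg p" using r[of p] by (simp add: agr_eqs[OF a1])
      qed
      moreover have "hit (?W 20)"
      proof -
        have "?W 20 q = \<rho> q" if "q \<in> grp g" for q using that A' by (auto simp: grp_def)
        then show ?thesis by (rule hit_cong[OF _ h])
      qed
      ultimately show "R0 = R0 \<and> agr ?W \<and> (\<forall>p. p < M \<longrightarrow> W0 12 p \<noteq> 0 \<longrightarrow> ?W 23 (tgt p) = Nul) \<and>
         (\<forall>p. p < M \<longrightarrow> W0 12 p \<noteq> 0 \<longrightarrow> ?W 20 p < dg p) \<and> hit (?W 20)" by blast
    qed
  next
    fix W2 R2
    assume "R2 = R0 \<and> agr W2 \<and> (\<forall>p. p < M \<longrightarrow> W0 12 p \<noteq> 0 \<longrightarrow> W2 23 (tgt p) = Nul) \<and>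
      (\<forall>p. p < M \<longrightarrow> W0 12 p \<noteq> 0 \<longrightarrow> W2 20 p < dg p) \<and> hit (W2 20)"
    then have m: "R2 = R0" "agr W2" "\<And>p. p < M \<Longrightarrow> W0 12 p \<noteq> 0 \<Longrightarrow> W2 23 (tgt p) = Nul"
      "\<And>p. p < M \<Longrightarrow> W0 12 p \<noteq> 0 \<Longrightarrow> W2 20 p < dg p" "hit (W2 20)" by blast+
    show "hp (15/16) (Seq (survivors (prm j)) (Seq (draw_slot (prm j)) (throw (prm j)))) Q W2 R2"
      unfolding m(1)
    proof (rule hp_seq0, rule hp_survivors[OF m(2-4)])
      fix W3 assume a3: "agr W3" and sv3: "\<And>p. p < M \<Longrightarrow> W3 26 p \<noteq> 0 \<longleftrightarrow> beats W0 R0 (cnd p) (W3 23 (tgt p))"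
        and f3: "\<And>g p. p \<in> grp g \<Longrightarrow> W3 23 g = Nul \<or> (\<exists>q\<in>grp g. W3 23 g = cnd q \<and> W0 3 (cnd q) \<noteq> 0)"
        and s3: "\<And>g p a. p \<in> grp g \<Longrightarrow> a < t p \<Longrightarrow> W3 21 (g * Z + a) = Nul"
        and h3: "\<And>g p a. p \<in> grp g \<Longrightarrow> a \<in> grp g \<Longrightarrow> rnk p < t p \<Longrightarrow> rnk a = W2 20 p \<Longrightarrow> \<not> beats W0 R0 (cnd a) (W3 23 g)"
      define S where "S = {p \<in> grp g. beats W0 R0 (cnd p) (W3 23 g)}"
      have SV: "S \<subseteq> V" by (auto simp: S_def V_def beats_def)
      have cS: "card S \<le> 4 * t z"
      proof (cases "card V \<le> k")
        case True
        then show ?thesis using card_mono[OF fV SV] k4 by simp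
      next
        case False
        then obtain q where q: "q \<in> grp g" "rnk q < t z" "W2 20 q \<in> rnk ` A" using m(5) unfolding hit_def by blast
        then obtain b where b: "b \<in> A" "W2 20 q = rnk b" by blast
        have AA: "A \<subseteq> V" "card A = k" "\<forall>b\<in>A. \<forall>p\<in>V - A. \<not> beats W0 R0 (cnd p) (cnd b)" using A False by auto
        have bg: "b \<in> grp g" "W0 3 (cnd b) \<noteq> 0" using b AA unfolding V_def by auto
        have nb: "\<not> beats W0 R0 (cnd b) (W3 23 g)" using h3[OF q(1) bg(1)] q(2) b(2) grp_same[OF q(1) z(1)] by simp
        \<comment> \<open>A survivor outside \<open>A\<close> would not beat the sampled
          \<open>b\<close>. Then \<open>b\<close> would beat the interim winner as well, although it
          took part in the sample.\<close>
        have "S \<subseteq> A"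
        proof
          fix p assume p: "p \<in> S"
          show "p \<in> A"
          proof (rule ccontr)
            assume "p \<notin> A"
            then have "\<not> beats W0 R0 (cnd p) (cnd b)" using AA(3) b(1) p SV by blast
            then have "beats W0 R0 (cnd b) (W3 23 g)" using beats_mono[OF bg(2)] p unfolding S_def by blast
            then show False using nb by blast
          qed
        qed
        moreover have "finite A" using AA(1) fV finite_subset by blast
        ultimately show ?thesis using card_mono[of A S] AA(2) k4 by simp
      qed
      \<comment> \<open>If the minimum did not survive, the interim winner is already as good and
        the throw need not achieve anything.\<close>
      define alone where "alone \<rho> \<longleftrightarrow> z \<notin> S \<or> (\<rho> z < t z \<and> (\<forall>p\<in>S. p \<noteq> z \<longrightarrow> \<rho> p \<noteq> \<rho> z))" for \<rho> :: "nat \<Rightarrow> nat"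
      have alone_cong: "alone f" if "\<And>p. p \<in> grp g \<Longrightarrow> f p = \<rho> p" "alone \<rho>" for f \<rho> :: "nat \<Rightarrow> nat"
      proof (cases "z \<in> S")
        case True
        have "f p = \<rho> p" if "p \<in> S" for p using that \<open>\<And>p. p \<in> grp g \<Longrightarrow> f p = \<rho> p\<close> by (simp add: S_def)
        then show ?thesis using that(2) True by (simp add: alone_def)
      qed (simp add: alone_def)
      have "hp (15/16 + (1 - 15/16) * 0) (Seq (draw_slot (prm j)) (throw (prm j))) Q W3 R0"
      proof (rule hp_seq[where M="\<lambda>W' R'. R' = R0 \<and> agr W' \<and> W' 21 = W3 21 \<and> W' 23 = W3 23 \<and> W' 26 = W3 26 \<and>
          (\<forall>p. p < M \<longrightarrow> W0 12 p \<noteq> 0 \<longrightarrow> W' 20 p < 8 * t p) \<and> alone (W' 20)"])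
        show "hp (15/16) (draw_slot (prm j)) (\<lambda>W' R'. R' = R0 \<and> agr W' \<and> W' 21 = W3 21 \<and> W' 23 = W3 23 \<and> W' 26 = W3 26 \<and>
          (\<forall>p. p < M \<longrightarrow> W0 12 p \<noteq> 0 \<longrightarrow> W' 20 p < 8 * t p) \<and> alone (W' 20)) W3 R0"
          unfolding draw_slot_def
        proof (rule hp_draw_good)
          let ?A = "{i. i < wv B W3 0 (prm j) \<and> wv B W3 i (Load 12 Pid) \<noteq> 0}"
          let ?e = "\<lambda>i. wv B W3 i (Op Mul (Const 8) (Load 16 Pid))"
          have A': "?A = {i. i < M \<and> W0 12 i \<noteq> 0}" using j16 by (simp add: agr_eqs[OF a3])
          have e: "?e i = 8 * t i" if "i \<in> ?A" for i
          proof -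
            have "i \<in> grp (tgt i)" using that A' by (auto simp: grp_def)
            then have "t i \<le> Z" using t_le(1,2) by (meson le_trans)
            then have "8 * t i < B" using bounds(3) by simp
            then show ?thesis by (simp add: agr_eqs[OF a3])
          qed
          show "measure_pmf.prob (Pi_pmf ?A 0 (\<lambda>i. pmf_of_set {..<max 1 (?e i)})) {\<rho>. \<not> alone \<rho>} \<le> 15 / 16"
          proof (cases "z \<in> S")
            case False
            then have "{\<rho>. \<not> alone \<rho>} = {}" by (auto simp: alone_def)
            then show ?thesis by simp
          next
            case True
            have SA: "S \<subseteq> ?A" unfolding A' by (auto simp: S_def grp_def)
            have "{\<rho>. \<not> alone \<rho>} = {\<rho>. \<not> (\<rho> z < t z \<and> (\<forall>p\<in>S. p \<noteq> z \<longrightarrow> \<rho> p \<noteq> \<rho> z))}"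
              using True by (simp add: alone_def)
            moreover have "measure_pmf.prob (Pi_pmf ?A 0 (\<lambda>i. pmf_of_set {..<max 1 (?e i)}))
               {\<rho>. \<not> (\<rho> z < t z \<and> (\<forall>p\<in>S. p \<noteq> z \<longrightarrow> \<rho> p \<noteq> \<rho> z))} \<le> 15 / 16"
            proof (rule prob_collision)
              show "?e i = 8 * t z" if "i \<in> S" for i
              proof -
                have "i \<in> grp g" using that by (simp add: S_def)
                then have "t i = t z" using grp_same z(1) by blast
                then show ?thesis using e[of i] SA that by auto
              qed
            qed (use SA True cS tz in auto)
            ultimately show ?thesis by simp
          qed
          fix \<rho> assume h: "alone \<rho>" and r: "\<And>i. i \<in> ?A \<Longrightarrow> 0 < ?e i \<Longrightarrow> \<rho> i < ?e i"
          let ?W = "W3(20 := \<lambda>x. if x \<in> ?A then \<rho> x else W3 20 x)"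
          have "agr ?W" by (rule agr_upd[OF a3, of 20]) auto
          moreover have "\<forall>p. p < M \<longrightarrow> W0 12 p \<noteq> 0 \<longrightarrow> ?W 20 p < 8 * t p"
          proof (intro allI impI)
            fix p assume p: "p < M" "W0 12 p \<noteq> 0"
            have pA: "p \<in> ?A" using A' p by auto
            moreover have "0 < t p" using tt[OF p] by simp
            ultimately show "?W 20 p < 8 * t p" using r[OF pA] e[OF pA] by simp
          qed
          moreover have "alone (?W 20)"
          proof -
            have "?W 20 q = \<rho> q" if "q \<in> grp g" for q using that A' by (auto simp: grp_def)
            moreover have "S \<subseteq> grp g" by (auto simp: S_def)
            ultimately show ?thesis by (intro alone_cong[OF _ h]) blast
          qed
          ultimately show "R0 = R0 \<and> agr ?W \<and> ?W 21 = W3 21 \<and> ?W 23 = W3 23 \<and> ?W 26 = W3 26 \<and>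
            (\<forall>p. p < M \<longrightarrow> W0 12 p \<noteq> 0 \<longrightarrow> ?W 20 p < 8 * t p) \<and> alone (?W 20)" by simp
        qed
      next
        fix W4 R4
        assume "R4 = R0 \<and> agr W4 \<and> W4 21 = W3 21 \<and> W4 23 = W3 23 \<and> W4 26 = W3 26 \<and>
          (\<forall>p. p < M \<longrightarrow> W0 12 p \<noteq> 0 \<longrightarrow> W4 20 p < 8 * t p) \<and> alone (W4 20)"
        then have m4: "R4 = R0" "agr W4" "W4 21 = W3 21" "W4 23 = W3 23" "W4 26 = W3 26"
          "\<And>p. p < M \<Longrightarrow> W0 12 p \<noteq> 0 \<Longrightarrow> W4 20 p < 8 * t p" "alone (W4 20)" by blast+
        show "hp 0 (throw (prm j)) Q W4 R4"
          unfolding m4(1)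
        proof (rule hp_throw[OF m4(2) _ _ z _ m4(6)])
          show "W4 26 p \<noteq> 0 \<longleftrightarrow> beats W0 R0 (cnd p) (W4 23 (tgt p))" if "p < M" for p
            unfolding m4 by (rule sv3[OF that])
          show "W4 23 g = Nul \<or> (\<exists>q\<in>grp g. W4 23 g = cnd q \<and> W0 3 (cnd q) \<noteq> 0)"
            unfolding m4 by (rule f3[OF z(1)])
          show "W4 21 (g * Z + b) = Nul" if "b < t z" for b
            unfolding m4 by (rule s3[OF z(1) that])
          show "W4 20 z < t z \<and> (\<forall>p\<in>grp g. p \<noteq> z \<longrightarrow> beats W0 R0 (cnd p) (W4 23 g) \<longrightarrow> W4 20 p \<noteq> W4 20 z)"
            if "beats W0 R0 (cnd z) (W4 23 g)"
          proof -
            have zS: "z \<in> S" using that z(1) unfolding S_def m4 by simp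
            then show ?thesis using m4(7) unfolding alone_def m4(4) S_def by blast
          qed
          fix W' q assume "agr W'" "q \<in> grp g" "W' 23 g = cnd q" "W0 3 (cnd q) \<noteq> 0" and nb: "\<not> beats W0 R0 (cnd z) (cnd q)"
          moreover have "\<not> beats W0 R0 (cnd p0) (cnd q)"
            using beats_mono[OF z(2) z(3)[OF p0(1)]] nb by blast
          ultimately show "Q W' R0" using Q by blast
        qed
      qed simp
      then show "hp (15/16) (Seq (draw_slot (prm j)) (throw (prm j))) Q W3 R0" by simp
    qed simp_all
  qed simp_all
  then have *: "hp (31/32) (Seq (draw_sample (prm j)) (Seq (survivors (prm j)) (Seq (draw_slot (prm j)) (throw (prm j))))) Q W1 R0"
    if "agr W1" and "\<And>p. p < M \<Longrightarrow> W0 12 p \<noteq> 0 \<Longrightarrow> W1 23 (tgt p) = Nul" for W1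
    using that by simp
  show ?thesis
    unfolding pick_def seqs.simps
    by (rule hp_seq0, rule hp_reset[OF a], rule *) auto
qed

end

section \<open>A complete round: candidates, winners, update\<close>

context desc
begin

lemma hp_mkcand:
  assumes nul: "W0 3 Nul = 0" and hops: "\<And>c. c < Nul \<Longrightarrow> W0 3 c \<noteq> 0 \<Longrightarrow> W0 5 c \<le> W0 0 0"
    and Q: "\<And>W' R'. cands res B j W' \<Longrightarrow> (\<And>a. a \<noteq> 3 \<Longrightarrow> a \<noteq> 5 \<Longrightarrow> W' a = W0 a) \<Longrightarrow>
      (\<And>c. c \<le> Nul \<Longrightarrow> W' 3 c = W0 3 c \<and> W' 5 c = W0 5 c \<and> R' 1 c = R0 1 c) \<Longrightarrow>
      (\<And>p. p < M \<Longrightarrow> W' 3 (cnd p) \<noteq> 0 \<longleftrightarrow>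
         W0 12 p \<noteq> 0 \<and> W0 3 (W0 17 p) \<noteq> 0 \<and> W0 3 (W0 18 p) \<noteq> 0 \<and> W0 5 (W0 17 p) + W0 5 (W0 18 p) < W0 0 0) \<Longrightarrow>
      (\<And>p. p < M \<Longrightarrow> W' 3 (cnd p) \<noteq> 0 \<Longrightarrow> W' 5 (cnd p) = W0 5 (W0 17 p) + W0 5 (W0 18 p) \<and>
         R' 1 (cnd p) = R0 1 (W0 17 p) + R0 1 (W0 18 p)) \<Longrightarrow> Q W' R'"
  shows "hp 0 (mkcand (prm j)) Q W0 R0"
  unfolding mkcand_def seqs.simps
proof (rule hp_seq0, rule hp_rstore_inj)
  have cv: "wv B W p cand = cnd p" if "W 0 = W0 0" "p < M" for W p
    using O1 bounds that by (simp add: cand_def)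
  let ?h = "Op Add (Load 5 (Load 17 Pid)) (Load 5 (Load 18 Pid))"
  let ?v = "wand (Load 12 Pid) (wand (Load 3 (Load 17 Pid)) (wand (Load 3 (Load 18 Pid)) (Op Less ?h (prm 0))))"
  fix i i' assume i: "i < wv B W0 0 (prm j)" "i' < wv B W0 0 (prm j)" and e: "wv B W0 i cand = wv B W0 i' cand"
  have "cnd i = cnd i'" using cv[of W0 i] cv[of W0 i'] i e j16 by simp
  then have "i = i'" by simp
  then show "rv B W0 R0 i (RAdd (RLoad 1 (Load 17 Pid)) (RLoad 1 (Load 18 Pid))) = rv B W0 R0 i' (RAdd (RLoad 1 (Load 17 Pid)) (RLoad 1 (Load 18 Pid)))"
    by (simp only:)
next
  have cv: "wv B W p cand = cnd p" if "W 0 = W0 0" "p < M" for W p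
    using O1 bounds that by (simp add: cand_def)
  let ?h = "Op Add (Load 5 (Load 17 Pid)) (Load 5 (Load 18 Pid))"
  let ?v = "wand (Load 12 Pid) (wand (Load 3 (Load 17 Pid)) (wand (Load 3 (Load 18 Pid)) (Op Less ?h (prm 0))))"
  fix R1 assume R1: "\<And>b. b \<noteq> 1 \<Longrightarrow> R1 b = R0 b"
    "\<And>i. i < wv B W0 0 (prm j) \<Longrightarrow> wv B W0 i (Const 1) \<noteq> 0 \<Longrightarrow>
       R1 1 (wv B W0 i cand) = rv B W0 R0 i (RAdd (RLoad 1 (Load 17 Pid)) (RLoad 1 (Load 18 Pid)))"
    "\<And>x. (\<And>i. i < wv B W0 0 (prm j) \<Longrightarrow> wv B W0 i (Const 1) \<noteq> 0 \<Longrightarrow> wv B W0 i cand \<noteq> x) \<Longrightarrow> R1 1 x = R0 1 x"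
  have r1: "R1 1 (cnd p) = R0 1 (W0 17 p) + R0 1 (W0 18 p)" if "p < M" for p
    using R1(2)[of p] cv[of W0 p] that j16 by simp
  have r0: "R1 1 c = R0 1 c" if "c \<le> Nul" for c
  proof (rule R1(3))
    fix i assume "i < wv B W0 0 (prm j)"
    then show "wv B W0 i cand \<noteq> c" using cv[of W0 i] j16 that by simp
  qed
  show "hp 0 (Seq (Par (prm j) (Const 1) (Store 5 cand ?h)) (Par (prm j) (Const 1) (Store 3 cand ?v))) Q W0 R1"
  proof (rule hp_seq0, rule hp_store_inj)
    fix i i' assume i: "i < wv B W0 0 (prm j)" "i' < wv B W0 0 (prm j)" and e: "wv B W0 i cand = wv B W0 i' cand"
    have "cnd i = cnd i'" using cv[of W0 i] cv[of W0 i'] i e j16 by simp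
    then have "i = i'" by simp
    then show "wv B W0 i ?h = wv B W0 i' ?h" by (simp only:)
  next
    fix W1 assume W1: "\<And>b. b \<noteq> 5 \<Longrightarrow> W1 b = W0 b"
      "\<And>i. i < wv B W0 0 (prm j) \<Longrightarrow> wv B W0 i (Const 1) \<noteq> 0 \<Longrightarrow> W1 5 (wv B W0 i cand) = wv B W0 i ?h"
      "\<And>x. (\<And>i. i < wv B W0 0 (prm j) \<Longrightarrow> wv B W0 i (Const 1) \<noteq> 0 \<Longrightarrow> wv B W0 i cand \<noteq> x) \<Longrightarrow> W1 5 x = W0 5 x"
    have e1: "W1 0 = W0 0" "W1 3 = W0 3" "W1 12 = W0 12" "W1 17 = W0 17" "W1 18 = W0 18" using W1(1) by simp_all
    have h1: "W1 5 (cnd p) = (W0 5 (W0 17 p) + W0 5 (W0 18 p)) mod B" if "p < M" for p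
      using W1(2)[of p] cv[of W0 p] that j16 by simp
    have h0: "W1 5 c = W0 5 c" if "c \<le> Nul" for c
    proof (rule W1(3))
      fix i assume "i < wv B W0 0 (prm j)"
      then show "wv B W0 i cand \<noteq> c" using cv[of W0 i] j16 that by simp
    qed
    show "hp 0 (Par (prm j) (Const 1) (Store 3 cand ?v)) Q W1 R1"
    proof (rule hp_store_inj)
      fix i i' assume i: "i < wv B W1 0 (prm j)" "i' < wv B W1 0 (prm j)" and e: "wv B W1 i cand = wv B W1 i' cand"
      have "cnd i = cnd i'" using cv[of W1 i] cv[of W1 i'] i e e1 j16 by simp
      then have "i = i'" by simp
      then show "wv B W1 i ?v = wv B W1 i' ?v" by (simp only:)
    next
      fix W2 assume W2: "\<And>b. b \<noteq> 3 \<Longrightarrow> W2 b = W1 b"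
        "\<And>i. i < wv B W1 0 (prm j) \<Longrightarrow> wv B W1 i (Const 1) \<noteq> 0 \<Longrightarrow> W2 3 (wv B W1 i cand) = wv B W1 i ?v"
        "\<And>x. (\<And>i. i < wv B W1 0 (prm j) \<Longrightarrow> wv B W1 i (Const 1) \<noteq> 0 \<Longrightarrow> wv B W1 i cand \<noteq> x) \<Longrightarrow> W2 3 x = W1 3 x"
      have f1: "W2 3 (cnd p) \<noteq> 0 \<longleftrightarrow> W0 12 p \<noteq> 0 \<and> W0 3 (W0 17 p) \<noteq> 0 \<and> W0 3 (W0 18 p) \<noteq> 0 \<and>
          W0 5 (W0 17 p) + W0 5 (W0 18 p) < W0 0 0" if p: "p < M" for p
      proof -
        have s: "W2 3 (cnd p) = wv B W1 p ?v" using W2(2)[of p] cv[of W1 p] p j16 e1 by simp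
        show ?thesis
        proof (cases "W0 12 p \<noteq> 0 \<and> W0 3 (W0 17 p) \<noteq> 0 \<and> W0 3 (W0 18 p) \<noteq> 0")
          case True
          have l: "W0 17 p < Nul" "W0 18 p < Nul" using adr[OF p] True by auto
          then have "W0 5 (W0 17 p) \<le> W0 0 0" "W0 5 (W0 18 p) \<le> W0 0 0" using hops True by auto
          then have "W0 5 (W0 17 p) + W0 5 (W0 18 p) < B" using bounds(4) by linarith
          moreover have "W1 5 (W0 17 p) = W0 5 (W0 17 p)" "W1 5 (W0 18 p) = W0 5 (W0 18 p)" using h0 l by auto
          ultimately show ?thesis using True unfolding s by (simp add: e1)
        next
          case False
          then show ?thesis unfolding s by (auto simp: e1)
        qed
      qed
      have f0: "W2 3 c = W0 3 c" if "c \<le> Nul" for c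
      proof -
        have "W2 3 c = W1 3 c"
        proof (rule W2(3))
          fix i assume "i < wv B W1 0 (prm j)"
          then show "wv B W1 i cand \<noteq> c" using cv[of W1 i] j16 e1 that by simp
        qed
        then show ?thesis by (simp add: e1)
      qed
      have oth: "W2 a = W0 a" if "a \<noteq> 3" "a \<noteq> 5" for a using W2(1) W1(1) that by simp
      have o: "W2 0 = W0 0" "W2 12 = W0 12" "W2 13 = W0 13" "W2 14 = W0 14" "W2 15 = W0 15" "W2 16 = W0 16" "W2 17 = W0 17"
        "W2 18 = W0 18" "W2 19 = W0 19" "W2 29 = W0 29" "W2 31 = W0 31" "W2 32 = W0 32" "W2 33 = W0 33" "W2 34 = W0 34" "W2 35 = W0 35"
        by (simp_all add: oth)
      have "desc res B j W2"
        by (unfold_locales, unfold o) (fact res B16 j16 O1 bounds adr rk tt slot_adr table small pairs same onto)+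
      then have c: "cands res B j W2"
        unfolding cands_def cands_axioms_def o using f0[of Nul] nul f1 by simp
      have v: "W2 5 (cnd p) = W0 5 (W0 17 p) + W0 5 (W0 18 p) \<and> R1 1 (cnd p) = R0 1 (W0 17 p) + R0 1 (W0 18 p)"
        if p: "p < M" and f: "W2 3 (cnd p) \<noteq> 0" for p
      proof -
        have "W0 5 (W0 17 p) + W0 5 (W0 18 p) < B" using f1[OF p] f bounds(4) by linarith
        then show ?thesis using h1[OF p] r1[OF p] W2(1)[of 5] by simp
      qed
      show "Q W2 R1"
      proof (rule Q)
        show "cands res B j W2" by (rule c)
        show "W2 a = W0 a" if "a \<noteq> 3" "a \<noteq> 5" for a by (rule oth[OF that])
        show "W2 3 c = W0 3 c \<and> W2 5 c = W0 5 c \<and> R1 1 c = R0 1 c" if "c \<le> Nul" for c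
          using f0[OF that] h0[OF that] r0[OF that] W2(1)[of 5] by simp
      qed (rule f1 v; assumption)+
    qed
  qed simp
qed simp

end

context desc
begin

lemma pick_frame: "\<forall>i\<in>instrs (pick (prm j)). a \<notin> ww i" if "a \<notin> {20, 21, 22, 23, 24, 25, 26, 28}"
  using that by (auto simp: pick_def reset_win_def draw_sample_def survivors_def draw_slot_def throw_def duel_def cmp2_def)

lemma pick_rframe: "\<forall>i\<in>instrs (pick (prm j)). a \<notin> rw i"
  by (auto simp: pick_def reset_win_def draw_sample_def survivors_def draw_slot_def throw_def duel_def cmp2_def)

text \<open>What a round does for every outcome of its draws: a cell is kept, or replaced by the sum
  of two cells in use that is strictly better. That the best sum is found is a separate,
  probabilistic statement.\<close>

definition rounds_to :: "wmemory \<Rightarrow> rmemory \<Rightarrow> bool" where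
  "rounds_to W' R' \<longleftrightarrow> (\<forall>a. a \<notin> {3, 5, 20, 21, 22, 23, 24, 25, 26, 28} \<longrightarrow> W' a = W0 a) \<and>
     (\<forall>c\<le>Nul. (W' 3 c = W0 3 c \<and> W' 5 c = W0 5 c \<and> R' 1 c = R0 1 c) \<or>
       (\<exists>p\<in>grp c. W0 3 (W0 17 p) \<noteq> 0 \<and> W0 3 (W0 18 p) \<noteq> 0 \<and> W0 5 (W0 17 p) + W0 5 (W0 18 p) < W0 0 0 \<and>
          W' 3 c = 1 \<and> W' 5 c = W0 5 (W0 17 p) + W0 5 (W0 18 p) \<and> R' 1 c = R0 1 (W0 17 p) + R0 1 (W0 18 p) \<and>
          (W0 3 c = 0 \<or> lexlt (lab W' R' c) (lab W0 R0 c))))"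

lemma hp_round_all:
  assumes nul: "W0 3 Nul = 0" and hops: "\<And>c. c < Nul \<Longrightarrow> W0 3 c \<noteq> 0 \<Longrightarrow> W0 5 c \<le> W0 0 0"
  shows "hp 0 (round (prm j)) rounds_to W0 R0"
  unfolding round_def seqs.simps
proof (rule hp_seq0, rule hp_mkcand[OF nul hops])
  fix W1 :: wmemory and R1 :: rmemory
  assume c: "cands res B j W1" and o: "\<And>a. a \<noteq> 3 \<Longrightarrow> a \<noteq> 5 \<Longrightarrow> W1 a = W0 a"
    and k: "\<And>c. c \<le> Nul \<Longrightarrow> W1 3 c = W0 3 c \<and> W1 5 c = W0 5 c \<and> R1 1 c = R0 1 c"
    and f: "\<And>p. p < M \<Longrightarrow> W1 3 (cnd p) \<noteq> 0 \<longleftrightarrow>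
         W0 12 p \<noteq> 0 \<and> W0 3 (W0 17 p) \<noteq> 0 \<and> W0 3 (W0 18 p) \<noteq> 0 \<and> W0 5 (W0 17 p) + W0 5 (W0 18 p) < W0 0 0"
    and v: "\<And>p. p < M \<Longrightarrow> W1 3 (cnd p) \<noteq> 0 \<Longrightarrow> W1 5 (cnd p) = W0 5 (W0 17 p) + W0 5 (W0 18 p) \<and>
         R1 1 (cnd p) = R0 1 (W0 17 p) + R0 1 (W0 18 p)"
  interpret c: cands res w B j W1 R1 by (rule c)
  have e: "W1 0 = W0 0" "W1 12 = W0 12" "W1 13 = W0 13" using o by simp_all
  have g: "c.grp = grp" by (simp add: fun_eq_iff c.grp_def grp_def e)
  show "hp 0 (Seq (pick (prm j)) (update (prm j))) rounds_to W1 R1"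
  proof (rule hp_seq0)
    \<comment> \<open>Of the selection only its frame is used here, because \<open>hp_update\<close>
      does not depend on the quality of the winners.\<close>
    have fr: "hp 0 (pick (prm j)) (\<lambda>W' R'. (\<forall>a. (\<forall>i\<in>instrs (pick (prm j)). a \<notin> ww i) \<longrightarrow> W' a = W1 a) \<and>
        (\<forall>a. (\<forall>i\<in>instrs (pick (prm j)). a \<notin> rw i) \<longrightarrow> R' a = R1 a)) W1 R1"
      by (rule hp_conj0[OF hp_frame hp_rframe])
    show "hp 0 (pick (prm j)) (hp 0 (update (prm j)) rounds_to) W1 R1"
    proof (rule hp_mono[OF fr order_refl])
      fix W2 :: wmemory and R2 :: rmemory
      assume a: "(\<forall>a. (\<forall>i\<in>instrs (pick (prm j)). a \<notin> ww i) \<longrightarrow> W2 a = W1 a) \<and>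
        (\<forall>a. (\<forall>i\<in>instrs (pick (prm j)). a \<notin> rw i) \<longrightarrow> R2 a = R1 a)"
      have R2: "R2 = R1" using a pick_rframe by (auto simp: fun_eq_iff)
      have a2: "c.agr W2" unfolding c.agr_def using a pick_frame by blast
      show "hp 0 (update (prm j)) rounds_to W2 R2"
        unfolding R2
      proof (rule c.hp_update[OF a2])
        fix W3 :: wmemory and R3 :: rmemory
        assume o3: "\<And>a. a \<notin> {3, 5, 20, 21, 22, 23, 24, 25, 26, 28} \<Longrightarrow> W3 a = W1 a"
          and u: "\<And>c. (\<exists>p\<in>c.grp c. W2 23 c = W1 0 11 + 1 + p \<and> beats W1 R1 (W1 0 11 + 1 + p) c \<and> W3 3 c = 1 \<and>
              W3 5 c = W1 5 (W1 0 11 + 1 + p) \<and> R3 1 c = R1 1 (W1 0 11 + 1 + p)) \<or>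
            ((\<forall>p\<in>c.grp c. W2 23 c = W1 0 11 + 1 + p \<longrightarrow> \<not> beats W1 R1 (W1 0 11 + 1 + p) c) \<and> W3 3 c = W1 3 c \<and> W3 5 c = W1 5 c \<and> R3 1 c = R1 1 c)"
        show "rounds_to W3 R3"
          unfolding rounds_to_def
        proof (intro conjI allI impI)
          fix a :: nat assume "a \<notin> {3, 5, 20, 21, 22, 23, 24, 25, 26, 28}"
          then show "W3 a = W0 a" using o3[of a] o[of a] by simp
        next
          fix c assume cN: "c \<le> Nul"
          from u[of c] show "(W3 3 c = W0 3 c \<and> W3 5 c = W0 5 c \<and> R3 1 c = R0 1 c) \<or>
            (\<exists>p\<in>grp c. W0 3 (W0 17 p) \<noteq> 0 \<and> W0 3 (W0 18 p) \<noteq> 0 \<and> W0 5 (W0 17 p) + W0 5 (W0 18 p) < W0 0 0 \<and>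
             W3 3 c = 1 \<and> W3 5 c = W0 5 (W0 17 p) + W0 5 (W0 18 p) \<and> R3 1 c = R0 1 (W0 17 p) + R0 1 (W0 18 p) \<and>
             (W0 3 c = 0 \<or> lexlt (lab W3 R3 c) (lab W0 R0 c)))"
          proof
            assume "\<exists>p\<in>c.grp c. W2 23 c = W1 0 11 + 1 + p \<and> beats W1 R1 (W1 0 11 + 1 + p) c \<and> W3 3 c = 1 \<and>
              W3 5 c = W1 5 (W1 0 11 + 1 + p) \<and> R3 1 c = R1 1 (W1 0 11 + 1 + p)"
            then obtain p where p: "p \<in> grp c" "beats W1 R1 (cnd p) c" "W3 3 c = 1" "W3 5 c = W1 5 (cnd p)" "R3 1 c = R1 1 (cnd p)"
              unfolding g e by blast
            have pM: "p < M" using grpD[OF p(1)] by simp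
            have fl: "W1 3 (cnd p) \<noteq> 0" using p(2) by (simp add: beats_def)
            have l: "W0 3 c = 0 \<or> lexlt (lab W3 R3 c) (lab W0 R0 c)"
              using p(2,4,5) k[OF cN] by (simp add: beats_def lab_def)
            have fp: "W0 3 (W0 17 p) \<noteq> 0" "W0 3 (W0 18 p) \<noteq> 0" "W0 5 (W0 17 p) + W0 5 (W0 18 p) < W0 0 0"
              using f[OF pM] fl by blast+
            have vp: "W3 5 c = W0 5 (W0 17 p) + W0 5 (W0 18 p)" "R3 1 c = R0 1 (W0 17 p) + R0 1 (W0 18 p)"
              using v[OF pM fl] p(4,5) by simp_all
            show ?thesis using p(1) fp p(3) vp l by blast
          next
            assume "(\<forall>p\<in>c.grp c. W2 23 c = W1 0 11 + 1 + p \<longrightarrow> \<not> beats W1 R1 (W1 0 11 + 1 + p) c) \<and> W3 3 c = W1 3 c \<and> W3 5 c = W1 5 c \<and> R3 1 c = R1 1 c"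
            then show ?thesis using k[OF cN] by simp
          qed
        qed
      qed
    qed
  qed simp
qed (simp_all)

text \<open>If the selection succeeds, \<open>p0\<close> does not beat the winner. The target then
  takes the winner, or keeps an old label that the winner does not beat; either way the sum at
  \<open>p0\<close> is not smaller than the new label.\<close>

lemma hp_round_prob:
  assumes nul: "W0 3 Nul = 0" and hops: "\<And>c. c < Nul \<Longrightarrow> W0 3 c \<noteq> 0 \<Longrightarrow> W0 5 c \<le> W0 0 0"
    and p0: "p0 \<in> grp g" "W0 3 (W0 17 p0) \<noteq> 0" "W0 3 (W0 18 p0) \<noteq> 0" "W0 5 (W0 17 p0) + W0 5 (W0 18 p0) < W0 0 0"
  shows "hp (31 / 32) (round (prm j)) (\<lambda>W' R'. W' 3 g \<noteq> 0 \<and>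
     \<not> lexlt (form_val w (R0 1 (W0 17 p0) + R0 1 (W0 18 p0)), W0 5 (W0 17 p0) + W0 5 (W0 18 p0)) (lab W' R' g)) W0 R0"
  (is "hp _ _ ?Q _ _")
  unfolding round_def seqs.simps
proof (rule hp_seq0, rule hp_mkcand[OF nul hops])
  fix W1 :: wmemory and R1 :: rmemory
  assume c: "cands res B j W1" and o: "\<And>a. a \<noteq> 3 \<Longrightarrow> a \<noteq> 5 \<Longrightarrow> W1 a = W0 a"
    and k: "\<And>c. c \<le> Nul \<Longrightarrow> W1 3 c = W0 3 c \<and> W1 5 c = W0 5 c \<and> R1 1 c = R0 1 c"
    and f: "\<And>p. p < M \<Longrightarrow> W1 3 (cnd p) \<noteq> 0 \<longleftrightarrow>
         W0 12 p \<noteq> 0 \<and> W0 3 (W0 17 p) \<noteq> 0 \<and> W0 3 (W0 18 p) \<noteq> 0 \<and> W0 5 (W0 17 p) + W0 5 (W0 18 p) < W0 0 0"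
    and v: "\<And>p. p < M \<Longrightarrow> W1 3 (cnd p) \<noteq> 0 \<Longrightarrow> W1 5 (cnd p) = W0 5 (W0 17 p) + W0 5 (W0 18 p) \<and>
         R1 1 (cnd p) = R0 1 (W0 17 p) + R0 1 (W0 18 p)"
  interpret c: cands res w B j W1 R1 by (rule c)
  have e: "W1 0 = W0 0" "W1 12 = W0 12" "W1 13 = W0 13" using o by simp_all
  have g: "c.grp = grp" by (simp add: fun_eq_iff c.grp_def grp_def e)
  have pM: "p0 < M" "W0 12 p0 \<noteq> 0" using grpD[OF p0(1)] by simp_all
  have fl: "W1 3 (cnd p0) \<noteq> 0" using f[OF pM(1)] pM(2) p0 by blast
  have l0: "lab W1 R1 (cnd p0) = (form_val w (R0 1 (W0 17 p0) + R0 1 (W0 18 p0)), W0 5 (W0 17 p0) + W0 5 (W0 18 p0))"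
    using v[OF pM(1) fl] by (simp add: lab_def)
  have a1: "c.agr W1" by (simp add: c.agr_def)
  have "hp (31 / 32) (pick (prm j)) (hp 0 (update (prm j)) ?Q) W1 R1"
  proof (rule c.hp_pick[OF a1])
    show "p0 \<in> c.grp g" using p0(1) by (simp add: \<open>c.grp = grp\<close>)
    show "W1 3 (W1 0 11 + 1 + p0) \<noteq> 0" using fl by (simp add: e)
    fix W2 q assume a2: "c.agr W2" and q: "q \<in> c.grp g" "W2 23 g = W1 0 11 + 1 + q" "W1 3 (W1 0 11 + 1 + q) \<noteq> 0"
      "\<not> beats W1 R1 (W1 0 11 + 1 + p0) (W1 0 11 + 1 + q)"
    have nq: "\<not> lexlt (lab W1 R1 (cnd p0)) (lab W1 R1 (cnd q))" using q(4) fl q(3) by (simp add: beats_def e)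
    show "hp 0 (update (prm j)) ?Q W2 R1"
    proof (rule c.hp_update[OF a2])
      fix W3 :: wmemory and R3 :: rmemory
      assume u: "\<And>c. (\<exists>p\<in>c.grp c. W2 23 c = W1 0 11 + 1 + p \<and> beats W1 R1 (W1 0 11 + 1 + p) c \<and> W3 3 c = 1 \<and>
              W3 5 c = W1 5 (W1 0 11 + 1 + p) \<and> R3 1 c = R1 1 (W1 0 11 + 1 + p)) \<or>
            ((\<forall>p\<in>c.grp c. W2 23 c = W1 0 11 + 1 + p \<longrightarrow> \<not> beats W1 R1 (W1 0 11 + 1 + p) c) \<and> W3 3 c = W1 3 c \<and> W3 5 c = W1 5 c \<and> R3 1 c = R1 1 c)"
      from u[of g] show "?Q W3 R3"
      proof
        assume "\<exists>p\<in>c.grp g. W2 23 g = W1 0 11 + 1 + p \<and> beats W1 R1 (W1 0 11 + 1 + p) g \<and> W3 3 g = 1 \<and>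
              W3 5 g = W1 5 (W1 0 11 + 1 + p) \<and> R3 1 g = R1 1 (W1 0 11 + 1 + p)"
        then obtain p where p: "W2 23 g = W1 0 11 + 1 + p" "W3 3 g = 1" "W3 5 g = W1 5 (W1 0 11 + 1 + p)" "R3 1 g = R1 1 (W1 0 11 + 1 + p)"
          by blast
        have "p = q" using p(1) q(2) by simp
        then have "lab W3 R3 g = lab W1 R1 (cnd q)" using p(3,4) by (simp add: lab_def e)
        then show ?thesis unfolding l0[symmetric] using nq p(2) by simp
      next
        assume n: "(\<forall>p\<in>c.grp g. W2 23 g = W1 0 11 + 1 + p \<longrightarrow> \<not> beats W1 R1 (W1 0 11 + 1 + p) g) \<and> W3 3 g = W1 3 g \<and> W3 5 g = W1 5 g \<and> R3 1 g = R1 1 g"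
        then have "\<not> beats W1 R1 (W1 0 11 + 1 + q) g" using q(1,2) by blast
        then have b: "W1 3 g \<noteq> 0" "\<not> lexlt (lab W1 R1 (cnd q)) (lab W1 R1 g)" using q(3) by (auto simp: beats_def e)
        have "lab W3 R3 g = lab W1 R1 g" using n by (simp add: lab_def)
        then show ?thesis unfolding l0[symmetric] using not_lexlt_trans[OF nq b(2)] b(1) n by simp
      qed
    qed
  qed
  then show "hp (31 / 32) (Seq (pick (prm j)) (update (prm j))) ?Q W1 R1"
    by (rule hp_seq_last)
qed simp_all

end

section \<open>Precomputing sample sizes and slot addresses\<close>

definition prep :: "wexp \<Rightarrow> prog" where
  "prep k = seqs
    [Par k (Const 1) (Store 16 Pid (Const 1)),
     While (prm 8) (Const 1)
       (Par k (wnot (Op Less (Load 15 Pid) (Op Mul (Const 4) (Op Mul (Load 16 Pid) (Load 16 Pid)))))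
         (Store 16 Pid (Op Add (Load 16 Pid) (Load 16 Pid)))),
     Par k (Const 1) (Store 29 Pid (Op Mul (Load 13 Pid) (prm 13))),
     Par k (Const 1) (Store 31 Pid (Op Add (Load 29 Pid) (Load 14 Pid))),
     Par k (Const 1) (Store 32 Pid (Op Add (Load 29 Pid) (Op Div (Load 14 Pid) (Load 16 Pid)))),
     Par k (Const 1) (Store 33 Pid (Op Add (Load 29 Pid) (wmd (Load 14 Pid) (Load 16 Pid)))),
     Par k (Const 1) (Store 34 Pid (wand (Load 12 Pid) (Op Less (Load 14 Pid) (Load 16 Pid)))),
     Par k (Const 1) (Store 35 Pid (wand (Load 12 Pid) (Op Less (Load 14 Pid) (Op Mul (Load 16 Pid) (Load 16 Pid))))),
     Par k (Load 12 Pid) (Store 19 (Load 31 Pid) cand)]"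

context machine
begin

lemma hp_set:
  assumes "\<And>W'. (\<And>b. b \<noteq> a \<Longrightarrow> W' b = W b) \<Longrightarrow> (\<And>x. x < wv B W 0 k \<Longrightarrow> W' a x = wv B W x e) \<Longrightarrow> Q W' R"
  shows "hp 0 (Par k (Const 1) (Store a Pid e)) Q W R"
  by (rule hp_own, rule assms) auto

text \<open>The square root of the group size is approximated by doubling \<open>t\<close> while
  \<open>4 t ^ 2 \<le> d\<close>. All processors iterate equally often, by \<open>it\<close> often
  enough for the largest group; those that are done idle.\<close>

lemma hp_prep:
  assumes j16: "j < 16"
    and O1: "W 0 12 = W 0 11 + 1"
    and bounds: "W 0 11 + 1 + W 0 j < B" "W 0 11 * W 0 13 + W 0 13 < B" "8 * W 0 13 < B" "2 * W 0 0 < B"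
    and adr: "\<And>p. p < W 0 j \<Longrightarrow> W 13 p < W 0 11 \<and> W 17 p < W 0 11 \<and> W 18 p < W 0 11"
    and rk: "\<And>p. p < W 0 j \<Longrightarrow> W 14 p < W 15 p \<and> W 15 p \<le> W 0 13"
    and it: "\<And>p. p < W 0 j \<Longrightarrow> W 15 p < 4 * 4 ^ W 0 8"
    and same: "\<And>p q. p < W 0 j \<Longrightarrow> q < W 0 j \<Longrightarrow> W 12 p \<noteq> 0 \<Longrightarrow> W 12 q \<noteq> 0 \<Longrightarrow> W 13 p = W 13 q \<Longrightarrow>
       W 15 p = W 15 q \<and> (W 14 p = W 14 q \<longrightarrow> p = q)"
    and onto: "\<And>p r. p < W 0 j \<Longrightarrow> W 12 p \<noteq> 0 \<Longrightarrow> r < W 15 p \<Longrightarrow>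
       \<exists>q<W 0 j. W 12 q \<noteq> 0 \<and> W 13 q = W 13 p \<and> W 14 q = r"
    and Q: "\<And>W'. desc res B j W' \<Longrightarrow> (\<And>a. a \<notin> {16, 19, 29, 31, 32, 33, 34, 35} \<Longrightarrow> W' a = W a) \<Longrightarrow> Q W' R"
  shows "hp 0 (prep (prm j)) Q W R"
proof -
  define M where "M = W 0 j"
  define tf where "tf d = (SOME t. 0 < t \<and> t * t \<le> d \<and> d < 4 * (t * t) \<and> (\<exists>i. t = 2 ^ i))" for d :: nat
  define loop where "loop = Par (prm j) (wnot (Op Less (Load 15 Pid) (Op Mul (Const 4) (Op Mul (Load 16 Pid) (Load 16 Pid)))))
         (Store 16 Pid (Op Add (Load 16 Pid) (Load 16 Pid)))"
  \<comment> \<open>An exponent \<open>i < k\<close> means that the doubling for \<open>p\<close>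
    has stopped; otherwise it has taken place in each of the \<open>k\<close> rounds.\<close>
  define I where "I k W' R' \<longleftrightarrow> R' = R \<and> (\<forall>a. a \<noteq> 16 \<longrightarrow> W' a = W a) \<and>
     (\<forall>p<M. \<exists>i\<le>k. W' 16 p = 2 ^ i \<and> 4 ^ i \<le> W 15 p \<and> (i < k \<longrightarrow> W 15 p < 4 * 4 ^ i))" for k :: nat and W' :: wmemory and R' :: rmemory
  have sq: "(2 ^ i) * (2 ^ i) = (4::nat) ^ i" for i by (simp add: power_mult_distrib[symmetric])
  have body: "hp 0 loop (I (Suc k)) W1 R1" if "I k W1 R1" for k W1 R1
    unfolding loop_def
  proof (rule hp_own)
    have o: "\<And>a. a \<noteq> 16 \<Longrightarrow> W1 a = W a" and R: "R1 = R" using that by (auto simp: I_def)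
    let ?g = "wnot (Op Less (Load 15 Pid) (Op Mul (Const 4) (Op Mul (Load 16 Pid) (Load 16 Pid))))"
    let ?e = "Op Add (Load 16 Pid) (Load 16 Pid)"
    define f where "f = (\<lambda>x. if x < wv B W1 0 (prm j) \<and> wv B W1 x ?g \<noteq> 0 then wv B W1 x ?e else W1 16 x)"
    let ?W = "W1(16 := f)"
    have fp: "f p = (if p < wv B W1 0 (prm j) \<and> wv B W1 p ?g \<noteq> 0 then wv B W1 p ?e else W1 16 p)" for p
      by (simp only: f_def)
    have "\<exists>i\<le>Suc k. f p = 2 ^ i \<and> 4 ^ i \<le> W 15 p \<and> (i < Suc k \<longrightarrow> W 15 p < 4 * 4 ^ i)" if p: "p < M" for p
    proof -
      obtain i where i: "i \<le> k" "W1 16 p = 2 ^ i" "4 ^ i \<le> W 15 p" "i < k \<longrightarrow> W 15 p < 4 * 4 ^ i"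
        using \<open>I k W1 R1\<close> p unfolding I_def by blast
      have pj: "p < W1 0 j" using p o[of 0] by (simp add: M_def)
      have "W 15 p \<le> W 0 13" using rk p by (simp add: M_def)
      then have b: "8 * W 15 p < B" using bounds(3) by simp
      then have b4: "4 * 4 ^ i < B" "(4::nat) ^ i < B" using i(3) by linarith+
      have w15: "W1 15 = W 15" using o by simp
      have v: "wv B W1 p (Op Mul (Const 4) (Op Mul (Load 16 Pid) (Load 16 Pid))) = 4 * 4 ^ i"
        using i(2) b4 by (simp add: sq)
      have g: "wv B W1 p ?g \<noteq> 0 \<longleftrightarrow> 4 * 4 ^ i \<le> W 15 p"
        unfolding wv_bool wv.simps(4)[of B W1 p Less] v by (auto simp: w15)
      have two: "(2::nat) ^ i \<le> 4 ^ i" by (rule power_mono) simp_all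
      then have e: "wv B W1 p ?e = 2 ^ Suc i" using i(2) b4 by simp
      show ?thesis
      proof (cases "4 * 4 ^ i \<le> W 15 p")
        case True
        then have "i = k" using i by (cases "i = k") auto
        moreover have "f p = 2 ^ Suc i" using g True e pj j16 unfolding fp by simp
        ultimately show ?thesis using True by (intro exI[of _ "Suc k"]) simp
      next
        case False
        then have "f p = 2 ^ i" using g i(2) unfolding fp by simp
        then show ?thesis using False i(1,3) by (intro exI[of _ i]) simp
      qed
    qed
    then have "I (Suc k) ?W R1" unfolding I_def using o R by simp
    then show "I (Suc k) (W1(16 := \<lambda>x. if x < wv B W1 0 (prm j) \<and> wv B W1 x ?g \<noteq> 0 then wv B W1 x ?e else W1 16 x)) R1"
      by (simp only: f_def)
  qed
  have T: "hp 0 (While (prm 8) (Const 1) loop) (I (W 0 8)) W1 R1" if "I 0 W1 R1" for W1 R1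
  proof -
    have "wv B W1 0 (prm 8) = W 0 8" using that by (simp add: I_def)
    then show ?thesis using hp_for_inv[of I W1 R1 loop "prm 8", OF that body] by simp
  qed
  let ?P = "\<lambda>a e. Par (prm j) (Const 1) (Store a Pid e)"
  define rest where "rest = Seq (?P 29 (Op Mul (Load 13 Pid) (prm 13))) (Seq (?P 31 (Op Add (Load 29 Pid) (Load 14 Pid)))
     (Seq (?P 32 (Op Add (Load 29 Pid) (Op Div (Load 14 Pid) (Load 16 Pid))))
     (Seq (?P 33 (Op Add (Load 29 Pid) (wmd (Load 14 Pid) (Load 16 Pid))))
     (Seq (?P 34 (wand (Load 12 Pid) (Op Less (Load 14 Pid) (Load 16 Pid))))
     (Seq (?P 35 (wand (Load 12 Pid) (Op Less (Load 14 Pid) (Op Mul (Load 16 Pid) (Load 16 Pid)))))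
     (Par (prm j) (Load 12 Pid) (Store 19 (Load 31 Pid) cand)))))))"
  have rest: "hp 0 rest Q W1 R1" if I: "I (W 0 8) W1 R1" for W1 R1
  proof -
    have o: "\<And>a. a \<noteq> 16 \<Longrightarrow> W1 a = W a" and R: "R1 = R" using I by (auto simp: I_def)
    have t: "0 < W1 16 p \<and> W1 16 p * W1 16 p \<le> W 15 p \<and> W 15 p < 4 * (W1 16 p * W1 16 p) \<and> (\<exists>i. W1 16 p = 2 ^ i \<and> 4 ^ i \<le> W 15 p \<and> W 15 p < 4 * 4 ^ i)" if p: "p < M" for p
    proof -
      obtain i where i: "i \<le> W 0 8" "W1 16 p = 2 ^ i" "4 ^ i \<le> W 15 p" "i < W 0 8 \<longrightarrow> W 15 p < 4 * 4 ^ i"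
        using I p unfolding I_def by blast
      have "W 15 p < 4 * 4 ^ i"
        using i(1,4) it[of p] p by (cases "i = W 0 8") (auto simp: M_def)
      then show ?thesis using i(2,3) by (auto simp: sq)
    qed
    \<comment> \<open>The interval \<open>4 ^ i \<le> d < 4 ^ (i + 1)\<close> determines
      \<open>i\<close>. Hence \<open>t\<close> is a function of the group size, and all members of a
      group agree on it.\<close>
    have tu: "W1 16 p = W1 16 q" if pq: "p < M" "q < M" "W 15 p = W 15 q" for p q
    proof -
      obtain i where i: "W1 16 p = 2 ^ i" "4 ^ i \<le> W 15 p" "W 15 p < 4 * 4 ^ i" using t[OF pq(1)] by blast
      obtain i' where i': "W1 16 q = 2 ^ i'" "4 ^ i' \<le> W 15 q" "W 15 q < 4 * 4 ^ i'" using t[OF pq(2)] by blast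
      have "(4::nat) ^ i < 4 ^ Suc i'" unfolding power_Suc using i(2) i'(3) pq(3) by linarith
      then have 1: "i < Suc i'" by (rule power_less_imp_less_exp[rotated]) simp
      have "(4::nat) ^ i' < 4 ^ Suc i" unfolding power_Suc using i'(2) i(3) pq(3) by linarith
      then have "i' < Suc i" by (rule power_less_imp_less_exp[rotated]) simp
      then have "i = i'" using 1 by simp
      then show ?thesis using i(1) i'(1) by simp
    qed
    have Mj: "wv B W' 0 (prm j) = M" if "W' 0 = W 0" for W' using that j16 by (simp add: M_def)
    have nb: "W 13 p * W 0 13 + W 0 13 < B" if p: "p < M" for p
    proof -
      have "Suc (W 13 p) * W 0 13 \<le> W 0 11 * W 0 13" using adr[of p] p by (intro mult_le_mono) (auto simp: M_def)
      then show ?thesis using bounds(2) by simp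
    qed
    have r: "W 14 p < W 15 p" "W 15 p \<le> W 0 13" if "p < M" for p using rk that by (auto simp: M_def)
    show ?thesis
      unfolding rest_def R
    proof (rule hp_seq0, rule hp_set)
      fix W2 assume W2: "\<And>b. b \<noteq> 29 \<Longrightarrow> W2 b = W1 b"
        "\<And>x. x < wv B W1 0 (prm j) \<Longrightarrow> W2 29 x = wv B W1 x (Op Mul (Load 13 Pid) (prm 13))"
      have o2: "\<And>a. a \<notin> {16, 29} \<Longrightarrow> W2 a = W a" using W2(1) o by simp
      have v2: "W2 29 p = W 13 p * W 0 13" if "p < M" for p
        using W2(2)[of p] Mj[of W1] o nb[OF that] that by simp
      show "hp 0 (Seq (?P 31 (Op Add (Load 29 Pid) (Load 14 Pid)))
     (Seq (?P 32 (Op Add (Load 29 Pid) (Op Div (Load 14 Pid) (Load 16 Pid))))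
     (Seq (?P 33 (Op Add (Load 29 Pid) (wmd (Load 14 Pid) (Load 16 Pid))))
     (Seq (?P 34 (wand (Load 12 Pid) (Op Less (Load 14 Pid) (Load 16 Pid))))
     (Seq (?P 35 (wand (Load 12 Pid) (Op Less (Load 14 Pid) (Op Mul (Load 16 Pid) (Load 16 Pid)))))
     (Par (prm j) (Load 12 Pid) (Store 19 (Load 31 Pid) cand))))))) Q W2 R"
      proof (rule hp_seq0, rule hp_set)
        fix W3 assume W3: "\<And>b. b \<noteq> 31 \<Longrightarrow> W3 b = W2 b"
          "\<And>x. x < wv B W2 0 (prm j) \<Longrightarrow> W3 31 x = wv B W2 x (Op Add (Load 29 Pid) (Load 14 Pid))"
        have o3: "\<And>a. a \<notin> {16, 29, 31} \<Longrightarrow> W3 a = W a" using W3(1) o2 by simp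
        have v3: "W3 31 p = W 13 p * W 0 13 + W 14 p" if "p < M" for p
          using W3(2)[of p] Mj[of W2] o2 nb[OF that] that v2[OF that] r[OF that] by simp
        have c3: "W3 29 = W2 29" "W3 16 = W1 16" using W3(1) W2(1) by simp_all
        show "hp 0 (Seq (?P 32 (Op Add (Load 29 Pid) (Op Div (Load 14 Pid) (Load 16 Pid))))
     (Seq (?P 33 (Op Add (Load 29 Pid) (wmd (Load 14 Pid) (Load 16 Pid))))
     (Seq (?P 34 (wand (Load 12 Pid) (Op Less (Load 14 Pid) (Load 16 Pid))))
     (Seq (?P 35 (wand (Load 12 Pid) (Op Less (Load 14 Pid) (Op Mul (Load 16 Pid) (Load 16 Pid)))))
     (Par (prm j) (Load 12 Pid) (Store 19 (Load 31 Pid) cand)))))) Q W3 R"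
        proof (rule hp_seq0, rule hp_set)
          fix W4 assume W4: "\<And>b. b \<noteq> 32 \<Longrightarrow> W4 b = W3 b"
            "\<And>x. x < wv B W3 0 (prm j) \<Longrightarrow> W4 32 x = wv B W3 x (Op Add (Load 29 Pid) (Op Div (Load 14 Pid) (Load 16 Pid)))"
          have o4: "\<And>a. a \<notin> {16, 29, 31, 32} \<Longrightarrow> W4 a = W a" using W4(1) o3 by simp
          have v4: "W4 32 p = W 13 p * W 0 13 + W 14 p div W1 16 p" if "p < M" for p
          proof -
            have d: "W 14 p div W1 16 p \<le> W 0 13" using r[OF that] div_le_dividend[of "W 14 p" "W1 16 p"] by linarith
            then have "W 13 p * W 0 13 + W 14 p div W1 16 p < B" "W 14 p div W1 16 p < B" using nb[OF that] by linarith+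
            then show ?thesis using W4(2)[of p] Mj[of W3] o3 that v2[OF that] by (simp add: c3)
          qed
          have c4: "W4 29 = W2 29" "W4 16 = W1 16" "W4 31 = W3 31" using W4(1) by (simp_all add: c3)
          show "hp 0 (Seq (?P 33 (Op Add (Load 29 Pid) (wmd (Load 14 Pid) (Load 16 Pid))))
     (Seq (?P 34 (wand (Load 12 Pid) (Op Less (Load 14 Pid) (Load 16 Pid))))
     (Seq (?P 35 (wand (Load 12 Pid) (Op Less (Load 14 Pid) (Op Mul (Load 16 Pid) (Load 16 Pid)))))
     (Par (prm j) (Load 12 Pid) (Store 19 (Load 31 Pid) cand))))) Q W4 R"
          proof (rule hp_seq0, rule hp_set)
            fix W5 assume W5: "\<And>b. b \<noteq> 33 \<Longrightarrow> W5 b = W4 b"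
              "\<And>x. x < wv B W4 0 (prm j) \<Longrightarrow> W5 33 x = wv B W4 x (Op Add (Load 29 Pid) (wmd (Load 14 Pid) (Load 16 Pid)))"
            have o5: "\<And>a. a \<notin> {16, 29, 31, 32, 33} \<Longrightarrow> W5 a = W a" using W5(1) o4 by simp
            have v5: "W5 33 p = W 13 p * W 0 13 + W 14 p mod W1 16 p" if "p < M" for p
            proof -
              have d: "W 14 p mod W1 16 p \<le> W 14 p" by simp
              then have b: "W 13 p * W 0 13 + W 14 p mod W1 16 p < B" "W 14 p < B" using nb[OF that] r[OF that] by linarith+
              have "wv B W4 p (wmd (Load 14 Pid) (Load 16 Pid)) = W 14 p mod W1 16 p"
                by (subst wv_wmd) (use b(2) o4 c4 in simp_all)
              then show ?thesis using W5(2)[of p] Mj[of W4] o4 that v2[OF that] b(1) by (simp add: c4)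
            qed
            have c5: "W5 29 = W2 29" "W5 16 = W1 16" "W5 31 = W3 31" "W5 32 = W4 32" using W5(1) by (simp_all add: c4)
            show "hp 0 (Seq (?P 34 (wand (Load 12 Pid) (Op Less (Load 14 Pid) (Load 16 Pid))))
     (Seq (?P 35 (wand (Load 12 Pid) (Op Less (Load 14 Pid) (Op Mul (Load 16 Pid) (Load 16 Pid)))))
     (Par (prm j) (Load 12 Pid) (Store 19 (Load 31 Pid) cand)))) Q W5 R"
            proof (rule hp_seq0, rule hp_set)
              fix W6 assume W6: "\<And>b. b \<noteq> 34 \<Longrightarrow> W6 b = W5 b"
                "\<And>x. x < wv B W5 0 (prm j) \<Longrightarrow> W6 34 x = wv B W5 x (wand (Load 12 Pid) (Op Less (Load 14 Pid) (Load 16 Pid)))"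
              have o6: "\<And>a. a \<notin> {16, 29, 31, 32, 33, 34} \<Longrightarrow> W6 a = W a" using W6(1) o5 by simp
              have v6: "W6 34 p \<noteq> 0 \<longleftrightarrow> W 12 p \<noteq> 0 \<and> W 14 p < W1 16 p" if "p < M" for p
                using W6(2)[of p] Mj[of W5] o5 that by (simp add: c5)
              have c6: "W6 29 = W2 29" "W6 16 = W1 16" "W6 31 = W3 31" "W6 32 = W4 32" "W6 33 = W5 33" using W6(1) by (simp_all add: c5)
              show "hp 0 (Seq (?P 35 (wand (Load 12 Pid) (Op Less (Load 14 Pid) (Op Mul (Load 16 Pid) (Load 16 Pid)))))
                (Par (prm j) (Load 12 Pid) (Store 19 (Load 31 Pid) cand))) Q W6 R"
              proof (rule hp_seq0, rule hp_set)
                fix W7 assume W7: "\<And>b. b \<noteq> 35 \<Longrightarrow> W7 b = W6 b"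
                  "\<And>x. x < wv B W6 0 (prm j) \<Longrightarrow> W7 35 x = wv B W6 x (wand (Load 12 Pid) (Op Less (Load 14 Pid) (Op Mul (Load 16 Pid) (Load 16 Pid))))"
                have o7: "\<And>a. a \<notin> {16, 29, 31, 32, 33, 34, 35} \<Longrightarrow> W7 a = W a" using W7(1) o6 by simp
                have v7: "W7 35 p \<noteq> 0 \<longleftrightarrow> W 12 p \<noteq> 0 \<and> W 14 p < W1 16 p * W1 16 p" if "p < M" for p
                proof -
                  have "W1 16 p * W1 16 p < B" using t[OF that] r[OF that] nb[OF that] by linarith
                  then show ?thesis using W7(2)[of p] Mj[of W6] o6 that by (simp add: c6)
                qed
                have c7: "W7 29 = W2 29" "W7 16 = W1 16" "W7 31 = W3 31" "W7 32 = W4 32" "W7 33 = W5 33" "W7 34 = W6 34" using W7(1) by (simp_all add: c6)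
                have u31: "p = q" if pq: "p < M" "q < M" "W 12 p \<noteq> 0" "W 12 q \<noteq> 0" "W3 31 p = W3 31 q" for p q
                proof -
                  have "W 13 p * W 0 13 + W 14 p = W 13 q * W 0 13 + W 14 q" using pq v3 by simp
                  moreover have "W 14 p < W 0 13" "W 14 q < W 0 13" using r[OF pq(1)] r[OF pq(2)] by linarith+
                  ultimately have "W 13 p = W 13 q" "W 14 p = W 14 q" using mult_add_unique[of "W 13 p" "W 0 13" "W 14 p" "W 13 q" "W 14 q"] by auto
                  then show ?thesis using same[of p q] pq by (simp add: M_def)
                qed
                have cv: "wv B W7 p cand = W 0 11 + 1 + p" if "p < M" for p
                  using o7 O1 bounds(1) that by (simp add: cand_def M_def)
                show "hp 0 (Par (prm j) (Load 12 Pid) (Store 19 (Load 31 Pid) cand)) Q W7 R"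
                proof (rule hp_store_inj)
                  fix i i' assume i: "i < wv B W7 0 (prm j)" "i' < wv B W7 0 (prm j)" "wv B W7 i (Load 12 Pid) \<noteq> 0"
                    "wv B W7 i' (Load 12 Pid) \<noteq> 0" "wv B W7 i (Load 31 Pid) = wv B W7 i' (Load 31 Pid)"
                  then have "i = i'" using u31[of i i'] Mj[of W7] o7 by (simp add: c7)
                  then show "wv B W7 i cand = wv B W7 i' cand" by simp
                next
                  fix W8 assume W8: "\<And>b. b \<noteq> 19 \<Longrightarrow> W8 b = W7 b"
                    "\<And>i. i < wv B W7 0 (prm j) \<Longrightarrow> wv B W7 i (Load 12 Pid) \<noteq> 0 \<Longrightarrow> W8 19 (wv B W7 i (Load 31 Pid)) = wv B W7 i cand"
                  have o8: "\<And>a. a \<notin> {16, 19, 29, 31, 32, 33, 34, 35} \<Longrightarrow> W8 a = W a" using W8(1) o7 by simp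
                  have c8: "W8 29 = W2 29" "W8 16 = W1 16" "W8 31 = W3 31" "W8 32 = W4 32" "W8 33 = W5 33" "W8 34 = W6 34" "W8 35 = W7 35"
                    using W8(1) by (simp_all add: c7)
                  have e8: "W8 0 = W 0" "W8 12 = W 12" "W8 13 = W 13" "W8 14 = W 14" "W8 15 = W 15" "W8 17 = W 17" "W8 18 = W 18"
                    using o8 by simp_all
                  have tb: "W8 19 (W3 31 p) = W 0 11 + 1 + p" if "p < M" "W 12 p \<noteq> 0" for p
                    using W8(2)[of p] that Mj[of W7] o7 cv[OF that(1)] by (simp add: c7)
                  have "desc res B j W8"
                  proof (unfold_locales, unfold e8 c8)
                    fix p q assume "p < W 0 j" "q < W 0 j" "W 12 p \<noteq> 0" "W 12 q \<noteq> 0" "W 13 p = W 13 q"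
                    then show "W 15 p = W 15 q \<and> W1 16 p = W1 16 q \<and> (W 14 p = W 14 q \<longrightarrow> p = q)"
                      using same[of p q] tu[of p q] by (simp add: M_def)
                  next
                    fix p assume "p < W 0 j" "W 12 p \<noteq> 0"
                    then show "W2 29 p = W 13 p * W 0 13 \<and> W3 31 p = W 13 p * W 0 13 + W 14 p \<and>
                      W4 32 p = W 13 p * W 0 13 + W 14 p div W1 16 p \<and> W5 33 p = W 13 p * W 0 13 + W 14 p mod W1 16 p"
                      using v2 v3 v4 v5 by (simp add: M_def)
                  next
                    fix p assume "p < W 0 j" "W 12 p \<noteq> 0"
                    then show "0 < W1 16 p \<and> W1 16 p * W1 16 p \<le> W 15 p \<and> W 15 p < 4 * (W1 16 p * W1 16 p)"
                      using t by (simp add: M_def)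
                  qed (use j16 O1 bounds adr rk tb v6 v7 onto in \<open>simp_all add: M_def\<close>)
                  then show "Q W8 R" by (rule Q) (rule o8)
                qed
              qed simp
            qed simp
          qed simp
        qed simp
      qed simp
    qed simp
  qed
  show ?thesis
    unfolding prep_def seqs.simps rest_def[symmetric] loop_def[symmetric]
  proof (rule hp_seq0, rule hp_set)
    fix W1 assume W1: "\<And>b. b \<noteq> 16 \<Longrightarrow> W1 b = W b" "\<And>x. x < wv B W 0 (prm j) \<Longrightarrow> W1 16 x = wv B W x (Const 1)"
    have "I 0 W1 R"
      unfolding I_def
    proof (intro conjI allI impI)
      fix p assume "p < M"
      then have "W1 16 p = 2 ^ 0" "4 ^ 0 \<le> W 15 p" using W1(2)[of p] j16 rk[of p] by (auto simp: M_def)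
      then show "\<exists>i\<le>0. W1 16 p = 2 ^ i \<and> 4 ^ i \<le> W 15 p \<and> (i < 0 \<longrightarrow> W 15 p < 4 * 4 ^ i)" by auto
    qed (use W1 in auto)
    then show "hp 0 (Seq (While (prm 8) (Const 1) loop) rest) Q W1 R"
      by (intro hp_seq0 hp_mono[OF T order_refl rest]) simp_all
  qed simp
qed

end

section \<open>Lexicographically shortest walks\<close>

locale sssp =
  fixes n m :: nat and G :: "(nat, nat) pre_digraph" and w :: "nat \<Rightarrow> real" and s :: nat
  assumes inst: "sssp_instance n m G w s"

sublocale sssp \<subseteq> fin_digraph G
  using inst by (simp add: sssp_instance_def)

sublocale sssp \<subseteq> nomulti_digraph G
  using inst by (simp add: sssp_instance_def)

context sssp
begin

lemma verts_G: "verts G = {..<n}" and arcs_G: "arcs G = {..<m}" and s_vert: "s \<in> verts G"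
  using inst by (auto simp: sssp_instance_def)

lemma s_n: "s < n" "0 < n" using s_vert verts_G by auto

lemma tail_n: "e < m \<Longrightarrow> tail G e < n" and head_n: "e < m \<Longrightarrow> head G e < n"
  using tail_in_verts head_in_verts verts_G arcs_G by auto

lemma arc_ends_inj: "e < m \<Longrightarrow> e' < m \<Longrightarrow> tail G e = tail G e' \<Longrightarrow> head G e = head G e' \<Longrightarrow> e = e'"
  using no_multi_arcs[of e e'] arcs_G by (auto simp: arc_to_ends_def)

lemma m_le: "m \<le> n * n"
proof -
  have "inj_on (arc_to_ends G) {..<m}"
    by (rule inj_onI) (auto simp: arc_to_ends_def intro: arc_ends_inj)
  moreover have "arc_to_ends G ` {..<m} \<subseteq> {..<n} \<times> {..<n}"
    using tail_n head_n by (auto simp: arc_to_ends_def)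
  ultimately have "card {..<m} \<le> card ({..<n} \<times> {..<n})" by (intro card_inj_on_le) auto
  then show ?thesis by simp
qed

text \<open>If the vertices after the first arc are distinct, the closed walk is a cycle. Otherwise
  it contains a shorter closed walk whose removal leaves another shorter one, and the induction
  hypothesis applies to both.\<close>

lemma closed_walk_nonneg: "awalk x c x \<Longrightarrow> awalk_cost w c \<ge> 0"
proof (induction "length c" arbitrary: x c rule: less_induct)
  case less
  show ?case
  proof (cases c)
    case (Cons e es)
    have aw: "awalk (head G e) es x" "e \<in> arcs G" "tail G e = x" using less.prems Cons by (auto simp: awalk_Cons_iff)
    show ?thesis
    proof (cases "distinct (awalk_verts (head G e) es)")
      case True
      have "awalk_verts x c = x # awalk_verts (head G e) es" using Cons aw by simp
      then have "cycle c" unfolding cycle_altdef closed_w_def using less.prems Cons True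
        by (intro conjI exI[of _ x]) (auto simp: cycle_def)
      then show ?thesis using inst unfolding sssp_instance_def by (meson not_less)
    next
      case False
      obtain q r t where d: "es = q @ r @ t" "\<exists>y. awalk (head G e) q y \<and> awalk y r y \<and> awalk y t x" "r \<noteq> []"
        using awalk_not_distinct_decomp[OF aw(1) False] by auto
      then obtain y where y: "awalk (head G e) q y" "awalk y r y" "awalk y t x" by blast
      note ne = d(3)
      have w1: "awalk x ((e # q) @ t) x" using aw awalk_appendI[OF y(1,3)] by (simp add: awalk_Cons_iff)
      have "awalk_cost w r \<ge> 0" by (rule less.hyps[OF _ y(2)]) (simp add: Cons d(1))
      moreover have "awalk_cost w ((e # q) @ t) \<ge> 0" by (rule less.hyps[OF _ w1]) (use Cons d(1) ne in simp)
      ultimately show ?thesis using Cons d(1) by simp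
    qed
  qed simp
qed

definition wl :: "nat list \<Rightarrow> real \<times> nat" where "wl p = (awalk_cost w p, length p)"

definition opt :: "nat \<Rightarrow> nat list \<Rightarrow> nat \<Rightarrow> bool" where
  "opt u p v \<longleftrightarrow> awalk u p v \<and> (\<forall>q. awalk u q v \<longrightarrow> \<not> lexlt (wl q) (wl p))"

text \<open>Cutting out a closed part does not increase the cost and strictly lowers the number of
  arcs, so even a part of cost zero makes the walk lexicographically worse.\<close>

lemma shorten:
  assumes "awalk u p v" "\<not> distinct (awalk_verts u p)"
  shows "\<exists>q. awalk u q v \<and> length q < length p \<and> lexlt (wl q) (wl p)"
proof -
  obtain q r t where d: "p = q @ r @ t" "\<exists>y. awalk u q y \<and> awalk y r y \<and> awalk y t v" "r \<noteq> []"
    using awalk_not_distinct_decomp[OF assms] by auto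
  then obtain y where y: "awalk u q y" "awalk y r y" "awalk y t v" by blast
  have "length (q @ t) < length p" using d(1,3) by simp
  moreover have "awalk_cost w (q @ t) \<le> awalk_cost w p" using closed_walk_nonneg[OF y(2)] d(1) by simp
  ultimately have "lexlt (wl (q @ t)) (wl p)" by (auto simp: lexlt_def wl_def)
  moreover have "awalk u (q @ t) v" by (rule awalk_appendI[OF y(1,3)])
  ultimately show ?thesis using \<open>length (q @ t) < length p\<close> by blast
qed

lemma ex_apath_le: "awalk u p v \<Longrightarrow> \<exists>q. apath u q v \<and> \<not> lexlt (wl p) (wl q)"
proof (induction "length p" arbitrary: p rule: less_induct)
  case less
  show ?case
  proof (cases "distinct (awalk_verts u p)")
    case True
    then show ?thesis using less.prems by (auto simp: apath_def)
  next
    case False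
    then obtain q where q: "awalk u q v" "length q < length p" "lexlt (wl q) (wl p)" using shorten less.prems by blast
    then obtain q' where "apath u q' v" "\<not> lexlt (wl q) (wl q')" using less.hyps by blast
    moreover have "\<not> lexlt (wl p) (wl q)" using q(3) by (auto simp: lexlt_def)
    ultimately show ?thesis using not_lexlt_trans by blast
  qed
qed

lemma ex_lexlt_min:
  assumes "finite S" "S \<noteq> {}" shows "\<exists>x\<in>S. \<forall>y\<in>S. \<not> lexlt (f y) (f x)"
  using assms
proof (induction S rule: finite_ne_induct)
  case (insert x F)
  then obtain z where z: "z \<in> F" "\<forall>y\<in>F. \<not> lexlt (f y) (f z)" by blast
  show ?case
  proof (cases "lexlt (f x) (f z)")
    case True
    have "\<not> lexlt (f y) (f x)" if "y \<in> F" for y using z(2) that lexlt_trans[OF _ True] by blast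
    then show ?thesis by auto
  next
    case False
    then show ?thesis using z by auto
  qed
qed simp

text \<open>There may be infinitely many walks, but each is dominated by one of the finitely many
  simple paths.\<close>

lemma ex_opt:
  assumes "u \<rightarrow>\<^sup>*\<^bsub>G\<^esub> v" shows "\<exists>p. opt u p v"
proof -
  have "{p. apath u p v} \<noteq> {}" using assms reachable_apath by auto
  then obtain p where p: "apath u p v" "\<forall>q. apath u q v \<longrightarrow> \<not> lexlt (wl q) (wl p)"
    using ex_lexlt_min[of "{p. apath u p v}" wl] apaths_finite by auto
  have "\<not> lexlt (wl q) (wl p)" if "awalk u q v" for q
    using ex_apath_le[OF that] p(2) not_lexlt_trans by blast
  then show ?thesis using p(1) unfolding opt_def apath_def by blast
qed

lemma opt_awalk: "opt u p v \<Longrightarrow> awalk u p v" by (simp add: opt_def)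

lemma opt_apath: "opt u p v \<Longrightarrow> apath u p v"
  using shorten[of u p v] by (auto simp: opt_def apath_def)

lemma opt_length: "opt u p v \<Longrightarrow> length p < n"
  using length_apath_less[OF opt_apath] verts_G by simp

lemma opt_unique: "opt u p v \<Longrightarrow> opt u q v \<Longrightarrow> wl p = wl q"
  unfolding opt_def using lexlt_linear by blast

lemma opt_same: "opt u p v \<Longrightarrow> awalk u q v \<Longrightarrow> wl p = wl q \<Longrightarrow> opt u q v"
  by (simp add: opt_def)

lemma opt_reach: "opt u p v \<Longrightarrow> u \<rightarrow>\<^sup>*\<^bsub>G\<^esub> v"
  using opt_awalk reachable_awalk by blast

lemma wl_append: "wl (p @ q) = (fst (wl p) + fst (wl q), snd (wl p) + snd (wl q))"
  by (simp add: wl_def)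

text \<open>Exchange argument: labels add up componentwise, and the lexicographic order is invariant
  under adding a fixed label on either side.\<close>

lemma opt_split:
  assumes "opt u (p @ q) v" "awalk u p x" "awalk x q v"
  shows "opt u p x" "opt x q v"
proof -
  show "opt u p x"
    unfolding opt_def
  proof (intro conjI allI impI)
    fix p' assume "awalk u p' x"
    then have "awalk u (p' @ q) v" using assms(3) by (rule awalk_appendI)
    then have "\<not> lexlt (wl (p' @ q)) (wl (p @ q))" using assms(1) by (simp add: opt_def)
    then show "\<not> lexlt (wl p') (wl p)" by (auto simp: lexlt_def wl_def)
  qed fact
  show "opt x q v"
    unfolding opt_def
  proof (intro conjI allI impI)
    fix q' assume "awalk x q' v"
    then have "awalk u (p @ q') v" by (rule awalk_appendI[OF assms(2)])
    then have "\<not> lexlt (wl (p @ q')) (wl (p @ q))" using assms(1) by (simp add: opt_def)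
    then show "\<not> lexlt (wl q') (wl q)" by (auto simp: lexlt_def wl_def)
  qed fact
qed

lemma opt_mu:
  assumes "opt u p v" shows "\<mu> w u v = ereal (awalk_cost w p)"
proof (rule antisym)
  show "\<mu> w u v \<le> ereal (awalk_cost w p)" using min_cost_le_walk_cost opt_awalk[OF assms] .
  show "ereal (awalk_cost w p) \<le> \<mu> w u v"
    unfolding \<mu>_def
  proof (rule INF_greatest)
    fix q assume "q \<in> {p. awalk u p v}"
    then have "\<not> lexlt (wl q) (wl p)" using assms by (simp add: opt_def)
    then show "ereal (awalk_cost w p) \<le> ereal (awalk_cost w q)" by (auto simp: lexlt_def wl_def)
  qed
qed

lemma opt_Nil: "u \<in> verts G \<Longrightarrow> opt u [] u"
  unfolding opt_def
proof (intro conjI allI impI)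
  fix q assume q: "awalk u q u"
  show "\<not> lexlt (wl q) (wl [])" using closed_walk_nonneg[OF q] by (auto simp: lexlt_def wl_def)
qed (simp add: awalk_Nil_iff)

text \<open>Tight arcs decrease the hop count, so following them backwards cannot run into a zero-weight cycle.\<close>

lemma pred_tree:
  assumes "opt s q v"
    and P: "\<And>v q. v \<noteq> s \<Longrightarrow> opt s q v \<Longrightarrow> P v \<in> arcs G \<and> head G (P v) = v \<and>
      (\<exists>q'. opt s q' (tail G (P v)) \<and> awalk_cost w q' + w (P v) \<le> awalk_cost w q \<and> Suc (length q') = length q)"
  shows "\<exists>p. pred_walk G P s v p \<and> opt s p v"
  using assms(1)
proof (induction "length q" arbitrary: q v rule: less_induct)
  case less
  show ?case
  proof (cases "v = s")
    case True
    then show ?thesis using opt_Nil[OF s_vert] pred_walk.intros(1) by blast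
  next
    case False
    from P[OF False less.prems] obtain q' where q: "P v \<in> arcs G" "head G (P v) = v" "opt s q' (tail G (P v))"
      "awalk_cost w q' + w (P v) \<le> awalk_cost w q" "Suc (length q') = length q" by blast
    have "length q' < length q" using q(5) by simp
    from less.hyps[OF this q(3)] obtain p where p: "pred_walk G P s (tail G (P v)) p" "opt s p (tail G (P v))" by blast
    have pl: "wl p = wl q'" using opt_unique[OF p(2) q(3)] .
    have aw: "awalk s (p @ [P v]) v"
    proof (rule awalk_appendI)
      show "awalk s p (tail G (P v))" by (rule opt_awalk[OF p(2)])
      show "awalk (tail G (P v)) [P v] v" using arc_implies_awalk[OF q(1)] q(2) by simp
    qed
    \<comment> \<open>Optimality of \<open>q\<close> gives one direction and tightness of the arc
      \<open>P v\<close> the other; since the order is linear, both walks have the same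
      label.\<close>
    then have "\<not> lexlt (wl (p @ [P v])) (wl q)" using less.prems by (simp add: opt_def)
    moreover have "\<not> lexlt (wl q) (wl (p @ [P v]))" using pl q(4,5) by (auto simp: lexlt_def wl_def)
    ultimately have "wl q = wl (p @ [P v])" using lexlt_linear by blast
    then have "opt s (p @ [P v]) v" using opt_same[OF less.prems aw] by simp
    then show ?thesis using pred_walk.intros(2)[OF False q(1,2) p(1)] by blast
  qed
qed

end

section \<open>Relaxation rounds\<close>

lemma form_val_superset:
  assumes "finite A" "Poly_Mapping.keys f \<subseteq> A"
  shows "form_val w f = (\<Sum>e\<in>A. of_int (Poly_Mapping.lookup f e) * w e)"
  unfolding form_val_def
  by (rule sum.mono_neutral_left[OF assms]) (auto simp: in_keys_iff)

lemma form_val_add: "form_val w (f + g) = form_val w f + form_val w g"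
proof -
  let ?A = "Poly_Mapping.keys f \<union> Poly_Mapping.keys g"
  have "form_val w (f + g) = (\<Sum>e\<in>?A. of_int (Poly_Mapping.lookup (f + g) e) * w e)"
    by (rule form_val_superset) (auto simp: Poly_Mapping.keys_add)
  also have "\<dots> = (\<Sum>e\<in>?A. of_int (Poly_Mapping.lookup f e) * w e) + (\<Sum>e\<in>?A. of_int (Poly_Mapping.lookup g e) * w e)"
    by (simp add: lookup_add algebra_simps sum.distrib)
  also have "\<dots> = form_val w f + form_val w g"
    using form_val_superset[of ?A f w] form_val_superset[of ?A g w] by simp
  finally show ?thesis .
qed

lemma form_val_zero: "form_val w 0 = 0"
  by (simp add: form_val_def)

lemma form_val_single: "form_val w (Poly_Mapping.single e 1) = w e"
  by (simp add: form_val_def)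

locale alg = sssp n m G w s + machine res w B
  for n m :: nat and G :: "(nat, nat) pre_digraph" and w :: "nat \<Rightarrow> real" and s :: nat and res :: resolution and B :: nat +
  fixes N :: nat
begin

text \<open>\<open>cell_walk S c p\<close>: cell \<open>c\<close> may hold the length and hop count of the walk \<open>p\<close>. Row \<open>i\<close> of the
  cells belongs to the source \<open>S i\<close>; the arcs follow after the \<open>N\<close> rows.\<close>

definition cell_walk :: "(nat \<Rightarrow> nat) \<Rightarrow> nat \<Rightarrow> nat list \<Rightarrow> bool" where
  "cell_walk S c p \<longleftrightarrow> (\<exists>i<N. \<exists>v<n. c = i * n + v \<and> awalk (S i) p v) \<or> (\<exists>e<m. c = N * n + e \<and> p = [e])"

text \<open>Soundness of all labels, which holds with certainty. The bound on hops is
  \<open>n\<close> and not \<open>n - 1\<close> because the cell of an arc has one hop even if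
  \<open>n = 1\<close>. Cell \<open>N * n + m\<close> is the one that is never in use.\<close>

definition cells :: "(nat \<Rightarrow> nat) \<Rightarrow> wmemory \<Rightarrow> rmemory \<Rightarrow> bool" where
  "cells S W R \<longleftrightarrow> (\<forall>c<N * n + m. W 3 c \<noteq> 0 \<longrightarrow> (\<exists>p. cell_walk S c p \<and> lab W R c = wl p \<and> length p \<le> n)) \<and>
     (\<forall>e<m. W 3 (N * n + e) \<noteq> 0) \<and> W 3 (N * n + m) = 0"

definition exact :: "(nat \<Rightarrow> nat) \<Rightarrow> nat \<Rightarrow> nat \<Rightarrow> wmemory \<Rightarrow> rmemory \<Rightarrow> bool" where
  "exact S i v W R \<longleftrightarrow> W 3 (i * n + v) \<noteq> 0 \<and> (\<exists>p. opt (S i) p v \<and> lab W R (i * n + v) = wl p)"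

lemma row_lt: "i < N \<Longrightarrow> v < n \<Longrightarrow> i * n + v < N * n"
proof -
  assume "i < N" "v < n"
  then have "i * n + v < Suc i * n" by simp
  also have "\<dots> \<le> N * n" using \<open>i < N\<close> by (intro mult_le_mono) auto
  finally show ?thesis .
qed

lemma row_walk: "i < N \<Longrightarrow> v < n \<Longrightarrow> cell_walk S (i * n + v) p \<longleftrightarrow> awalk (S i) p v"
  using row_lt[of i v] mult_add_unique[of _ n] unfolding cell_walk_def by (metis not_add_less1)

lemma arc_walk: "e < m \<Longrightarrow> cell_walk S (N * n + e) p \<longleftrightarrow> p = [e]"
proof -
  assume e: "e < m"
  have "N * n + e \<noteq> i * n + v" if "i < N" "v < n" for i v using row_lt[OF that] by simp
  then show ?thesis using e unfolding cell_walk_def by auto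
qed

lemma cells_row:
  assumes "cells S W R" "i < N" "v < n" "W 3 (i * n + v) \<noteq> 0"
  shows "\<exists>p. awalk (S i) p v \<and> lab W R (i * n + v) = wl p"
  using assms row_walk[OF assms(2,3)] row_lt[OF assms(2,3)] unfolding cells_def by (metis trans_less_add1)

end

text \<open>Bellman-Ford and min-plus squaring differ only in their lists of candidates. Soundness
  needs no more than \<open>compat\<close>, by which adding two labels means concatenating walks,
  and \<open>target\<close>, by which the labels of the arcs are never overwritten.\<close>

locale phase = alg n m G w s res B N
  for n m :: nat and G :: "(nat, nat) pre_digraph" and w :: "nat \<Rightarrow> real" and s :: nat and res :: resolution and B N :: nat +
  fixes j :: nat and W0 :: wmemory and S :: "nat \<Rightarrow> nat"
  assumes dsc: "desc res B j W0" and Nul: "W0 0 11 = N * n + m" and par_n: "W0 0 0 = n"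
    and target: "\<And>p. p < W0 0 j \<Longrightarrow> W0 12 p \<noteq> 0 \<Longrightarrow> W0 13 p < N * n"
    and compat: "\<And>p q q'. p < W0 0 j \<Longrightarrow> W0 12 p \<noteq> 0 \<Longrightarrow> cell_walk S (W0 17 p) q \<Longrightarrow> cell_walk S (W0 18 p) q' \<Longrightarrow>
      cell_walk S (W0 13 p) (q @ q')"
begin

definition inv :: "wmemory \<Rightarrow> rmemory \<Rightarrow> bool" where
  "inv W R \<longleftrightarrow> (\<forall>a. a \<notin> {3, 5, 20, 21, 22, 23, 24, 25, 26, 28} \<longrightarrow> W a = W0 a) \<and> cells S W R"

lemma inv_desc: "inv W R \<Longrightarrow> desc res B j W"
proof -
  assume "inv W R"
  then have o: "W 0 = W0 0" "W 12 = W0 12" "W 13 = W0 13" "W 14 = W0 14" "W 15 = W0 15" "W 16 = W0 16" "W 17 = W0 17"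
        "W 18 = W0 18" "W 19 = W0 19" "W 29 = W0 29" "W 31 = W0 31" "W 32 = W0 32" "W 33 = W0 33" "W 34 = W0 34" "W 35 = W0 35"
    by (simp_all add: inv_def)
  have "desc res B j W \<longleftrightarrow> desc res B j W0"
    unfolding desc_def desc_axioms_def o ..
  then show ?thesis using dsc by simp
qed

lemma inv_hops:
  assumes "inv W R"
  shows "W 3 (W 0 11) = 0" "\<And>c. c < W 0 11 \<Longrightarrow> W 3 c \<noteq> 0 \<Longrightarrow> W 5 c \<le> W 0 0"
proof -
  have o: "W 0 = W0 0" using assms by (simp add: inv_def)
  show "W 3 (W 0 11) = 0" using assms unfolding o Nul inv_def cells_def by blast
  fix c assume "c < W 0 11" "W 3 c \<noteq> 0"
  then obtain p where "lab W R c = wl p" "length p \<le> n" using assms unfolding o Nul inv_def cells_def by blast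
  then show "W 5 c \<le> W 0 0" unfolding o par_n by (simp add: lab_def wl_def)
qed

text \<open>Exactness survives a round for every outcome: an exact cell could only be replaced by a
  strictly smaller label, but the new label again belongs to a walk, and none is better than an
  optimal one.\<close>

lemma round_effect:
  assumes i: "inv W R" and r: "desc.rounds_to w j W R W' R'"
  shows "inv W' R'" "\<And>i v. i < N \<Longrightarrow> v < n \<Longrightarrow> exact S i v W R \<Longrightarrow> exact S i v W' R'"
proof -
  interpret d: desc res w B j W R by (rule inv_desc[OF i])
  have o: "W 0 = W0 0" "W 12 = W0 12" "W 13 = W0 13" "W 17 = W0 17" "W 18 = W0 18" using i by (simp_all add: inv_def)
  have cl: "cells S W R" using i by (simp add: inv_def)
  have fr: "W' a = W0 a" if "a \<notin> {3, 5, 20, 21, 22, 23, 24, 25, 26, 28}" for a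
    using r i that unfolding d.rounds_to_def inv_def by metis
  define upd where "upd c p \<longleftrightarrow> p \<in> d.grp c \<and> W 3 (W 17 p) \<noteq> 0 \<and> W 3 (W 18 p) \<noteq> 0 \<and> W 5 (W 17 p) + W 5 (W 18 p) < W 0 0 \<and>
          W' 3 c = 1 \<and> W' 5 c = W 5 (W 17 p) + W 5 (W 18 p) \<and> R' 1 c = R 1 (W 17 p) + R 1 (W 18 p) \<and>
          (W 3 c = 0 \<or> lexlt (lab W' R' c) (lab W R c))" for c p
  have ch: "(W' 3 c = W 3 c \<and> W' 5 c = W 5 c \<and> R' 1 c = R 1 c) \<or> (\<exists>p. upd c p)" if "c \<le> N * n + m" for c
    using r that unfolding d.rounds_to_def upd_def o Nul by blast
  have updw: "\<exists>q. cell_walk S c q \<and> lab W' R' c = wl q \<and> length q \<le> n \<and> c < N * n" if u: "upd c p" for c p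
  proof -
    have p: "p < W0 0 j" "W0 12 p \<noteq> 0" "W0 13 p = c" using u unfolding upd_def d.grp_def o by auto
    have x: "W 17 p < N * n + m" "W 18 p < N * n + m" using d.adr[of p] p unfolding o Nul by auto
    obtain q q' where q: "cell_walk S (W 17 p) q" "lab W R (W 17 p) = wl q" "cell_walk S (W 18 p) q'" "lab W R (W 18 p) = wl q'"
      using cl x u unfolding cells_def upd_def by meson
    have "cell_walk S c (q @ q')" using compat[OF p(1,2)] q(1,3) p(3) unfolding o by blast
    moreover have "lab W' R' c = wl (q @ q')"
      using u q(2,4) unfolding upd_def by (simp add: lab_def wl_def form_val_add)
    moreover have "length (q @ q') \<le> n" using u q(2,4) unfolding upd_def o par_n by (simp add: lab_def wl_def)
    moreover have "c < N * n" using target[OF p(1,2)] p(3) by simp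
    ultimately show ?thesis by blast
  qed
  have labeq: "lab W' R' c = lab W R c" if "W' 5 c = W 5 c" "R' 1 c = R 1 c" for c using that by (simp add: lab_def)
  have cl': "cells S W' R'"
    unfolding cells_def
  proof (intro conjI allI impI)
    fix c assume c: "c < N * n + m" "W' 3 c \<noteq> 0"
    from ch[of c] c(1) consider "W' 3 c = W 3 c" "lab W' R' c = lab W R c" | p where "upd c p"
      using labeq by (metis less_or_eq_imp_le)
    then show "\<exists>p. cell_walk S c p \<and> lab W' R' c = wl p \<and> length p \<le> n"
    proof cases
      case 1
      then show ?thesis using cl c unfolding cells_def by simp
    next
      case 2
      then show ?thesis using updw by blast
    qed
  next
    fix e assume e: "e < m"
    then have "\<not> upd (N * n + e) p" for p using updw[of "N * n + e" p] by auto
    then have "W' 3 (N * n + e) = W 3 (N * n + e)" using ch[of "N * n + e"] e by auto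
    then show "W' 3 (N * n + e) \<noteq> 0" using cl e unfolding cells_def by simp
  next
    have "\<not> upd (N * n + m) p" for p using updw[of "N * n + m" p] by auto
    then have "W' 3 (N * n + m) = W 3 (N * n + m)" using ch[of "N * n + m"] by auto
    then show "W' 3 (N * n + m) = 0" using cl unfolding cells_def by simp
  qed
  then show "inv W' R'" using fr by (simp add: inv_def)
  fix i v assume iv: "i < N" "v < n" and ex: "exact S i v W R"
  have "i * n + v \<le> N * n + m" using row_lt[OF iv] by simp
  from ch[OF this] consider "W' 3 (i * n + v) = W 3 (i * n + v)" "lab W' R' (i * n + v) = lab W R (i * n + v)" | p where "upd (i * n + v) p"
    using labeq by blast
  then show "exact S i v W' R'"
  proof cases
    case 1
    then show ?thesis using ex by (simp add: exact_def)
  next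
    case 2
    have 3: "W 3 (i * n + v) \<noteq> 0" using ex by (simp add: exact_def)
    then have l: "lexlt (lab W' R' (i * n + v)) (lab W R (i * n + v))" using 2 unfolding upd_def by simp
    obtain q where q: "cell_walk S (i * n + v) q" "lab W' R' (i * n + v) = wl q" using updw[OF 2] by blast
    have "awalk (S i) q v" using q(1) row_walk[OF iv] by simp
    then show ?thesis using ex l q(2) unfolding exact_def opt_def by metis
  qed
qed

lemma hp_inv: "inv W R \<Longrightarrow> hp 0 (round (prm j)) (\<lambda>W' R'. inv W' R' \<and> (\<forall>i<N. \<forall>v<n. exact S i v W R \<longrightarrow> exact S i v W' R')) W R"
proof -
  assume i: "inv W R"
  interpret d: desc res w B j W R by (rule inv_desc[OF i])
  show ?thesis
  proof (rule hp_mono[OF d.hp_round_all[OF inv_hops[OF i]] order_refl])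
    fix W' R' assume "d.rounds_to W' R'"
    note r = round_effect[OF i this]
    show "inv W' R' \<and> (\<forall>i<N. \<forall>v<n. exact S i v W R \<longrightarrow> exact S i v W' R')"
      by (intro conjI allI impI r)
  qed
qed

text \<open>A candidate with the optimal label is present. A successful minimum is no larger than
  it, and by soundness no label is smaller.\<close>

lemma hp_hit:
  assumes i: "inv W R" and p: "p < W0 0 j" "W0 12 p \<noteq> 0" "W0 13 p = k * n + v" "k < N" "v < n"
    and fl: "W 3 (W0 17 p) \<noteq> 0" "W 3 (W0 18 p) \<noteq> 0"
    and q: "opt (S k) q v" "wl q = (fst (lab W R (W0 17 p)) + fst (lab W R (W0 18 p)), snd (lab W R (W0 17 p)) + snd (lab W R (W0 18 p)))"
  shows "hp (31 / 32) (round (prm j)) (exact S k v) W R"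
proof -
  interpret d: desc res w B j W R by (rule inv_desc[OF i])
  have o: "W 0 = W0 0" "W 12 = W0 12" "W 13 = W0 13" "W 17 = W0 17" "W 18 = W0 18" using i by (simp_all add: inv_def)
  have pg: "p \<in> d.grp (k * n + v)" using p unfolding d.grp_def o by simp
  have hop: "W 5 (W 17 p) + W 5 (W 18 p) < W 0 0"
    using opt_length[OF q(1)] q(2) unfolding o par_n by (simp add: wl_def lab_def)
  have lq: "(form_val w (R 1 (W 17 p) + R 1 (W 18 p)), W 5 (W 17 p) + W 5 (W 18 p)) = wl q"
    using q(2) unfolding o by (simp add: lab_def form_val_add)
  have "hp (31 / 32) (round (prm j)) (\<lambda>W' R'. (inv W' R' \<and> (\<forall>i<N. \<forall>v<n. exact S i v W R \<longrightarrow> exact S i v W' R')) \<and>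
      (W' 3 (k * n + v) \<noteq> 0 \<and> \<not> lexlt (wl q) (lab W' R' (k * n + v)))) W R"
    by (rule hp_conj0[OF hp_inv[OF i] d.hp_round_prob[OF inv_hops[OF i] pg _ _ hop, unfolded lq]]) (use fl o in simp_all)
  then show ?thesis
  proof (rule hp_mono[OF _ order_refl], elim conjE)
    fix W' R' assume i': "inv W' R'" and f: "W' 3 (k * n + v) \<noteq> 0" and l: "\<not> lexlt (wl q) (lab W' R' (k * n + v))"
    have "cells S W' R'" using i' by (simp add: inv_def)
    from cells_row[OF this p(4,5) f] obtain q' where q': "awalk (S k) q' v" "lab W' R' (k * n + v) = wl q'" by blast
    then have "\<not> lexlt (lab W' R' (k * n + v)) (wl q)" using q(1) by (simp add: opt_def)
    then have "lab W' R' (k * n + v) = wl q" using l by (rule lexlt_linear)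
    then show "exact S k v W' R'" using f q(1) unfolding exact_def by blast
  qed
qed

end

section \<open>Paths as chains of links between samples\<close>

fun route_end :: "nat \<Rightarrow> (nat list \<times> nat) list \<Rightarrow> nat" where
  "route_end a [] = a" | "route_end a ((p, b) # xs) = route_end b xs"

text \<open>A link is a walk together with the index of the sample where it ends. The links are
  paired up, first with second, third with fourth, and a pair is merged if the table holds the
  merged link. Fixed disjoint pairs make the expected number of merges additive without any
  independence between them.\<close>

fun contract :: "(nat \<Rightarrow> nat \<Rightarrow> bool) \<Rightarrow> nat \<Rightarrow> (nat list \<times> nat) list \<Rightarrow> (nat list \<times> nat) list" where
  "contract good a ((p, b) # (q, c) # xs) =
     (if good a c then (p @ q, c) # contract good c xs else (p, b) # (q, c) # contract good c xs)"
| "contract good a xs = xs"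

definition route_walk :: "(nat list \<times> nat) list \<Rightarrow> nat list" where "route_walk xs = concat (map fst xs)"

lemma route_walk_simps [simp]: "route_walk [] = []" "route_walk ((p, b) # xs) = p @ route_walk xs"
  by (auto simp: route_walk_def)

lemma contract_end: "route_end a (contract good a xs) = route_end a xs"
  by (induction good a xs rule: contract.induct) auto

lemma contract_walk: "route_walk (contract good a xs) = route_walk xs"
  by (induction good a xs rule: contract.induct) auto

lemma contract_ne: "contract good a xs = [] \<longleftrightarrow> xs = []"
  by (induction good a xs rule: contract.induct) auto

lemma contract_length: "length (contract good a xs) \<le> length xs"
  by (induction good a xs rule: contract.induct) auto

fun links :: "(nat \<Rightarrow> nat \<Rightarrow> bool) \<Rightarrow> nat \<Rightarrow> (nat list \<times> nat) list \<Rightarrow> bool" where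
  "links good a [] \<longleftrightarrow> True"
| "links good a ((p, b) # xs) \<longleftrightarrow> good a b \<and> links good b xs"

context alg
begin

text \<open>A vertex may be sampled several times. Then \<open>alive\<close> singles out one index
  for it, the only one that occurs as a target column in squaring; so links have to end at such
  indices.\<close>

fun route :: "(nat \<Rightarrow> nat) \<Rightarrow> (nat \<Rightarrow> bool) \<Rightarrow> nat \<Rightarrow> (nat list \<times> nat) list \<Rightarrow> bool" where
  "route S alive a [] \<longleftrightarrow> True"
| "route S alive a ((p, b) # xs) \<longleftrightarrow> b < N \<and> alive b \<and> awalk (S a) p (S b) \<and> route S alive b xs"

lemma route_awalk: "route S alive a xs \<Longrightarrow> S a \<in> verts G \<Longrightarrow> awalk (S a) (route_walk xs) (S (route_end a xs))"
proof (induction xs arbitrary: a)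
  case (Cons x xs)
  obtain p b where x: "x = (p, b)" by (cases x)
  have "awalk (S a) p (S b)" "route S alive b xs" using Cons.prems(1) x by auto
  moreover have "S b \<in> verts G" using calculation(1) awalk_last_in_verts by blast
  ultimately show ?case using Cons.IH[of b] x by (auto intro: awalk_appendI)
qed (simp add: awalk_Nil_iff)

end

context phase
begin

lemma contract_route: "route S alive a xs \<Longrightarrow> route S alive a (contract good a xs)"
  by (induction good a xs rule: contract.induct) (auto intro: awalk_appendI)

lemma contract_links: "links good a xs \<Longrightarrow> links good a (contract good a xs)"
  by (induction good a xs rule: contract.induct) auto

lemma links_mono: "links good a xs \<Longrightarrow> route S alive a xs \<Longrightarrow> (\<And>b c. c < N \<Longrightarrow> b < N \<Longrightarrow> good b c \<Longrightarrow> good' b c) \<Longrightarrow> a < N \<Longrightarrow> links good' a xs"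
  by (induction good a xs rule: links.induct) auto

lemma awalk_n: "awalk u p v \<Longrightarrow> u < n \<and> v < n"
  using awalk_hd_in_verts awalk_last_in_verts verts_G by blast

text \<open>Relaxing all arcs: along a shortest walk one more vertex becomes exact with constant probability per round.\<close>

lemma bellman_ford:
  assumes arcs: "\<And>i e. i < N \<Longrightarrow> e < m \<Longrightarrow> \<exists>p<W0 0 j. W0 12 p \<noteq> 0 \<and> W0 13 p = i * n + head G e \<and>
      W0 17 p = i * n + tail G e \<and> W0 18 p = N * n + e"
    and i: "i < N" and init: "inv W R" "exact S i y W R"
    and o: "opt (S i) (r @ q) v" "awalk (S i) r y" "awalk y q v"
  shows "hp (if q = [] then 0 else 2 ^ length q * (63 / 64) ^ W0 0 7) (While (prm 7) (Const 1) (round (prm j))) (exact S i v) W R"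
proof -
  define x where "x a = (if a = 0 then y else head G (q ! (a - 1)))" for a
  define l where "l = length q"
  have xw: "awalk y (take a q) (x a) \<and> awalk (x a) (drop a q) v" if "a \<le> l" for a
    using that
  proof (induction a)
    case 0
    have "y \<in> verts G" using o(3) awalk_hd_in_verts by blast
    then show ?case using o(3) by (simp add: x_def awalk_Nil_iff)
  next
    case (Suc a)
    then have a: "a < length q" by (simp add: l_def)
    have IH: "awalk y (take a q) (x a)" "awalk (x a) (q ! a # drop (Suc a) q) v"
      using Suc a by (simp_all add: Cons_nth_drop_Suc)
    have e: "q ! a \<in> arcs G" "tail G (q ! a) = x a" "awalk (head G (q ! a)) (drop (Suc a) q) v"
      using IH(2) by (simp_all add: awalk_Cons_iff)
    have "awalk (x a) [q ! a] (head G (q ! a))" using arc_implies_awalk[OF e(1)] e(2) by simp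
    then have "awalk y (take a q @ [q ! a]) (head G (q ! a))" using IH(1) by (rule awalk_appendI[rotated])
    then show ?case using e(3) a by (simp add: take_Suc_conv_app_nth x_def)
  qed
  have xl: "x l = v"
    using xw[of l] by (simp add: l_def awalk_Nil_iff)
  have xn: "x a < n" if "a \<le> l" for a using xw[OF that] awalk_n by blast
  have xo: "opt (S i) (r @ take a q) (x a)" if "a \<le> l" for a
  proof (rule opt_split(1))
    show "opt (S i) ((r @ take a q) @ drop a q) v" using o(1) by simp
    show "awalk (S i) (r @ take a q) (x a)" using o(2) xw[OF that] by (blast intro: awalk_appendI)
    show "awalk (x a) (drop a q) v" using xw[OF that] by blast
  qed
  have "hp (if l = 0 then 0 else 2 ^ l * (1 - (1 / 32) / 2) ^ wv B W 0 (prm 7)) (While (prm 7) (Const 1) (round (prm j)))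
     (\<lambda>W R. exact S i (x (min l l)) W R) W R"
  \<comment> \<open>Levels are the vertices along \<open>q\<close>. They are cut off at
    \<open>l\<close> because the preservation assumption has to hold for every level number.\<close>
  proof (rule hp_for_levels[where I=inv and E="\<lambda>a. exact S i (x (min a l))"])
    fix a W R assume I: "inv W R" and E: "exact S i (x (min a l)) W R"
    have "x (min a l) < n" using xn[of "min a l"] by simp
    then show "hp 0 (round (prm j)) (\<lambda>W R. inv W R \<and> exact S i (x (min a l)) W R) W R"
      by (intro hp_mono[OF hp_inv[OF I] order_refl]) (use E i in blast)
  next
    fix a W R assume al: "a < l" and I: "inv W R" and E: "exact S i (x (min a l)) W R"
    have a: "a < length q" using al by (simp add: l_def)
    let ?e = "q ! a"
    have dr: "awalk (x a) (?e # drop (Suc a) q) v" using xw[of a] al a by (simp add: Cons_nth_drop_Suc)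
    have e: "?e < m" "tail G ?e = x a" using dr arcs_G by (auto simp: awalk_Cons_iff)
    have xS: "x (Suc a) = head G ?e" by (simp add: x_def)
    obtain p where p: "p < W0 0 j" "W0 12 p \<noteq> 0" "W0 13 p = i * n + x (Suc a)" "W0 17 p = i * n + x a" "W0 18 p = N * n + ?e"
      using arcs[OF i e(1)] e(2) xS by auto
    have Ex: "W 3 (i * n + x a) \<noteq> 0" "\<exists>p. opt (S i) p (x a) \<and> lab W R (i * n + x a) = wl p" using E al by (simp_all add: exact_def)
    then obtain p' where p': "opt (S i) p' (x a)" "lab W R (i * n + x a) = wl p'" by blast
    have l1: "lab W R (i * n + x a) = wl (r @ take a q)" using opt_unique[OF p'(1) xo[of a]] al p'(2) by simp
    have cl: "cells S W R" using I by (simp add: inv_def)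
    have fe: "W 3 (N * n + ?e) \<noteq> 0" using cl e(1) by (simp add: cells_def)
    then obtain q' where "cell_walk S (N * n + ?e) q'" "lab W R (N * n + ?e) = wl q'"
      using cl e(1) unfolding cells_def by (meson nat_add_left_cancel_less)
    then have l2: "lab W R (N * n + ?e) = wl [?e]" using arc_walk[OF e(1)] by simp
    have "hp (31 / 32) (round (prm j)) (exact S i (x (Suc a))) W R"
    proof (rule hp_hit[OF I p(1-3) i])
      show "x (Suc a) < n" using xn[of "Suc a"] al by simp
      show "W 3 (W0 17 p) \<noteq> 0" "W 3 (W0 18 p) \<noteq> 0" using Ex(1) fe p by simp_all
      show "opt (S i) (r @ take (Suc a) q) (x (Suc a))" using xo[of "Suc a"] al by simp
      show "wl (r @ take (Suc a) q) = (fst (lab W R (W0 17 p)) + fst (lab W R (W0 18 p)), snd (lab W R (W0 17 p)) + snd (lab W R (W0 18 p)))"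
        unfolding p(4,5) l1 l2 using a by (simp add: take_Suc_conv_app_nth wl_def)
    qed
    then show "hp (1 - 1 / 32) (round (prm j)) (exact S i (x (min (Suc a) l))) W R"
      using al by (simp add: min_def Suc_leI)
  next
    show "exact S i (x (min 0 l)) W R" using init(2) by (simp add: x_def)
  qed (use init in simp_all)
  moreover have k: "wv B W 0 (prm 7) = W0 0 7" using init(1) by (simp add: inv_def)
  \<comment> \<open>The factor \<open>1 - p / 2\<close> of the level argument for the success
    probability \<open>p = 1 / 32\<close> of a round.\<close>
  moreover have c: "1 - (1 / 32) / 2 = (63 / 64 :: real)" by simp
  moreover have "(l = 0) = (q = [])" by (simp add: l_def)
  ultimately have "hp (if q = [] then 0 else 2 ^ l * (63 / 64) ^ W0 0 7) (While (prm 7) (Const 1) (round (prm j))) (exact S i (x l)) W R"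
    by (simp only: min.idem)
  then show ?thesis using xl by (simp only: l_def)
qed

text \<open>Path doubling: in every round each of the disjoint pairs of consecutive links of a route is
  merged with constant probability, so the expected number of surplus links decreases geometrically.\<close>

lemma contract_expectation:
  assumes triples: "\<And>i k c. i < N \<Longrightarrow> k < N \<Longrightarrow> c < N \<Longrightarrow> alive c \<Longrightarrow> \<exists>p<W0 0 j. W0 12 p \<noteq> 0 \<and>
      W0 13 p = i * n + S c \<and> W0 17 p = i * n + S k \<and> W0 18 p = k * n + S c"
    and I: "inv (wmem \<sigma>) (rmem \<sigma>)"
    and "a < N" "route S alive a xs" "links (\<lambda>a b. exact S a (S b) (wmem \<sigma>) (rmem \<sigma>)) a xs"
      "opt (S a) (route_walk xs) (S (route_end a xs))"
  shows "(\<integral>\<tau>. real (length (contract (\<lambda>a b. exact S a (S b) (wmem \<tau>) (rmem \<tau>)) a xs)) \<partial>measure_pmf (exec res w B (round (prm j)) \<sigma>))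
    \<le> real (length xs) - real (length xs div 2) / 32"
  using assms(3-)
proof (induction xs arbitrary: a rule: induct_list012)
  case (3 x y zs)
  obtain p b where x: "x = (p, b)" by (cases x)
  obtain q c where y: "y = (q, c)" by (cases y)
  let ?M = "exec res w B (round (prm j)) \<sigma>"
  let ?good = "\<lambda>\<tau> a b. exact S a (S b) (wmem \<tau>) (rmem \<tau>)"
  have r: "b < N" "c < N" "alive c" "awalk (S a) p (S b)" "awalk (S b) q (S c)" "route S alive c zs" using 3(4) x y by auto
  have lk: "?good \<sigma> a b" "?good \<sigma> b c" "links (?good \<sigma>) c zs" using 3(5) x y by auto
  have o: "opt (S a) ((p @ q) @ route_walk zs) (S (route_end c zs))" using 3(6) x y by simp
  have Sc: "S c \<in> verts G" using r(5) awalk_last_in_verts by blast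
  have wz: "awalk (S c) (route_walk zs) (S (route_end c zs))" by (rule route_awalk[OF r(6) Sc])
  have pq: "awalk (S a) (p @ q) (S c)" using r(4,5) by (rule awalk_appendI)
  note osp = opt_split[OF o pq wz]
  note op = opt_split[OF osp(1) r(4,5)]
  have l1: "lab (wmem \<sigma>) (rmem \<sigma>) (a * n + S b) = wl p" using lk(1) op(1) opt_unique unfolding exact_def by metis
  have l2: "lab (wmem \<sigma>) (rmem \<sigma>) (b * n + S c) = wl q" using lk(2) op(2) opt_unique unfolding exact_def by metis
  obtain d where d: "d < W0 0 j" "W0 12 d \<noteq> 0" "W0 13 d = a * n + S c" "W0 17 d = a * n + S b" "W0 18 d = b * n + S c"
    using triples[OF 3(3) r(1-3)] by blast
  have "hp (31 / 32) (round (prm j)) (exact S a (S c)) (wmem \<sigma>) (rmem \<sigma>)"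
  proof (rule hp_hit[OF I d(1-3) 3(3)])
    show "S c < n" using Sc verts_G by simp
    show "wmem \<sigma> 3 (W0 17 d) \<noteq> 0" "wmem \<sigma> 3 (W0 18 d) \<noteq> 0" using lk d by (simp_all add: exact_def)
    show "wl (p @ q) = (fst (lab (wmem \<sigma>) (rmem \<sigma>) (W0 17 d)) + fst (lab (wmem \<sigma>) (rmem \<sigma>) (W0 18 d)),
       snd (lab (wmem \<sigma>) (rmem \<sigma>) (W0 17 d)) + snd (lab (wmem \<sigma>) (rmem \<sigma>) (W0 18 d)))"
      unfolding d l1 l2 by (simp add: wl_append)
  qed (rule osp(1))
  then have pr: "measure_pmf.prob ?M {\<tau>. \<not> ?good \<tau> a c} \<le> 31 / 32" unfolding hp_def by blast
  \<comment> \<open>The leading pair leaves one link if it is merged and two otherwise; taking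
    expectations reduces the claim to the remaining links.\<close>
  have eq: "real (length (contract (?good \<tau>) a (x # y # zs))) = 1 + indicator {\<tau>. \<not> ?good \<tau> a c} \<tau> + real (length (contract (?good \<tau>) c zs))" for \<tau>
    by (simp add: x y indicator_def)
  have bd: "integrable (measure_pmf ?M) (\<lambda>\<tau>. real (length (contract (?good \<tau>) c zs)))"
    by (rule measure_pmf.integrable_const_bound[where B="real (length zs)"]) (auto simp: contract_length)
  have bi: "integrable (measure_pmf ?M) (\<lambda>\<tau>. indicator {\<tau>. \<not> ?good \<tau> a c} \<tau> :: real)"
    by (rule measure_pmf.integrable_const_bound[where B=1]) (auto simp: indicator_def)
  have "(\<integral>\<tau>. real (length (contract (?good \<tau>) a (x # y # zs))) \<partial>measure_pmf ?M)
     = 1 + measure_pmf.prob ?M {\<tau>. \<not> ?good \<tau> a c} + (\<integral>\<tau>. real (length (contract (?good \<tau>) c zs)) \<partial>measure_pmf ?M)"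
    unfolding eq using bd bi by simp
  also have "\<dots> \<le> 1 + 31 / 32 + (real (length zs) - real (length zs div 2) / 32)"
    using pr 3(1)[OF r(2) r(6) lk(3) osp(2)] by linarith
  also have "\<dots> \<le> real (length (x # y # zs)) - real (length (x # y # zs) div 2) / 32"
    by (simp add: field_simps)
  finally show ?case .
qed simp_all

text \<open>With \<open>K\<close> rounds left, failure has probability at most the number of surplus
  links times \<open>(63 / 64) ^ K\<close>. Without surplus, the single link is the exact one asked
  for; with surplus, the bound is at least 1 when \<open>K = 0\<close>. A last unpaired link is
  harmless since \<open>(l - 1) / 2 \<le> l div 2\<close>: each round removes on average at least
  \<open>(l - 1) / 64\<close> links.\<close>

lemma doubling:
  assumes triples: "\<And>i k c. i < N \<Longrightarrow> k < N \<Longrightarrow> c < N \<Longrightarrow> alive c \<Longrightarrow> \<exists>p<W0 0 j. W0 12 p \<noteq> 0 \<and>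
      W0 13 p = i * n + S c \<and> W0 17 p = i * n + S k \<and> W0 18 p = k * n + S c"
    and init: "inv W R" "a < N" "route S alive a xs" "links (\<lambda>a b. exact S a (S b) W R) a xs"
      "opt (S a) (route_walk xs) (S (route_end a xs))" "xs \<noteq> []"
  shows "hp (real (length xs - 1) * (63 / 64) ^ W0 0 8) (While (prm 8) (Const 1) (round (prm j))) (exact S a (S (route_end a xs))) W R"
proof -
  let ?good = "\<lambda>\<tau> a b. exact S a (S b) (wmem \<tau>) (rmem \<tau>)"
  let ?end = "route_end a xs"
  have *: "measure_pmf.prob (rep 3 (round (prm j)) K \<sigma>) {\<tau>. \<not> ?good \<tau> a ?end} \<le> (real (length ys) - 1) * (63 / 64) ^ K"
    if "inv (wmem \<sigma>) (rmem \<sigma>)" "route S alive a ys" "links (?good \<sigma>) a ys" "opt (S a) (route_walk ys) (S (route_end a ys))" "ys \<noteq> []"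
      "route_end a ys = ?end" for K \<sigma> ys
    using that
  proof (induction K arbitrary: \<sigma> ys)
    case 0
    show ?case
    proof (cases "\<exists>y. ys = [y]")
      case True
      then obtain p b where y: "ys = [(p, b)]" by force
      then have "?good \<sigma> a ?end" using 0(3,6) by simp
      then show ?thesis using y by (simp add: rep_def measure_return_pmf)
    next
      case False
      then have "2 \<le> length ys" using 0(5) by (cases ys; cases "tl ys") auto
      then show ?thesis by (auto intro: order_trans[OF measure_pmf.prob_le_1])
    qed
  next
    case (Suc K)
    let ?\<sigma> = "charge 3 3 \<sigma>"
    let ?M = "exec res w B (round (prm j)) ?\<sigma>"
    let ?c = "\<lambda>\<tau>. contract (?good \<tau>) a ys"
    have I: "inv (wmem ?\<sigma>) (rmem ?\<sigma>)" using Suc.prems(1) by simp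
    have step: "measure_pmf.prob (rep 3 (round (prm j)) K \<tau>) {\<tau>. \<not> ?good \<tau> a ?end} \<le> (real (length (?c \<tau>)) - 1) * (63 / 64) ^ K"
      if t: "\<tau> \<in> set_pmf ?M" for \<tau>
    proof (rule Suc.IH)
      have h: "inv (wmem \<tau>) (rmem \<tau>) \<and> (\<forall>i<N. \<forall>v<n. exact S i v (wmem \<sigma>) (rmem \<sigma>) \<longrightarrow> exact S i v (wmem \<tau>) (rmem \<tau>))"
        using hp_inv[OF I, unfolded hp0_iff, THEN spec, of ?\<sigma>] t by simp
      then show "inv (wmem \<tau>) (rmem \<tau>)" by blast
      show "route S alive a (?c \<tau>)" by (rule contract_route[OF Suc.prems(2)])
      have "links (?good \<tau>) a ys"
      proof (rule links_mono[OF Suc.prems(3,2) _ init(2)])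
        fix b c assume bc: "c < N" "b < N" "exact S b (S c) (wmem \<sigma>) (rmem \<sigma>)"
        then have "S c < n" using opt_awalk awalk_n unfolding exact_def by blast
        then show "exact S b (S c) (wmem \<tau>) (rmem \<tau>)" using h bc by blast
      qed
      then show "links (?good \<tau>) a (?c \<tau>)" by (rule contract_links)
    qed (use Suc.prems in \<open>simp_all add: contract_walk contract_end contract_ne\<close>)
    have bd: "integrable (measure_pmf ?M) (\<lambda>\<tau>. real (length (?c \<tau>)))"
      by (rule measure_pmf.integrable_const_bound[where B="real (length ys)"]) (auto simp: contract_length)
    have "measure_pmf.prob (rep 3 (round (prm j)) (Suc K) \<sigma>) {\<tau>. \<not> ?good \<tau> a ?end}
       = (\<integral>\<tau>. measure_pmf.prob (rep 3 (round (prm j)) K \<tau>) {\<tau>. \<not> ?good \<tau> a ?end} \<partial>measure_pmf ?M)"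
      unfolding rep_Suc by (rule prob_bind_pmf)
    also have "\<dots> \<le> (\<integral>\<tau>. (real (length (?c \<tau>)) - 1) * (63 / 64) ^ K \<partial>measure_pmf ?M)"
    proof (rule integral_mono_AE)
      show "integrable (measure_pmf ?M) (\<lambda>\<tau>. measure_pmf.prob (rep 3 (round (prm j)) K \<tau>) {\<tau>. \<not> ?good \<tau> a ?end})"
        by (intro measure_pmf.integrable_const_bound[where B=1]) auto
      show "integrable (measure_pmf ?M) (\<lambda>\<tau>. (real (length (?c \<tau>)) - 1) * (63 / 64) ^ K)"
        using bd by simp
    qed (use step in \<open>simp add: AE_measure_pmf_iff\<close>)
    also have "\<dots> = ((\<integral>\<tau>. real (length (?c \<tau>)) \<partial>measure_pmf ?M) - 1) * (63 / 64) ^ K"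
      using bd by simp
    also have "\<dots> \<le> ((real (length ys) - real (length ys div 2) / 32) - 1) * (63 / 64) ^ K"
      using contract_expectation[OF triples I init(2) Suc.prems(2) _ Suc.prems(4)] Suc.prems(3) by (intro mult_right_mono) auto
    also have "\<dots> \<le> ((real (length ys) - 1) * (63 / 64)) * (63 / 64) ^ K"
    proof (rule mult_right_mono)
      have "real (length ys) - 1 \<le> 2 * real (length ys div 2)" by linarith
      then show "real (length ys) - real (length ys div 2) / 32 - 1 \<le> (real (length ys) - 1) * (63 / 64)" by simp
    qed simp
    finally show ?case by (simp only: power_Suc mult.assoc)
  qed
  show ?thesis
  proof (rule hp_for)
    fix \<sigma> :: state assume s: "wmem \<sigma> = W" "rmem \<sigma> = R"
    have "wv B W 0 (prm 8) = W0 0 8" using init(1) by (simp add: inv_def)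
    then show "measure_pmf.prob (rep 3 (round (prm j)) (wv B W 0 (prm 8)) \<sigma>) {\<tau>. \<not> exact S a (S ?end) (wmem \<tau>) (rmem \<tau>)}
       \<le> real (length xs - 1) * (63 / 64) ^ W0 0 8"
      using *[of \<sigma> xs "W0 0 8"] init s by (cases xs) auto
  qed
qed

lemma hp_for_inv': "inv W R \<Longrightarrow> hp 0 (While k (Const 1) (round (prm j)))
    (\<lambda>W' R'. inv W' R' \<and> (\<forall>i<N. \<forall>v<n. exact S i v W R \<longrightarrow> exact S i v W' R')) W R"
proof -
  assume I: "inv W R"
  show ?thesis
  proof (rule hp_for_inv[of "\<lambda>_ W' R'. inv W' R' \<and> (\<forall>i<N. \<forall>v<n. exact S i v W R \<longrightarrow> exact S i v W' R')"])
    fix k W1 R1 assume a: "inv W1 R1 \<and> (\<forall>i<N. \<forall>v<n. exact S i v W R \<longrightarrow> exact S i v W1 R1)"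
    show "hp 0 (round (prm j)) (\<lambda>W' R'. inv W' R' \<and> (\<forall>i<N. \<forall>v<n. exact S i v W R \<longrightarrow> exact S i v W' R')) W1 R1"
      by (rule hp_mono[OF hp_inv order_refl]) (use a in blast)+
  qed (use I in blast)
qed

end

section \<open>The candidates of Bellman-Ford and of min-plus squaring\<close>

definition bf_index :: "wexp" where "bf_index = Op Div Pid (prm 1)"
definition bf_arc :: "wexp" where "bf_arc = wmd Pid (prm 1)"

text \<open>Candidate \<open>i * m + e\<close> extends walks from sample \<open>i\<close> by the arc
  \<open>e\<close>. Its competitors are the arcs with the same head, whose numbering is looked up in
  arrays 8 and 9.\<close>

definition bfdesc :: prog where
  "bfdesc = seqs
    [Par (prm 9) (Const 1) (Store 12 Pid (Const 1)),
     Par (prm 9) (Const 1) (Store 13 Pid (Op Add (Op Mul bf_index (prm 0)) (Load 2 bf_arc))),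
     Par (prm 9) (Const 1) (Store 14 Pid (Load 8 bf_arc)),
     Par (prm 9) (Const 1) (Store 15 Pid (Load 9 bf_arc)),
     Par (prm 9) (Const 1) (Store 17 Pid (Op Add (Op Mul bf_index (prm 0)) (Load 1 bf_arc))),
     Par (prm 9) (Const 1) (Store 18 Pid (Op Add (Op Mul (prm 6) (prm 0)) bf_arc))]"

definition mx_i :: wexp where "mx_i = Op Div Pid (Op Mul (prm 6) (prm 6))"
definition mx_c :: wexp where "mx_c = wmd (Op Div Pid (prm 6)) (prm 6)"
definition mx_k :: wexp where "mx_k = wmd Pid (prm 6)"

text \<open>Candidate \<open>(i * N + c) * N + k\<close> joins the link from \<open>i\<close> to
  \<open>k\<close> with the link from \<open>k\<close> to \<open>c\<close>, so \<open>k\<close>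
  itself is its rank in a group of size \<open>N\<close>. Columns \<open>c\<close> of repeated
  samples are switched off, or one cell would be the target of several groups.\<close>

definition mxdesc :: prog where
  "mxdesc = seqs
    [Par (prm 10) (Const 1) (Store 12 Pid (weq (Load 7 (Load 6 mx_c)) mx_c)),
     Par (prm 10) (Const 1) (Store 13 Pid (Op Add (Op Mul mx_i (prm 0)) (Load 6 mx_c))),
     Par (prm 10) (Const 1) (Store 14 Pid mx_k),
     Par (prm 10) (Const 1) (Store 15 Pid (prm 6)),
     Par (prm 10) (Const 1) (Store 17 Pid (Op Add (Op Mul mx_i (prm 0)) (Load 6 mx_k))),
     Par (prm 10) (Const 1) (Store 18 Pid (Op Add (Op Mul mx_k (prm 0)) (Load 6 mx_c)))]"

definition bf :: prog where
  "bf = Seq (Seq bfdesc (prep (prm 9))) (While (prm 7) (Const 1) (round (prm 9)))"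

definition mx :: prog where
  "mx = Seq (Seq mxdesc (prep (prm 10))) (While (prm 8) (Const 1) (round (prm 10)))"

context sssp
begin

text \<open>The arcs into a vertex are numbered by their tails, which are distinct in the absence of
  parallel arcs.\<close>

definition rank :: "nat \<Rightarrow> nat" where "rank e = card {e'. e' < m \<and> head G e' = head G e \<and> tail G e' < tail G e}"
definition indeg :: "nat \<Rightarrow> nat" where "indeg e = card {e'. e' < m \<and> head G e' = head G e}"

lemma rank_less: "e < m \<Longrightarrow> rank e < indeg e"
  unfolding rank_def indeg_def by (rule psubset_card_mono) auto

lemma indeg_le: "indeg e \<le> n"
proof -
  have "inj_on (tail G) {e'. e' < m \<and> head G e' = head G e}"
    by (rule inj_onI) (auto intro: arc_ends_inj)
  moreover have "tail G ` {e'. e' < m \<and> head G e' = head G e} \<subseteq> {..<n}" using tail_n by auto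
  ultimately have "card {e'. e' < m \<and> head G e' = head G e} \<le> card {..<n}" by (intro card_inj_on_le) auto
  then show ?thesis by (simp add: indeg_def)
qed

lemma rank_mono: "e < m \<Longrightarrow> head G e = head G e' \<Longrightarrow> tail G e < tail G e' \<Longrightarrow> rank e < rank e'"
  unfolding rank_def by (rule psubset_card_mono) auto

lemma rank_inj: "e < m \<Longrightarrow> e' < m \<Longrightarrow> head G e = head G e' \<Longrightarrow> rank e = rank e' \<Longrightarrow> e = e'"
  using rank_mono[of e e'] rank_mono[of e' e] arc_ends_inj[of e e'] by (metis less_irrefl linorder_neqE_nat)

lemma rank_onto: assumes "r < indeg e" shows "\<exists>e'<m. head G e' = head G e \<and> rank e' = r"
proof -
  let ?A = "{e'. e' < m \<and> head G e' = head G e}"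
  have "inj_on rank ?A" by (rule inj_onI) (auto intro: rank_inj)
  then have "card (rank ` ?A) = card {..<indeg e}" by (simp add: card_image indeg_def)
  moreover have "rank ` ?A \<subseteq> {..<indeg e}"
  proof
    fix x assume "x \<in> rank ` ?A"
    then obtain e' where e': "e' < m" "head G e' = head G e" "x = rank e'" by auto
    then show "x \<in> {..<indeg e}" using rank_less[OF e'(1)] by (simp add: indeg_def)
  qed
  ultimately have "rank ` ?A = {..<indeg e}" by (intro card_subset_eq) auto
  then have "r \<in> rank ` ?A" using assms by simp
  then show ?thesis by auto
qed

end

text \<open>\<open>Q\<close> dominates all sizes, and one of the five powers of \<open>Q\<close> in
  \<open>Q ^ 5 \<le> B\<close> supplies a spare factor of 16; so no address and no processor count
  overflows. By \<open>it\<close>, \<open>T2\<close> doublings serve both kinds of groups: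
  in-degrees, at most \<open>n\<close>, and \<open>N\<close>.\<close>

locale config = alg n m G w s res B N
  for n m :: nat and G :: "(nat, nat) pre_digraph" and w :: "nat \<Rightarrow> real" and s :: nat and res :: resolution and B N :: nat +
  fixes L T1 T2 Q :: nat
  assumes sizes: "n \<le> Q" "m \<le> Q" "N \<le> Q" "16 \<le> Q" "Q ^ 5 \<le> B"
    and it: "n < 4 * 4 ^ T2" "N < 4 * 4 ^ T2"
    and N0: "0 < N"
begin

lemma big:
  assumes "a \<le> Q" "b \<le> Q" "c \<le> Q" "d \<le> Q"
  shows "a * b * c * d < B" "a * b * c + d < B" "(a * b + c) * (a + d) + (a + d) < B"
proof -
  have Q0: "1 \<le> Q" using sizes(4) by simp
  have q: "a * b \<le> Q * Q" "a * b * c \<le> Q * Q * Q" "a * b * c * d \<le> Q * Q * Q * Q"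
    using assms by (auto intro!: mult_le_mono)
  have Q5: "16 * (Q * Q * Q * Q) \<le> B"
  proof -
    have "16 * (Q * Q * Q * Q) \<le> Q * (Q * Q * Q * Q)" using sizes(4) by (rule mult_le_mono1)
    also have "\<dots> = Q ^ 5" by (simp add: eval_nat_numeral)
    finally show ?thesis using sizes(5) by simp
  qed
  have m1: "Q \<le> Q * Q" "Q * Q \<le> Q * Q * Q" "Q * Q * Q \<le> Q * Q * Q * Q" using Q0 by (auto simp: mult.assoc)
  have p: "0 < Q * Q * Q * Q" using Q0 by simp
  show "a * b * c * d < B" using q(3) Q5 p by linarith
  show "a * b * c + d < B" using q(2) assms(4) Q5 m1 p by linarith
  have "(a * b + c) * (a + d) \<le> (2 * (Q * Q)) * (2 * Q)"
    using q(1) assms m1(1) by (intro mult_le_mono) linarith+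
  also have "\<dots> = 4 * (Q * Q * Q)" by (simp add: algebra_simps)
  finally show "(a * b + c) * (a + d) + (a + d) < B" using assms Q5 m1 p by linarith
qed

definition params :: "wmemory \<Rightarrow> bool" where
  "params W \<longleftrightarrow> W 0 0 = n \<and> W 0 1 = m \<and> W 0 2 = s \<and> W 0 4 = L \<and> W 0 6 = N \<and> W 0 7 = T1 \<and> W 0 8 = T2 \<and>
     W 0 9 = N * m \<and> W 0 10 = N * N * N \<and> W 0 11 = N * n + m \<and> W 0 12 = N * n + m + 1 \<and> W 0 13 = N + n \<and> W 0 14 = m * n"

text \<open>Array 7 assigns to each sampled vertex one of the indices under which it was sampled, no
  matter which.\<close>

definition base :: "(nat \<Rightarrow> nat) \<Rightarrow> wmemory \<Rightarrow> bool" where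
  "base S W \<longleftrightarrow> params W \<and> (\<forall>e<m. W 1 e = tail G e \<and> W 2 e = head G e \<and> W 8 e = rank e \<and> W 9 e = indeg e) \<and>
     (\<forall>i<N. S i < n \<and> W 6 i = S i \<and> W 7 (S i) < N \<and> S (W 7 (S i)) = S i)"

lemma params_eqs:
  assumes "params W"
  shows "W 0 0 = n" "W 0 1 = m" "W 0 2 = s" "W 0 4 = L" "W 0 6 = N" "W 0 7 = T1" "W 0 8 = T2" "W 0 9 = N * m" "W 0 10 = N * N * N"
    "W 0 11 = N * n + m" "W 0 12 = N * n + m + 1" "W 0 13 = N + n" "W 0 14 = m * n"
  using assms by (simp_all add: params_def)

lemma params_cong: "W' 0 = W 0 \<Longrightarrow> params W' = params W"
  by (simp add: params_def)

lemma base_cong: "base S W \<Longrightarrow> (\<And>a. a \<in> {0, 1, 2, 6, 7, 8, 9} \<Longrightarrow> W' a = W a) \<Longrightarrow> base S W'"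
  by (simp add: base_def params_def)

lemma row_B: "i < N \<Longrightarrow> v < n \<Longrightarrow> i * n + v < B"
  using row_lt[of i v] big(1)[of N n 1 1] sizes by simp

lemma decode_bf: "p < N * m \<Longrightarrow> p div m < N \<and> p mod m < m"
  by (cases "m = 0") (auto simp: less_mult_imp_div_less)

lemma hp_bfdesc:
  assumes b: "base S W"
    and Post: "\<And>W'. (\<And>a. a \<notin> {12, 13, 14, 15, 17, 18} \<Longrightarrow> W' a = W a) \<Longrightarrow>
      (\<And>p. p < N * m \<Longrightarrow> W' 12 p = 1 \<and> W' 13 p = p div m * n + head G (p mod m) \<and> W' 14 p = rank (p mod m) \<and>
         W' 15 p = indeg (p mod m) \<and> W' 17 p = p div m * n + tail G (p mod m) \<and> W' 18 p = N * n + p mod m) \<Longrightarrow> Post W' R"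
  shows "hp 0 bfdesc Post W R"
proof -
  have P: "params W" using b by (simp add: base_def)
  note pe = params_eqs[OF P]
  have be: "\<And>e. e < m \<Longrightarrow> W 1 e = tail G e \<and> W 2 e = head G e \<and> W 8 e = rank e \<and> W 9 e = indeg e" using b by (simp add: base_def)
  have NmB: "N * m < B" using big(1)[of N m 1 1] sizes by simp
  have ev: "wv B W' p bf_index = p div m" "wv B W' p bf_arc = p mod m" if "p < N * m" "W' 0 = W 0" for W' p
  proof -
    have "p div m < B" using that NmB div_le_dividend[of p m] by linarith
    then show "wv B W' p bf_index = p div m" using that pe by (simp add: bf_index_def)
    show "wv B W' p bf_arc = p mod m" unfolding bf_arc_def by (subst wv_wmd) (use that pe NmB in simp_all)
  qed
  have in1: "p div m * n < B" "p div m * n + v < B" if "p < N * m" "v < n" for p v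
    using row_B[of "p div m" v] decode_bf[OF that(1)] that(2) by simp_all
  have in2: "N * n < B" "N * n + p mod m < B" if "p < N * m" for p
    using big(2)[of N n 1 m] sizes decode_bf[OF that] by simp_all
  show ?thesis
    unfolding bfdesc_def seqs.simps
  proof (rule hp_seq0, rule hp_set)
    fix W1 assume W1: "\<And>b. b \<noteq> 12 \<Longrightarrow> W1 b = W b" "\<And>x. x < wv B W 0 (prm 9) \<Longrightarrow> W1 12 x = wv B W x (Const 1)"
    let ?P = "\<lambda>a e. Par (prm 9) (Const 1) (Store a Pid e)"
    let ?e13 = "Op Add (Op Mul bf_index (prm 0)) (Load 2 bf_arc)" and ?e14 = "Load 8 bf_arc" and ?e15 = "Load 9 bf_arc"
      and ?e17 = "Op Add (Op Mul bf_index (prm 0)) (Load 1 bf_arc)" and ?e18 = "Op Add (Op Mul (prm 6) (prm 0)) bf_arc"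
    show "hp 0 (Seq (?P 13 ?e13) (Seq (?P 14 ?e14) (Seq (?P 15 ?e15) (Seq (?P 17 ?e17) (?P 18 ?e18))))) Post W1 R"
    proof (rule hp_seq0, rule hp_set)
      fix W2 assume W2: "\<And>b. b \<noteq> 13 \<Longrightarrow> W2 b = W1 b" "\<And>x. x < wv B W1 0 (prm 9) \<Longrightarrow> W2 13 x = wv B W1 x ?e13"
      show "hp 0 (Seq (?P 14 ?e14) (Seq (?P 15 ?e15) (Seq (?P 17 ?e17) (?P 18 ?e18)))) Post W2 R"
      proof (rule hp_seq0, rule hp_set)
        fix W3 assume W3: "\<And>b. b \<noteq> 14 \<Longrightarrow> W3 b = W2 b" "\<And>x. x < wv B W2 0 (prm 9) \<Longrightarrow> W3 14 x = wv B W2 x ?e14"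
        show "hp 0 (Seq (?P 15 ?e15) (Seq (?P 17 ?e17) (?P 18 ?e18))) Post W3 R"
        proof (rule hp_seq0, rule hp_set)
          fix W4 assume W4: "\<And>b. b \<noteq> 15 \<Longrightarrow> W4 b = W3 b" "\<And>x. x < wv B W3 0 (prm 9) \<Longrightarrow> W4 15 x = wv B W3 x ?e15"
          show "hp 0 (Seq (?P 17 ?e17) (?P 18 ?e18)) Post W4 R"
          proof (rule hp_seq0, rule hp_set)
            fix W5 assume W5: "\<And>b. b \<noteq> 17 \<Longrightarrow> W5 b = W4 b" "\<And>x. x < wv B W4 0 (prm 9) \<Longrightarrow> W5 17 x = wv B W4 x ?e17"
            show "hp 0 (?P 18 ?e18) Post W5 R"
            proof (rule hp_set)
              fix W6 assume W6: "\<And>b. b \<noteq> 18 \<Longrightarrow> W6 b = W5 b" "\<And>x. x < wv B W5 0 (prm 9) \<Longrightarrow> W6 18 x = wv B W5 x ?e18"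
              show "Post W6 R"
              proof (rule Post)
                fix a :: nat assume "a \<notin> {12, 13, 14, 15, 17, 18}"
                then show "W6 a = W a" using W1(1) W2(1) W3(1) W4(1) W5(1) W6(1) by simp
              next
                fix p assume p: "p < N * m"
                have z: "W1 0 = W 0" "W2 0 = W 0" "W3 0 = W 0" "W4 0 = W 0" "W5 0 = W 0"
                  using W1(1) W2(1) W3(1) W4(1) W5(1) by simp_all
                have l: "W1 2 = W 2" "W2 8 = W 8" "W3 9 = W 9" "W4 1 = W 1"
                  using W1(1) W2(1) W3(1) W4(1) by simp_all
                have k: "W6 12 = W1 12" "W6 13 = W2 13" "W6 14 = W3 14" "W6 15 = W4 15" "W6 17 = W5 17"
                  using W1(1) W2(1) W3(1) W4(1) W5(1) W6(1) by simp_all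
                have d: "p mod m < m" "p div m < N" using decode_bf[OF p] by auto
                have hd: "head G (p mod m) < n" "tail G (p mod m) < n" using head_n tail_n d by auto
                show "W6 12 p = 1 \<and> W6 13 p = p div m * n + head G (p mod m) \<and> W6 14 p = rank (p mod m) \<and>
                  W6 15 p = indeg (p mod m) \<and> W6 17 p = p div m * n + tail G (p mod m) \<and> W6 18 p = N * n + p mod m"
                  unfolding k
                  using W1(2)[of p] W2(2)[of p] W3(2)[of p] W4(2)[of p] W5(2)[of p] W6(2)[of p] p
                  by (simp del: One_nat_def add: z l pe ev be[OF d(1)] in1[OF p hd(1)] in1[OF p hd(2)] in2[OF p])
              qed
            qed
          qed simp
        qed simp
      qed simp
    qed simp
  qed simp
qed

lemma bounds9: "N * n + m + 1 + N * m < B" "N * n + m + 1 + N * N * N < B" "(N * n + m) * (N + n) + (N + n) < B" "8 * (N + n) < B" "2 * n < B"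
proof -
  have q: "16 * (Q * Q * Q * Q) \<le> B" "1 \<le> Q"
  proof -
    have "16 * (Q * Q * Q * Q) \<le> Q * (Q * Q * Q * Q)" using sizes(4) by (rule mult_le_mono1)
    also have "\<dots> = Q ^ 5" by (simp add: eval_nat_numeral)
    finally show "16 * (Q * Q * Q * Q) \<le> B" using sizes(5) by simp
  qed (use sizes(4) in simp)
  have m1: "Q \<le> Q * Q" "Q * Q \<le> Q * Q * Q" "Q * Q * Q \<le> Q * Q * Q * Q" "0 < Q * Q * Q * Q" using q(2) by (auto simp: mult.assoc)
  have "16 * Q \<le> Q ^ 2" using mult_le_mono1[OF sizes(4), of Q] by (simp add: power2_eq_square)
  moreover have "Q ^ 2 < Q ^ 5" using sizes(4) by (intro power_strict_increasing) auto
  ultimately have lin: "16 * Q < B" using sizes(5) by linarith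
  have r: "N * n \<le> Q * Q" "N * m \<le> Q * Q" "N * N * N \<le> Q * Q * Q" using sizes by (auto intro!: mult_le_mono)
  show "N * n + m + 1 + N * m < B" "N * n + m + 1 + N * N * N < B"
    using r q m1 sizes by linarith+
  have "8 * (N + n) \<le> 16 * Q" using sizes(1,3) by simp
  then show "8 * (N + n) < B" using lin by (rule le_less_trans)
  have "2 * n \<le> 16 * Q" using sizes(1) by simp
  then show "2 * n < B" using lin by (rule le_less_trans)
  show "(N * n + m) * (N + n) + (N + n) < B" by (rule big(3)) (use sizes in auto)
qed

lemma hp_bfprep:
  assumes b: "base S W"
    and Post: "\<And>W'. phase n m G w s res B N 9 W' S \<Longrightarrow>
      (\<And>i e. i < N \<Longrightarrow> e < m \<Longrightarrow> \<exists>p<W' 0 9. W' 12 p \<noteq> 0 \<and> W' 13 p = i * n + head G e \<and> W' 17 p = i * n + tail G e \<and> W' 18 p = N * n + e) \<Longrightarrow>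
      (\<And>a. a \<notin> {12, 13, 14, 15, 16, 17, 18, 19, 29, 31, 32, 33, 34, 35} \<Longrightarrow> W' a = W a) \<Longrightarrow> Post W' R"
  shows "hp 0 (Seq bfdesc (prep (prm 9))) Post W R"
proof (rule hp_seq0, rule hp_bfdesc[OF b])
  fix W1 assume o: "\<And>a. a \<notin> {12, 13, 14, 15, 17, 18} \<Longrightarrow> W1 a = W a"
    and v: "\<And>p. p < N * m \<Longrightarrow> W1 12 p = 1 \<and> W1 13 p = p div m * n + head G (p mod m) \<and> W1 14 p = rank (p mod m) \<and>
         W1 15 p = indeg (p mod m) \<and> W1 17 p = p div m * n + tail G (p mod m) \<and> W1 18 p = N * n + p mod m"
  have P: "params W1" using b o params_cong[of W1 W] by (simp add: base_def)
  note pe = params_eqs[OF P]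
  have code: "i * m + e < N * m \<and> (i * m + e) div m = i \<and> (i * m + e) mod m = e" if "i < N" "e < m" for i e
  proof -
    have "i * m + e < Suc i * m" using that by simp
    also have "\<dots> \<le> N * m" using that(1) by (intro mult_le_mono) auto
    finally show ?thesis using that by simp
  qed
  show "hp 0 (prep (prm 9)) Post W1 R"
  proof (rule hp_prep, unfold pe)
    fix p assume p: "p < N * m"
    note d = decode_bf[OF p]
    show "W1 13 p < N * n + m \<and> W1 17 p < N * n + m \<and> W1 18 p < N * n + m"
      using v[OF p] d row_lt[of "p div m" "head G (p mod m)"] row_lt[of "p div m" "tail G (p mod m)"] head_n tail_n by simp
    show "W1 14 p < W1 15 p \<and> W1 15 p \<le> N + n" using v[OF p] d rank_less indeg_le[of "p mod m"] by simp
    show "W1 15 p < 4 * 4 ^ T2" using v[OF p] indeg_le[of "p mod m"] it by simp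
  next
    fix p q assume p: "p < N * m" and q: "q < N * m" and e: "W1 13 p = W1 13 q"
    note dp = decode_bf[OF p] and dq = decode_bf[OF q]
    have "p div m * n + head G (p mod m) = q div m * n + head G (q mod m)" using e v[OF p] v[OF q] by simp
    then have h: "p div m = q div m" "head G (p mod m) = head G (q mod m)"
      using mult_add_unique[of "p div m" n "head G (p mod m)" "q div m" "head G (q mod m)"] head_n dp dq by auto
    have "indeg (p mod m) = indeg (q mod m)" using h(2) by (simp add: indeg_def)
    moreover have "p = q" if "rank (p mod m) = rank (q mod m)"
    proof -
      have "p mod m = q mod m" using rank_inj[OF _ _ h(2) that] dp dq by simp
      then show ?thesis using h(1) by (metis div_mult_mod_eq)
    qed
    ultimately show "W1 15 p = W1 15 q \<and> (W1 14 p = W1 14 q \<longrightarrow> p = q)" using v[OF p] v[OF q] by auto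
  next
    fix p r assume p: "p < N * m" and r: "r < W1 15 p"
    note d = decode_bf[OF p]
    have "r < indeg (p mod m)" using r v[OF p] by simp
    then obtain e where e: "e < m" "head G e = head G (p mod m)" "rank e = r" using rank_onto by blast
    note c = code[OF d[THEN conjunct1] e(1)]
    have vq: "W1 12 (p div m * m + e) = 1" "W1 13 (p div m * m + e) = W1 13 p" "W1 14 (p div m * m + e) = r"
      using v[of "p div m * m + e"] c e v[OF p] by simp_all
    show "\<exists>q<N * m. W1 12 q \<noteq> 0 \<and> W1 13 q = W1 13 p \<and> W1 14 q = r"
      by (rule exI[of _ "p div m * m + e"]) (use vq c in simp)
  next
    fix W' assume dsc: "desc res B 9 W'" and o': "\<And>a. a \<notin> {16, 19, 29, 31, 32, 33, 34, 35} \<Longrightarrow> W' a = W1 a"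
    have z: "W' 0 = W1 0" "W' 12 = W1 12" "W' 13 = W1 13" "W' 17 = W1 17" "W' 18 = W1 18" using o' by simp_all
    have arcs: "\<exists>p<W' 0 9. W' 12 p \<noteq> 0 \<and> W' 13 p = i * n + head G e \<and> W' 17 p = i * n + tail G e \<and> W' 18 p = N * n + e" if "i < N" "e < m" for i e
      by (rule exI[of _ "i * m + e"]) (use code[OF that] v[of "i * m + e"] in \<open>simp add: z pe\<close>)
    show "Post W' R"
    proof (rule Post)
      show "phase n m G w s res B N 9 W' S"
      proof (intro phase.intro phase_axioms.intro, rule alg_axioms, rule dsc, unfold z pe)
        fix p assume p: "p < N * m"
        note d = decode_bf[OF p]
        show "W1 13 p < N * n" using v[OF p] d row_lt head_n by simp
        fix q q' assume q: "cell_walk S (W1 17 p) q" "cell_walk S (W1 18 p) q'"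
        have "awalk (S (p div m)) q (tail G (p mod m))" using q(1) v[OF p] d row_walk tail_n by simp
        moreover have "q' = [p mod m]" using q(2) v[OF p] d arc_walk by simp
        moreover have "awalk (tail G (p mod m)) [p mod m] (head G (p mod m))" using arc_implies_awalk d arcs_G by simp
        ultimately have "awalk (S (p div m)) (q @ q') (head G (p mod m))" using awalk_appendI by blast
        then show "cell_walk S (W1 13 p) (q @ q')" using v[OF p] d row_walk head_n by simp
      qed simp_all
      show "W' a = W a" if "a \<notin> {12, 13, 14, 15, 16, 17, 18, 19, 29, 31, 32, 33, 34, 35}" for a
        using o'[of a] o[of a] that by simp
    qed (rule arcs)
  qed (use bounds9 in simp_all)
qed simp

end

context machine
begin

text \<open>Bounds obtained by summing failures may exceed 1, in which case the judgement holds
  trivially.\<close>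

lemma hp_seq0': "hp 0 p (hp b q Q) W R \<Longrightarrow> 0 \<le> b \<Longrightarrow> hp b (Seq p q) Q W R"
  using hp_seq_add[of 0 p "hp b q Q" W R b q Q] by simp

end

context config
begin

lemma decode_mx: "p < N * N * N \<Longrightarrow> p div (N * N) < N \<and> p div N mod N < N \<and> p mod N < N"
  using N0 by (auto simp: less_mult_imp_div_less mult.assoc)

lemma code_mx: "i < N \<Longrightarrow> c < N \<Longrightarrow> k < N \<Longrightarrow> (i * N + c) * N + k < N * N * N \<and>
  ((i * N + c) * N + k) div (N * N) = i \<and> ((i * N + c) * N + k) div N mod N = c \<and> ((i * N + c) * N + k) mod N = k"
proof -
  assume a: "i < N" "c < N" "k < N"
  have "i * N + c < Suc i * N" using a by simp
  also have "\<dots> \<le> N * N" using a by (intro mult_le_mono) auto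
  finally have 1: "i * N + c < N * N" .
  have "(i * N + c) * N + k < Suc (i * N + c) * N" using a by simp
  also have "\<dots> \<le> (N * N) * N" using 1 by (intro mult_le_mono) auto
  finally show ?thesis using a by (simp add: div_mult2_eq)
qed

lemma hp_mxdesc:
  assumes b: "base S W"
    and Post: "\<And>W'. (\<And>a. a \<notin> {12, 13, 14, 15, 17, 18} \<Longrightarrow> W' a = W a) \<Longrightarrow>
      (\<And>p. p < N * N * N \<Longrightarrow> (W' 12 p \<noteq> 0 \<longleftrightarrow> W 7 (S (p div N mod N)) = p div N mod N) \<and>
         W' 13 p = p div (N * N) * n + S (p div N mod N) \<and> W' 14 p = p mod N \<and> W' 15 p = N \<and>
         W' 17 p = p div (N * N) * n + S (p mod N) \<and> W' 18 p = p mod N * n + S (p div N mod N)) \<Longrightarrow> Post W' R"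
  shows "hp 0 mxdesc Post W R"
proof -
  have P: "params W" using b by (simp add: base_def)
  note pe = params_eqs[OF P]
  have be: "\<And>i. i < N \<Longrightarrow> S i < n \<and> W 6 i = S i \<and> W 7 (S i) < N" using b by (simp add: base_def)
  have N3B: "N * N * N < B" "N * N < B" using big(1)[of N N N 1] big(1)[of N N 1 1] sizes by simp_all
  have ev: "wv B W' p mx_i = p div (N * N)" "wv B W' p mx_c = p div N mod N" "wv B W' p mx_k = p mod N"
    if "p < N * N * N" "W' 0 = W 0" for W' p
  proof -
    have pB: "p < B" "p div N < B" "p div (N * N) < B"
      using that N3B div_le_dividend[of p N] div_le_dividend[of p "N * N"] by linarith+
    show "wv B W' p mx_i = p div (N * N)" using that pe pB N3B by (simp add: mx_i_def)
    have dN: "wv B W' p (Op Div Pid (prm 6)) = p div N" using that pe pB by simp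
    show "wv B W' p mx_c = p div N mod N" unfolding mx_c_def
      by (subst wv_wmd) (use that pe pB dN in simp_all)
    show "wv B W' p mx_k = p mod N" unfolding mx_k_def by (subst wv_wmd) (use that pe pB in simp_all)
  qed
  have in1: "i * n < B" "i * n + S k < B" if "i < N" "k < N" for i k
    using row_B[of i "S k"] be[OF that(2)] that by simp_all
  show ?thesis
    unfolding mxdesc_def seqs.simps
  proof (rule hp_seq0, rule hp_set)
    let ?P = "\<lambda>a e. Par (prm 10) (Const 1) (Store a Pid e)"
    let ?e12 = "weq (Load 7 (Load 6 mx_c)) mx_c"
    let ?e13 = "Op Add (Op Mul mx_i (prm 0)) (Load 6 mx_c)" and ?e14 = "mx_k" and ?e15 = "prm 6"
      and ?e17 = "Op Add (Op Mul mx_i (prm 0)) (Load 6 mx_k)" and ?e18 = "Op Add (Op Mul mx_k (prm 0)) (Load 6 mx_c)"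
    fix W1 assume W1: "\<And>b. b \<noteq> 12 \<Longrightarrow> W1 b = W b" "\<And>x. x < wv B W 0 (prm 10) \<Longrightarrow> W1 12 x = wv B W x ?e12"
    show "hp 0 (Seq (?P 13 ?e13) (Seq (?P 14 ?e14) (Seq (?P 15 ?e15) (Seq (?P 17 ?e17) (?P 18 ?e18))))) Post W1 R"
    proof (rule hp_seq0, rule hp_set)
      fix W2 assume W2: "\<And>b. b \<noteq> 13 \<Longrightarrow> W2 b = W1 b" "\<And>x. x < wv B W1 0 (prm 10) \<Longrightarrow> W2 13 x = wv B W1 x ?e13"
      show "hp 0 (Seq (?P 14 ?e14) (Seq (?P 15 ?e15) (Seq (?P 17 ?e17) (?P 18 ?e18)))) Post W2 R"
      proof (rule hp_seq0, rule hp_set)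
        fix W3 assume W3: "\<And>b. b \<noteq> 14 \<Longrightarrow> W3 b = W2 b" "\<And>x. x < wv B W2 0 (prm 10) \<Longrightarrow> W3 14 x = wv B W2 x ?e14"
        show "hp 0 (Seq (?P 15 ?e15) (Seq (?P 17 ?e17) (?P 18 ?e18))) Post W3 R"
        proof (rule hp_seq0, rule hp_set)
          fix W4 assume W4: "\<And>b. b \<noteq> 15 \<Longrightarrow> W4 b = W3 b" "\<And>x. x < wv B W3 0 (prm 10) \<Longrightarrow> W4 15 x = wv B W3 x ?e15"
          show "hp 0 (Seq (?P 17 ?e17) (?P 18 ?e18)) Post W4 R"
          proof (rule hp_seq0, rule hp_set)
            fix W5 assume W5: "\<And>b. b \<noteq> 17 \<Longrightarrow> W5 b = W4 b" "\<And>x. x < wv B W4 0 (prm 10) \<Longrightarrow> W5 17 x = wv B W4 x ?e17"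
            show "hp 0 (?P 18 ?e18) Post W5 R"
            proof (rule hp_set)
              fix W6 assume W6: "\<And>b. b \<noteq> 18 \<Longrightarrow> W6 b = W5 b" "\<And>x. x < wv B W5 0 (prm 10) \<Longrightarrow> W6 18 x = wv B W5 x ?e18"
              show "Post W6 R"
              proof (rule Post)
                fix a :: nat assume "a \<notin> {12, 13, 14, 15, 17, 18}"
                then show "W6 a = W a" using W1(1) W2(1) W3(1) W4(1) W5(1) W6(1) by simp
              next
                fix p assume p: "p < N * N * N"
                have z: "W1 0 = W 0" "W2 0 = W 0" "W3 0 = W 0" "W4 0 = W 0" "W5 0 = W 0"
                  using W1(1) W2(1) W3(1) W4(1) W5(1) by simp_all
                have l: "W1 6 = W 6" "W2 6 = W 6" "W3 6 = W 6" "W4 6 = W 6" "W5 6 = W 6"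
                  using W1(1) W2(1) W3(1) W4(1) W5(1) by simp_all
                have k: "W6 12 = W1 12" "W6 13 = W2 13" "W6 14 = W3 14" "W6 15 = W4 15" "W6 17 = W5 17"
                  using W1(1) W2(1) W3(1) W4(1) W5(1) W6(1) by simp_all
                have d: "p div (N * N) < N" "p div N mod N < N" "p mod N < N" using decode_mx[OF p] by auto
                show "(W6 12 p \<noteq> 0 \<longleftrightarrow> W 7 (S (p div N mod N)) = p div N mod N) \<and>
                   W6 13 p = p div (N * N) * n + S (p div N mod N) \<and> W6 14 p = p mod N \<and> W6 15 p = N \<and>
                   W6 17 p = p div (N * N) * n + S (p mod N) \<and> W6 18 p = p mod N * n + S (p div N mod N)"
                  unfolding k
                  using W1(2)[of p] W2(2)[of p] W3(2)[of p] W4(2)[of p] W5(2)[of p] W6(2)[of p] p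
                  by (simp add: z l pe ev be[OF d(2)] be[OF d(3)] in1[OF d(1,2)] in1[OF d(1,3)] in1[OF d(3,2)])
              qed
            qed
          qed simp
        qed simp
      qed simp
    qed simp
  qed simp
qed

lemma hp_mxprep:
  assumes b: "base S W"
    and Post: "\<And>W'. phase n m G w s res B N 10 W' S \<Longrightarrow>
      (\<And>i k c. i < N \<Longrightarrow> k < N \<Longrightarrow> c < N \<Longrightarrow> W 7 (S c) = c \<Longrightarrow> \<exists>p<W' 0 10. W' 12 p \<noteq> 0 \<and>
         W' 13 p = i * n + S c \<and> W' 17 p = i * n + S k \<and> W' 18 p = k * n + S c) \<Longrightarrow>
      (\<And>a. a \<notin> {12, 13, 14, 15, 16, 17, 18, 19, 29, 31, 32, 33, 34, 35} \<Longrightarrow> W' a = W a) \<Longrightarrow> Post W' R"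
  shows "hp 0 (Seq mxdesc (prep (prm 10))) Post W R"
proof (rule hp_seq0, rule hp_mxdesc[OF b])
  fix W1 assume o: "\<And>a. a \<notin> {12, 13, 14, 15, 17, 18} \<Longrightarrow> W1 a = W a"
    and v: "\<And>p. p < N * N * N \<Longrightarrow> (W1 12 p \<noteq> 0 \<longleftrightarrow> W 7 (S (p div N mod N)) = p div N mod N) \<and>
         W1 13 p = p div (N * N) * n + S (p div N mod N) \<and> W1 14 p = p mod N \<and> W1 15 p = N \<and>
         W1 17 p = p div (N * N) * n + S (p mod N) \<and> W1 18 p = p mod N * n + S (p div N mod N)"
  have P: "params W1" using b o params_cong[of W1 W] by (simp add: base_def)
  note pe = params_eqs[OF P]
  have Sn: "S i < n" if "i < N" for i using b that by (simp add: base_def)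
  show "hp 0 (prep (prm 10)) Post W1 R"
  proof (rule hp_prep, unfold pe)
    fix p assume p: "p < N * N * N"
    note d = decode_mx[OF p]
    have "p div (N * N) * n + S (p div N mod N) < N * n" "p div (N * N) * n + S (p mod N) < N * n" "p mod N * n + S (p div N mod N) < N * n"
      using d Sn by (auto intro!: row_lt)
    then show "W1 13 p < N * n + m \<and> W1 17 p < N * n + m \<and> W1 18 p < N * n + m"
      using v[OF p] by simp
    show "W1 14 p < W1 15 p \<and> W1 15 p \<le> N + n" using v[OF p] d by simp
    show "W1 15 p < 4 * 4 ^ T2" using v[OF p] it by simp
  next
    fix p q assume p: "p < N * N * N" and q: "q < N * N * N" and a: "W1 12 p \<noteq> 0" "W1 12 q \<noteq> 0" and e: "W1 13 p = W1 13 q"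
    note dp = decode_mx[OF p] and dq = decode_mx[OF q]
    have "p div (N * N) * n + S (p div N mod N) = q div (N * N) * n + S (q div N mod N)" using e v[OF p] v[OF q] by simp
    moreover have "S (p div N mod N) < n" "S (q div N mod N) < n" using Sn dp dq by blast+
    ultimately have h: "p div (N * N) = q div (N * N)" "S (p div N mod N) = S (q div N mod N)"
      using mult_add_unique by blast+
    have "W 7 (S (p div N mod N)) = p div N mod N" "W 7 (S (q div N mod N)) = q div N mod N"
      using a v[OF p] v[OF q] by blast+
    \<comment> \<open>Both columns are switched on, hence both equal the one index that array 7
      assigns to their common vertex.\<close>
    then have e1: "p div N mod N = q div N mod N" using h(2) by metis
    have e2: "p div N div N = q div N div N" using h(1) by (simp only: div_mult2_eq)
    have eqI: "x = y" if "x div N = y div N" "x mod N = y mod N" for x y using that by (metis div_mult_mod_eq)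
    have pq: "p div N = q div N" by (rule eqI[OF e2 e1])
    have "W1 15 p = N" "W1 15 q = N" "W1 14 p = p mod N" "W1 14 q = q mod N" using v[OF p] v[OF q] by blast+
    then show "W1 15 p = W1 15 q \<and> (W1 14 p = W1 14 q \<longrightarrow> p = q)" using eqI[OF pq] by simp
  next
    fix p r assume p: "p < N * N * N" and a: "W1 12 p \<noteq> 0" and r: "r < W1 15 p"
    note d = decode_mx[OF p]
    have rN: "r < N" using r v[OF p] by simp
    note c = code_mx[of "p div (N * N)" "p div N mod N" r]
    let ?q = "(p div (N * N) * N + p div N mod N) * N + r"
    have c': "?q < N * N * N" "?q div (N * N) = p div (N * N)" "?q div N mod N = p div N mod N" "?q mod N = r"
      using c d rN by blast+
    show "\<exists>q<N * N * N. W1 12 q \<noteq> 0 \<and> W1 13 q = W1 13 p \<and> W1 14 q = r"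
      by (rule exI[of _ ?q]) (use v[OF p] v[OF c'(1), unfolded c'(2-4)] c'(1) a in simp)
  next
    fix W' assume dsc: "desc res B 10 W'" and o': "\<And>a. a \<notin> {16, 19, 29, 31, 32, 33, 34, 35} \<Longrightarrow> W' a = W1 a"
    have z: "W' 0 = W1 0" "W' 12 = W1 12" "W' 13 = W1 13" "W' 17 = W1 17" "W' 18 = W1 18" using o' by simp_all
    have tr: "\<exists>p<W' 0 10. W' 12 p \<noteq> 0 \<and> W' 13 p = i * n + S c \<and> W' 17 p = i * n + S k \<and> W' 18 p = k * n + S c"
      if ikc: "i < N" "k < N" "c < N" and al: "W 7 (S c) = c" for i k c
    proof -
      let ?q = "(i * N + c) * N + k"
      have c': "?q < N * N * N" "?q div (N * N) = i" "?q div N mod N = c" "?q mod N = k"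
        using code_mx[OF ikc(1,3,2)] by blast+
      show ?thesis
        by (rule exI[of _ ?q]) (use v[OF c'(1), unfolded c'(2-4)] c'(1) al in \<open>simp add: z pe\<close>)
    qed
    show "Post W' R"
    proof (rule Post)
      show "phase n m G w s res B N 10 W' S"
      proof (intro phase.intro phase_axioms.intro, rule alg_axioms, rule dsc, unfold z pe)
        fix p assume p: "p < N * N * N"
        note d = decode_mx[OF p]
        have i: "p div (N * N) < N" "p div N mod N < N" "p mod N < N" using d by auto
        show "W1 13 p < N * n" using v[OF p] row_lt[OF i(1) Sn[OF i(2)]] by simp
        fix q q' assume q: "cell_walk S (W1 17 p) q" "cell_walk S (W1 18 p) q'"
        have "awalk (S (p div (N * N))) q (S (p mod N))" using q(1) v[OF p] row_walk[OF i(1) Sn[OF i(3)]] by simp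
        moreover have "awalk (S (p mod N)) q' (S (p div N mod N))" using q(2) v[OF p] row_walk[OF i(3) Sn[OF i(2)]] by simp
        ultimately have "awalk (S (p div (N * N))) (q @ q') (S (p div N mod N))" by (rule awalk_appendI)
        then show "cell_walk S (W1 13 p) (q @ q')" using v[OF p] row_walk[OF i(1) Sn[OF i(2)]] by simp
      qed simp_all
      show "W' a = W a" if "a \<notin> {12, 13, 14, 15, 16, 17, 18, 19, 29, 31, 32, 33, 34, 35}" for a
        using o'[of a] o[of a] that by simp
    qed (rule tr)
  qed (use bounds9 in \<open>simp_all add: add.assoc\<close>)
qed simp

definition keeps :: "(nat \<Rightarrow> nat) \<Rightarrow> wmemory \<Rightarrow> rmemory \<Rightarrow> wmemory \<Rightarrow> rmemory \<Rightarrow> bool" where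
  "keeps S W R W' R' \<longleftrightarrow> base S W' \<and> cells S W' R' \<and> W' 7 = W 7 \<and> (\<forall>i<N. \<forall>v<n. exact S i v W R \<longrightarrow> exact S i v W' R')"

lemma exact_cong: "W' 3 = W 3 \<Longrightarrow> W' 5 = W 5 \<Longrightarrow> exact S i v W' R = exact S i v W R"
  by (simp add: exact_def lab_def)

lemma cells_cong: "W' 3 = W 3 \<Longrightarrow> W' 5 = W 5 \<Longrightarrow> cells S W' R = cells S W R"
  by (simp add: cells_def lab_def)

text \<open>Asking for an exact vertex \<open>y\<close> and an optimal walk with at most
  \<open>H\<close> arcs behind it covers both uses: at first \<open>y\<close> is the sample itself
  and \<open>r = []\<close>, later \<open>y\<close> is a sample that squaring has reached. The
  failures are summed over all \<open>N * n\<close> cells. If there are no arcs the bound is 0,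
  which is needed because the loop then performs no round at all.\<close>

lemma hp_bf:
  assumes b: "base S W" "cells S W R"
  shows "hp (real (N * n) * (if m = 0 then 0 else 2 ^ H * (63 / 64) ^ T1)) bf (\<lambda>W' R'. keeps S W R W' R' \<and>
     (\<forall>i<N. \<forall>v<n. (\<exists>y r q. exact S i y W R \<and> opt (S i) (r @ q) v \<and> awalk (S i) r y \<and> awalk y q v \<and> length q \<le> H) \<longrightarrow>
        exact S i v W' R')) W R"
  unfolding bf_def
proof (rule hp_seq0', rule hp_bfprep[OF b(1)])
  let ?e = "if m = 0 then 0 else 2 ^ H * (63 / 64) ^ T1 :: real"
  let ?while = "While (prm 7) (Const 1) (round (prm 9))"
  fix W1 assume ph: "phase n m G w s res B N 9 W1 S"
    and arcs: "\<And>i e. i < N \<Longrightarrow> e < m \<Longrightarrow> \<exists>p<W1 0 9. W1 12 p \<noteq> 0 \<and> W1 13 p = i * n + head G e \<and> W1 17 p = i * n + tail G e \<and> W1 18 p = N * n + e"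
    and o: "\<And>a. a \<notin> {12, 13, 14, 15, 16, 17, 18, 19, 29, 31, 32, 33, 34, 35} \<Longrightarrow> W1 a = W a"
  interpret p: phase n m G w s res B N 9 W1 S by (rule ph)
  have o35: "W1 3 = W 3" "W1 5 = W 5" using o by simp_all
  have inv: "p.inv W1 R" using b(2) cells_cong[OF o35] by (simp add: p.inv_def)
  have T: "W1 0 7 = T1" using o[of 0] params_eqs(6)[of W] b(1) by (simp add: base_def)
  have k: "hp 0 ?while (keeps S W R) W1 R"
  proof (rule hp_mono[OF p.hp_for_inv'[OF inv] order_refl])
    fix W2 R2 assume h: "p.inv W2 R2 \<and> (\<forall>i<N. \<forall>v<n. exact S i v W1 R \<longrightarrow> exact S i v W2 R2)"
    then have o2: "W2 a = W a" if "a \<in> {0, 1, 2, 6, 7, 8, 9}" for a using that o[of a] unfolding p.inv_def by auto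
    show "keeps S W R W2 R2"
      unfolding keeps_def using base_cong[OF b(1) o2] o2[of 7] h exact_cong[OF o35] by (simp add: p.inv_def)
  qed
  let ?c = "\<lambda>i v. \<exists>y r q. exact S i y W R \<and> opt (S i) (r @ q) v \<and> awalk (S i) r y \<and> awalk y q v \<and> length q \<le> H"
  have one: "hp ?e ?while (\<lambda>W' R'. ?c i v \<longrightarrow> exact S i v W' R') W1 R" if iv: "i < N" for i v
  proof (cases "?c i v")
    case True
    then obtain y r q where c: "exact S i y W R" "opt (S i) (r @ q) v" "awalk (S i) r y" "awalk y q v" "length q \<le> H" by blast
    have "hp (if q = [] then 0 else 2 ^ length q * (63 / 64) ^ W1 0 7) ?while (exact S i v) W1 R"
      by (rule p.bellman_ford[OF arcs iv inv _ c(2-4)]) (use c(1) exact_cong[OF o35] in simp_all)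
    moreover have "(if q = [] then 0 else 2 ^ length q * (63 / 64) ^ W1 0 7) \<le> ?e"
    proof (cases "q = []")
      case False
      then obtain e q' where "q = e # q'" by (cases q) auto
      then have "e < m" using c(4) arcs_G by (auto simp: awalk_Cons_iff)
      then show ?thesis using False T c(5) by (auto intro!: mult_right_mono power_increasing)
    qed simp
    ultimately show ?thesis by (rule hp_mono) simp
  next
    case False
    have "0 \<le> ?e" by simp
    then show ?thesis using False by (intro hp_mono[OF k]) auto
  qed
  have "hp (real (card ({..<N} \<times> {..<n})) * ?e) ?while (\<lambda>W' R'. \<forall>iv\<in>{..<N} \<times> {..<n}. ?c (fst iv) (snd iv) \<longrightarrow> exact S (fst iv) (snd iv) W' R') W1 R"
    by (rule hp_ball) (use one in auto)
  then have "hp (real (N * n) * ?e) ?while (\<lambda>W' R'. \<forall>iv\<in>{..<N} \<times> {..<n}. ?c (fst iv) (snd iv) \<longrightarrow> exact S (fst iv) (snd iv) W' R') W1 R"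
    by (simp add: card_cartesian_product)
  from hp_conj0[OF k this] show "hp (real (N * n) * ?e) ?while (\<lambda>W' R'. keeps S W R W' R' \<and>
     (\<forall>i<N. \<forall>v<n. ?c i v \<longrightarrow> exact S i v W' R')) W1 R"
    by (rule hp_mono[OF _ order_refl]) auto
qed simp

text \<open>All rows take part in the squaring, but only the row of the source is claimed, for which
  summing over \<open>n\<close> end vertices suffices.\<close>

lemma hp_mx:
  assumes b: "base S W" "cells S W R"
  shows "hp (real n * (real n * (63 / 64) ^ T2)) mx (\<lambda>W' R'. keeps S W R W' R' \<and>
     (\<forall>v<n. (\<exists>xs. route S (\<lambda>c. W 7 (S c) = c) 0 xs \<and> links (\<lambda>a b. exact S a (S b) W R) 0 xs \<and>
         opt (S 0) (route_walk xs) v \<and> S (route_end 0 xs) = v \<and> xs \<noteq> [] \<and> length xs \<le> n) \<longrightarrow> exact S 0 v W' R')) W R"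
  unfolding mx_def
proof (rule hp_seq0', rule hp_mxprep[OF b(1)])
  let ?e = "real n * (63 / 64) ^ T2 :: real"
  let ?while = "While (prm 8) (Const 1) (round (prm 10))"
  fix W1 assume ph: "phase n m G w s res B N 10 W1 S"
    and triples: "\<And>i k c. i < N \<Longrightarrow> k < N \<Longrightarrow> c < N \<Longrightarrow> W 7 (S c) = c \<Longrightarrow> \<exists>p<W1 0 10. W1 12 p \<noteq> 0 \<and>
         W1 13 p = i * n + S c \<and> W1 17 p = i * n + S k \<and> W1 18 p = k * n + S c"
    and o: "\<And>a. a \<notin> {12, 13, 14, 15, 16, 17, 18, 19, 29, 31, 32, 33, 34, 35} \<Longrightarrow> W1 a = W a"
  interpret p: phase n m G w s res B N 10 W1 S by (rule ph)
  have o35: "W1 3 = W 3" "W1 5 = W 5" using o by simp_all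
  have inv: "p.inv W1 R" using b(2) cells_cong[OF o35] by (simp add: p.inv_def)
  have T: "W1 0 8 = T2" using o[of 0] params_eqs(7)[of W] b(1) by (simp add: base_def)
  have k: "hp 0 ?while (keeps S W R) W1 R"
  proof (rule hp_mono[OF p.hp_for_inv'[OF inv] order_refl])
    fix W2 R2 assume h: "p.inv W2 R2 \<and> (\<forall>i<N. \<forall>v<n. exact S i v W1 R \<longrightarrow> exact S i v W2 R2)"
    then have o2: "W2 a = W a" if "a \<in> {0, 1, 2, 6, 7, 8, 9}" for a using that o[of a] unfolding p.inv_def by auto
    show "keeps S W R W2 R2"
      unfolding keeps_def using base_cong[OF b(1) o2] o2[of 7] h exact_cong[OF o35] by (simp add: p.inv_def)
  qed
  let ?c = "\<lambda>v. \<exists>xs. route S (\<lambda>c. W 7 (S c) = c) 0 xs \<and> links (\<lambda>a b. exact S a (S b) W R) 0 xs \<and>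
         opt (S 0) (route_walk xs) v \<and> S (route_end 0 xs) = v \<and> xs \<noteq> [] \<and> length xs \<le> n"
  have one: "hp ?e ?while (\<lambda>W' R'. ?c v \<longrightarrow> exact S 0 v W' R') W1 R" for v
  proof (cases "?c v")
    case True
    then obtain xs where c: "route S (\<lambda>c. W 7 (S c) = c) 0 xs" "links (\<lambda>a b. exact S a (S b) W R) 0 xs"
         "opt (S 0) (route_walk xs) v" "S (route_end 0 xs) = v" "xs \<noteq> []" "length xs \<le> n" by blast
    have "hp (real (length xs - 1) * (63 / 64) ^ W1 0 8) ?while (exact S 0 (S (route_end 0 xs))) W1 R"
      by (rule p.doubling[OF triples inv N0 c(1)]) (use c exact_cong[OF o35] in simp_all)
    moreover have "real (length xs - 1) * (63 / 64) ^ W1 0 8 \<le> ?e"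
      unfolding T by (rule mult_right_mono) (use c(6) in simp_all)
    ultimately show ?thesis by (rule hp_mono) (use c(4) in simp)
  next
    case False
    have "0 \<le> ?e" by simp
    then show ?thesis using False by (intro hp_mono[OF k]) auto
  qed
  have "hp (real (card {..<n}) * ?e) ?while (\<lambda>W' R'. \<forall>v\<in>{..<n}. ?c v \<longrightarrow> exact S 0 v W' R') W1 R"
    by (rule hp_ball) (use one in auto)
  then have "hp (real n * ?e) ?while (\<lambda>W' R'. \<forall>v\<in>{..<n}. ?c v \<longrightarrow> exact S 0 v W' R') W1 R"
    by (simp only: card_lessThan)
  from hp_conj0[OF k this] show "hp (real n * ?e) ?while (\<lambda>W' R'. keeps S W R W' R' \<and> (\<forall>v<n. ?c v \<longrightarrow> exact S 0 v W' R')) W1 R"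
    by (rule hp_mono[OF _ order_refl]) auto
qed simp

end

section \<open>Preparation and result\<close>

definition pw :: wexp where "pw = Load 36 (Const 0)"

text \<open>Row \<open>e\<close> of array 11 is the row of the adjacency matrix that belongs to the
  head of \<open>e\<close>. One row per arc, not per vertex, keeps the work of a prefix step at
  \<open>m * n\<close> instead of \<open>n * n\<close>, which matters for graphs with few
  arcs.\<close>

definition marks :: prog where
  "marks = seqs
    [Par (prm 1) (Const 1) (Store 30 (Op Add (Op Mul (Load 2 Pid) (prm 0)) (Load 1 Pid)) (Const 1)),
     Par (prm 14) (Const 1) (Store 11 Pid (Load 30 (Op Add (Op Mul (Load 2 (Op Div Pid (prm 0))) (prm 0)) (wmd Pid (prm 0))))),
     Par (Const 1) (Const 1) (Store 36 Pid (Const 1))]"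

text \<open>Prefix sums by doubling: a window of width \<open>k\<close> is joined with the adjacent
  one before it, unless it already reaches the beginning of the row.\<close>

definition prefix_round :: prog where
  "prefix_round = Seq
    (Par (prm 14) (wnot (Op Less (wmd Pid (prm 0)) pw)) (Store 11 Pid (Op Add (Load 11 Pid) (Load 11 (Op Sub Pid pw)))))
    (Par (Const 1) (Const 1) (Store 36 Pid (Op Add pw pw)))"

definition ranks :: prog where
  "ranks = Seq marks (Seq (While (prm 4) (Const 1) prefix_round) (Seq
    (Par (prm 1) (Const 1) (Store 8 Pid (Op Sub (Load 11 (Op Add (Op Mul Pid (prm 0)) (Load 1 Pid))) (Const 1))))
    (Par (prm 1) (Const 1) (Store 9 Pid (Load 11 (Op Add (Op Mul Pid (prm 0)) (Op Sub (prm 0) (Const 1))))))))"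

context sssp
begin

definition adj :: "nat \<Rightarrow> nat \<Rightarrow> bool" where "adj v u \<longleftrightarrow> (\<exists>e<m. head G e = v \<and> tail G e = u)"

definition window :: "nat \<Rightarrow> nat \<Rightarrow> nat \<Rightarrow> nat" where "window v u k = card {u'. u' \<le> u \<and> u < u' + k \<and> adj v u'}"

lemma window_one: "window v u 1 = (if adj v u then 1 else 0)"
proof -
  have "{u'. u' \<le> u \<and> u < u' + 1 \<and> adj v u'} = (if adj v u then {u} else {})" by (auto dest: le_antisym)
  then show ?thesis by (simp add: window_def)
qed

lemma window_double: "window v u (k + k) = window v u k + (if k \<le> u then window v (u - k) k else 0)"
proof (cases "k \<le> u")
  case True
  have "{u'. u' \<le> u \<and> u < u' + (k + k) \<and> adj v u'} = {u'. u' \<le> u \<and> u < u' + k \<and> adj v u'} \<union> {u'. u' \<le> u - k \<and> u - k < u' + k \<and> adj v u'}"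
    using True by auto
  moreover have "{u'. u' \<le> u \<and> u < u' + k \<and> adj v u'} \<inter> {u'. u' \<le> u - k \<and> u - k < u' + k \<and> adj v u'} = {}"
    using True by auto
  moreover have "finite {u'. u' \<le> u \<and> u < u' + k \<and> adj v u'}" "finite {u'. u' \<le> u - k \<and> u - k < u' + k \<and> adj v u'}"
    by (rule finite_subset[of _ "{..u}"], auto)+
  ultimately show ?thesis using True by (simp add: window_def card_Un_disjoint)
next
  case False
  then have "{u'. u' \<le> u \<and> u < u' + (k + k) \<and> adj v u'} = {u'. u' \<le> u \<and> u < u' + k \<and> adj v u'}" by auto
  then show ?thesis using False by (simp add: window_def)
qed

lemma window_le: "window v u k \<le> u + 1"
proof -
  have "card {u'. u' \<le> u \<and> u < u' + k \<and> adj v u'} \<le> card {..u}" by (rule card_mono) auto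
  then show ?thesis by (simp add: window_def)
qed

lemma adj_card: "card {u'. P u' \<and> adj v u'} = card {e. e < m \<and> head G e = v \<and> P (tail G e)}"
proof -
  have "inj_on (tail G) {e. e < m \<and> head G e = v \<and> P (tail G e)}" by (rule inj_onI) (auto intro: arc_ends_inj)
  moreover have "tail G ` {e. e < m \<and> head G e = v \<and> P (tail G e)} = {u'. P u' \<and> adj v u'}" by (auto simp: adj_def)
  ultimately show ?thesis using card_image[of "tail G" "{e. e < m \<and> head G e = v \<and> P (tail G e)}"] by simp
qed

lemma window_indeg: "n \<le> k \<Longrightarrow> window (head G e) (n - 1) k = indeg e"
proof -
  assume k: "n \<le> k"
  have "window (head G e) (n - 1) k = card {e'. e' < m \<and> head G e' = head G e \<and> (tail G e' \<le> n - 1 \<and> n - 1 < tail G e' + k)}"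
    unfolding window_def using adj_card[of "\<lambda>u'. u' \<le> n - 1 \<and> n - 1 < u' + k" "head G e"] by (simp add: conj_assoc)
  also have "{e'. e' < m \<and> head G e' = head G e \<and> (tail G e' \<le> n - 1 \<and> n - 1 < tail G e' + k)} = {e'. e' < m \<and> head G e' = head G e}"
    using tail_n k s_n by fastforce
  finally show ?thesis by (simp add: indeg_def)
qed

text \<open>The window includes its right end, so the arc itself is counted; \<open>ranks\<close>
  subtracts it again.\<close>

lemma window_rank: "n \<le> k \<Longrightarrow> e < m \<Longrightarrow> window (head G e) (tail G e) k = Suc (rank e)"
proof -
  assume k: "n \<le> k" and e: "e < m"
  have t: "tail G e < k" using tail_n[OF e] k by simp
  have "window (head G e) (tail G e) k = card {e'. e' < m \<and> head G e' = head G e \<and> (tail G e' \<le> tail G e \<and> tail G e < tail G e' + k)}"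
    unfolding window_def using adj_card[of "\<lambda>u'. u' \<le> tail G e \<and> tail G e < u' + k" "head G e"] by (simp add: conj_assoc)
  also have "{e'. e' < m \<and> head G e' = head G e \<and> (tail G e' \<le> tail G e \<and> tail G e < tail G e' + k)}
     = insert e {e'. e' < m \<and> head G e' = head G e \<and> tail G e' < tail G e}"
    using t e arc_ends_inj by (auto simp: le_less)
  also have "card \<dots> = Suc (rank e)" by (simp add: rank_def)
  finally show ?thesis .
qed

end

context config
begin

definition arcs_in :: "wmemory \<Rightarrow> bool" where
  "arcs_in W \<longleftrightarrow> params W \<and> (\<forall>e<m. W 1 e = tail G e \<and> W 2 e = head G e)"

lemma pair_less: "e < m \<Longrightarrow> v < n \<Longrightarrow> e * n + v < m * n"
proof -
  assume "e < m" "v < n"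
  then have "e * n + v < Suc e * n" by simp
  also have "\<dots> \<le> m * n" using \<open>e < m\<close> by (intro mult_le_mono) auto
  finally show ?thesis .
qed

lemma pair_B: "e < m \<Longrightarrow> v < n \<Longrightarrow> e * n + v < B" "u < n \<Longrightarrow> v < n \<Longrightarrow> u * n + v < B" "m * n < B"
proof -
  show mn: "m * n < B" using big(1)[of m n 1 1] sizes by simp
  show "e < m \<Longrightarrow> v < n \<Longrightarrow> e * n + v < B" using pair_less[of e v] mn by simp
  have "n * n + n < B" using big(2)[of n n 1 n] sizes by simp
  moreover have "u * n \<le> n * n" if "u < n" using that by simp
  ultimately show "u < n \<Longrightarrow> v < n \<Longrightarrow> u * n + v < B" by (meson add_mono_thms_linordered_field(4) order_less_imp_le less_trans le_less_trans add_le_less_mono)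
qed

lemma decode_pair: "p < m * n \<Longrightarrow> p div n < m \<and> p mod n < n"
  using s_n by (auto simp: less_mult_imp_div_less)

lemma hp_marks:
  assumes a: "arcs_in W" and z: "W 30 = (\<lambda>_. 0)"
    and Post: "\<And>W'. (\<And>a. a \<notin> {11, 30, 36} \<Longrightarrow> W' a = W a) \<Longrightarrow> W' 36 0 = 1 \<Longrightarrow>
      (\<And>p. p < m * n \<Longrightarrow> W' 11 p = window (head G (p div n)) (p mod n) 1) \<Longrightarrow> Post W' R"
  shows "hp 0 marks Post W R"
  unfolding marks_def seqs.simps
proof (rule hp_seq0)
  have P: "params W" and ar: "\<And>e. e < m \<Longrightarrow> W 1 e = tail G e \<and> W 2 e = head G e" using a by (simp_all add: arcs_in_def)
  note pe = params_eqs[OF P]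
  let ?adr = "Op Add (Op Mul (Load 2 Pid) (prm 0)) (Load 1 Pid)"
  let ?cell = "Op Add (Op Mul (Load 2 (Op Div Pid (prm 0))) (prm 0)) (wmd Pid (prm 0))"
  have one: "wv B W e (Const 1) = 1" for e using B16 by simp
  have mult_B: "u * n < B" if "u < n" for u using pair_B(2)[OF that, of 0] s_n by simp
  have ad: "wv B W e ?adr = head G e * n + tail G e" if "e < m" for e
    using that ar pe mult_B pair_B(2) head_n tail_n by (simp add: prm_def)
  show "hp 0 (Par (prm 1) (Const 1) (Store 30 ?adr (Const 1)))
     (hp 0 (Seq (Par (prm 14) (Const 1) (Store 11 Pid (Load 30 ?cell))) (Par (Const 1) (Const 1) (Store 36 Pid (Const 1)))) Post) W R"
  proof (rule hp_store)
    fix f assume f: "\<And>x. (\<exists>i<wv B W 0 (prm 1). wv B W i (Const 1) \<noteq> 0 \<and> wv B W i ?adr = x \<and> f x = wv B W i (Const 1)) \<or>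
      ((\<forall>i<wv B W 0 (prm 1). wv B W i (Const 1) \<noteq> 0 \<longrightarrow> wv B W i ?adr \<noteq> x) \<and> f x = W 30 x)"
    let ?W1 = "W(30 := f)"
    have k: "wv B W 0 (prm 1) = m" using pe by (simp add: prm_def)
    have fx: "f (v * n + u) = (if adj v u then 1 else 0)" if "u < n" for u v
    proof -
      have inj: "head G e * n + tail G e = v * n + u \<longleftrightarrow> head G e = v \<and> tail G e = u" if "e < m" for e
        using mult_add_unique[of "head G e" n "tail G e" v u] tail_n[OF that] \<open>u < n\<close> by blast
      show ?thesis
        using f[of "v * n + u"] unfolding k one z adj_def using ad inj by auto
    qed
    show "hp 0 (Seq (Par (prm 14) (Const 1) (Store 11 Pid (Load 30 ?cell))) (Par (Const 1) (Const 1) (Store 36 Pid (Const 1)))) Post ?W1 R"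
    proof (rule hp_seq0, rule hp_set)
      fix W2 assume W2: "\<And>b. b \<noteq> 11 \<Longrightarrow> W2 b = ?W1 b" "\<And>x. x < wv B ?W1 0 (prm 14) \<Longrightarrow> W2 11 x = wv B ?W1 x (Load 30 ?cell)"
      show "hp 0 (Par (Const 1) (Const 1) (Store 36 Pid (Const 1))) Post W2 R"
      proof (rule hp_set)
        fix W3 assume W3: "\<And>b. b \<noteq> 36 \<Longrightarrow> W3 b = W2 b" "\<And>x. x < wv B W2 0 (Const 1) \<Longrightarrow> W3 36 x = wv B W2 x (Const 1)"
        show "Post W3 R"
        proof (rule Post)
          fix a :: nat assume "a \<notin> {11, 30, 36}"
          then show "W3 a = W a" using W3(1) W2(1) by simp
        next
          show "W3 36 0 = 1" using W3(2)[of 0] B16 by simp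
        next
          fix p assume p: "p < m * n"
          note d = decode_pair[OF p]
          have pB: "p < B" using p pair_B(3) by simp
          have dB: "p div n < B" using div_le_dividend[of p n] pB by linarith
          have wm: "wv B ?W1 p (wmd Pid (prm 0)) = p mod n" by (subst wv_wmd) (use pe pB in \<open>simp_all add: prm_def\<close>)
          have hn: "head G (p div n) < n" using d head_n by simp
          have "wv B ?W1 p ?cell = head G (p div n) * n + p mod n"
            unfolding wv.simps wop_val.simps wm
            using d ar pe dB mult_B[OF hn] pair_B(2)[OF hn, of "p mod n"] by (simp add: prm_def)
          then have "W3 11 p = f (head G (p div n) * n + p mod n)" using W3(1) W2(2)[of p] p pe by (simp add: prm_def)
          then show "W3 11 p = window (head G (p div n)) (p mod n) 1" using fx d by (simp only: window_one)
        qed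
      qed
    qed simp
  qed
qed simp

lemma hp_prefix_round:
  assumes a: "params W" and k: "W 36 0 = k" "k + k < B" and x: "\<And>p. p < m * n \<Longrightarrow> W 11 p = window (head G (p div n)) (p mod n) k"
    and Post: "\<And>W'. (\<And>a. a \<notin> {11, 36} \<Longrightarrow> W' a = W a) \<Longrightarrow> W' 36 0 = k + k \<Longrightarrow>
      (\<And>p. p < m * n \<Longrightarrow> W' 11 p = window (head G (p div n)) (p mod n) (k + k)) \<Longrightarrow> Post W' R"
  shows "hp 0 prefix_round Post W R"
  unfolding prefix_round_def
proof (rule hp_seq0, rule hp_own)
  note pe = params_eqs[OF a]
  let ?g = "wnot (Op Less (wmd Pid (prm 0)) pw)" and ?e = "Op Add (Load 11 Pid) (Load 11 (Op Sub Pid pw))"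
  let ?W1 = "W(11 := \<lambda>x. if x < wv B W 0 (prm 14) \<and> wv B W x ?g \<noteq> 0 then wv B W x ?e else W 11 x)"
  have pk: "wv B W p pw = k" for p using k B16 by (simp add: pw_def)
  have new: "?W1 11 p = window (head G (p div n)) (p mod n) (k + k)" if p: "p < m * n" for p
  proof -
    note d = decode_pair[OF p]
    have pB: "p < B" using p pair_B(3) by simp
    have wm: "wv B W p (wmd Pid (prm 0)) = p mod n" by (subst wv_wmd) (use pe pB in \<open>simp_all add: prm_def\<close>)
    have g: "wv B W p ?g \<noteq> 0 \<longleftrightarrow> k \<le> p mod n" using wm pk B16 by (auto simp: wnot_def)
    show ?thesis
    proof (cases "k \<le> p mod n")
      case True
      have pm: "p = (p div n) * n + p mod n" by simp
      define a b where "a = p div n" and "b = p mod n"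
      have pab: "p = a * n + b" "k \<le> b" "b < n" using pm True d unfolding a_def b_def by blast+
      have "p - k = a * n + (b - k)" using pab by simp
      then have pk': "p - k = a * n + c" "c < n" "c = b - k" if "c = b - k" for c using that pab by simp_all
      then have q: "(p - k) div n = a" "(p - k) mod n = b - k" using pk'[OF refl] by (simp_all only:) simp_all
      have pkl: "p - k < m * n" using p by simp
      have "W 11 p + W 11 (p - k) = window (head G a) b (k + k)"
        using x[OF p] x[OF pkl] q pab(2) unfolding window_double a_def[symmetric] b_def[symmetric] by simp
      moreover have "window (head G a) b (k + k) < B" using window_le[of "head G a" b "k + k"] pab(3) sizes bounds9(5) s_n by linarith
      moreover have "p - k < B" using pB by simp
      ultimately have "wv B W p ?e = window (head G a) b (k + k)" by (simp add: pk)
      then show ?thesis using g True p pe unfolding a_def b_def by (simp add: prm_def)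
    next
      case False
      then show ?thesis using g x[OF p] by (simp add: window_double)
    qed
  qed
  show "hp 0 (Par (Const 1) (Const 1) (Store 36 Pid (Op Add pw pw))) Post ?W1 R"
  proof (rule hp_set)
    fix W2 assume W2: "\<And>b. b \<noteq> 36 \<Longrightarrow> W2 b = ?W1 b" "\<And>x. x < wv B ?W1 0 (Const 1) \<Longrightarrow> W2 36 x = wv B ?W1 x (Op Add pw pw)"
    show "Post W2 R"
    proof (rule Post)
      show "W2 a = W a" if "a \<notin> {11, 36}" for a using that W2(1) by simp
      show "W2 36 0 = k + k" using W2(2)[of 0] k B16 by (simp add: pw_def)
      show "W2 11 p = window (head G (p div n)) (p mod n) (k + k)" if "p < m * n" for p
      proof -
        have "W2 11 = ?W1 11" by (rule W2(1)) simp
        then show ?thesis using new[OF that] by (simp only:)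
      qed
    qed
  qed
qed simp

lemma hp_ranks:
  assumes a: "arcs_in W" and z: "W 30 = (\<lambda>_. 0)" and L: "n \<le> 2 ^ L" "2 ^ L \<le> 2 * n"
    and Post: "\<And>W'. (\<And>a. a \<notin> {8, 9, 11, 30, 36} \<Longrightarrow> W' a = W a) \<Longrightarrow> (\<And>e. e < m \<Longrightarrow> W' 8 e = rank e \<and> W' 9 e = indeg e) \<Longrightarrow> Post W' R"
  shows "hp 0 ranks Post W R"
  unfolding ranks_def
proof (rule hp_seq0, rule hp_marks[OF a z])
  let ?r8 = "Op Sub (Load 11 (Op Add (Op Mul Pid (prm 0)) (Load 1 Pid))) (Const 1)"
    and ?r9 = "Load 11 (Op Add (Op Mul Pid (prm 0)) (Op Sub (prm 0) (Const 1)))"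
  let ?p8 = "Par (prm 1) (Const 1) (Store 8 Pid ?r8)" and ?p9 = "Par (prm 1) (Const 1) (Store 9 Pid ?r9)"
  fix W1 assume W1: "\<And>a. a \<notin> {11, 30, 36} \<Longrightarrow> W1 a = W a" "W1 36 0 = 1"
      "\<And>p. p < m * n \<Longrightarrow> W1 11 p = window (head G (p div n)) (p mod n) 1"
  \<comment> \<open>The invariant is void beyond \<open>L\<close> rounds. The loop rule asks for
    preservation at every \<open>j\<close>, but the doubled width is known to fit into a word only
    up to \<open>2 ^ L\<close>.\<close>
  define I where "I j W' R' \<longleftrightarrow> (j \<le> L \<longrightarrow> R' = R \<and> (\<forall>a. a \<notin> {11, 30, 36} \<longrightarrow> W' a = W a) \<and> W' 36 0 = 2 ^ j \<and>
      (\<forall>p<m * n. W' 11 p = window (head G (p div n)) (p mod n) (2 ^ j)))" for j :: nat and W' :: wmemory and R' :: rmemory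
  have P: "params W" using a by (simp add: arcs_in_def)
  have k: "wv B W1 0 (prm 4) = L" using W1(1)[of 0] params_eqs(4)[OF P] by (simp add: prm_def)
  have "hp 0 (While (prm 4) (Const 1) prefix_round) (I (wv B W1 0 (prm 4))) W1 R"
  proof (rule hp_for_inv)
    show "I 0 W1 R" using W1 by (simp add: I_def)
  next
    fix j and W' :: wmemory and R' :: rmemory assume I: "I j W' R'"
    show "hp 0 prefix_round (I (Suc j)) W' R'"
    proof (cases "Suc j \<le> L")
      case True
      then have h: "R' = R" "\<And>a. a \<notin> {11, 30, 36} \<Longrightarrow> W' a = W a" "W' 36 0 = 2 ^ j"
        "\<And>p. p < m * n \<Longrightarrow> W' 11 p = window (head G (p div n)) (p mod n) (2 ^ j)" using I unfolding I_def by auto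
      have "(2::nat) ^ Suc j \<le> 2 ^ L" using True by (intro power_increasing) auto
      then have lt: "2 ^ j + 2 ^ j < B" using L(2) bounds9(5) by simp
      have p: "params W'" using P params_cong[of W' W] h(2) by simp
      show ?thesis
      proof (rule hp_prefix_round[OF p h(3) lt h(4)])
        fix W2 assume W2: "\<And>a. a \<notin> {11, 36} \<Longrightarrow> W2 a = W' a" "W2 36 0 = 2 ^ j + 2 ^ j"
          "\<And>p. p < m * n \<Longrightarrow> W2 11 p = window (head G (p div n)) (p mod n) (2 ^ j + 2 ^ j)"
        have e: "(2::nat) ^ Suc j = 2 ^ j + 2 ^ j" by simp
        show "I (Suc j) W2 R'" unfolding I_def e using W2 h(1,2) by simp
      qed
    next
      case False
      then have "I (Suc j) = (\<lambda>W R. True)" by (intro ext) (simp add: I_def)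
      then show ?thesis by (simp add: hp0_iff)
    qed
  qed
  then have it: "hp 0 (While (prm 4) (Const 1) prefix_round) (I L) W1 R" unfolding k .
  show "hp 0 (Seq (While (prm 4) (Const 1) prefix_round) (Seq ?p8 ?p9)) Post W1 R"
  proof (rule hp_seq0, rule hp_mono[OF it order_refl])
    fix W2 :: wmemory and R2 :: rmemory assume "I L W2 R2"
    then have h: "R2 = R" "\<And>a. a \<notin> {11, 30, 36} \<Longrightarrow> W2 a = W a"
        "\<And>p. p < m * n \<Longrightarrow> W2 11 p = window (head G (p div n)) (p mod n) (2 ^ L)" unfolding I_def by auto
    have A: "arcs_in W2" using a params_cong[of W2 W] h(2) by (simp add: arcs_in_def)
    then have ar: "\<And>e. e < m \<Longrightarrow> W2 1 e = tail G e \<and> W2 2 e = head G e" by (simp add: arcs_in_def)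
    note pe = params_eqs[of W2, OF A[unfolded arcs_in_def, THEN conjunct1]]
    show "hp 0 (Seq ?p8 ?p9) Post W2 R2"
    proof (rule hp_seq0, rule hp_set)
      fix W3 assume W3: "\<And>b. b \<noteq> 8 \<Longrightarrow> W3 b = W2 b" "\<And>x. x < wv B W2 0 (prm 1) \<Longrightarrow> W3 8 x = wv B W2 x ?r8"
      show "hp 0 ?p9 Post W3 R2"
      proof (rule hp_set)
        fix W4 assume W4: "\<And>b. b \<noteq> 9 \<Longrightarrow> W4 b = W3 b" "\<And>x. x < wv B W3 0 (prm 1) \<Longrightarrow> W4 9 x = wv B W3 x ?r9"
        show "Post W4 R2" unfolding h(1)
        proof (rule Post)
          show "W4 a = W a" if "a \<notin> {8, 9, 11, 30, 36}" for a using that W4(1) W3(1) h(2) by simp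
          fix e assume e: "e < m"
          have t: "tail G e < n" "n - 1 < n" using tail_n[OF e] s_n by auto
          have eB: "e * n < B" using pair_B(1)[OF e, of 0] s_n by simp
          have ad8: "wv B W2 e (Op Add (Op Mul Pid (prm 0)) (Load 1 Pid)) = e * n + tail G e"
            using ar[OF e] pe eB pair_B(1)[OF e t(1)] by (simp add: prm_def)
          have nB: "n - 1 < B" using bounds9(5) by simp
          have o3: "W3 0 = W2 0" "W3 11 = W2 11" using W3(1) by simp_all
          have ad9: "wv B W3 e (Op Add (Op Mul Pid (prm 0)) (Op Sub (prm 0) (Const 1))) = e * n + (n - 1)"
            using o3 pe eB pair_B(1)[OF e t(2)] nB B16 by (simp add: prm_def)
          have q: "(e * n + v) div n = e" "(e * n + v) mod n = v" if "v < n" for v using that by simp_all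
          have w: "W2 11 (e * n + v) = window (head G e) v (2 ^ L)" if "v < n" for v
            using h(3)[OF pair_less[OF e that]] q[OF that] by simp
          have m1: "wv B W2 0 (prm 1) = m" "wv B W3 0 (prm 1) = m" using o3 pe by (simp_all add: prm_def)
          have "W4 8 e = wv B W2 e ?r8" using W4(1) W3(2)[of e] m1 e by simp
          also have "\<dots> = (W2 11 (e * n + tail G e) - 1) mod B"
            unfolding wv.simps(3) wv.simps(4)[of _ _ _ Sub] wop_val.simps ad8 using B16 by simp
          also have "W2 11 (e * n + tail G e) = Suc (rank e)" using w[OF t(1)] window_rank[OF L(1) e] by simp
          also have "rank e < B" using rank_less[OF e] indeg_le[of e] bounds9(5) by linarith
          then have "(Suc (rank e) - 1) mod B = rank e" by simp
          finally have "W4 8 e = rank e" .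
          moreover have "W4 9 e = W2 11 (e * n + (n - 1))"
            using W4(2)[of e] m1 e ad9 o3 by (simp only: wv.simps(3))
          then have "W4 9 e = indeg e" using w[OF t(2)] window_indeg[OF L(1), of e] by simp
          ultimately show "W4 8 e = rank e \<and> W4 9 e = indeg e" by simp
        qed
      qed
    qed simp
  qed simp
qed simp

end

section \<open>Random samples\<close>

definition sample :: prog where
  "sample = Seq (Par (prm 6) (Const 1) (Draw 6 (prm 0)))
     (Seq (Par (Const 1) (Const 1) (Store 6 Pid (prm 2)))
     (Par (prm 6) (Const 1) (Store 7 (Load 6 Pid) Pid)))"

text \<open>Index 0 does not count since its draw is going to be replaced by the source; this
  explains the exponent \<open>N - 1\<close>. Each remaining draw misses a set of at least
  \<open>b\<close> vertices with probability at most \<open>1 - b / n\<close>.\<close>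

lemma prob_miss:
  fixes n N b :: nat and T :: "nat set set"
  assumes "finite T" "\<And>A. A \<in> T \<Longrightarrow> A \<subseteq> {..<n} \<and> b \<le> card A" "0 < n" "0 < N"
  shows "measure_pmf.prob (Pi_pmf {..<N} 0 (\<lambda>_. pmf_of_set {..<n})) {\<rho>. \<not> (\<forall>A\<in>T. \<exists>j\<in>{1..<N}. \<rho> j \<in> A)}
    \<le> real (card T) * (1 - real b / real n) ^ (N - 1)"
proof -
  let ?M = "Pi_pmf {..<N} 0 (\<lambda>_. pmf_of_set {..<n})"
  let ?E = "\<lambda>A. Pi {..<N} (\<lambda>j. if j = 0 then UNIV else - A)"
  have one: "measure_pmf.prob ?M (?E A) \<le> (1 - real b / real n) ^ (N - 1)" if A: "A \<in> T" for A
  proof -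
    have A': "A \<subseteq> {..<n}" "b \<le> card A" using assms(2)[OF A] by auto
    have ne: "{..<n} \<noteq> {}" using assms(3) by (simp add: lessThan_empty_iff)
    have "{..<n} \<inter> - A = {..<n} - A" by auto
    then have "card ({..<n} \<inter> - A) = n - card A" using A'(1) by (simp add: card_Diff_subset finite_subset)
    moreover have "card A \<le> n" using card_mono[OF _ A'(1)] by simp
    ultimately have pA: "measure_pmf.prob (pmf_of_set {..<n}) (- A) = 1 - real (card A) / real n"
      using ne assms(3) by (simp add: measure_pmf_of_set of_nat_diff diff_divide_distrib)
    have "measure_pmf.prob ?M (?E A) = (\<Prod>j<N. measure_pmf.prob (pmf_of_set {..<n}) (if j = 0 then UNIV else - A))"
      by (rule measure_Pi_pmf_Pi) simp
    also have "\<dots> = (\<Prod>j<Suc (N - 1). if j = 0 then 1 else 1 - real (card A) / real n)"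
      using assms(4) by (intro prod.cong) (auto simp: pA)
    also have "\<dots> = (1 - real (card A) / real n) ^ (N - 1)"
      by (simp only: prod.lessThan_Suc_shift) simp
    also have "\<dots> \<le> (1 - real b / real n) ^ (N - 1)"
      using A'(2) \<open>card A \<le> n\<close> assms(3) by (intro power_mono) (auto simp: divide_right_mono field_simps)
    finally show ?thesis .
  qed
  have "measure_pmf.prob ?M {\<rho>. \<not> (\<forall>A\<in>T. \<exists>j\<in>{1..<N}. \<rho> j \<in> A)} \<le> measure_pmf.prob ?M (\<Union>A\<in>T. ?E A)"
    by (rule measure_pmf.finite_measure_mono) auto
  also have "\<dots> \<le> (\<Sum>A\<in>T. measure_pmf.prob ?M (?E A))"
    by (rule measure_pmf.finite_measure_subadditive_finite) (use assms(1) in auto)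
  also have "\<dots> \<le> (\<Sum>A\<in>T. (1 - real b / real n) ^ (N - 1))" by (rule sum_mono) (rule one)
  finally show ?thesis by simp
qed

context config
begin

text \<open>Repeated samples are resolved by the write conflict itself: all indices of a vertex
  compete for its cell in array 7, and the one that succeeds becomes its representative.\<close>

lemma hp_sample:
  assumes P: "params W" and T: "finite T" "\<And>A. A \<in> T \<Longrightarrow> A \<subseteq> {..<n} \<and> b \<le> card A" "b \<le> n"
    and Post: "\<And>W'. (\<And>a. a \<notin> {6, 7} \<Longrightarrow> W' a = W a) \<Longrightarrow>
      (\<And>i. i < N \<Longrightarrow> W' 6 i < n \<and> W' 7 (W' 6 i) < N \<and> W' 6 (W' 7 (W' 6 i)) = W' 6 i) \<Longrightarrow> W' 6 0 = s \<Longrightarrow>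
      (\<And>A. A \<in> T \<Longrightarrow> \<exists>j<N. W' 6 j \<in> A) \<Longrightarrow> Post W' R"
  shows "hp (real (card T) * (1 - real b / real n) ^ (N - 1)) sample Post W R"
  unfolding sample_def
proof (rule hp_seq_last, rule hp_draw_good)
  note pe = params_eqs[OF P]
  have one: "wv B V i (Const 1) = 1" for V i using B16 by simp
  have pv: "wv B W i (prm 6) = N" "wv B W i (prm 0) = n" for i using pe by (simp_all add: prm_def)
  let ?A = "{i. i < wv B W 0 (prm 6) \<and> wv B W i (Const 1) \<noteq> 0}"
  have A: "?A = {..<N}" unfolding one pv by auto
  have mx: "max 1 n = n" using s_n by simp
  show "measure_pmf.prob (Pi_pmf ?A 0 (\<lambda>i. pmf_of_set {..<max 1 (wv B W i (prm 0))})) {\<rho>. \<not> (\<forall>A\<in>T. \<exists>j\<in>{1..<N}. \<rho> j \<in> A)}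
      \<le> real (card T) * (1 - real b / real n) ^ (N - 1)"
    unfolding pv A[unfolded pv] mx by (rule prob_miss) (use T s_n N0 in auto)
  fix \<rho> assume good: "\<forall>A\<in>T. \<exists>j\<in>{1..<N}. \<rho> j \<in> A" and r: "\<And>i. i \<in> ?A \<Longrightarrow> 0 < wv B W i (prm 0) \<Longrightarrow> \<rho> i < wv B W i (prm 0)"
  have rn: "\<rho> i < n" if "i < N" for i using r[of i] that s_n unfolding A unfolding pv by simp
  let ?W1 = "W(6 := \<lambda>x. if x \<in> ?A then \<rho> x else W 6 x)"
  show "hp 0 (Seq (Par (Const 1) (Const 1) (Store 6 Pid (prm 2))) (Par (prm 6) (Const 1) (Store 7 (Load 6 Pid) Pid))) Post ?W1 R"
  proof (rule hp_seq0, rule hp_own)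
    define f where "f x = (if x < wv B ?W1 0 (Const 1) \<and> wv B ?W1 x (Const 1) \<noteq> 0 then wv B ?W1 x (prm 2) else ?W1 6 x)" for x
    have s2: "wv B ?W1 x (prm 2) = s" for x using pe by (simp add: prm_def)
    have f: "f x = (if x = 0 then s else \<rho> x)" if "x < N" for x
      using that pe B16 by (simp add: f_def prm_def)
    define W2 where "W2 = ?W1(6 := f)"
    have W2: "W2 6 = f" "\<And>a. a \<noteq> 6 \<Longrightarrow> W2 a = W a" by (simp_all add: W2_def)
    have N2: "wv B W2 0 (prm 6) = N" using pe W2(2) by (simp add: prm_def)
    have "hp 0 (Par (prm 6) (Const 1) (Store 7 (Load 6 Pid) Pid)) Post W2 R"
    proof (rule hp_store)
      fix g assume g: "\<And>x. (\<exists>i<wv B W2 0 (prm 6). wv B W2 i (Const 1) \<noteq> 0 \<and> wv B W2 i (Load 6 Pid) = x \<and> g x = wv B W2 i Pid) \<or>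
         ((\<forall>i<wv B W2 0 (prm 6). wv B W2 i (Const 1) \<noteq> 0 \<longrightarrow> wv B W2 i (Load 6 Pid) \<noteq> x) \<and> g x = W2 7 x)"
      have W3: "(W2(7 := g)) 6 = f" "(W2(7 := g)) 7 = g" using W2(1) by simp_all
      have fn: "f i < n" if "i < N" for i using f[OF that] rn[OF that] s_n by (cases "i = 0") simp_all
      show "Post (W2(7 := g)) R"
      proof (rule Post)
        show "(W2(7 := g)) a = W a" if "a \<notin> {6, 7}" for a using that W2(2) by simp
        show "(W2(7 := g)) 6 0 = s" unfolding W3 using f[OF N0] by (simp only: if_True refl)
        show "\<exists>j<N. (W2(7 := g)) 6 j \<in> A" if AT: "A \<in> T" for A
        proof -
          obtain j where j: "1 \<le> j" "j < N" "\<rho> j \<in> A" using good AT by fastforce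
          then have "f j = \<rho> j" using f[OF j(2)] by simp
          then show ?thesis unfolding W3 using j by metis
        qed
        fix i assume i: "i < N"
        have l6: "wv B W2 k (Load 6 Pid) = f k" for k using W2(1) by simp
        have "\<exists>k<N. f k = f i \<and> g (f i) = k"
        proof -
          have ex: "\<exists>k<N. P k \<and> Q k" if "(\<exists>k<N. c \<noteq> (0::nat) \<and> P k \<and> Q k) \<or> ((\<forall>k<N. c \<noteq> 0 \<longrightarrow> \<not> P k) \<and> X)" "P i" "c = 1" for P Q :: "nat \<Rightarrow> bool" and c X
            using that i by auto
          show ?thesis by (rule ex[OF g[of "f i", unfolded N2 one l6 wv.simps(2)] refl refl])
        qed
        then obtain k where k: "k < N" "f k = f i" "g (f i) = k" by blast
        show "(W2(7 := g)) 6 i < n \<and> (W2(7 := g)) 7 ((W2(7 := g)) 6 i) < N \<and>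
          (W2(7 := g)) 6 ((W2(7 := g)) 7 ((W2(7 := g)) 6 i)) = (W2(7 := g)) 6 i"
          unfolding W3 k(3) using fn[OF i] k by blast
      qed
    qed
    then show "hp 0 (Par (prm 6) (Const 1) (Store 7 (Load 6 Pid) Pid)) Post
       (?W1(6 := \<lambda>x. if x < wv B ?W1 0 (Const 1) \<and> wv B ?W1 x (Const 1) \<noteq> 0 then wv B ?W1 x (prm 2) else ?W1 6 x)) R"
      unfolding W2_def f_def .
  qed simp
qed

end

section \<open>Initial labels and the tree of shortest paths\<close>

definition init_cells :: prog where
  "init_cells = Seq
    (Par (prm 6) (Const 1) (Store 3 (Op Add (Op Mul Pid (prm 0)) (Load 6 Pid)) (Const 1)))
    (Seq (Par (prm 1) (Const 1) (Store 3 (Op Add (Op Mul (prm 6) (prm 0)) Pid) (Const 1)))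
    (Seq (Par (prm 1) (Const 1) (Store 5 (Op Add (Op Mul (prm 6) (prm 0)) Pid) (Const 1)))
    (Par (prm 1) (Const 1) (RStore 1 (Op Add (Op Mul (prm 6) (prm 0)) Pid) (RLoad 0 Pid)))))"

text \<open>Row 0 belongs to the source, so arrays 3 and 1 already contain the reachability flags
  and distances where the output is expected. A predecessor is any arc along which the exact labels
  fit together in length and hops. Testing \<open>\<le>\<close> is enough, as exact lengths cannot
  decrease along an arc by more than its weight allows.\<close>

definition fin :: prog where
  "fin = Seq
    (Par (prm 1) (Const 1) (Compare 24 Pid (RAdd (RLoad 1 (Load 1 Pid)) (RLoad 0 Pid)) (RLoad 1 (Load 2 Pid))))
    (Par (prm 1) (wand (wand (Load 3 (Load 1 Pid)) (Load 3 (Load 2 Pid)))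
        (wand (Load 24 Pid) (weq (Op Add (Load 5 (Load 1 Pid)) (Const 1)) (Load 5 (Load 2 Pid)))))
      (Store 4 (Load 2 Pid) Pid))"

lemma write_cases:
  fixes c :: "nat \<Rightarrow> nat"
  assumes "(\<exists>i<K. c i \<noteq> 0 \<and> a i = x \<and> y = v i) \<or> ((\<forall>i<K. c i \<noteq> 0 \<longrightarrow> a i \<noteq> x) \<and> y = z)"
    and "\<And>i. i < K \<Longrightarrow> c i = 1" "\<And>i. i < K \<Longrightarrow> a i = b i"
  shows "(\<exists>i<K. b i = x \<and> y = v i) \<or> ((\<forall>i<K. b i \<noteq> x) \<and> y = z)"
  using assms by fastforce

context config
begin

lemma hp_init_cells:
  assumes b: "base S W" and z: "W 3 = (\<lambda>_. 0)" "W 5 = (\<lambda>_. 0)" "R 1 = (\<lambda>_. 0)"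
    and R0: "\<And>e. e < m \<Longrightarrow> R 0 e = Poly_Mapping.single e 1"
    and Post: "\<And>W' R'. (\<And>a. a \<notin> {3, 5} \<Longrightarrow> W' a = W a) \<Longrightarrow> R' 0 = R 0 \<Longrightarrow> cells S W' R' \<Longrightarrow>
      (\<And>i. i < N \<Longrightarrow> exact S i (S i) W' R') \<Longrightarrow> Post W' R'"
  shows "hp 0 init_cells Post W R"
  unfolding init_cells_def
proof (rule hp_seq0, rule hp_store)
  have P: "params W" using b by (simp add: base_def)
  note pe = params_eqs[OF P]
  have be: "\<And>i. i < N \<Longrightarrow> S i < n \<and> W 6 i = S i" using b by (simp add: base_def)
  have one: "wv B V i (Const 1) = 1" for V i using B16 by simp
  let ?a1 = "Op Add (Op Mul Pid (prm 0)) (Load 6 Pid)" and ?a2 = "Op Add (Op Mul (prm 6) (prm 0)) Pid"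
  have p16: "wv B V i (prm 1) = m" "wv B V i (prm 6) = N" if "V 0 = W 0" for V i using that pe by (simp_all add: prm_def)
  have Nn: "N * n < B" "N * n + e < B" if "e < m" for e using big(2)[of N n 1 m] sizes that by simp_all
  have a2: "wv B V e ?a2 = N * n + e" if "V 0 = W 0" "e < m" for V e
    using that pe Nn[of e] by (simp add: prm_def)
  have a1: "wv B W i ?a1 = i * n + S i" if "i < N" for i
    using that pe be[OF that] row_B[of i "S i"] by (simp add: prm_def)
  have out: "\<And>e i. e < m \<Longrightarrow> i < N \<Longrightarrow> N * n + e \<noteq> i * n + S i" using row_lt be by fastforce
  fix f3 assume f3: "\<And>x. (\<exists>i<wv B W 0 (prm 6). wv B W i (Const 1) \<noteq> 0 \<and> wv B W i ?a1 = x \<and> f3 x = wv B W i (Const 1)) \<or>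
      ((\<forall>i<wv B W 0 (prm 6). wv B W i (Const 1) \<noteq> 0 \<longrightarrow> wv B W i ?a1 \<noteq> x) \<and> f3 x = W 3 x)"
  have f3': "f3 x \<noteq> 0 \<longleftrightarrow> (\<exists>i<N. x = i * n + S i)" for x
    using write_cases[OF f3[of x, unfolded p16(2)[of W, OF refl]] one a1] one z(1) by (metis one_neq_zero)
  define W1 where "W1 = W(3 := f3)"
  have W1: "W1 0 = W 0" "W1 3 = f3" "\<And>a. a \<noteq> 3 \<Longrightarrow> W1 a = W a" by (simp_all add: W1_def)
  let ?p2 = "Par (prm 1) (Const 1) (Store 3 ?a2 (Const 1))" and ?p3 = "Par (prm 1) (Const 1) (Store 5 ?a2 (Const 1))"
    and ?p4 = "Par (prm 1) (Const 1) (RStore 1 ?a2 (RLoad 0 Pid))"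
  have "hp 0 (Seq ?p2 (Seq ?p3 ?p4)) Post W1 R"
  proof (rule hp_seq0, rule hp_store)
    fix g3 assume g3: "\<And>x. (\<exists>i<wv B W1 0 (prm 1). wv B W1 i (Const 1) \<noteq> 0 \<and> wv B W1 i ?a2 = x \<and> g3 x = wv B W1 i (Const 1)) \<or>
      ((\<forall>i<wv B W1 0 (prm 1). wv B W1 i (Const 1) \<noteq> 0 \<longrightarrow> wv B W1 i ?a2 \<noteq> x) \<and> g3 x = W1 3 x)"
    have g3': "g3 x \<noteq> 0 \<longleftrightarrow> (\<exists>i<N. x = i * n + S i) \<or> (\<exists>e<m. x = N * n + e)" for x
      using write_cases[OF g3[of x, unfolded p16(1)[of W1, OF W1(1)]] one a2[of W1, OF W1(1)]] one f3'[of x] W1(2) by (metis one_neq_zero)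
    define W2 where "W2 = W1(3 := g3)"
    have W2: "W2 0 = W 0" "W2 3 = g3" "\<And>a. a \<noteq> 3 \<Longrightarrow> W2 a = W a" using W1 by (simp_all add: W2_def)
    have "hp 0 (Seq ?p3 ?p4) Post W2 R"
    proof (rule hp_seq0, rule hp_store)
      fix f5 assume f5: "\<And>x. (\<exists>i<wv B W2 0 (prm 1). wv B W2 i (Const 1) \<noteq> 0 \<and> wv B W2 i ?a2 = x \<and> f5 x = wv B W2 i (Const 1)) \<or>
        ((\<forall>i<wv B W2 0 (prm 1). wv B W2 i (Const 1) \<noteq> 0 \<longrightarrow> wv B W2 i ?a2 \<noteq> x) \<and> f5 x = W2 5 x)"
      have f5': "f5 x = (if \<exists>e<m. x = N * n + e then 1 else 0)" for x
        using write_cases[OF f5[of x, unfolded p16(1)[of W2, OF W2(1)]] one a2[of W2, OF W2(1)]] one z(2) W2(3)[of 5] by (auto simp del: wv.simps)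
      define W3 where "W3 = W2(5 := f5)"
      have W3: "W3 0 = W 0" "W3 3 = g3" "W3 5 = f5" "\<And>a. a \<notin> {3, 5} \<Longrightarrow> W3 a = W a" using W2 by (simp_all add: W3_def)
      have "hp 0 ?p4 Post W3 R"
      proof (rule hp_rstore)
        fix r assume r: "\<And>x. (\<exists>i<wv B W3 0 (prm 1). wv B W3 i (Const 1) \<noteq> 0 \<and> wv B W3 i ?a2 = x \<and> r x = rv B W3 R i (RLoad 0 Pid)) \<or>
          ((\<forall>i<wv B W3 0 (prm 1). wv B W3 i (Const 1) \<noteq> 0 \<longrightarrow> wv B W3 i ?a2 \<noteq> x) \<and> r x = R 1 x)"
        have r1: "r (N * n + e) = Poly_Mapping.single e 1" if "e < m" for e
          using write_cases[OF r[of "N * n + e", unfolded p16(1)[of W3, OF W3(1)]] one a2[of W3, OF W3(1)]] R0 that by auto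
        have r2: "r x = 0" if "\<And>e. e < m \<Longrightarrow> x \<noteq> N * n + e" for x
          using write_cases[OF r[of x, unfolded p16(1)[of W3, OF W3(1)]] one a2[of W3, OF W3(1)]] z(3) that by auto
        define R' where "R' = R(1 := r)"
        have R': "R' 1 = r" "R' 0 = R 0" by (simp_all add: R'_def)
        have lab1: "lab W3 R' (N * n + e) = wl [e]" if "e < m" for e
        proof -
          have "f5 (N * n + e) = 1" using f5' that by auto
          then show ?thesis unfolding lab_def R'(1) W3(3) r1[OF that] form_val_single by (simp add: wl_def)
        qed
        have lab2: "lab W3 R' (i * n + S i) = wl []" if "i < N" for i
        proof -
          have o: "\<And>e. e < m \<Longrightarrow> i * n + S i \<noteq> N * n + e" using out[OF _ that] by metis
          have "f5 (i * n + S i) = 0" using f5' o by auto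
          moreover have "r (i * n + S i) = 0" by (rule r2) (rule o)
          ultimately show ?thesis unfolding lab_def R'(1) W3(3) by (simp add: wl_def form_val_zero)
        qed
        have Sv: "S i \<in> verts G" if "i < N" for i using be[OF that] verts_G by simp
        have "Post W3 R'"
        proof (rule Post)
          show "W3 a = W a" if "a \<notin> {3, 5}" for a using W3(4) that .
          show "R' 0 = R 0" by (rule R')
          show "cells S W3 R'"
            unfolding cells_def W3(2)
          proof (intro conjI allI impI)
            fix c assume c: "c < N * n + m" "g3 c \<noteq> 0"
            show "\<exists>p. cell_walk S c p \<and> lab W3 R' c = wl p \<and> length p \<le> n"
            proof (rule disjE[OF c(2)[unfolded g3']])
              assume "\<exists>i<N. c = i * n + S i"
              then obtain i where i: "i < N" "c = i * n + S i" by blast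
              have "awalk (S i) [] (S i)" using Sv[OF i(1)] by (simp only: awalk_Nil_iff)
              then have "cell_walk S c []" unfolding i(2) using row_walk[OF i(1)] be[OF i(1)] by blast
              then show ?thesis using lab2[OF i(1)] unfolding i(2)[symmetric] by (intro exI[of _ "[]"]) simp
            next
              assume "\<exists>e<m. c = N * n + e"
              then obtain e where e: "e < m" "c = N * n + e" by blast
              then show ?thesis using lab1[OF e(1)] arc_walk[OF e(1)] s_n(2) by (intro exI[of _ "[e]"]) simp
            qed
          next
            fix e assume "e < m"
            then show "g3 (N * n + e) \<noteq> 0" unfolding g3' by blast
          next
            have "N * n + m \<noteq> i * n + S i" if "i < N" for i using row_lt[OF that, of "S i"] be[OF that] by linarith
            then have "\<not> g3 (N * n + m) \<noteq> 0" unfolding g3' by auto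
            then show "g3 (N * n + m) = 0" by blast
          qed
          fix i assume i: "i < N"
          have "g3 (i * n + S i) \<noteq> 0" unfolding g3' using i by blast
          then show "exact S i (S i) W3 R'"
            unfolding exact_def W3(2) using lab2[OF i] opt_Nil[OF Sv[OF i]] by blast
        qed
        then show "Post W3 (R(1 := r))" unfolding R'_def .
      qed
      then show "hp 0 ?p4 Post (W2(5 := f5)) R" unfolding W3_def .
    qed simp
    then show "hp 0 (Seq ?p3 ?p4) Post (W1(3 := g3)) R" unfolding W2_def .
  qed simp
  then show "hp 0 (Seq ?p2 (Seq ?p3 ?p4)) Post (W(3 := f3)) R" unfolding W1_def .
qed simp

definition solved :: "wmemory \<Rightarrow> rmemory \<Rightarrow> bool" where
  "solved W R \<longleftrightarrow> (\<forall>v<n. (W 3 v \<noteq> 0 \<longleftrightarrow> s \<rightarrow>\<^sup>*\<^bsub>G\<^esub> v) \<and>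
     (s \<rightarrow>\<^sup>*\<^bsub>G\<^esub> v \<longrightarrow> ereal (form_val w (R 1 v)) = \<mu> w s v \<and>
       (\<exists>p. pred_walk G (W 4) s v p \<and> apath s p v \<and> ereal (awalk_cost w p) = \<mu> w s v)))"

lemma hp_fin:
  assumes b: "base S W" "S 0 = s" and c: "cells S W R" and ex: "\<And>v. v < n \<Longrightarrow> s \<rightarrow>\<^sup>*\<^bsub>G\<^esub> v \<Longrightarrow> exact S 0 v W R"
    and R0: "\<And>e. e < m \<Longrightarrow> R 0 e = Poly_Mapping.single e 1"
  shows "hp 0 fin solved W R"
  unfolding fin_def
proof (rule hp_seq0, rule hp_compare)
  have P: "params W" and ar: "\<And>e. e < m \<Longrightarrow> W 1 e = tail G e \<and> W 2 e = head G e" using b by (simp_all add: base_def)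
  note pe = params_eqs[OF P]
  have m1: "wv B V i (prm 1) = m" if "V 0 = W 0" for V i using that pe by (simp add: prm_def)
  have flag: "W 3 v \<noteq> 0 \<longleftrightarrow> s \<rightarrow>\<^sup>*\<^bsub>G\<^esub> v" if v: "v < n" for v
  proof
    assume "W 3 v \<noteq> 0"
    then obtain p where "awalk s p v" using cells_row[OF c N0 v] b(2) by auto
    then show "s \<rightarrow>\<^sup>*\<^bsub>G\<^esub> v" by (rule reachable_awalkI)
  next
    assume "s \<rightarrow>\<^sup>*\<^bsub>G\<^esub> v"
    then show "W 3 v \<noteq> 0" using ex[OF v] by (simp add: exact_def)
  qed
  have lb: "form_val w (R 1 v) = awalk_cost w p \<and> W 5 v = length p" if vn: "v < n" and op: "opt s p v" for v p
  proof -
    obtain p' where "opt s p' v" "lab W R v = wl p'" using ex[OF vn opt_reach[OF op]] b(2) by (auto simp: exact_def)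
    then show ?thesis using opt_unique[OF op] by (simp add: lab_def wl_def)
  qed
  let ?cmp = "\<lambda>x. if x < wv B W 0 (prm 1) \<and> wv B W x (Const 1) \<noteq> 0
       then if form_val w (rv B W R x (RAdd (RLoad 1 (Load 1 Pid)) (RLoad 0 Pid))) \<le> form_val w (rv B W R x (RLoad 1 (Load 2 Pid))) then 1 else 0
       else W 24 x"
  define W1 where "W1 = W(24 := ?cmp)"
  have W1: "W1 24 = ?cmp" "\<And>a. a \<noteq> 24 \<Longrightarrow> W1 a = W a" by (simp_all add: W1_def)
  let ?g = "wand (wand (Load 3 (Load 1 Pid)) (Load 3 (Load 2 Pid)))
        (wand (Load 24 Pid) (weq (Op Add (Load 5 (Load 1 Pid)) (Const 1)) (Load 5 (Load 2 Pid))))"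
  have g: "wv B W1 e ?g \<noteq> 0 \<longleftrightarrow> W 3 (tail G e) \<noteq> 0 \<and> W 3 (head G e) \<noteq> 0 \<and>
      form_val w (R 1 (tail G e)) + w e \<le> form_val w (R 1 (head G e)) \<and> Suc (W 5 (tail G e)) = W 5 (head G e)" if e: "e < m" for e
  proof (cases "W 3 (tail G e) \<noteq> 0")
    case True
    then obtain q where q: "opt s q (tail G e)" using flag tail_n[OF e] ex_opt by blast
    have "W 5 (tail G e) + 1 < B" using lb[OF tail_n[OF e] q] opt_length[OF q] bounds9(5) by simp
    moreover have fv: "form_val w (R 1 (tail G e) + R 0 e) = form_val w (R 1 (tail G e)) + w e"
      unfolding R0[OF e] form_val_add form_val_single ..
    have "W1 24 e = (if form_val w (R 1 (tail G e) + R 0 e) \<le> form_val w (R 1 (head G e)) then 1 else 0)"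
      unfolding W1(1) using e B16 ar[OF e] pe by (simp add: prm_def)
    then have "W1 24 e \<noteq> 0 \<longleftrightarrow> form_val w (R 1 (tail G e)) + w e \<le> form_val w (R 1 (head G e))"
      unfolding fv by simp
    ultimately show ?thesis using B16 ar[OF e] W1(2) by (auto simp: wand_def weq_def wnot_def)
  next
    case False
    then show ?thesis using B16 ar[OF e] W1(2) by (simp add: wand_def)
  qed
  have "hp 0 (Par (prm 1) ?g (Store 4 (Load 2 Pid) Pid)) solved W1 R"
  proof (rule hp_store)
    fix f assume f: "\<And>x. (\<exists>i<wv B W1 0 (prm 1). wv B W1 i ?g \<noteq> 0 \<and> wv B W1 i (Load 2 Pid) = x \<and> f x = wv B W1 i Pid) \<or>
        ((\<forall>i<wv B W1 0 (prm 1). wv B W1 i ?g \<noteq> 0 \<longrightarrow> wv B W1 i (Load 2 Pid) \<noteq> x) \<and> f x = W1 4 x)"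
    have hd: "wv B W1 e (Load 2 Pid) = head G e" if "e < m" for e using ar[OF that] W1(2) by simp
    have m1': "wv B W1 0 (prm 1) = m" by (rule m1) (simp add: W1(2))
    \<comment> \<open>The last arc of an optimal path passes the test, so some processor writes to
      \<open>v\<close>; whichever arc succeeds has passed the same test.\<close>
    have P': "f v \<in> arcs G \<and> head G (f v) = v \<and>
      (\<exists>q'. opt s q' (tail G (f v)) \<and> awalk_cost w q' + w (f v) \<le> awalk_cost w q \<and> Suc (length q') = length q)"
      if v: "v \<noteq> s" and q: "opt s q v" for v q
    proof -
      have vn: "v < n" using opt_awalk[OF q] awalk_last_in_verts verts_G by blast
      have "q \<noteq> []" using v opt_awalk[OF q] by (auto simp: awalk_Nil_iff)
      then obtain q' e where qe: "q = q' @ [e]" by (metis rev_exhaust)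
      have aw: "awalk s q' (tail G e)" "e \<in> arcs G" "head G e = v"
        using opt_awalk[OF q] unfolding qe by (auto simp: awalk_append_iff awalk_Cons_iff awalk_Nil_iff)
      have em: "e < m" using aw(2) arcs_G by simp
      have aw2: "awalk (tail G e) [e] v" using arc_implies_awalk[OF aw(2)] aw(3) by simp
      have oq': "opt s q' (tail G e)" using opt_split(1)[OF q[unfolded qe] aw(1) aw2] .
      have lq': "form_val w (R 1 (tail G e)) = awalk_cost w q'" "W 5 (tail G e) = length q'" using lb[OF tail_n[OF em] oq'] by auto
      have lq: "form_val w (R 1 v) = awalk_cost w q" "W 5 v = length q" using lb[OF vn q] by auto
      have "wv B W1 e ?g \<noteq> 0"
        unfolding g[OF em] using flag[OF tail_n[OF em]] flag[OF vn] opt_reach[OF oq'] opt_reach[OF q] lq lq' aw(3) qe by simp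
      then have "\<not> (\<forall>i<m. wv B W1 i ?g \<noteq> 0 \<longrightarrow> wv B W1 i (Load 2 Pid) \<noteq> v)" using em hd[OF em] aw(3) by metis
      then obtain e' where e': "e' < m" "wv B W1 e' ?g \<noteq> 0" "wv B W1 e' (Load 2 Pid) = v" "f v = e'"
        using f[of v] unfolding m1' wv.simps(2) by metis
      have h': "head G e' = v" using e'(3) hd[OF e'(1)] by simp
      note g' = e'(2)[unfolded g[OF e'(1)]]
      obtain q2 where q2: "opt s q2 (tail G e')" using g' flag[OF tail_n[OF e'(1)]] ex_opt by blast
      show ?thesis
        using g' lb[OF tail_n[OF e'(1)] q2] lq h' q2 e'(1,4) arcs_G by auto
    qed
    define W2 where "W2 = W1(4 := f)"
    have W2: "W2 3 = W 3" "W2 4 = f" using W1(2) by (simp_all add: W2_def)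
    have "solved W2 R"
      unfolding solved_def W2
    proof (intro allI impI conjI)
      fix v assume v: "v < n"
      show "W 3 v \<noteq> 0 \<longleftrightarrow> s \<rightarrow>\<^sup>*\<^bsub>G\<^esub> v" by (rule flag[OF v])
      assume r: "s \<rightarrow>\<^sup>*\<^bsub>G\<^esub> v"
      then obtain q where q: "opt s q v" using ex_opt by blast
      show "ereal (form_val w (R 1 v)) = \<mu> w s v" using lb[OF v q] opt_mu[OF q] by simp
      obtain p where p: "pred_walk G f s v p" "opt s p v" using pred_tree[OF q P'] by blast
      show "\<exists>p. pred_walk G f s v p \<and> apath s p v \<and> ereal (awalk_cost w p) = \<mu> w s v"
        using p opt_apath[OF p(2)] opt_mu[OF p(2)] by auto
    qed
    then show "solved (W1(4 := f)) R" unfolding W2_def .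
  qed
  then show "hp 0 (Par (prm 1) ?g (Store 4 (Load 2 Pid) Pid)) solved (W(24 := ?cmp)) R" unfolding W1_def .
qed simp

end

section \<open>Correctness of the complete algorithm\<close>

definition body :: prog where
  "body = Seq ranks (Seq sample (Seq init_cells (Seq bf (Seq mx (Seq bf fin)))))"

context config
begin

definition hits :: "nat \<Rightarrow> (nat \<Rightarrow> nat) \<Rightarrow> nat list \<Rightarrow> bool" where
  "hits b S p \<longleftrightarrow> (\<forall>a. a + b \<le> length p \<longrightarrow> (\<exists>j<N. S j \<in> head G ` set (take b (drop a p))))"

lemma awalk_cut:
  assumes "awalk u p v" "k < length p"
  shows "awalk u (take (Suc k) p) (head G (p ! k)) \<and> awalk (head G (p ! k)) (drop (Suc k) p) v"
proof -
  obtain x where x: "awalk u (take (Suc k) p) x" "awalk x (drop (Suc k) p) v"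
    using assms(1) append_take_drop_id[of "Suc k" p] awalk_append_iff[of u "take (Suc k) p" "drop (Suc k) p" v] by metis
  have "take (Suc k) p = take k p @ [p ! k]" using assms(2) by (simp add: take_Suc_conv_app_nth)
  then have "x = head G (p ! k)" using x(1) by (auto simp: awalk_append_iff awalk_Cons_iff awalk_Nil_iff)
  then show ?thesis using x by simp
qed

text \<open>Greedy decomposition: while more than \<open>b\<close> arcs remain, go to a sample among
  the first \<open>b\<close> heads and continue from its representative index. The density of
  samples is inherited by the rest of the path.\<close>

lemma chain:
  assumes S: "\<And>i. i < N \<Longrightarrow> W 7 (S i) < N \<and> S (W 7 (S i)) = S i" and b: "1 \<le> b"
    and "awalk (S a) p v" "hits b S p" "a < N"
  shows "\<exists>xs q. p = route_walk xs @ q \<and> route S (\<lambda>c. W 7 (S c) = c) a xs \<and> length q \<le> b \<and>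
    awalk (S (route_end a xs)) q v \<and> length xs \<le> length p \<and> (\<forall>x\<in>set xs. length (fst x) \<le> b) \<and> route_end a xs < N"
  using assms(3-)
proof (induction "length p" arbitrary: a p rule: less_induct)
  case less
  show ?case
  proof (cases "length p \<le> b")
    case True
    then show ?thesis using less.prems by (intro exI[of _ "[]"] exI[of _ p]) simp
  next
    case False
    then obtain j where j: "j < N" "S j \<in> head G ` set (take b p)"
      using less.prems(2) unfolding hits_def by (metis add_0 drop_0 nat_le_linear)
    then obtain k where k: "k < b" "k < length p" "S j = head G (p ! k)" by (auto simp: in_set_conv_nth)
    let ?c = "W 7 (S j)" and ?p2 = "drop (Suc k) p"
    have c: "?c < N" "S ?c = S j" using S[OF j(1)] by auto
    have aw: "awalk (S a) (take (Suc k) p) (S ?c)" "awalk (S ?c) ?p2 v"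
      using awalk_cut[OF less.prems(1) k(2)] c(2) k(3) by simp_all
    have "hits b S ?p2"
      unfolding hits_def
    proof (intro allI impI)
      fix x assume x: "x + b \<le> length ?p2"
      then have "(x + Suc k) + b \<le> length p" using k(2) by simp
      then have "\<exists>j<N. S j \<in> head G ` set (take b (drop (x + Suc k) p))" using less.prems(2) unfolding hits_def by blast
      then show "\<exists>j<N. S j \<in> head G ` set (take b (drop x ?p2))" by simp
    qed
    moreover have "length ?p2 < length p" using k(2) by simp
    ultimately obtain xs q where r: "?p2 = route_walk xs @ q" "route S (\<lambda>c. W 7 (S c) = c) ?c xs" "length q \<le> b"
      "awalk (S (route_end ?c xs)) q v" "length xs \<le> length ?p2" "\<forall>x\<in>set xs. length (fst x) \<le> b" "route_end ?c xs < N"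
      using less.hyps[of ?p2 ?c] aw(2) c(1) by blast
    have "p = take (Suc k) p @ route_walk xs @ q" unfolding r(1)[symmetric] by simp
    moreover have "W 7 (S ?c) = ?c" using c(2) by simp
    moreover have "Suc (length xs) \<le> length p" using r(5) k(2) by simp
    ultimately show ?thesis
      using r c aw(1) k by (intro exI[of _ "(take (Suc k) p, ?c) # xs"] exI[of _ q]) simp
  qed
qed

text \<open>Every link is a segment of an optimal walk, hence optimal itself, and short enough for
  the first Bellman-Ford phase to have made it exact.\<close>

lemma chain_links:
  assumes good: "\<And>a b p. a < N \<Longrightarrow> b < N \<Longrightarrow> opt (S a) p (S b) \<Longrightarrow> length p \<le> k \<Longrightarrow> good a b"
    and "route S alive a xs" "opt (S a) (route_walk xs @ q) v" "awalk (S (route_end a xs)) q v"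
      "\<forall>x\<in>set xs. length (fst x) \<le> k" "a < N"
  shows "links good a xs"
  using assms(2-)
proof (induction xs arbitrary: a)
  case (Cons x xs)
  obtain p b where x: "x = (p, b)" by (cases x)
  have r: "b < N" "awalk (S a) p (S b)" "route S alive b xs" using Cons.prems(1) x by auto
  have o: "opt (S a) (p @ (route_walk xs @ q)) v" using Cons.prems(2) x by simp
  obtain y where y: "awalk (S a) p y" "awalk y (route_walk xs @ q) v" using opt_awalk[OF o] by (auto simp: awalk_append_iff)
  have "y = S b"
  proof (cases p rule: rev_cases)
    case Nil
    then show ?thesis using r(2) y(1) by (simp add: awalk_Nil_iff)
  next
    case (snoc p' e)
    have "head G e = z" if "awalk (S a) p z" for z
      using that unfolding snoc awalk_append_iff by (simp add: awalk_Cons_iff awalk_Nil_iff)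
    note z = this
    show ?thesis by (rule trans[OF z[OF y(1), symmetric] z[OF r(2)]])
  qed
  then have op: "opt (S a) p (S b)" "opt (S b) (route_walk xs @ q) v" using opt_split[OF o] y by blast+
  have "good a b" by (rule good[OF Cons.prems(5) r(1) op(1)]) (use Cons.prems(4) x in simp)
  moreover have "links good b xs" by (rule Cons.IH[OF r(3) op(2)]) (use Cons.prems x r(1) in auto)
  ultimately show ?case using x by simp
qed simp

text \<open>One shortest path per vertex is fixed before the draws; otherwise the family of segments
  to be hit would depend on the samples.\<close>

definition sp :: "nat \<Rightarrow> nat list" where "sp v = (SOME p. opt s p v)"

lemma sp: "s \<rightarrow>\<^sup>*\<^bsub>G\<^esub> v \<Longrightarrow> opt s (sp v) v"
  unfolding sp_def by (rule someI_ex) (rule ex_opt)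

definition segments :: "nat \<Rightarrow> nat set set" where
  "segments b = (\<lambda>(v, a). head G ` set (take b (drop a (sp v)))) ` {(v, a). v < n \<and> a < n \<and> s \<rightarrow>\<^sup>*\<^bsub>G\<^esub> v \<and> a + b \<le> length (sp v)}"

text \<open>An optimal path is simple, so its arcs have distinct heads and a segment of
  \<open>b\<close> arcs contributes \<open>b\<close> vertices. There is at most one segment for each
  end vertex and offset.\<close>

lemma segments:
  shows "finite (segments b)" "card (segments b) \<le> n * n" "\<And>A. A \<in> segments b \<Longrightarrow> A \<subseteq> {..<n} \<and> b \<le> card A"
proof -
  let ?D = "{(v, a). v < n \<and> a < n \<and> s \<rightarrow>\<^sup>*\<^bsub>G\<^esub> v \<and> a + b \<le> length (sp v)}"
  have D: "?D \<subseteq> {..<n} \<times> {..<n}" by auto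
  then have fD: "finite ?D" by (rule finite_subset) simp
  then show "finite (segments b)" unfolding segments_def by simp
  have "card (segments b) \<le> card ?D" unfolding segments_def by (rule card_image_le[OF fD])
  also have "\<dots> \<le> card ({..<n} \<times> {..<n})" by (rule card_mono[OF _ D]) simp
  finally show "card (segments b) \<le> n * n" by simp
  fix A assume "A \<in> segments b"
  then obtain v a where va: "s \<rightarrow>\<^sup>*\<^bsub>G\<^esub> v" "a + b \<le> length (sp v)" "A = head G ` set (take b (drop a (sp v)))"
    unfolding segments_def by auto
  let ?p = "sp v" and ?q = "take b (drop a (sp v))"
  have p: "awalk s ?p v" "distinct (awalk_verts s ?p)" using opt_apath[OF sp[OF va(1)]] by (auto simp: apath_def)
  have vs: "awalk_verts s ?p = (if ?p = [] then [s] else tail G (hd ?p) # map (head G) ?p)"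
    by (rule awalk_verts_conv'[of s ?p v]) (use p(1) in \<open>simp add: awalk_def\<close>)
  have d: "distinct (map (head G) ?p)" using p(2) vs by (cases "?p = []") simp_all
  have "map (head G) ?q = take b (drop a (map (head G) ?p))" by (simp only: take_map drop_map)
  then have "distinct (map (head G) ?q)" using distinct_take[OF distinct_drop[OF d]] by metis
  then have "card (set (map (head G) ?q)) = length ?q" using distinct_card by (metis length_map)
  moreover have "length ?q = b" using va(2) by simp
  ultimately have "card A = b" using va(3) by simp
  moreover have "set ?p \<subseteq> arcs G" using p(1) by (simp add: awalk_def)
  then have "set ?q \<subseteq> arcs G" using set_take_subset set_drop_subset by (meson order_trans)
  then have "A \<subseteq> {..<n}" using va(3) head_n arcs_G by auto
  ultimately show "A \<subseteq> {..<n} \<and> b \<le> card A" by simp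
qed

lemma hits_sp:
  assumes "1 \<le> b" "v < n" "s \<rightarrow>\<^sup>*\<^bsub>G\<^esub> v" and h: "\<And>A. A \<in> segments b \<Longrightarrow> \<exists>j<N. S j \<in> A"
  shows "hits b S (sp v)"
  unfolding hits_def
proof (intro allI impI)
  fix a assume a: "a + b \<le> length (sp v)"
  have "a < n" using a assms(1) opt_length[OF sp[OF assms(3)]] by simp
  then have "head G ` set (take b (drop a (sp v))) \<in> segments b"
    unfolding segments_def using assms(2,3) a by (intro image_eqI[of _ _ "(v, a)"]) auto
  then show "\<exists>j<N. S j \<in> head G ` set (take b (drop a (sp v)))" by (rule h)
qed

text \<open>The summands are the failures of the sampling, \<open>e1\<close>, of the two
  Bellman-Ford phases, \<open>e2\<close> each, and of the squaring, \<open>e3\<close>.\<close>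

lemma hp_body:
  assumes a: "arcs_in W" and z: "W 30 = (\<lambda>_. 0)" "W 3 = (\<lambda>_. 0)" "W 5 = (\<lambda>_. 0)" "R 1 = (\<lambda>_. 0)"
    and R0: "\<And>e. e < m \<Longrightarrow> R 0 e = Poly_Mapping.single e 1"
    and L: "n \<le> 2 ^ L" "2 ^ L \<le> 2 * n" and b: "1 \<le> b" "b \<le> n"
  defines "e1 \<equiv> real (n * n) * (1 - real b / real n) ^ (N - 1)"
    and "e2 \<equiv> real (N * n) * (if m = 0 then 0 else 2 ^ b * (63 / 64) ^ T1) :: real"
    and "e3 \<equiv> real n * (real n * (63 / 64) ^ T2) :: real"
  shows "hp (e1 + (e2 + (e3 + e2))) body solved W R"
  unfolding body_def
proof (rule hp_seq0', rule hp_ranks[OF a z(1) L])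
  have e0: "0 \<le> e1" "0 \<le> e2" "0 \<le> e3" using b(2) s_n by (simp_all add: e1_def e2_def e3_def)
  show "0 \<le> e1 + (e2 + (e3 + e2))" using e0 by linarith
  fix W1 assume W1: "\<And>a. a \<notin> {8, 9, 11, 30, 36} \<Longrightarrow> W1 a = W a" "\<And>e. e < m \<Longrightarrow> W1 8 e = rank e \<and> W1 9 e = indeg e"
  have P1: "params W1" using a params_cong[of W1 W] W1(1) by (simp add: arcs_in_def)
  have ar1: "\<And>e. e < m \<Longrightarrow> W1 1 e = tail G e \<and> W1 2 e = head G e" using a W1(1) by (simp add: arcs_in_def)
  have rw0: "\<forall>i\<in>instrs bf. 0 \<notin> rw i" "\<forall>i\<in>instrs mx. 0 \<notin> rw i"
    by (simp_all add: bf_def mx_def bfdesc_def mxdesc_def prep_def round_def mkcand_def pick_def update_def duel_def cmp2_def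
      reset_win_def draw_sample_def survivors_def draw_slot_def throw_def)
  show "hp (e1 + (e2 + (e3 + e2))) (Seq sample (Seq init_cells (Seq bf (Seq mx (Seq bf fin))))) solved W1 R"
  proof (rule hp_seq_add)
    have "hp (real (card (segments b)) * (1 - real b / real n) ^ (N - 1)) sample (\<lambda>W' R'. \<exists>S. base S W' \<and> S 0 = s \<and>
        (\<forall>a. a \<notin> {6, 7} \<longrightarrow> W' a = W1 a) \<and> R' = R \<and> (\<forall>A\<in>segments b. \<exists>j<N. S j \<in> A)) W1 R"
    proof (rule hp_sample[OF P1 segments(1) segments(3) b(2)])
      fix W2 assume W2: "\<And>a. a \<notin> {6, 7} \<Longrightarrow> W2 a = W1 a"
        "\<And>i. i < N \<Longrightarrow> W2 6 i < n \<and> W2 7 (W2 6 i) < N \<and> W2 6 (W2 7 (W2 6 i)) = W2 6 i" "W2 6 0 = s"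
        "\<And>A. A \<in> segments b \<Longrightarrow> \<exists>j<N. W2 6 j \<in> A"
      have "base (W2 6) W2"
        unfolding base_def using P1 params_cong[of W2 W1] W2(1) W1(2) ar1 W2(2) by simp
      then show "\<exists>S. base S W2 \<and> S 0 = s \<and> (\<forall>a. a \<notin> {6, 7} \<longrightarrow> W2 a = W1 a) \<and> R = R \<and> (\<forall>A\<in>segments b. \<exists>j<N. S j \<in> A)"
        using W2(1,3,4) by blast
    qed
    moreover have "real (card (segments b)) * (1 - real b / real n) ^ (N - 1) \<le> e1"
      unfolding e1_def using segments(2)[of b] b(2) s_n by (intro mult_right_mono zero_le_power) (simp_all del: of_nat_mult)
    ultimately show "hp e1 sample (\<lambda>W' R'. \<exists>S. base S W' \<and> S 0 = s \<and>
        (\<forall>a. a \<notin> {6, 7} \<longrightarrow> W' a = W1 a) \<and> R' = R \<and> (\<forall>A\<in>segments b. \<exists>j<N. S j \<in> A)) W1 R" by (rule hp_mono)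
  next
    fix W2 :: wmemory and R2 :: rmemory
    assume "\<exists>S. base S W2 \<and> S 0 = s \<and> (\<forall>a. a \<notin> {6, 7} \<longrightarrow> W2 a = W1 a) \<and> R2 = R \<and> (\<forall>A\<in>segments b. \<exists>j<N. S j \<in> A)"
    then obtain S where W2: "base S W2" "S 0 = s" "\<And>a. a \<notin> {6, 7} \<Longrightarrow> W2 a = W1 a" "R2 = R"
        "\<And>A. A \<in> segments b \<Longrightarrow> \<exists>j<N. S j \<in> A" by blast
    have z2: "W2 3 = (\<lambda>_. 0)" "W2 5 = (\<lambda>_. 0)" "R2 1 = (\<lambda>_. 0)" using W2(3,4) W1(1) z by simp_all
    have Sn: "\<And>i. i < N \<Longrightarrow> S i < n" using W2(1) by (simp add: base_def)
    \<comment> \<open>A shortest path to \<open>v\<close> as a chain of links followed by a tail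
      \<open>q\<close> of at most \<open>b\<close> arcs. The three phases make exact in turn the
      links, the sample at the end of the chain, and \<open>v\<close>.\<close>
    define mid where "mid = (\<lambda>v xs q. opt s (route_walk xs @ q) v \<and> route S (\<lambda>c. W2 7 (S c) = c) 0 xs \<and> length q \<le> b \<and>
      awalk (S (route_end 0 xs)) q v \<and> length xs \<le> n \<and> (\<forall>x\<in>set xs. length (fst x) \<le> b) \<and> route_end 0 xs < N)"
    have mid: "\<exists>xs q. mid v xs q" if v: "v < n" "s \<rightarrow>\<^sup>*\<^bsub>G\<^esub> v" for v
    proof -
      have alive: "\<And>i. i < N \<Longrightarrow> W2 7 (S i) < N \<and> S (W2 7 (S i)) = S i" using W2(1) by (simp add: base_def)
      have aw: "awalk (S 0) (sp v) v" using opt_awalk[OF sp[OF v(2)]] W2(2) by simp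
      obtain xs q where x: "sp v = route_walk xs @ q" "route S (\<lambda>c. W2 7 (S c) = c) 0 xs" "length q \<le> b"
        "awalk (S (route_end 0 xs)) q v" "length xs \<le> length (sp v)" "\<forall>x\<in>set xs. length (fst x) \<le> b" "route_end 0 xs < N"
        using chain[of W2 S b 0 "sp v" v, OF alive b(1) aw hits_sp[of b v S, OF b(1) v W2(5)] N0] by blast
      have "mid v xs q" unfolding mid_def using x sp[OF v(2)] opt_length[OF sp[OF v(2)]] by simp
      then show ?thesis by blast
    qed
    have frame0: "hp e p (\<lambda>W' R'. P W' R' \<and> R' 0 = R 0) W' R'"
      if hp: "hp e p P W' R'" and fr: "\<forall>i\<in>instrs p. 0 \<notin> rw i" "R' 0 = R 0" for e p P and W' :: wmemory and R' :: rmemory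
    proof -
      have "hp 0 p (\<lambda>W1 R1. R1 0 = R 0) W' R'"
        by (rule hp_mono[OF hp_rframe order_refl]) (use fr in auto)
      from hp_conj0[OF this hp] show ?thesis by (rule hp_mono[OF _ order_refl]) blast
    qed
    have R02: "\<And>e. e < m \<Longrightarrow> R2 0 e = Poly_Mapping.single e 1" using R0 W2(4) by simp
    let ?J1 = "\<lambda>W' R'. base S W' \<and> W' 7 = W2 7 \<and> R' 0 = R 0 \<and> cells S W' R' \<and> (\<forall>i<N. exact S i (S i) W' R')"
    let ?J2 = "\<lambda>W' R'. ?J1 W' R' \<and> (\<forall>i<N. \<forall>v<n. (\<exists>q. opt (S i) q v \<and> length q \<le> b) \<longrightarrow> exact S i v W' R')"
    let ?J3 = "\<lambda>W' R'. ?J1 W' R' \<and> (\<forall>v xs q. mid v xs q \<longrightarrow> exact S 0 (S (route_end 0 xs)) W' R')"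
    let ?J4 = "\<lambda>W' R'. ?J1 W' R' \<and> (\<forall>v<n. s \<rightarrow>\<^sup>*\<^bsub>G\<^esub> v \<longrightarrow> exact S 0 v W' R')"
    have keep: "?J1 W' R'" if "?J1 W3 R3" "keeps S W3 R3 W' R'" "R' 0 = R 0" for W3 W' :: wmemory and R3 R' :: rmemory
      using that Sn unfolding keeps_def by simp
    have init: "hp 0 init_cells ?J1 W2 R2"
    proof (rule hp_init_cells[OF W2(1) z2 R02])
      fix W' :: wmemory and R' :: rmemory assume h: "\<And>a. a \<notin> {3, 5} \<Longrightarrow> W' a = W2 a" "R' 0 = R2 0" "cells S W' R'" "\<And>i. i < N \<Longrightarrow> exact S i (S i) W' R'"
      have "base S W'" by (rule base_cong[OF W2(1) h(1)]) auto
      then show "?J1 W' R'" using h W2(4) by simp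
    qed
    have bf1: "hp e2 bf ?J2 W3 R3" if J: "?J1 W3 R3" for W3 :: wmemory and R3 :: rmemory
    proof -
      have J': "base S W3" "cells S W3 R3" "R3 0 = R 0" using J by blast+
      show ?thesis
      proof (rule hp_mono[OF frame0[OF hp_bf[OF J'(1,2), of b] rw0(1) J'(3)] eq_refl])
        fix W' :: wmemory and R' :: rmemory assume h: "(keeps S W3 R3 W' R' \<and> (\<forall>i<N. \<forall>v<n. (\<exists>y r q. exact S i y W3 R3 \<and> opt (S i) (r @ q) v \<and>
          awalk (S i) r y \<and> awalk y q v \<and> length q \<le> b) \<longrightarrow> exact S i v W' R')) \<and> R' 0 = R 0"
        have "exact S i v W' R'" if v: "i < N" "v < n" and q: "opt (S i) q v" "length q \<le> b" for i v q
        proof -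
          \<comment> \<open>In the first phase the exact vertex to start from is the sample itself,
            whose own cell is exact from the initialization on.\<close>
          have "awalk (S i) [] (S i)" using Sn[OF v(1)] verts_G by (simp add: awalk_Nil_iff)
          then have "\<exists>y r q. exact S i y W3 R3 \<and> opt (S i) (r @ q) v \<and> awalk (S i) r y \<and> awalk y q v \<and> length q \<le> b"
            using J v q opt_awalk[OF q(1)] by (intro exI[of _ "S i"] exI[of _ "[]"] exI[of _ q]) simp
          then show ?thesis using h v by blast
        qed
        then show "?J2 W' R'" using keep[OF J] h by blast
      qed (simp add: e2_def)
    qed
    have mx1: "hp e3 mx ?J3 W3 R3" if J: "?J2 W3 R3" for W3 :: wmemory and R3 :: rmemory
    proof -
      have J': "base S W3" "cells S W3 R3" "R3 0 = R 0" "W3 7 = W2 7" "?J1 W3 R3" using J by blast+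
      show ?thesis
      proof (rule hp_mono[OF frame0[OF hp_mx[OF J'(1,2)] rw0(2) J'(3)] eq_refl])
        fix W' :: wmemory and R' :: rmemory assume h: "(keeps S W3 R3 W' R' \<and> (\<forall>v<n. (\<exists>xs. route S (\<lambda>c. W3 7 (S c) = c) 0 xs \<and>
          links (\<lambda>a b. exact S a (S b) W3 R3) 0 xs \<and> opt (S 0) (route_walk xs) v \<and> S (route_end 0 xs) = v \<and>
          xs \<noteq> [] \<and> length xs \<le> n) \<longrightarrow> exact S 0 v W' R')) \<and> R' 0 = R 0"
        have j: "?J1 W' R'" using keep[OF J'(5)] h by blast
        have "exact S 0 (S (route_end 0 xs)) W' R'" if md: "mid v xs q" for v xs q
        proof (cases "xs = []")
          case True
          then show ?thesis using j N0 by simp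
        next
          case False
          have l: "links (\<lambda>a b. exact S a (S b) W3 R3) 0 xs"
          proof (rule chain_links[where q=q and v=v and k=b and alive="\<lambda>c. W2 7 (S c) = c"])
            fix a c p assume "a < N" "c < N" "opt (S a) p (S c)" "length p \<le> b"
            then show "exact S a (S c) W3 R3" using J Sn by blast
          qed (use md W2(2) N0 in \<open>simp_all add: mid_def\<close>)
          have rw: "awalk (S 0) (route_walk xs) (S (route_end 0 xs))"
            by (rule route_awalk[where alive="\<lambda>c. W2 7 (S c) = c"]) (use md N0 Sn verts_G in \<open>auto simp: mid_def\<close>)
          have "opt (S 0) (route_walk xs) (S (route_end 0 xs))"
            by (rule opt_split(1)[OF _ rw]) (use md W2(2) in \<open>auto simp: mid_def\<close>)
          then have "\<exists>ys. route S (\<lambda>c. W3 7 (S c) = c) 0 ys \<and>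
            links (\<lambda>a b. exact S a (S b) W3 R3) 0 ys \<and> opt (S 0) (route_walk ys) (S (route_end 0 xs)) \<and> S (route_end 0 ys) = S (route_end 0 xs) \<and>
            ys \<noteq> [] \<and> length ys \<le> n"
            using l False md J'(4) by (intro exI[of _ xs]) (simp add: mid_def)
          moreover have "S (route_end 0 xs) < n" using md Sn by (simp add: mid_def)
          ultimately show ?thesis using h by blast
        qed
        then show "?J3 W' R'" using j by blast
      qed (simp add: e3_def)
    qed
    have bf2: "hp e2 bf ?J4 W3 R3" if J: "?J3 W3 R3" for W3 :: wmemory and R3 :: rmemory
    proof -
      have J': "base S W3" "cells S W3 R3" "R3 0 = R 0" "?J1 W3 R3" using J by blast+
      show ?thesis
      proof (rule hp_mono[OF frame0[OF hp_bf[OF J'(1,2), of b] rw0(1) J'(3)] eq_refl])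
        fix W' :: wmemory and R' :: rmemory assume h: "(keeps S W3 R3 W' R' \<and> (\<forall>i<N. \<forall>v<n. (\<exists>y r q. exact S i y W3 R3 \<and> opt (S i) (r @ q) v \<and>
          awalk (S i) r y \<and> awalk y q v \<and> length q \<le> b) \<longrightarrow> exact S i v W' R')) \<and> R' 0 = R 0"
        have "exact S 0 v W' R'" if v: "v < n" "s \<rightarrow>\<^sup>*\<^bsub>G\<^esub> v" for v
        proof -
          obtain xs q where md: "mid v xs q" using mid[OF v] by blast
          have rw: "awalk (S 0) (route_walk xs) (S (route_end 0 xs))"
            by (rule route_awalk[where alive="\<lambda>c. W2 7 (S c) = c"]) (use md N0 Sn verts_G in \<open>auto simp: mid_def\<close>)
          have "\<exists>y r q. exact S 0 y W3 R3 \<and> opt (S 0) (r @ q) v \<and> awalk (S 0) r y \<and> awalk y q v \<and> length q \<le> b"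
            using J md rw W2(2) by (intro exI[of _ "S (route_end 0 xs)"] exI[of _ "route_walk xs"] exI[of _ q]) (auto simp: mid_def)
          then show ?thesis using h v N0 by blast
        qed
        then show "?J4 W' R'" using keep[OF J'(4)] h by blast
      qed (simp add: e2_def)
    qed
    have fin1: "hp 0 fin solved W3 R3" if J: "?J4 W3 R3" for W3 :: wmemory and R3 :: rmemory
    proof -
      have J': "base S W3" "cells S W3 R3" "\<And>v. v < n \<Longrightarrow> s \<rightarrow>\<^sup>*\<^bsub>G\<^esub> v \<Longrightarrow> exact S 0 v W3 R3"
        "\<And>e. e < m \<Longrightarrow> R3 0 e = Poly_Mapping.single e 1" using J R0 by auto
      show ?thesis by (rule hp_fin[OF J'(1) W2(2) J'(2,3,4)])
    qed
    have "hp (e2 + 0) (Seq bf fin) solved W3 R3" if "?J3 W3 R3" for W3 :: wmemory and R3 :: rmemory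
      by (rule hp_seq_add[OF bf2[OF that] fin1]) (use e0 in auto)
    then have "hp (e3 + (e2 + 0)) (Seq mx (Seq bf fin)) solved W3 R3" if "?J2 W3 R3" for W3 :: wmemory and R3 :: rmemory
      by (intro hp_seq_add[OF mx1[OF that]]) (use e0 in auto)
    then have "hp (e2 + (e3 + (e2 + 0))) (Seq bf (Seq mx (Seq bf fin))) solved W3 R3" if "?J1 W3 R3" for W3 :: wmemory and R3 :: rmemory
      by (intro hp_seq_add[OF bf1[OF that]]) (use e0 in auto)
    then have "hp (0 + (e2 + (e3 + (e2 + 0)))) (Seq init_cells (Seq bf (Seq mx (Seq bf fin)))) solved W2 R2"
      by (intro hp_seq_add[OF init]) (use e0 in auto)
    then show "hp (e2 + (e3 + e2)) (Seq init_cells (Seq bf (Seq mx (Seq bf fin)))) solved W2 R2" by simp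
  qed (use e0 in linarith)+
qed

end

section \<open>Parameters and costs\<close>

definition setp :: "nat \<Rightarrow> nat \<Rightarrow> wexp \<Rightarrow> prog" where
  "setp a i e = Par (Const 1) (Const 1) (Store a (Const i) e)"

text \<open>The static cost bound excludes programs that write parameters, so effect and cost of the
  set-up are computed directly. The only writer leaves the resolution no choice.\<close>

lemma exec_setp:
  assumes "is_resolution res" "16 \<le> B" "i < 16" "\<tau> \<in> set_pmf (exec res w B (setp a i e) \<sigma>)"
  shows "wmem \<tau> = (wmem \<sigma>)(a := (wmem \<sigma> a)(i := wv B (wmem \<sigma>) 0 e))" "rmem \<tau> = rmem \<sigma>"
    "work \<tau> = work \<sigma> + (wcost e + 5)" "depth \<tau> = depth \<sigma> + (wcost e + 5)"
proof -
  have v: "wval B \<sigma> j (Const 1) = 1" "wval B \<sigma> j (Const i) = i" for j using assms(2,3) by simp_all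
  have A: "{j. j < 1 \<and> (1::nat) \<noteq> 0} = {0::nat}" by auto
  have r: "res \<sigma> x {0} = 0" for x using assms(1)[unfolded is_resolution_def, rule_format, of "{0}" \<sigma> x] by simp
  have cw: "cwrite (res \<sigma>) {0} (\<lambda>j. i) (\<lambda>j. wv B (wmem \<sigma>) j e) f = f(i := wv B (wmem \<sigma>) 0 e)" for f
    by (rule ext) (auto simp: cwrite_def Let_def r)
  have c: "wcost (Const 1) + 1 + 1 * (wcost (Const 1) + icost (Store a (Const i) e)) = wcost e + 5"
    "wcost (Const 1) + 1 + (wcost (Const 1) + icost (Store a (Const i) e)) = wcost e + 5" by simp_all
  have "exec res w B (setp a i e) \<sigma> =
    return_pmf (charge (wcost e + 5) (wcost e + 5) (\<sigma>\<lparr>wmem := (wmem \<sigma>)(a := (wmem \<sigma> a)(i := wv B (wmem \<sigma>) 0 e))\<rparr>))"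
    unfolding setp_def exec.simps Let_def v A c step.simps map_return_pmf unfolding wval_eq cw ..
  then have "\<tau> = charge (wcost e + 5) (wcost e + 5) (\<sigma>\<lparr>wmem := (wmem \<sigma>)(a := (wmem \<sigma> a)(i := wv B (wmem \<sigma>) 0 e))\<rparr>)"
    using assms(4) by simp
  then show "wmem \<tau> = (wmem \<sigma>)(a := (wmem \<sigma> a)(i := wv B (wmem \<sigma>) 0 e))" "rmem \<tau> = rmem \<sigma>"
    "work \<tau> = work \<sigma> + (wcost e + 5)" "depth \<tau> = depth \<sigma> + (wcost e + 5)" by simp_all
qed

definition sets :: "(nat \<times> wexp) list \<Rightarrow> prog" where
  "sets xs = foldr (\<lambda>(i, e). Seq (setp 0 i e)) xs Skip"

definition upd :: "nat \<Rightarrow> wmemory \<Rightarrow> nat \<times> wexp \<Rightarrow> wmemory" where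
  "upd B W x = W(0 := (W 0)(fst x := wv B W 0 (snd x)))"

lemma exec_sets:
  assumes "is_resolution res" "16 \<le> B" "\<forall>x\<in>set xs. fst x < 16" "\<tau> \<in> set_pmf (exec res w B (sets xs) \<sigma>)"
  shows "wmem \<tau> = foldl (upd B) (wmem \<sigma>) xs \<and> rmem \<tau> = rmem \<sigma> \<and>
    work \<tau> = work \<sigma> + (\<Sum>x\<leftarrow>xs. wcost (snd x) + 5) \<and> depth \<tau> = depth \<sigma> + (\<Sum>x\<leftarrow>xs. wcost (snd x) + 5)"
  using assms(3,4)
proof (induction xs arbitrary: \<sigma>)
  case (Cons x xs)
  obtain i e where x: "x = (i, e)" by (cases x)
  obtain \<upsilon> where u: "\<upsilon> \<in> set_pmf (exec res w B (setp 0 i e) \<sigma>)" "\<tau> \<in> set_pmf (exec res w B (sets xs) \<upsilon>)"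
    using Cons.prems(2) x by (auto simp: sets_def)
  have "i < 16" using Cons.prems(1) x by simp
  note st = exec_setp[OF assms(1,2) this u(1)]
  have "wmem \<upsilon> = upd B (wmem \<sigma>) x" using st(1) x by (simp add: upd_def)
  then show ?case using Cons.IH[OF _ u(2)] Cons.prems(1) st(2-) x by simp
qed (simp add: sets_def)

lemma iterate_Suc_set:
  assumes "\<tau> \<in> set_pmf (iterate t g f (Suc k) \<sigma>)"
  shows "g \<sigma> \<Longrightarrow> \<exists>\<upsilon>\<in>set_pmf (f (charge t t \<sigma>)). \<tau> \<in> set_pmf (iterate t g f k \<upsilon>)"
    "\<not> g \<sigma> \<Longrightarrow> \<tau> = charge t t \<sigma>"
  using assms by (auto simp: Let_def)

text \<open>The number of binary digits is found by doubling a power of two until it exceeds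
  \<open>n\<close>. As a bound for the loop \<open>n\<close> is sufficient, since
  \<open>2 ^ (L - 1) \<le> n\<close> implies \<open>L \<le> n\<close>.\<close>

definition find_log :: prog where
  "find_log = Seq (setp 10 0 (Const 1))
    (While (prm 0) (wnot (Op Less (prm 0) (Load 10 (Const 0))))
      (Seq (setp 10 0 (Op Add (Load 10 (Const 0)) (Load 10 (Const 0)))) (setp 0 4 (Op Add (prm 4) (Const 1)))))"

lemma exec_find_log:
  assumes res: "is_resolution res" and B: "16 \<le> B" "2 * n < B" and n: "1 \<le> n"
    and L: "1 \<le> L" "2 ^ (L - 1) \<le> n" "n < 2 ^ L"
    and init: "wmem \<sigma> 0 0 = n" "wmem \<sigma> 0 4 = 0"
    and t: "\<tau> \<in> set_pmf (exec res w B find_log \<sigma>)"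
  shows "wmem \<tau> 0 = (wmem \<sigma> 0)(4 := L) \<and> (\<forall>a. a \<notin> {0, 10} \<longrightarrow> wmem \<tau> a = wmem \<sigma> a) \<and> rmem \<tau> = rmem \<sigma> \<and>
    work \<tau> \<le> work \<sigma> + 100 * L \<and> depth \<tau> \<le> depth \<sigma> + 100 * L"
proof -
  let ?g = "wnot (Op Less (prm 0) (Load 10 (Const 0)))"
  let ?p = "Seq (setp 10 0 (Op Add (Load 10 (Const 0)) (Load 10 (Const 0)))) (setp 0 4 (Op Add (prm 4) (Const 1)))"
  have loop: "wmem \<tau> 0 = (wmem \<sigma> 0)(4 := L) \<and> (\<forall>a. a \<notin> {0, 10} \<longrightarrow> wmem \<tau> a = wmem \<sigma> a) \<and> rmem \<tau> = rmem \<sigma> \<and>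
      work \<tau> \<le> work \<sigma> + 50 * (L - j) + 10 \<and> depth \<tau> \<le> depth \<sigma> + 50 * (L - j) + 10"
    if "\<tau> \<in> set_pmf (iterate (wcost ?g + 2) (\<lambda>\<tau>. wval B \<tau> 0 ?g \<noteq> 0) (exec res w B ?p) k \<sigma>)"
      "wmem \<sigma> 0 0 = n" "wmem \<sigma> 0 4 = j" "wmem \<sigma> 10 0 = 2 ^ j" "j \<le> L" "L \<le> j + k" for k j \<sigma> \<tau>
    using that
  proof (induction k arbitrary: j \<sigma>)
    case 0
    then show ?case by auto
  next
    case (Suc k)
    let ?\<sigma> = "charge (wcost ?g + 2) (wcost ?g + 2) \<sigma>"
    have g: "wval B \<sigma> 0 ?g \<noteq> 0 \<longleftrightarrow> 2 ^ j \<le> n"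
      using Suc.prems(2,4) B by (auto simp: wnot_def prm_def)
    have c: "wcost ?g + 2 = 9" by (simp add: wnot_def prm_def)
    show ?case
    proof (cases "j < L")
      case True
      have "(2::nat) ^ j \<le> 2 ^ (L - 1)" using True by (intro power_increasing) auto
      then have jn: "2 ^ j \<le> n" by (rule order_trans) (rule L(2))
      then obtain \<upsilon> where u: "\<upsilon> \<in> set_pmf (exec res w B ?p ?\<sigma>)"
        "\<tau> \<in> set_pmf (iterate (wcost ?g + 2) (\<lambda>\<tau>. wval B \<tau> 0 ?g \<noteq> 0) (exec res w B ?p) k \<upsilon>)"
        using iterate_Suc_set(1)[OF Suc.prems(1)] g by blast
      obtain \<sigma>1 where s1: "\<sigma>1 \<in> set_pmf (exec res w B (setp 10 0 (Op Add (Load 10 (Const 0)) (Load 10 (Const 0)))) ?\<sigma>)"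
        "\<upsilon> \<in> set_pmf (exec res w B (setp 0 4 (Op Add (prm 4) (Const 1))) \<sigma>1)" using u(1) by auto
      note a = exec_setp[OF res B(1) _ s1(1)]
      note b = exec_setp[OF res B(1) _ s1(2)]
      have jB: "2 ^ j + 2 ^ j < B" "j + 1 < B" using jn B(2) less_exp[of j] by linarith+
      have w1: "wmem \<sigma>1 = (wmem \<sigma>)(10 := (wmem \<sigma> 10)(0 := 2 ^ j + 2 ^ j))" using a(1) Suc.prems(4) jB(1) by simp
      have w2: "wmem \<upsilon> = (wmem \<sigma>1)(0 := (wmem \<sigma> 0)(4 := j + 1))"
        using b(1) w1 Suc.prems(3) jB(2) B(1) by (simp add: prm_def del: One_nat_def)
      have w: "wmem \<upsilon> 0 = (wmem \<sigma> 0)(4 := Suc j)" "wmem \<upsilon> 10 0 = 2 ^ Suc j" "\<forall>a. a \<notin> {0, 10} \<longrightarrow> wmem \<upsilon> a = wmem \<sigma> a"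
        unfolding w2 w1 by simp_all
      have co: "rmem \<upsilon> = rmem \<sigma>" "work \<upsilon> \<le> work \<sigma> + 50" "depth \<upsilon> \<le> depth \<sigma> + 50"
        using a(2-4) b(2-4) c by (simp_all add: prm_def)
      have "wmem \<tau> 0 = (wmem \<upsilon> 0)(4 := L) \<and> (\<forall>a. a \<notin> {0, 10} \<longrightarrow> wmem \<tau> a = wmem \<upsilon> a) \<and> rmem \<tau> = rmem \<upsilon> \<and>
        work \<tau> \<le> work \<upsilon> + 50 * (L - Suc j) + 10 \<and> depth \<tau> \<le> depth \<upsilon> + 50 * (L - Suc j) + 10"
        by (rule Suc.IH[OF u(2)]) (use w Suc.prems True in simp_all)
      moreover have "50 * (L - j) = 50 * (L - Suc j) + 50" using True by simp
      ultimately show ?thesis using w co by simp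
    next
      case False
      then have j: "j = L" using Suc.prems(5) by simp
      then have "\<tau> = ?\<sigma>" using g L(3) by (intro iterate_Suc_set(2)[OF Suc.prems(1)]) simp
      then show ?thesis using c Suc.prems(3) j by auto
    qed
  qed
  obtain \<sigma>0 where s0: "\<sigma>0 \<in> set_pmf (exec res w B (setp 10 0 (Const 1)) \<sigma>)"
    "\<tau> \<in> set_pmf (exec res w B (While (prm 0) ?g ?p) \<sigma>0)" using t by (auto simp: find_log_def)
  note a = exec_setp[OF res B(1) _ s0(1)]
  have w0: "wmem \<sigma>0 0 = wmem \<sigma> 0" "wmem \<sigma>0 10 0 = 1" "\<forall>a. a \<notin> {0, 10} \<longrightarrow> wmem \<sigma>0 a = wmem \<sigma> a" using a(1) B(1) by simp_all
  have k: "wval B \<sigma>0 0 (prm 0) = n" using w0 init by (simp add: prm_def)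
  have Ln: "L \<le> 0 + n" using L(2) less_exp[of "L - 1"] L(1) by linarith
  let ?\<sigma> = "charge (wcost (prm 0) + 1) (wcost (prm 0) + 1) \<sigma>0"
  have "wmem \<tau> 0 = (wmem ?\<sigma> 0)(4 := L) \<and> (\<forall>a. a \<notin> {0, 10} \<longrightarrow> wmem \<tau> a = wmem ?\<sigma> a) \<and> rmem \<tau> = rmem ?\<sigma> \<and>
      work \<tau> \<le> work ?\<sigma> + 50 * (L - 0) + 10 \<and> depth \<tau> \<le> depth ?\<sigma> + 50 * (L - 0) + 10"
    by (rule loop[where k=n]) (use s0(2) k w0 init Ln in \<open>simp_all\<close>)
  then show ?thesis using w0 a(2-4) L(1) by (simp add: prm_def)
qed

text \<open>Cell 5 is \<open>max h L\<close>, expressed by truncated subtraction. The factor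
  \<open>0 < m\<close> in cell 7 suppresses the Bellman-Ford rounds of a graph without arcs: even
  with no processors at work, \<open>b\<close> rounds have control costs, which for large
  \<open>h\<close> would exceed the work bound.\<close>

definition set_params :: "nat \<Rightarrow> prog" where
  "set_params C = Seq find_log (sets
    [(5, Op Add (prm 3) (Op Sub (prm 4) (prm 3))),
     (6, Op Add (Op Mul (Op Mul (Const C) (Op Add (Op Div (prm 0) (prm 5)) (Const 1))) (prm 4)) (Const 1)),
     (7, Op Mul (Op Mul (Const C) (prm 5)) (Op Less (Const 0) (prm 1))),
     (8, Op Mul (Const C) (prm 4)),
     (9, Op Mul (prm 6) (prm 1)),
     (10, Op Mul (Op Mul (prm 6) (prm 6)) (prm 6)),
     (11, Op Add (Op Mul (prm 6) (prm 0)) (prm 1)),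
     (12, Op Add (prm 11) (Const 1)),
     (13, Op Add (prm 6) (prm 0)),
     (14, Op Mul (prm 1) (prm 0))])"

context config
begin

lemma exec_set_params:
  assumes L: "1 \<le> L" "2 ^ (L - 1) \<le> n" "n < 2 ^ L"
    and h: "1 \<le> h" "h \<le> n" "b = max h L" and C: "C \<le> Q"
    and NT: "N = C * (n div b + 1) * L + 1" "T1 = C * b * (if 0 < m then 1 else 0)" "T2 = C * L"
    and init: "wmem \<sigma> 0 0 = n" "wmem \<sigma> 0 1 = m" "wmem \<sigma> 0 2 = s" "wmem \<sigma> 0 3 = h" "wmem \<sigma> 0 4 = 0"
    and t: "\<tau> \<in> set_pmf (exec res w B (set_params C) \<sigma>)"
  shows "params (wmem \<tau>) \<and> (\<forall>a. a \<notin> {0, 10} \<longrightarrow> wmem \<tau> a = wmem \<sigma> a) \<and> rmem \<tau> = rmem \<sigma> \<and>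
    work \<tau> \<le> work \<sigma> + 1000 * L \<and> depth \<tau> \<le> depth \<sigma> + 1000 * L"
proof -
  have n1: "1 \<le> n" using s_n by simp
  have Ln: "L \<le> n" using L(1,2) less_exp[of "L - 1"] by linarith
  have b: "b \<le> n" "1 \<le> b" "h + (L - h) = b" using h Ln L(1) by auto
  have bQ: "b \<le> Q" "L \<le> Q" "h \<le> Q" using b Ln h sizes(1) by auto
  have lin: "16 * Q < B"
  proof -
    have "16 * Q \<le> Q ^ 2" using mult_le_mono1[OF sizes(4), of Q] by (simp add: power2_eq_square)
    moreover have "Q ^ 2 < Q ^ 5" using sizes(4) by (intro power_strict_increasing) auto
    ultimately show ?thesis using sizes(5) by linarith
  qed
  have dn: "n div b \<le> n" by simp
  have ND: "C * (n div b + 1) * L + 1 < B"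
    using NT(1) sizes(3) lin sizes(4) by linarith
  have small: "n < B" "m < B" "N < B" "L < B" "b < B" "C < B" "h < B" "n div b + 1 < B" "16 < B"
    using sizes bQ C lin dn by linarith+
  have pr: "C * (n div b + 1) < B" "C * (n div b + 1) * L < B" "C * b < B" "C * L < B" "N * m < B" "N * N < B" "N * N * N < B" "N * n < B"
    "N * n + m < B" "N * n + m + 1 < B" "N + n < B" "m * n < B"
  proof -
    show "C * (n div b + 1) * L < B" using ND by simp
    have "C * (n div b + 1) \<le> C * (n div b + 1) * L" using L(1) by simp
    then show "C * (n div b + 1) < B" using ND by linarith
    show "N + n < B" using sizes lin by linarith
    show "C * b < B" "C * L < B" "N * m < B" "N * N < B" "N * N * N < B" "N * n < B" "m * n < B"
      using big(1)[of C b 1 1] big(1)[of C L 1 1] big(1)[of N m 1 1] big(1)[of N N 1 1] big(1)[of N N N 1] big(1)[of N n 1 1] big(1)[of m n 1 1]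
        C bQ sizes by simp_all
    show "N * n + m < B" "N * n + m + 1 < B" using bounds9(1) by linarith+
  qed
  obtain \<upsilon> where u: "\<upsilon> \<in> set_pmf (exec res w B find_log \<sigma>)"
    "\<tau> \<in> set_pmf (exec res w B (sets
    [(5, Op Add (prm 3) (Op Sub (prm 4) (prm 3))),
     (6, Op Add (Op Mul (Op Mul (Const C) (Op Add (Op Div (prm 0) (prm 5)) (Const 1))) (prm 4)) (Const 1)),
     (7, Op Mul (Op Mul (Const C) (prm 5)) (Op Less (Const 0) (prm 1))),
     (8, Op Mul (Const C) (prm 4)),
     (9, Op Mul (prm 6) (prm 1)),
     (10, Op Mul (Op Mul (prm 6) (prm 6)) (prm 6)),
     (11, Op Add (Op Mul (prm 6) (prm 0)) (prm 1)),
     (12, Op Add (prm 11) (Const 1)),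
     (13, Op Add (prm 6) (prm 0)),
     (14, Op Mul (prm 1) (prm 0))]) \<upsilon>)" using t by (auto simp: set_params_def)
  have fl: "wmem \<upsilon> 0 = (wmem \<sigma> 0)(4 := L) \<and> (\<forall>a. a \<notin> {0, 10} \<longrightarrow> wmem \<upsilon> a = wmem \<sigma> a) \<and> rmem \<upsilon> = rmem \<sigma> \<and>
    work \<upsilon> \<le> work \<sigma> + 100 * L \<and> depth \<upsilon> \<le> depth \<sigma> + 100 * L"
    by (rule exec_find_log[OF res B16 bounds9(5) n1 L init(1,5) u(1)])
  define W where "W = wmem \<upsilon>"
  have W: "W 0 0 = n" "W 0 1 = m" "W 0 2 = s" "W 0 3 = h" "W 0 4 = L" using fl init unfolding W_def by simp_all
  define W5 where "W5 = upd B W (5, Op Add (prm 3) (Op Sub (prm 4) (prm 3)))"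
  have "W5 0 = (W 0)(5 := b)" using W small b(3) by (simp add: W5_def upd_def prm_def)
  note W5 = this
  define W6 where "W6 = upd B W5 (6, Op Add (Op Mul (Op Mul (Const C) (Op Add (Op Div (prm 0) (prm 5)) (Const 1))) (prm 4)) (Const 1))"
  have W6: "W6 0 = (W5 0)(6 := N)"
  proof -
    have d: "n div b < B" "(n div b + 1) mod B = n div b + 1" using small by simp_all
    show ?thesis using W W5 small pr ND d unfolding NT(1) by (simp add: W6_def upd_def prm_def del: One_nat_def)
  qed
  define W7 where "W7 = upd B W6 (7, Op Mul (Op Mul (Const C) (prm 5)) (Op Less (Const 0) (prm 1)))"
  have W7: "W7 0 = (W6 0)(7 := T1)" using W W5 W6 small pr B16 unfolding NT(2) by (simp add: W7_def upd_def prm_def)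
  define W8 where "W8 = upd B W7 (8, Op Mul (Const C) (prm 4))"
  have W8: "W8 0 = (W7 0)(8 := T2)" using W W5 W6 W7 small pr unfolding NT(3) by (simp add: W8_def upd_def prm_def)
  define W9 where "W9 = upd B W8 (9, Op Mul (prm 6) (prm 1))"
  have W9: "W9 0 = (W8 0)(9 := N * m)" using W W5 W6 W7 W8 pr by (simp add: W9_def upd_def prm_def)
  define W10 where "W10 = upd B W9 (10, Op Mul (Op Mul (prm 6) (prm 6)) (prm 6))"
  have W10: "W10 0 = (W9 0)(10 := N * N * N)" using W W5 W6 W7 W8 W9 pr by (simp add: W10_def upd_def prm_def)
  define W11 where "W11 = upd B W10 (11, Op Add (Op Mul (prm 6) (prm 0)) (prm 1))"
  have W11: "W11 0 = (W10 0)(11 := N * n + m)" using W W5 W6 W7 W8 W9 W10 pr by (simp add: W11_def upd_def prm_def)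
  define W12 where "W12 = upd B W11 (12, Op Add (prm 11) (Const 1))"
  have W12: "W12 0 = (W11 0)(12 := N * n + m + 1)" using W11 pr B16 by (simp add: W12_def upd_def prm_def)
  define W13 where "W13 = upd B W12 (13, Op Add (prm 6) (prm 0))"
  have W13: "W13 0 = (W12 0)(13 := N + n)" using W W5 W6 W7 W8 W9 W10 W11 W12 pr by (simp add: W13_def upd_def prm_def)
  define W14 where "W14 = upd B W13 (14, Op Mul (prm 1) (prm 0))"
  have W14: "W14 0 = (W13 0)(14 := m * n)" using W W5 W6 W7 W8 W9 W10 W11 W12 W13 pr by (simp add: W14_def upd_def prm_def)
  have T: "wmem \<tau> = W14" "rmem \<tau> = rmem \<upsilon>" "work \<tau> \<le> work \<upsilon> + 900" "depth \<tau> \<le> depth \<upsilon> + 900"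
    using exec_sets[OF res B16 _ u(2)]
    unfolding W14_def W13_def W12_def W11_def W10_def W9_def W8_def W7_def W6_def W5_def W_def by (simp_all add: prm_def)
  have "params W14" unfolding params_def using W W5 W6 W7 W8 W9 W10 W11 W12 W13 W14 by simp
  moreover have upd_other: "upd B V x a = V a" if "a \<noteq> 0" for V x a using that by (simp add: upd_def)
  have "W14 a = wmem \<upsilon> a" if "a \<noteq> 0" for a
    by (simp only: upd_other[OF that] W14_def W13_def W12_def W11_def W10_def W9_def W8_def W7_def W6_def W5_def W_def)
  ultimately show ?thesis using T fl L(1) by simp
qed

end

section \<open>Work and depth of the program\<close>

primrec flat :: "nat \<Rightarrow> (nat \<Rightarrow> nat) \<Rightarrow> prog \<Rightarrow> bool" where
  "flat X par Skip = True"
| "flat X par (Par k g i) = (okk k \<and> kv par k \<le> X * kv (\<lambda>_. 1) k)"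
| "flat X par (Seq p q) = (flat X par p \<and> flat X par q)"
| "flat X par (Cond e p q) = False"
| "flat X par (While b g p) = False"

primrec fits :: "nat \<Rightarrow> nat \<Rightarrow> (nat \<Rightarrow> nat) \<Rightarrow> prog \<Rightarrow> bool" where
  "fits X Y par Skip = True"
| "fits X Y par (Par k g i) = (okk k \<and> kv par k \<le> X * kv (\<lambda>_. 1) k)"
| "fits X Y par (Seq p q) = (fits X Y par p \<and> fits X Y par q)"
| "fits X Y par (Cond e p q) = False"
| "fits X Y par (While b g p) = (flat X par p \<and> kv par b \<le> Y * kv (\<lambda>_. 1) b)"

lemma flat_cost:
  assumes "1 \<le> X" shows "flat X par p \<Longrightarrow> wbound par p \<le> X * wbound (\<lambda>_. 1) p \<and> dbound par p = dbound (\<lambda>_. 1) p"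
proof (induction p)
  case (Par k g i)
  have "kv par k * (wcost g + icost i) \<le> X * kv (\<lambda>_. 1) k * (wcost g + icost i)" using Par by (intro mult_le_mono1) simp
  moreover have "wcost k + 1 \<le> X * (wcost k + 1)" using assms mult_le_mono1[of 1 X "wcost k + 1"] by simp
  ultimately have "wbound par (Par k g i) \<le> X * (wcost k + 1) + X * (kv (\<lambda>_. 1) k * (wcost g + icost i))"
    unfolding wbound.simps mult.assoc[symmetric] by linarith
  then show ?case unfolding wbound.simps dbound.simps distrib_left[of X, symmetric] by blast
next
  case (Seq p q)
  then have "wbound par p + wbound par q \<le> X * wbound (\<lambda>_. 1) p + X * wbound (\<lambda>_. 1) q" "dbound par p + dbound par q = dbound (\<lambda>_. 1) p + dbound (\<lambda>_. 1) q"
    by (auto intro: add_mono)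
  then show ?case unfolding wbound.simps dbound.simps distrib_left[of X, symmetric] by blast
qed simp_all

text \<open>Scaling argument: with all parameters set to 1 the static bound is an absolute constant.
  Actual processor counts are larger by at most the factor \<open>X\<close> and iteration bounds by
  at most \<open>Y\<close>; loops are not nested, so each factor enters once. Depth ignores the
  processor counts.\<close>

lemma fits_cost:
  assumes X: "1 \<le> X"
  shows "fits X Y par p \<Longrightarrow> wbound par p \<le> X * (1 + Y) * wbound (\<lambda>_. 1) p \<and> dbound par p \<le> (1 + Y) * dbound (\<lambda>_. 1) p"
proof (induction p)
  case (Par k g i)
  then have f: "flat X par (Par k g i)" by simp
  have "X * z \<le> X * (1 + Y) * z" for z by (intro mult_le_mono1) simp
  from this[of "wbound (\<lambda>_. 1) (Par k g i)"] have "X * wbound (\<lambda>_. 1) (Par k g i) \<le> X * (1 + Y) * wbound (\<lambda>_. 1) (Par k g i)" .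
  moreover have "z \<le> (1 + Y) * z" for z by simp
  from this[of "dbound (\<lambda>_. 1) (Par k g i)"] have "dbound (\<lambda>_. 1) (Par k g i) \<le> (1 + Y) * dbound (\<lambda>_. 1) (Par k g i)" .
  ultimately show ?case using flat_cost[OF X f] by linarith
next
  case (Seq p q)
  then have "wbound par p + wbound par q \<le> X * (1 + Y) * wbound (\<lambda>_. 1) p + X * (1 + Y) * wbound (\<lambda>_. 1) q"
    "dbound par p + dbound par q \<le> (1 + Y) * dbound (\<lambda>_. 1) p + (1 + Y) * dbound (\<lambda>_. 1) q"
    unfolding fits.simps by (meson add_mono)+
  then show ?case unfolding wbound.simps dbound.simps distrib_left[of "X * (1 + Y)", symmetric] distrib_left[of "1 + Y", symmetric] by blast
next
  case (While b g p)
  let ?c = "wcost g + 2 + wbound (\<lambda>_. 1) p" and ?d = "wcost g + 2 + dbound (\<lambda>_. 1) p" and ?k = "kv (\<lambda>_. 1) b"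
  have fl: "wbound par p \<le> X * wbound (\<lambda>_. 1) p" "dbound par p = dbound (\<lambda>_. 1) p" using flat_cost[OF X] While.prems by auto
  have add: "x \<le> a \<Longrightarrow> a \<le> y \<Longrightarrow> 1 * c \<le> d \<Longrightarrow> c + x \<le> d + y" for x a y c d :: nat by linarith
  have kb: "kv par b \<le> Y * ?k" using While.prems by simp
  have "wcost g + 2 \<le> X * (wcost g + 2)" using X mult_le_mono1[of 1 X "wcost g + 2"] by simp
  then have "wcost g + 2 + wbound par p \<le> X * ?c" using fl(1) unfolding distrib_left[of X] by linarith
  then have "kv par b * (wcost g + 2 + wbound par p) \<le> (Y * ?k) * (X * ?c)" using kb by (rule mult_le_mono[rotated])
  also have "\<dots> = X * Y * (?k * ?c)" by (simp only: mult_ac)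
  finally have 1: "kv par b * (wcost g + 2 + wbound par p) \<le> X * Y * (?k * ?c)" .
  have "X * Y * (?k * ?c) \<le> X * (1 + Y) * (?k * ?c)" by (intro mult_le_mono1 mult_le_mono2) simp
  moreover have "1 * (wcost b + 1) \<le> X * (1 + Y) * (wcost b + 1)" by (rule mult_le_mono1) (use X in simp)
  ultimately have w: "wbound par (While b g p) \<le> X * (1 + Y) * wbound (\<lambda>_. 1) (While b g p)"
    unfolding wbound.simps distrib_left[of "X * (1 + Y)" "wcost b + 1"] by (rule add[OF 1])
  have "kv par b * ?d \<le> Y * ?k * ?d" using kb by (rule mult_le_mono1)
  also have "\<dots> = Y * (?k * ?d)" by (simp only: mult_ac)
  finally have 2: "kv par b * ?d \<le> Y * (?k * ?d)" .
  have "Y * (?k * ?d) \<le> (1 + Y) * (?k * ?d)" "1 * (wcost b + 1) \<le> (1 + Y) * (wcost b + 1)" by (intro mult_le_mono1, simp)+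
  then have "dbound par (While b g p) \<le> (1 + Y) * dbound (\<lambda>_. 1) (While b g p)"
    unfolding dbound.simps fl(2) distrib_left[of "1 + Y" "wcost b + 1"] by (rule add[OF 2])
  then show ?case using w by simp
qed simp_all

lemmas prog_defs = ranks_def marks_def prefix_round_def sample_def init_cells_def fin_def bf_def mx_def bfdesc_def mxdesc_def
  prep_def round_def mkcand_def pick_def update_def duel_def cmp2_def reset_win_def draw_sample_def survivors_def
  draw_slot_def throw_def

lemma okp_body: "okp body"
  by (simp add: body_def prog_defs prm_def)

lemma nosub_body: "\<forall>i\<in>instrs body. nosubi i"
  by (simp add: body_def prog_defs)

definition bf_loop :: prog where "bf_loop = While (prm 7) (Const 1) (round (prm 9))"

lemma body_fits:
  fixes par :: "nat \<Rightarrow> nat"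
  shows "par 1 \<le> X \<Longrightarrow> par 6 \<le> X \<Longrightarrow> par 14 \<le> X \<Longrightarrow> 1 \<le> X \<Longrightarrow> par 4 \<le> Y \<Longrightarrow> fits X Y par (Seq ranks (Seq sample (Seq init_cells fin)))"
    "par 9 \<le> X \<Longrightarrow> 1 \<le> X \<Longrightarrow> par 8 \<le> Y \<Longrightarrow> fits X Y par (Seq bfdesc (prep (prm 9)))"
    "par 9 \<le> X \<Longrightarrow> 1 \<le> X \<Longrightarrow> par 7 \<le> Y \<Longrightarrow> fits X Y par bf_loop"
    "par 9 \<le> X \<Longrightarrow> 1 \<le> X \<Longrightarrow> flat X par (round (prm 9))"
    "par 10 \<le> X \<Longrightarrow> 1 \<le> X \<Longrightarrow> par 8 \<le> Y \<Longrightarrow> fits X Y par mx"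
  by (simp_all add: prog_defs bf_loop_def prm_def)

lemma bf_loop_cost:
  assumes "par 9 \<le> X" "1 \<le> X"
  shows "wbound par bf_loop \<le> (3 + par 7 * X) * wbound (\<lambda>_. 1) bf_loop"
proof -
  let ?r = "wbound (\<lambda>_. 1) (round (prm 9))"
  have "wbound par (round (prm 9)) \<le> X * ?r" using flat_cost[OF assms(2) body_fits(4)[of par X, OF assms]] by simp
  moreover have "1 * (wcost (Const 1) + 2) \<le> X * (wcost (Const 1) + 2)" using assms(2) by (rule mult_le_mono1)
  moreover have "x \<le> a \<Longrightarrow> 1 * c \<le> d \<Longrightarrow> c + x \<le> d + a" for x a c d :: nat by linarith
  ultimately have "wcost (Const 1) + 2 + wbound par (round (prm 9)) \<le> X * (wcost (Const 1) + 2 + ?r)"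
    unfolding distrib_left[of X "wcost (Const 1) + 2"] by blast
  then have 1: "par 7 * (wcost (Const 1) + 2 + wbound par (round (prm 9))) \<le> par 7 * (X * (wcost (Const 1) + 2 + ?r))" by (rule mult_le_mono2)
  have k: "kv p (prm 7) = p 7" for p :: "nat \<Rightarrow> nat" by (simp add: prm_def)
  have gen: "a + x \<le> (3 + q * X) * (a + 1 * c)" if "x \<le> q * (X * c)" for a x q c
  proof -
    have "(3 + q * X) * (a + 1 * c) = 3 * a + 3 * c + q * X * a + q * (X * c)" by (simp add: algebra_simps)
    then show ?thesis using that by linarith
  qed
  show ?thesis unfolding bf_loop_def wbound.simps k by (rule gen) (rule 1)
qed

definition kw :: nat where
  "kw = wbound (\<lambda>_. 1) (Seq ranks (Seq sample (Seq init_cells fin))) + wbound (\<lambda>_. 1) (Seq bfdesc (prep (prm 9))) +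
    wbound (\<lambda>_. 1) bf_loop + wbound (\<lambda>_. 1) mx"

definition kd :: nat where
  "kd = dbound (\<lambda>_. 1) (Seq ranks (Seq sample (Seq init_cells fin))) + dbound (\<lambda>_. 1) (Seq bfdesc (prep (prm 9))) +
    dbound (\<lambda>_. 1) bf_loop + dbound (\<lambda>_. 1) mx"

context config
begin

text \<open>The three summands are dominated by the prefix sums, the squaring and the Bellman-Ford
  rounds. As \<open>N\<close> is positive, \<open>L * (N * N * N)\<close> absorbs the costs of
  smaller order, and \<open>L \<le> b\<close> those of preparing the candidates.\<close>

lemma body_work:
  assumes P: "params W" and L: "1 \<le> L" "L \<le> b"
    and NT: "T1 = C * b * (if 0 < m then 1 else 0)" "T2 = C * L"
  shows "wbound (W 0) body \<le> 40 * (C + 1) * kw * (L * m * n + L * (N * N * N) + m * N * b)"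
    and "dbound (W 0) body \<le> 8 * (C + 1) * kd * b"
proof -
  note pe = params_eqs[OF P]
  define Z where "Z = L * m * n + L * (N * N * N) + m * N * b"
  have N3: "N \<le> N * N * N" "1 \<le> N" "1 \<le> N * N * N" using N0 by (auto simp: Suc_le_eq)
  have n1: "1 \<le> n" using s_n by simp
  have mn: "m \<le> m * n" using n1 by simp
  let ?A = "1 + m * n + N" and ?Bf = "1 + N * m" and ?M = "N * N * N"
  let ?p1 = "Seq ranks (Seq sample (Seq init_cells fin))" and ?p2 = "Seq bfdesc (prep (prm 9))"
  note f1 = fits_cost[OF _ body_fits(1)[where par="W 0" and X="?A" and Y=L]]
  note f2 = fits_cost[OF _ body_fits(2)[where par="W 0" and X="?Bf" and Y=T2]]
  note f3 = fits_cost[OF _ body_fits(3)[where par="W 0" and X="?Bf" and Y=T1]]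
  note f5 = fits_cost[OF _ body_fits(5)[where par="W 0" and X="?M" and Y=T2]]
  have mA: "m \<le> ?A" using mn by linarith
  have c1: "wbound (W 0) ?p1 \<le> ?A * (1 + L) * wbound (\<lambda>_. 1) ?p1 \<and> dbound (W 0) ?p1 \<le> (1 + L) * dbound (\<lambda>_. 1) ?p1"
    by (rule f1) (use pe(2,4,5,13) mA in simp_all)
  have c2: "wbound (W 0) ?p2 \<le> ?Bf * (1 + T2) * wbound (\<lambda>_. 1) ?p2 \<and> dbound (W 0) ?p2 \<le> (1 + T2) * dbound (\<lambda>_. 1) ?p2"
    by (rule f2) (use pe in simp_all)
  have c3: "dbound (W 0) bf_loop \<le> (1 + T1) * dbound (\<lambda>_. 1) bf_loop"
    using f3 pe by simp
  have c4: "wbound (W 0) bf_loop \<le> (3 + T1 * ?Bf) * wbound (\<lambda>_. 1) bf_loop"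
    using bf_loop_cost[of "W 0" ?Bf] pe by simp
  have c5: "wbound (W 0) mx \<le> ?M * (1 + T2) * wbound (\<lambda>_. 1) mx \<and> dbound (W 0) mx \<le> (1 + T2) * dbound (\<lambda>_. 1) mx"
    by (rule f5) (use pe N3 in simp_all)
  have LZ: "L \<le> L * (N * N * N)" "L * N \<le> L * (N * N * N)" "L * (N * N * N) \<le> Z" "L * m * n \<le> Z" "m * N * b \<le> Z" "m * n \<le> L * m * n"
    "1 \<le> Z" "N * N * N \<le> L * (N * N * N)"
    using N3 L unfolding Z_def by (auto intro!: mult_le_mono2 simp: Suc_le_eq)
  have t1: "?A * (1 + L) \<le> 8 * (C + 1) * Z"
  proof -
    have "?A * (1 + L) \<le> ?A * (2 * L)" using L(1) by (intro mult_le_mono2) simp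
    also have "\<dots> = 2 * L + 2 * (L * m * n) + 2 * (L * N)" by (simp add: algebra_simps)
    also have "\<dots> \<le> 6 * Z" using LZ by linarith
    also have "\<dots> \<le> 8 * (C + 1) * Z" by (intro mult_le_mono1) simp
    finally show ?thesis .
  qed
  have TL: "1 + T2 \<le> (C + 1) * L" using L(1) NT(2) by simp
  have t2: "?Bf * (1 + T2) \<le> 8 * (C + 1) * Z"
  proof -
    have "?Bf * (1 + T2) \<le> ?Bf * ((C + 1) * L)" using TL by (rule mult_le_mono2)
    also have "\<dots> = (C + 1) * (L + m * N * L)" by (simp add: algebra_simps)
    also have "\<dots> \<le> (C + 1) * (2 * Z)"
    proof (rule mult_le_mono2)
      have "m * N * L \<le> m * N * b" using L(2) by (rule mult_le_mono2)
      then show "L + m * N * L \<le> 2 * Z" using LZ by linarith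
    qed
    also have "(C + 1) * (2 * Z) = (2 * (C + 1)) * Z" by (simp only: mult_ac)
    also have "\<dots> \<le> 8 * (C + 1) * Z" by (intro mult_le_mono1) simp
    finally show ?thesis .
  qed
  have t3: "3 + T1 * ?Bf \<le> 8 * (C + 1) * Z"
  proof (cases "m = 0")
    case True
    have "3 * 1 \<le> 8 * (C + 1) * Z" using LZ(7) by (intro mult_le_mono) simp_all
    then show ?thesis using True NT(1) by simp
  next
    case False
    have "?Bf \<le> 2 * (N * m)" using False N0 by (simp add: Suc_le_eq)
    then have "T1 * ?Bf \<le> T1 * (2 * (N * m))" by (rule mult_le_mono2)
    also have "\<dots> = 2 * C * (m * N * b)" using False NT(1) by (simp add: algebra_simps)
    also have "\<dots> \<le> 2 * C * Z" using LZ(5) by (rule mult_le_mono2)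
    finally have "3 + T1 * ?Bf \<le> 3 * Z + 2 * C * Z" using LZ(7) by linarith
    also have "\<dots> = (3 + 2 * C) * Z" by (simp add: algebra_simps)
    also have "\<dots> \<le> 8 * (C + 1) * Z" by (intro mult_le_mono1) simp
    finally show ?thesis .
  qed
  have t5: "?M * (1 + T2) \<le> 8 * (C + 1) * Z"
  proof -
    have "?M * (1 + T2) \<le> ?M * ((C + 1) * L)" using TL by (rule mult_le_mono2)
    also have "\<dots> = (C + 1) * (L * (N * N * N))" by (simp add: algebra_simps)
    also have "\<dots> \<le> (C + 1) * Z" using LZ(3) by (rule mult_le_mono2)
    also have "\<dots> \<le> 8 * (C + 1) * Z" by (intro mult_le_mono1) simp
    finally show ?thesis .
  qed
  let ?t = "8 * (C + 1) * Z"
  have up: "x \<le> ?t * k" if "x \<le> y * k" "y \<le> ?t" for x y k using that mult_le_mono1[of y ?t k] by linarith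
  have "wbound (W 0) body = wbound (W 0) ?p1 + wbound (W 0) ?p2 + wbound (W 0) bf_loop + wbound (W 0) mx + wbound (W 0) ?p2 + wbound (W 0) bf_loop"
    by (simp add: body_def bf_def bf_loop_def)
  also have "\<dots> \<le> ?t * wbound (\<lambda>_. 1) ?p1 + ?t * wbound (\<lambda>_. 1) ?p2 + ?t * wbound (\<lambda>_. 1) bf_loop + ?t * wbound (\<lambda>_. 1) mx +
    ?t * wbound (\<lambda>_. 1) ?p2 + ?t * wbound (\<lambda>_. 1) bf_loop"
    by (intro add_mono up[OF _ t1] up[OF _ t2] up[OF _ t3] up[OF _ t5] c1[THEN conjunct1] c2[THEN conjunct1] c4 c5[THEN conjunct1])
  also have "\<dots> \<le> 2 * (?t * kw)" unfolding kw_def distrib_left by linarith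
  also have "\<dots> \<le> 40 * (C + 1) * kw * Z" by simp
  finally show "wbound (W 0) body \<le> 40 * (C + 1) * kw * (L * m * n + L * (N * N * N) + m * N * b)" unfolding Z_def .
  let ?u = "2 * (C + 1) * b"
  have b1: "1 \<le> b" using L by simp
  have CL: "C * L \<le> C * b" using L(2) by (rule mult_le_mono2)
  have e: "?u = 2 * (C * b) + 2 * b" by simp
  have "T1 \<le> C * b" using NT(1) by simp
  then have u: "1 + L \<le> ?u" "1 + T2 \<le> ?u" "1 + T1 \<le> ?u" unfolding e using b1 L NT(2) CL by linarith+
  have up: "x \<le> ?u * k" if "x \<le> y * k" "y \<le> ?u" for x y k using that mult_le_mono1[of y ?u k] by linarith
  have "dbound (W 0) body = dbound (W 0) ?p1 + dbound (W 0) ?p2 + dbound (W 0) bf_loop + dbound (W 0) mx + dbound (W 0) ?p2 + dbound (W 0) bf_loop"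
    by (simp add: body_def bf_def bf_loop_def)
  also have "\<dots> \<le> ?u * dbound (\<lambda>_. 1) ?p1 + ?u * dbound (\<lambda>_. 1) ?p2 + ?u * dbound (\<lambda>_. 1) bf_loop + ?u * dbound (\<lambda>_. 1) mx +
    ?u * dbound (\<lambda>_. 1) ?p2 + ?u * dbound (\<lambda>_. 1) bf_loop"
    by (intro add_mono up[OF _ u(1)] up[OF _ u(2)] up[OF _ u(3)] c1[THEN conjunct2] c2[THEN conjunct2] c3 c5[THEN conjunct2])
  also have "\<dots> \<le> 2 * (?u * kd)" unfolding kd_def distrib_left by linarith
  also have "\<dots> \<le> 8 * (C + 1) * kd * b" by (simp add: algebra_simps)
  finally show "dbound (W 0) body \<le> 8 * (C + 1) * kd * b" .
qed

end

section \<open>Estimates for the failure probability and for the costs\<close>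

lemma power_63_64: "(63 / 64 :: real) ^ (64 * k) \<le> 1 / 2 ^ k"
proof -
  \<comment> \<open>From \<open>1 - 1 / 64 \<le> exp (- 1 / 64)\<close>, 64 factors amount to at
    most \<open>1 / e\<close>, which is below \<open>1 / 2\<close>.\<close>
  have "(63 / 64 :: real) ^ 64 \<le> exp (- 1 / 64) ^ 64"
    using exp_ge_add_one_self[of "- 1 / 64 :: real"] by (intro power_mono) simp_all
  also have "exp (- 1 / 64 :: real) ^ 64 = exp (- 1)" by (simp add: exp_of_nat_mult[symmetric])
  also have "exp (- 1 :: real) \<le> 1 / 2" using exp_ge_add_one_self[of "1 :: real"] by (simp add: exp_minus field_simps)
  finally have "(63 / 64 :: real) ^ 64 \<le> 1 / 2" .
  then have "((63 / 64 :: real) ^ 64) ^ k \<le> (1 / 2) ^ k" by (intro power_mono) simp_all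
  then show ?thesis by (simp add: power_mult power_divide)
qed

text \<open>The multiplier \<open>128 q\<close> turns \<open>(63 / 64) ^ (128 q x)\<close> into at most \<open>4 ^ (- q x)\<close>.\<close>

lemma failure_bound:
  fixes n m N q b L T1 T2 :: nat and c :: real
  assumes n: "2 \<le> n" and L: "n < 2 ^ L" "1 \<le> L" "L \<le> b" and b: "b \<le> n"
    and N: "N = 128 * q * (n div b + 1) * L + 1" and q: "c + 15 \<le> real q"
    and T: "T2 = 128 * q * L" and T1: "0 < m \<Longrightarrow> T1 = 128 * q * b" and c: "1 \<le> c"
  shows "real (n * n) * (1 - real b / real n) ^ (N - 1) + (real (N * n) * (if m = 0 then 0 else 2 ^ b * (63 / 64) ^ T1) +
    (real n * (real n * (63 / 64) ^ T2) + real (N * n) * (if m = 0 then 0 else 2 ^ b * (63 / 64) ^ T1))) \<le> 1 / real n powr c"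
proof -
  have q16: "16 \<le> q" using q c by linarith
  have n0: "0 < real n" "1 \<le> real n" "2 \<le> real n" using n by simp_all
  have b0: "0 < b" "1 \<le> b" using L by simp_all
  \<comment> \<open>Common bound for the four summands. The critical one is the Bellman-Ford
    failure, \<open>1 / n ^ (q - 10)\<close> times \<open>n ^ 3\<close> from the number of cells;
    another \<open>n ^ 2 \<ge> 4\<close> pays for adding up four terms. This is the origin of
    \<open>c + 15\<close>.\<close>
  let ?u = "1 / real n ^ (q - 13)"
  have nb: "real n \<le> 2 ^ x" if "L \<le> x" for x
  proof -
    have "(2::real) ^ L \<le> 2 ^ x" using that by (intro power_increasing) auto
    moreover have "real n < 2 ^ L" using L(1) by (metis of_nat_less_iff of_nat_numeral of_nat_power)
    ultimately show ?thesis by linarith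
  qed
  have inv: "1 / 2 ^ (x * k) \<le> 1 / real n ^ k" if "L \<le> x" for x k
    using power_mono[OF nb[OF that], of k] n0 by (simp add: power_mult frac_le)
  have red: "real n * (real n * (1 / real n ^ (2 * q))) = 1 / real n ^ (2 * q - 2)"
  proof -
    define k where "k = 2 * q - 2"
    have q2: "2 * q = Suc (Suc k)" unfolding k_def using q16 by linarith
    show ?thesis unfolding k_def[symmetric] unfolding q2 using n0 by simp
  qed
  have e3: "real n * (real n * (63 / 64) ^ T2) \<le> ?u"
  proof -
    have "(63 / 64 :: real) ^ T2 \<le> 1 / 2 ^ (2 * q * L)" using power_63_64[of "2 * q * L"] T by (simp add: mult_ac)
    also have "\<dots> \<le> 1 / real n ^ (2 * q)" using inv[of L "2 * q"] by (simp add: mult_ac)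
    finally have "real n * (real n * (63 / 64) ^ T2) \<le> real n * (real n * (1 / real n ^ (2 * q)))" using n0 by (intro mult_left_mono) auto
    also have "\<dots> \<le> ?u" unfolding red using n0 q16 by (intro divide_left_mono power_increasing) auto
    finally show ?thesis .
  qed
  have e1: "real (n * n) * (1 - real b / real n) ^ (N - 1) \<le> ?u"
  proof -
    have bn: "real b / real n \<le> 1" "0 \<le> real b / real n" using b n0 by simp_all
    have "n < b * (n div b + 1)" using b0 by (metis Suc_eq_plus1 dividend_less_times_div mult.commute mult_Suc_right add.commute)
    then have "real n \<le> real b * real (n div b + 1)" by (metis less_imp_le of_nat_le_iff of_nat_mult)
    then have g: "1 \<le> real b / real n * real (n div b + 1)" using n0 by (simp add: field_simps)
    have "(1 - real b / real n) ^ (N - 1) \<le> exp (- (real b / real n)) ^ (N - 1)"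
      using bn exp_ge_add_one_self[of "- (real b / real n)"] by (intro power_mono) simp_all
    also have "\<dots> = exp (- (real b / real n * real (N - 1)))" by (simp add: exp_of_nat_mult[symmetric] mult.commute)
    also have "\<dots> \<le> exp (- (real (128 * q * L)))"
    proof -
      have N1: "N - 1 = (n div b + 1) * (128 * q * L)" unfolding N by (simp add: mult_ac)
      have "real b / real n * real (N - 1) = (real b / real n * real (n div b + 1)) * real (128 * q * L)"
        unfolding N1 of_nat_mult by (simp only: mult.assoc)
      moreover have "1 * real (128 * q * L) \<le> (real b / real n * real (n div b + 1)) * real (128 * q * L)"
        by (rule mult_right_mono[OF g]) simp
      ultimately have "real (128 * q * L) \<le> real b / real n * real (N - 1)" by (simp only: mult_1)
      then show ?thesis by (simp only: exp_le_cancel_iff neg_le_iff_le)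
    qed
    also have "\<dots> \<le> 1 / 2 ^ (L * (2 * q))"
    proof -
      have "(2::real) ^ (L * (2 * q)) \<le> exp 1 ^ (L * (2 * q))" using exp_ge_add_one_self[of "1::real"] by (intro power_mono) simp_all
      also have "\<dots> = exp (real (L * (2 * q)))" by (simp add: exp_of_nat_mult[symmetric])
      also have "\<dots> \<le> exp (real (128 * q * L))" by simp
      finally show ?thesis by (simp add: exp_minus field_simps)
    qed
    also have "\<dots> \<le> 1 / real n ^ (2 * q)" by (rule inv) simp
    finally have "real (n * n) * (1 - real b / real n) ^ (N - 1) \<le> real (n * n) * (1 / real n ^ (2 * q))" by (intro mult_left_mono) auto
    also have "\<dots> = 1 / real n ^ (2 * q - 2)" unfolding of_nat_mult mult.assoc by (rule red)
    also have "\<dots> \<le> ?u" using n0 q16 by (intro divide_left_mono power_increasing) auto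
    finally show ?thesis .
  qed
  have e2: "real (N * n) * (if m = 0 then 0 else 2 ^ b * (63 / 64) ^ T1) \<le> ?u"
  proof (cases "m = 0")
    case False
    have Nn: "N \<le> 2 ^ (q + 9) * (n * n)"
    proof -
      have "n div b + 1 \<le> n + 1" by simp
      moreover have "L \<le> n" using L(3) b by simp
      ultimately have "(n div b + 1) * L \<le> (n + 1) * n" by (rule mult_le_mono)
      also have "\<dots> \<le> 2 * (n * n)" using n by simp
      finally have h: "128 * q * ((n div b + 1) * L) \<le> 128 * q * (2 * (n * n))" by (rule mult_le_mono2)
      have h1: "1 * 1 \<le> 128 * q * (n * n)" using q16 n by (intro mult_le_mono) auto
      have "N = 128 * q * ((n div b + 1) * L) + 1" unfolding N by (simp only: mult.assoc)
      also have "\<dots> \<le> 128 * q * (2 * (n * n)) + 128 * q * (n * n)" by (rule add_mono[OF h h1[unfolded mult_1]])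
      also have "\<dots> = (128 * q) * (3 * (n * n))" by (simp add: algebra_simps)
      also have "(128 * q) * (3 * (n * n)) = (384 * q) * (n * n)" by simp
      also have "\<dots> \<le> 2 ^ (q + 9) * (n * n)"
      proof (rule mult_le_mono1)
        have "(2::nat) ^ (q + 9) = 512 * 2 ^ q" by (simp add: power_add)
        then show "384 * q \<le> 2 ^ (q + 9)" using less_exp[of q] by linarith
      qed
      finally show ?thesis .
    qed
    have "T1 = 64 * (2 * q * b)" using T1 False by simp
    then have "(63 / 64 :: real) ^ T1 \<le> 1 / 2 ^ (2 * q * b)" using power_63_64[of "2 * q * b"] by simp
    then have "2 ^ b * (63 / 64 :: real) ^ T1 \<le> 2 ^ b * (1 / 2 ^ (2 * q * b))" by (intro mult_left_mono) auto
    \<comment> \<open>The exponent is spent in three portions: \<open>b\<close> cancels the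
      \<open>2 ^ b\<close> of the level argument, \<open>b * (q + 9)\<close> the constant factor in
      the estimate of \<open>N\<close>, and the rest becomes a power of \<open>n\<close> because
      \<open>n < 2 ^ L\<close> and \<open>L \<le> b\<close>.\<close>
    also have "2 * q * b = b + (b * (q + 9) + b * (q - 10))"
    proof -
      obtain r where "q = 10 + r" using q16 le_Suc_ex[of 10 q] by auto
      then show ?thesis by (simp add: algebra_simps)
    qed
    also have "(2::real) ^ b * (1 / 2 ^ (b + (b * (q + 9) + b * (q - 10)))) = 1 / 2 ^ (b * (q + 9)) * (1 / 2 ^ (b * (q - 10)))"
      by (simp add: power_add)
    also have "\<dots> \<le> 1 / 2 ^ (q + 9) * (1 / real n ^ (q - 10))"
    proof (intro mult_mono inv)
      have "(2::real) ^ (q + 9) \<le> 2 ^ (b * (q + 9))" using b0 by (intro power_increasing) auto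
      then show "1 / (2::real) ^ (b * (q + 9)) \<le> 1 / 2 ^ (q + 9)" by (simp add: frac_le)
    qed (use L in auto)
    finally have 1: "2 ^ b * (63 / 64 :: real) ^ T1 \<le> 1 / 2 ^ (q + 9) * (1 / real n ^ (q - 10))" .
    have "real (N * n) \<le> real (2 ^ (q + 9) * (n * n) * n)" using Nn by (intro of_nat_mono mult_le_mono1)
    also have "\<dots> = 2 ^ (q + 9) * real n ^ 3" by (simp add: eval_nat_numeral)
    finally have 2: "real (N * n) \<le> 2 ^ (q + 9) * real n ^ 3" .
    have "real (N * n) * (2 ^ b * (63 / 64) ^ T1) \<le> (2 ^ (q + 9) * real n ^ 3) * (1 / 2 ^ (q + 9) * (1 / real n ^ (q - 10)))"
      by (rule mult_mono[OF 2 1]) simp_all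
    also have "\<dots> = real n ^ 3 / real n ^ (q - 10)" by simp
    also have "q - 10 = 3 + (q - 13)" using q16 by simp
    also have "real n ^ 3 / real n ^ (3 + (q - 13)) = ?u" using n0 by (simp only: power_add) simp
    finally show ?thesis using False by simp
  qed simp
  have "4 * ?u \<le> 1 / real n ^ (q - 15)"
  proof -
    have "q - 13 = 2 + (q - 15)" using q16 by simp
    then have "real n ^ (q - 13) = real n ^ 2 * real n ^ (q - 15)" by (simp only: power_add)
    moreover have "4 \<le> real n ^ 2" using power_mono[OF n0(3), of 2] by simp
    ultimately have "4 * real n ^ (q - 15) \<le> real n ^ (q - 13)" using n0 by simp
    then show ?thesis using n0 by (simp add: field_simps)
  qed
  also have "\<dots> \<le> 1 / real n powr c"
  proof -
    have "real n powr c \<le> real n powr real (q - 15)" using q q16 n0 by (intro powr_mono) auto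
    then have "real n powr c \<le> real n ^ (q - 15)" using n0 by (simp add: powr_realpow)
    then show ?thesis using n0 by (intro divide_left_mono) auto
  qed
  finally show ?thesis using e1 e2 e3 by linarith
qed

text \<open>In \<open>m * N * b\<close> the factor \<open>b\<close> cancels against
  \<open>N = O((n / b) * L)\<close>, leaving \<open>m * n * lg\<close>. In \<open>N ^ 3 * L\<close>
  the bound \<open>h \<le> b\<close> gives \<open>n ^ 3 / h ^ 3\<close> with three logarithms from
  \<open>N\<close> and one from \<open>L\<close>. The set-up cost of order \<open>L\<close> is
  covered by the same term, as \<open>N\<close> is at least 1.\<close>

lemma cost_bound:
  fixes n m N C b h L :: nat
  assumes n: "2 \<le> n" and L: "1 \<le> L" "2 ^ (L - 1) \<le> n" and h: "1 \<le> h" "h \<le> n" "b = max h L" "b \<le> n"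
    and N: "N = C * (n div b + 1) * L + 1"
  defines "lg \<equiv> log 2 (real n)"
  shows "real (L * m * n + L * (N * N * N) + m * N * b) \<le>
      (8 + 200 * (real C + 1) ^ 3) * (real m * real n * lg + real n ^ 3 / real h ^ 3 * lg ^ 4)" (is "_ \<le> ?K * _")
    and "real b \<le> 2 * (real h + lg)" and "real L \<le> 2 * lg" and "1 \<le> lg"
    and "real L \<le> 200 * (real C + 1) ^ 3 * (real m * real n * lg + real n ^ 3 / real h ^ 3 * lg ^ 4)"
proof -
  show lg1: "1 \<le> lg" unfolding lg_def using n by (simp add: le_log_iff)
  have "real (L - 1) \<le> lg"
  proof -
    have "(2::real) ^ (L - 1) \<le> real n" using L(2) by (metis of_nat_le_iff of_nat_numeral of_nat_power)
    then show ?thesis unfolding lg_def using n by (simp add: le_log_iff powr_realpow)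
  qed
  then show Ll: "real L \<le> 2 * lg" using L(1) lg1 by (simp add: of_nat_diff)
  then show "real b \<le> 2 * (real h + lg)" using h(3) lg1 by (cases "h \<le> L") (auto simp: max_def)
  have pos: "0 < real n" "0 < real h" "0 < real b" "1 \<le> real L" "0 < lg" "1 \<le> b" using n h L lg1 by auto
  let ?c = "2 * real C + 1"
  have Nb: "real N \<le> ?c * (real n / real b * real L)"
  proof -
    have 1: "1 \<le> real n / real b" using h(4) pos by simp
    have "real (n div b) \<le> real n / real b" by (rule of_nat_div_le_of_nat)
    then have "real (n div b) + 1 \<le> 2 * (real n / real b)" using 1 by linarith
    then have "real C * (real (n div b) + 1) * real L \<le> real C * (2 * (real n / real b)) * real L"
      by (intro mult_right_mono mult_left_mono) auto
    moreover have "1 * 1 \<le> real n / real b * real L" using 1 pos(4) by (intro mult_mono) auto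
    moreover have "real N = real C * (real (n div b) + 1) * real L + 1" unfolding N by (simp only: of_nat_add of_nat_mult of_nat_1)
    moreover have e: "?c * (y * l) = real C * (2 * y) * l + y * l" for y l :: real by (simp add: algebra_simps)
    ultimately show ?thesis unfolding e mult_1 by linarith
  qed
  have bh: "real h \<le> real b" using h(3) by simp
  have "real n / real b \<le> real n / real h" using bh pos by (intro divide_left_mono) auto
  then have "real n / real b * real L \<le> real n / real h * (2 * lg)" using Ll pos by (intro mult_mono) auto
  then have "?c * (real n / real b * real L) \<le> ?c * (real n / real h * (2 * lg))" by (rule mult_left_mono) simp
  with Nb have Nh: "real N \<le> 2 * ?c * (real n / real h * lg)" by (simp add: mult_ac)
  have N3: "real N ^ 3 * lg \<le> (2 * ?c) ^ 3 * (real n ^ 3 / real h ^ 3 * lg ^ 4)"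
  proof -
    have "real N ^ 3 \<le> (2 * ?c * (real n / real h * lg)) ^ 3" using Nh by (rule power_mono) simp
    then have "real N ^ 3 * lg \<le> (2 * ?c * (real n / real h * lg)) ^ 3 * lg" using lg1 by (intro mult_right_mono) auto
    also have "\<dots> = (2 * ?c) ^ 3 * (real n ^ 3 / real h ^ 3 * lg ^ 4)"
      by (simp only: power_mult_distrib power_divide) (simp add: eval_nat_numeral)
    finally show ?thesis .
  qed
  have t1: "real (L * m * n) \<le> 2 * (real m * real n * lg)"
    using mult_right_mono[OF Ll, of "real m * real n"] by (simp add: mult_ac)
  have t2: "real (L * (N * N * N)) \<le> 2 * (real N ^ 3 * lg)"
    using mult_right_mono[OF Ll, of "real N ^ 3"] by (simp add: mult_ac eval_nat_numeral)
  have "real N * real b \<le> ?c * (real n / real b * real L) * real b" using Nb by (rule mult_right_mono) simp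
  also have "\<dots> = ?c * (real n * real L)" using pos by simp
  also have "\<dots> \<le> ?c * (real n * (2 * lg))" using Ll by (intro mult_left_mono) auto
  finally have "real m * (real N * real b) \<le> real m * (?c * (real n * (2 * lg)))" by (rule mult_left_mono) simp
  then have t3: "real (m * N * b) \<le> 2 * ?c * (real m * real n * lg)" by (simp add: mult_ac)
  let ?A = "real m * real n * lg" and ?D = "real n ^ 3 / real h ^ 3 * lg ^ 4"
  have AD: "0 \<le> ?A" "0 \<le> ?D" using pos by auto
  let ?E = "(real C + 1) ^ 3"
  have cE: "real C + 1 \<le> ?E" using power_increasing[of 1 3 "real C + 1"] by simp
  have "2 * ?c \<le> 4 * (real C + 1)" by simp
  then have "(2 * ?c) ^ 3 \<le> (4 * (real C + 1)) ^ 3" by (rule power_mono) simp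
  also have "\<dots> = 64 * ?E" by (simp only: power_mult_distrib) simp
  finally have c3: "(2 * ?c) ^ 3 \<le> 64 * ?E" .
  have D: "real N ^ 3 * lg \<le> 64 * ?E * ?D" using N3 mult_right_mono[OF c3 AD(2)] by linarith
  have "2 * ?c * ?A \<le> (4 * ?E) * ?A" using cE AD by (intro mult_right_mono) auto
  then have "real (L * m * n + L * (N * N * N) + m * N * b) \<le> 2 * ?A + 2 * (64 * ?E * ?D) + 4 * ?E * ?A"
    using t1 t2 t3 D by simp
  also have "\<dots> \<le> (8 + 200 * ?E) * ?A + (8 + 200 * ?E) * ?D"
  proof -
    have E: "0 \<le> ?E" by simp
    have "2 * ?A + 4 * ?E * ?A \<le> (8 + 200 * ?E) * ?A" unfolding distrib_right[symmetric] using E AD by (intro mult_right_mono) auto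
    moreover have "2 * (64 * ?E * ?D) = (128 * ?E) * ?D" by simp
    moreover have "(128 * ?E) * ?D \<le> (8 + 200 * ?E) * ?D" using E AD by (intro mult_right_mono) auto
    ultimately show ?thesis by linarith
  qed
  finally show "real (L * m * n + L * (N * N * N) + m * N * b) \<le> ?K * (?A + ?D)" by (simp add: distrib_left)
  have "1 \<le> N" using N by simp
  then have "1 * lg \<le> real N ^ 3 * lg" using lg1 by (intro mult_right_mono one_le_power) auto
  then have "real L \<le> 2 * (64 * ?E * ?D)" using Ll D by linarith
  also have "\<dots> \<le> 200 * ?E * (?A + ?D)"
  proof -
    have g: "2 * (64 * x * d) \<le> 200 * x * (a + d)" if "0 \<le> x * a" "0 \<le> x * d" for x a d :: real
    proof -
      have "200 * x * (a + d) = 200 * (x * a) + 200 * (x * d)" "2 * (64 * x * d) = 128 * (x * d)" by (simp_all add: algebra_simps)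
      then show ?thesis using that by linarith
    qed
    have E: "0 \<le> ?E" by simp
    show ?thesis by (rule g[OF mult_nonneg_nonneg[OF E AD(1)] mult_nonneg_nonneg[OF E AD(2)]])
  qed
  finally show "real L \<le> 200 * ?E * (?A + ?D)" .
qed

definition sssp_prog :: "nat \<Rightarrow> prog" where "sssp_prog C = Seq (set_params C) body"

lemma sssp_prog_nosub: "\<forall>i\<in>instrs (sssp_prog C). nosubi i"
  using nosub_body by (auto simp: sssp_prog_def set_params_def find_log_def sets_def setp_def)

lemma ex_log: "1 \<le> n \<Longrightarrow> \<exists>L\<ge>1. 2 ^ (L - 1) \<le> n \<and> n < (2::nat) ^ L"
proof -
  assume n: "1 \<le> n"
  define L where "L = (LEAST l. n < 2 ^ l)"
  have 1: "n < 2 ^ L" unfolding L_def by (rule LeastI_ex) (use less_exp in blast)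
  then have 2: "1 \<le> L" using n by (cases L) auto
  have "\<not> n < 2 ^ (L - 1)" unfolding L_def by (rule not_less_Least) (use 2 in \<open>simp add: L_def[symmetric]\<close>)
  then show ?thesis using 1 2 by (intro exI[of _ L]) auto
qed

text \<open>The exponent of the word bound depends on \<open>C\<close> only, so words have
  \<open>O(log n)\<close> bits. The constant factor \<open>C\<close> is absorbed by
  \<open>(n + 1) ^ C\<close>, which works even for the smallest graphs because
  \<open>n + 1 \<ge> 2\<close>.\<close>

lemma parameter_sizes:
  fixes n m L b C N :: nat
  assumes n: "1 \<le> n" and m: "m \<le> n * n" and L: "1 \<le> L" "L \<le> n" "n < 2 ^ L" and C: "2 \<le> C"
    and N: "N = C * (n div b + 1) * L + 1"
  defines "Q \<equiv> (n + 1) ^ (C + 4)"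
  shows "n \<le> Q" "m \<le> Q" "N \<le> Q" "16 \<le> Q" "C \<le> Q" "Q ^ 5 = (n + 1) ^ (5 * (C + 4))" "n < 4 * 4 ^ (C * L)" "N < 4 * 4 ^ (C * L)"
proof -
  let ?x = "n + 1"
  have x2: "2 \<le> ?x" using n by simp
  have pw: "?x ^ i \<le> Q" if "i \<le> C + 4" for i unfolding Q_def using that by (intro power_increasing) auto
  have C2: "C + 1 \<le> 2 ^ C" using less_exp[of C] by (simp add: Suc_le_eq)
  have N1: "N \<le> 2 ^ C * ?x ^ 2"
  proof -
    have "(n div b + 1) * L \<le> ?x * ?x" using L(2) by (intro mult_le_mono) auto
    then have "C * ((n div b + 1) * L) \<le> C * (?x * ?x)" by (rule mult_le_mono2)
    moreover have "1 * 1 \<le> ?x * ?x" by (intro mult_le_mono) auto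
    moreover have "N = C * ((n div b + 1) * L) + 1" unfolding N by (simp only: mult.assoc)
    ultimately have "N \<le> (C + 1) * (?x * ?x)" by (simp only: distrib_right mult_1)
    also have "\<dots> \<le> 2 ^ C * (?x * ?x)" by (rule mult_le_mono1[OF C2])
    finally show ?thesis by (simp only: power2_eq_square)
  qed
  have "(2::nat) ^ C \<le> ?x ^ C" using x2 by (rule power_mono) simp
  then have "2 ^ C * ?x ^ 2 \<le> ?x ^ (C + 2)" unfolding power_add by (rule mult_le_mono1)
  then show "N \<le> Q" using N1 pw[of "C + 2"] by linarith
  show "n \<le> Q" using pw[of 1] by simp
  have "n * n \<le> ?x ^ 2" by (simp add: power2_eq_square)
  then show "m \<le> Q" using m pw[of 2] by linarith
  have "(2::nat) ^ 4 \<le> ?x ^ 4" using x2 by (rule power_mono) simp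
  then show "16 \<le> Q" using pw[of 4] by simp
  show "C \<le> Q" using C2 \<open>2 ^ C \<le> ?x ^ C\<close> pw[of C] by linarith
  show "Q ^ 5 = ?x ^ (5 * (C + 4))" unfolding Q_def by (simp only: power_mult[symmetric] mult.commute)
  have "(2::nat) ^ L \<le> 2 ^ (2 * (C * L))" using C by (intro power_increasing) auto
  then have "n < 4 ^ (C * L)" using L(3) by (simp add: power_mult)
  then show "n < 4 * 4 ^ (C * L)" by simp
  have "C + 2 * L \<le> C * L + C * L" using C L(1) by (intro add_mono) auto
  then have "(2::nat) ^ (C + 2 * L) \<le> 2 ^ (2 * (C * L))" by (intro power_increasing) auto
  moreover have "(2::nat) ^ (C + 2 * L) = 2 ^ C * (2 ^ L) ^ 2" by (simp add: power_add power_mult[symmetric] mult.commute)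
  moreover have "(2::nat) ^ (2 * (C * L)) = 4 ^ (C * L)" by (simp add: power_mult)
  ultimately have "2 ^ C * (2 ^ L) ^ 2 \<le> (4::nat) ^ (C * L)" by (simp only:)
  moreover have "2 ^ C * ?x ^ 2 \<le> 2 ^ C * (2 ^ L) ^ 2" using L(3) by (intro mult_le_mono2 power_mono) auto
  ultimately have "N \<le> 4 ^ (C * L)" using N1 by linarith
  then show "N < 4 * 4 ^ (C * L)" using zero_less_power[of "4::nat" "C * L"] by linarith
qed

lemma initial_wmem:
  "wmem (initial n m G s h) 0 0 = n" "wmem (initial n m G s h) 0 1 = m" "wmem (initial n m G s h) 0 2 = s"
  "wmem (initial n m G s h) 0 3 = h" "wmem (initial n m G s h) 0 4 = 0"
  "e < m \<Longrightarrow> wmem (initial n m G s h) 1 e = tail G e" "e < m \<Longrightarrow> wmem (initial n m G s h) 2 e = head G e"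
  "2 < a \<Longrightarrow> wmem (initial n m G s h) a = (\<lambda>_. 0)"
  by (auto simp: initial_def eval_nat_numeral)

lemma sssp_prog_correct:
  fixes c :: real
  assumes inst: "sssp_instance n m G w s" and h: "1 \<le> h" "h \<le> n" and res: "is_resolution res" and n: "2 \<le> n"
    and c: "1 \<le> c" and q: "c + 15 \<le> real q"
  defines "C \<equiv> 128 * q" and "X \<equiv> real m * real n * log 2 (real n) + real n ^ 3 / real h ^ 3 * log 2 (real n) ^ 4"
  defines "R \<equiv> exec res w ((n + 1) ^ (5 * (C + 4))) (sssp_prog C) (initial n m G s h)"
  shows "measure_pmf.prob R {\<sigma>. solves_sssp G w s \<sigma>} \<ge> 1 - 1 / real n powr c"
    and "\<sigma> \<in> set_pmf R \<Longrightarrow> real (work \<sigma>) \<le> (1000 * (200 * (real C + 1) ^ 3) + real (40 * (C + 1) * kw) * (8 + 200 * (real C + 1) ^ 3)) * X"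
    and "\<sigma> \<in> set_pmf R \<Longrightarrow> real (depth \<sigma>) \<le> (2000 + real (8 * (C + 1) * kd) * 2) * (real h + log 2 (real n))"
proof -
  have n1: "1 \<le> n" using n by simp
  obtain L where L: "1 \<le> L" "2 ^ (L - 1) \<le> n" "n < 2 ^ L" using ex_log[OF n1] by blast
  have Ln: "L \<le> n" using L(1,2) less_exp[of "L - 1"] by linarith
  have L2: "n \<le> 2 ^ L" "2 ^ L \<le> 2 * n"
  proof -
    have "(2::nat) ^ L = 2 * 2 ^ (L - 1)" using L(1) by (metis Suc_diff_1 less_eq_Suc_le One_nat_def power_Suc)
    then show "2 ^ L \<le> 2 * n" using L(2) by linarith
  qed (use L(3) in simp)
  have q16: "16 \<le> q" using c q by linarith
  then have C2: "2 \<le> C" by (simp add: C_def)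
  define b where "b = max h L"
  have b: "L \<le> b" "b \<le> n" "1 \<le> b" using h Ln L(1) by (auto simp: b_def)
  define N where "N = C * (n div b + 1) * L + 1"
  define T1 where "T1 = C * b * (if 0 < m then 1 else 0)"
  define T2 where "T2 = C * L"
  define Q where "Q = (n + 1) ^ (C + 4)"
  define B where "B = (n + 1) ^ (5 * (C + 4))"
  interpret sssp n m G w s by (rule sssp.intro) (rule inst)
  note sz = parameter_sizes[OF n1 m_le L(1) Ln L(3) C2 N_def, folded Q_def B_def T2_def]
  have "Q ^ 1 \<le> Q ^ 5" using sz(4) by (intro power_increasing) auto
  then have B16: "16 \<le> B" using sz(4,6) by simp
  interpret config n m G w s res B N L T1 T2 Q
    by (intro config.intro alg.intro sssp.intro machine.intro config_axioms.intro)
      (use inst res B16 sz N_def in \<open>simp_all\<close>)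
  let ?\<sigma> = "initial n m G s h"
  have set: "params (wmem \<upsilon>) \<and> (\<forall>a. a \<notin> {0, 10} \<longrightarrow> wmem \<upsilon> a = wmem ?\<sigma> a) \<and> rmem \<upsilon> = rmem ?\<sigma> \<and>
    work \<upsilon> \<le> 1000 * L \<and> depth \<upsilon> \<le> 1000 * L" if "\<upsilon> \<in> set_pmf (exec res w B (set_params C) ?\<sigma>)" for \<upsilon>
    using exec_set_params[OF L h b_def sz(5) N_def T1_def T2_def initial_wmem(1-5) that] by (simp add: initial_def)
  have R: "R = bind_pmf (exec res w B (set_params C) ?\<sigma>) (exec res w B body)"
    by (simp add: R_def B_def sssp_prog_def)
  let ?e1 = "real (n * n) * (1 - real b / real n) ^ (N - 1)" and ?e2 = "real (N * n) * (if m = 0 then 0 else 2 ^ b * (63 / 64) ^ T1) :: real"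
    and ?e3 = "real n * (real n * (63 / 64) ^ T2) :: real"
  have e: "?e1 + (?e2 + (?e3 + ?e2)) \<le> 1 / real n powr c"
    by (rule failure_bound[OF n L(3,1) b(1,2) _ q _ _ c]) (simp_all add: N_def T1_def T2_def C_def)
  have sol: "solves_sssp G w s \<sigma>" if "solved (wmem \<sigma>) (rmem \<sigma>)" for \<sigma>
    using that verts_G unfolding solved_def solves_sssp_def by simp
  have one: "measure_pmf.prob (exec res w B body \<upsilon>) {\<sigma>. \<not> solves_sssp G w s \<sigma>} \<le> 1 / real n powr c"
    if u: "\<upsilon> \<in> set_pmf (exec res w B (set_params C) ?\<sigma>)" for \<upsilon>
  proof -
    have s: "params (wmem \<upsilon>)" "\<And>a. a \<notin> {0, 10} \<Longrightarrow> wmem \<upsilon> a = wmem ?\<sigma> a" "rmem \<upsilon> = rmem ?\<sigma>" using set[OF u] by blast+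
    have "arcs_in (wmem \<upsilon>)" unfolding arcs_in_def using s(1) s(2)[of 1] s(2)[of 2] initial_wmem(6,7) by simp
    moreover have "wmem \<upsilon> 30 = (\<lambda>_. 0)" "wmem \<upsilon> 3 = (\<lambda>_. 0)" "wmem \<upsilon> 5 = (\<lambda>_. 0)"
      using s(2)[of 30] s(2)[of 3] s(2)[of 5] initial_wmem(8) by simp_all
    moreover have "rmem \<upsilon> 1 = (\<lambda>_. 0)" "\<And>e. e < m \<Longrightarrow> rmem \<upsilon> 0 e = Poly_Mapping.single e 1"
      unfolding s(3) by (simp_all add: initial_def)
    ultimately have "hp (?e1 + (?e2 + (?e3 + ?e2))) body solved (wmem \<upsilon>) (rmem \<upsilon>)"
      using L2 b by (intro hp_body)
    then have "measure_pmf.prob (exec res w B body \<upsilon>) {\<tau>. \<not> solved (wmem \<tau>) (rmem \<tau>)} \<le> ?e1 + (?e2 + (?e3 + ?e2))"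
      unfolding hp_def by blast
    moreover have "measure_pmf.prob (exec res w B body \<upsilon>) {\<sigma>. \<not> solves_sssp G w s \<sigma>} \<le>
      measure_pmf.prob (exec res w B body \<upsilon>) {\<tau>. \<not> solved (wmem \<tau>) (rmem \<tau>)}"
      by (rule measure_pmf.finite_measure_mono) (use sol in auto)
    ultimately show ?thesis using e by linarith
  qed
  have "measure_pmf.prob R {\<sigma>. \<not> solves_sssp G w s \<sigma>} \<le> 1 / real n powr c + 1 * (1 / real n powr c - 1 / real n powr c)"
    unfolding R by (rule prob_bind_le[where G=UNIV]) (use one in auto)
  moreover have "measure_pmf.prob R (UNIV - {\<sigma>. solves_sssp G w s \<sigma>}) = 1 - measure_pmf.prob R {\<sigma>. solves_sssp G w s \<sigma>}"
    using measure_pmf.prob_compl[of "{\<sigma>. solves_sssp G w s \<sigma>}" R] by simp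
  moreover have "UNIV - {\<sigma>. solves_sssp G w s \<sigma>} = {\<sigma>. \<not> solves_sssp G w s \<sigma>}" by auto
  ultimately show "measure_pmf.prob R {\<sigma>. solves_sssp G w s \<sigma>} \<ge> 1 - 1 / real n powr c" by simp
  note cb = cost_bound[OF n L(1,2) h b_def b(2) N_def]
  assume "\<sigma> \<in> set_pmf R"
  then obtain \<upsilon> where u: "\<upsilon> \<in> set_pmf (exec res w B (set_params C) ?\<sigma>)" "\<sigma> \<in> set_pmf (exec res w B body \<upsilon>)"
    unfolding R by auto
  have P: "params (wmem \<upsilon>)" using set[OF u(1)] by blast
  note bw = body_work[OF P L(1) b(1) T1_def T2_def]
  have co: "work \<sigma> \<le> work \<upsilon> + wbound (wmem \<upsilon> 0) body" "depth \<sigma> \<le> depth \<upsilon> + dbound (wmem \<upsilon> 0) body"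
    using exec_cost[OF B16 u(2) okp_body] by auto
  let ?Z = "L * m * n + L * (N * N * N) + m * N * b"
  have "work \<sigma> \<le> 1000 * L + 40 * (C + 1) * kw * ?Z" using co(1) set[OF u(1)] bw(1) by linarith
  then have "real (work \<sigma>) \<le> real (1000 * L + 40 * (C + 1) * kw * ?Z)" by (rule of_nat_mono)
  then have w: "real (work \<sigma>) \<le> 1000 * real L + real (40 * (C + 1) * kw) * real ?Z" by (simp only: of_nat_add of_nat_mult of_nat_numeral)
  have gen: "r \<le> (A + k * D) * Y" if "r \<le> a + k * z" "a \<le> A * Y" "k * z \<le> k * (D * Y)" for r a k z A D Y :: real
    using that by (simp add: distrib_right mult.assoc)
  have "1000 * real L \<le> 1000 * (200 * (real C + 1) ^ 3 * X)" using cb(5) unfolding X_def by (rule mult_left_mono) simp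
  then have "1000 * real L \<le> 1000 * (200 * (real C + 1) ^ 3) * X" by (simp only: mult.assoc)
  moreover have "real (40 * (C + 1) * kw) * real ?Z \<le> real (40 * (C + 1) * kw) * ((8 + 200 * (real C + 1) ^ 3) * X)"
    using cb(1) unfolding X_def by (intro mult_left_mono) simp_all
  ultimately show "real (work \<sigma>) \<le> (1000 * (200 * (real C + 1) ^ 3) + real (40 * (C + 1) * kw) * (8 + 200 * (real C + 1) ^ 3)) * X"
    by (rule gen[OF w])
  have "depth \<sigma> \<le> 1000 * L + 8 * (C + 1) * kd * b" using co(2) set[OF u(1)] bw(2) by linarith
  then have "real (depth \<sigma>) \<le> real (1000 * L + 8 * (C + 1) * kd * b)" by (rule of_nat_mono)
  then have d: "real (depth \<sigma>) \<le> 1000 * real L + real (8 * (C + 1) * kd) * real b" by (simp only: of_nat_add of_nat_mult of_nat_numeral)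
  let ?lg = "log 2 (real n)"
  have "1000 * real L \<le> 2000 * (real h + ?lg)" using cb(3) by simp
  moreover have "real (8 * (C + 1) * kd) * real b \<le> real (8 * (C + 1) * kd) * (2 * (real h + ?lg))"
    using cb(2) by (intro mult_left_mono) simp_all
  ultimately show "real (depth \<sigma>) \<le> (2000 + real (8 * (C + 1) * kd) * 2) * (real h + ?lg)"
    by (rule gen[OF d])
qed

theorem theorem13:
  fixes c :: real
  assumes "c \<ge> 1"
  shows "\<exists>(P :: prog) (\<kappa> :: nat) (K :: real).
    \<forall>(n :: nat) (m :: nat) (G :: (nat, nat) pre_digraph) (w :: nat \<Rightarrow> real) (s :: nat) (h :: nat)
      (res :: resolution).
      sssp_instance n m G w s \<and> 1 \<le> h \<and> h \<le> n \<and> is_resolution res \<longrightarrow>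
      (let R = exec res w ((n + 1) ^ \<kappa>) P (initial n m G s h) in
         measure_pmf.prob R {\<sigma>. solves_sssp G w s \<sigma>} \<ge> 1 - 1 / real n powr c \<and>
         (\<forall>\<sigma>\<in>set_pmf R.
            (2 \<le> n \<longrightarrow>
               real (work \<sigma>) \<le> K * (real m * real n * log 2 (real n)
                                  + real n ^ 3 / real h ^ 3 * log 2 (real n) ^ 4) \<and>
               real (depth \<sigma>) \<le> K * (real h + log 2 (real n))) \<and>
            compared \<sigma> \<subseteq> arc_sums G))"
proof -
  define q where "q = nat \<lceil>c + 15\<rceil>"
  have q: "c + 15 \<le> real q" unfolding q_def by (rule real_nat_ceiling_ge)
  define C where "C = 128 * q"
  define K1 where "K1 = 1000 * (200 * (real C + 1) ^ 3) + real (40 * (C + 1) * kw) * (8 + 200 * (real C + 1) ^ 3)"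
  define K2 where "K2 = 2000 + real (8 * (C + 1) * kd) * 2"
  have K: "K1 \<le> K1 + K2" "K2 \<le> K1 + K2" unfolding K1_def K2_def by simp_all
  show ?thesis
  proof (intro exI[of _ "sssp_prog C"] exI[of _ "5 * (C + 4)"] exI[of _ "K1 + K2"] allI impI, unfold Let_def, intro conjI ballI impI)
    fix n m h s :: nat and G :: "(nat, nat) pre_digraph" and w :: "nat \<Rightarrow> real" and res :: resolution
    assume a: "sssp_instance n m G w s \<and> 1 \<le> h \<and> h \<le> n \<and> is_resolution res"
    let ?R = "exec res w ((n + 1) ^ (5 * (C + 4))) (sssp_prog C) (initial n m G s h)"
    show "1 - 1 / real n powr c \<le> measure_pmf.prob ?R {\<sigma>. solves_sssp G w s \<sigma>}"
    proof (cases "2 \<le> n")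
      case True
      show ?thesis unfolding C_def by (rule sssp_prog_correct(1)[OF _ _ _ _ True assms q]) (use a in blast)+
    next
      case False
      \<comment> \<open>For a single vertex the required probability is
        \<open>1 - 1 = 0\<close>.\<close>
      then have "n = 1" using a by simp
      then show ?thesis by simp
    qed
    fix \<sigma> assume s: "\<sigma> \<in> set_pmf ?R"
    have "arcs G = {..<m}" using a by (simp add: sssp_instance_def)
    then have "rmem (initial n m G s h) x y \<in> arc_sums G" for x y
      using arc_sums_zero arc_sums_single[of y G] by (simp add: initial_def)
    then show "compared \<sigma> \<subseteq> arc_sums G"
      by (intro exec_arc_sums[OF s sssp_prog_nosub]) (simp_all add: initial_def)
    assume n: "2 \<le> n"
    let ?X = "real m * real n * log 2 (real n) + real n ^ 3 / real h ^ 3 * log 2 (real n) ^ 4" and ?Y = "real h + log 2 (real n)"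
    have "0 \<le> log 2 (real n)" using n by simp
    then have pos: "0 \<le> ?X" "0 \<le> ?Y" by simp_all
    have "real (work \<sigma>) \<le> K1 * ?X" unfolding K1_def C_def
      by (rule sssp_prog_correct(2)[OF _ _ _ _ n assms q]) (use a s[unfolded C_def] in blast)+
    then show "real (work \<sigma>) \<le> (K1 + K2) * ?X" using mult_right_mono[OF K(1) pos(1)] by linarith
    have "real (depth \<sigma>) \<le> K2 * ?Y" unfolding K2_def C_def
      by (rule sssp_prog_correct(3)[OF _ _ _ _ n assms q]) (use a s[unfolded C_def] in blast)+
    then show "real (depth \<sigma>) \<le> (K1 + K2) * ?Y" using mult_right_mono[OF K(2) pos(2)] by linarith
  qed
qed

end
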